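(* Let $[\Delta,\vec c,\vec\epsilon\,]$ be any semitoric polygon. Let $d$ be its number of hidden plus Delzant corners, let $\ell_1,\dots,\ell_d>0$ be the $\mathrm{SL}_2(\mathbb{Z})$-lengths of its semitoric edges, let $\alpha_1,\dots,\alpha_d\in[0,\infty]$ be the marked point bounds, let $\mathcal{P}_{\mathrm{ST}}$ be the set of packings of $[\Delta,\vec c,\vec\epsilon\,]$, and let $\Lambda:\mathcal{P}_{\mathrm{ST}}\to\mathbb{R}^d$ be the map sending a packing to $(\lambda_1,\dots,\lambda_d)$, where $\lambda_i$ is the $\mathrm{SL}_2(\mathbb{Z})$-size of the triangle packed at the $i$-th corner ($\lambda_i=0$ if there is none). Put $$\widetilde{\mathcal{P}_{\mathrm{ST}}}=\big\{(\lambda_1,\dots,\lambda_d)\in\mathbb{R}^d : \lambda_i\ge 0,\ \lambda_i+\lambda_{i+1}\le \ell_i,\ \text{and } \lambda_i\le\alpha_i \text{ for all } i\in\{1,\dots,d\}\big\},$$ with $\lambda_{d+1}=\lambda_1$. Then $\Lambda(\mathcal{P}_{\mathrm{ST}})=\widetilde{\mathcal{P}_{\mathrm{ST}}}$, and $\Lambda$ is a bijection from $\mathcal{P}_{\mathrm{ST}}$ to the compact convex polytope $\widetilde{\mathcal{P}_{\mathrm{ST}}}$. Furthermore, $\operatorname{area}([P])=\frac12\|\Lambda([P])\|^2$ for every packing $[P]\in\mathcal{P}_{\mathrm{ST}}$.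
   Context: Semitoric polygons. Let $T=\begin{pmatrix}1&0\\1&1\end{pmatrix}$. A (compact) polygon is rational if each edge is directed along an integer vector. Let $v$ be a vertex of a rational convex polygon and $u_1,u_2\in\mathbb{Z}^2$ the primitive integer vectors directing the edges emanating from $v$, ordered so that $\det(u_1,u_2)>0$. Then $v$ satisfies the Delzant condition if $\det(u_1,u_2)=1$; for $k\in\mathbb{Z}_{>0}$ it satisfies the fake corner condition for $k$ cuts if $\det(u_1,T^ku_2)=0$ and the hidden corner condition for $k$ cuts if $\det(u_1,T^ku_2)=1$. A semitoric polygon representative is a triple $(\Delta,\vec c,\vec\epsilon\,)$ where $\Delta\subset\mathbb{R}^2$ is a convex rational polygon, $\vec c=(c_1,\dots,c_m)$ are points of $\operatorname{int}(\Delta)$ (marked points, ordered lexicographically), and $\vec\epsilon\in\{\pm1\}^m$. The $i$-th cut is the intersection of $\Delta$ with the ray starting at $c_i$ in direction $(0,\epsilon_i)$. It is required that each point of $\partial\Delta$ met by exactly $k\ge1$ cuts is a vertex of $\Delta$ satisfying the fake or the hidden corner condition for $k$ cuts (then called a fake corner or hidden corner respectively), and that every other vertex satisfies the Delzant condition (these are called Delzant corners). Group action. For $j\in\mathbb{R}$ let $\mathfrak t_j(x,y)=(x,y+x-j)$ if $x\ge j$ and $\mathfrak t_j(x,y)=(x,y)$ otherwise. Let $\mathcal T$ be the group of transformations of $\mathbb{R}^2$ generated by powers of $T$ and vertical translations, and $G_m=\{1,-1\}^m$. An element $(\tau,\vec\epsilon\,')\in\mathcal T\times G_m$ acts by $(\tau,\vec\epsilon\,')\cdot(\Delta,\vec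 c,\vec\epsilon\,)=(\sigma(\Delta),\sigma(\vec c),(\epsilon_1'\epsilon_1,\dots,\epsilon_m'\epsilon_m))$, where $\sigma=\tau\circ\mathfrak t_{x_1}^{u_1}\circ\cdots\circ\mathfrak t_{x_m}^{u_m}$, $x_k$ is the first coordinate of $c_k$, and $u_k=\epsilon_k(1-\epsilon_k')/2$; we also write $\sigma$ for the group element. The result is again a representative. A semitoric polygon $[\Delta,\vec c,\vec\epsilon\,]$ is the orbit of a representative under $\mathcal T\times G_m$. The maps $\sigma$ send hidden or Delzant corners to hidden or Delzant corners and preserve area. $\mathrm{SL}_2(\mathbb{Z})$-length. For a segment that is vertical or has rational slope, with endpoints $p,q$, its $\mathrm{SL}_2(\mathbb{Z})$-length is the unique $\ell\ge0$ with $M(q-p)=(\ell,0)^{t}$ for some $M\in\mathrm{SL}_2(\mathbb{Z})$; for a chain of segments it is the sum of the lengths. Packings. For $\lambda>0$ let $B(\lambda)=\{(x,y): x\ge0,\,y\ge0,\,x+y<\lambda\}$. For a representative $(\Delta,\vec c,\vec\epsilon\,)$ and a vertex $p$ of $\Delta$, a set $B\subset\Delta$ is an admissibly packed triangle at $p$ of $\mathrm{SL}_2(\mathbb{Z})$-size $\lambda>0$ if there is $\sigma\in\mathcal T\times G_m$ such that: (1) $\sigma(p)$ is a Delzant corner of $\sigma\cdot(\Delta,\vec c,\vec\epsilon\,)$; (2) $\sigma(c_i)\notin\sigma(B)$ for all $i$; (3) $\sigma(B)=M(B(\lambda))+\sigma(p)$ for some $M\in\mathrm{SL}_2(\mathbb{Z})$;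 (4) $\sigma(B)$ and $\sigma(\Delta)$ coincide in a small neighborhood of $\sigma(p)$. A packing of $(\Delta,\vec c,\vec\epsilon\,)$ is a union $P=\bigcup_i B_i$ of pairwise disjoint admissibly packed triangles. A packing $[P]$ of $[\Delta,\vec c,\vec\epsilon\,]$ is the family $\{\sigma(P):\sigma\in\mathcal T\times G_m\}$, where $P$ is a packing of $(\Delta,\vec c,\vec\epsilon\,)$ (so $\sigma(P)$ is a packing of $\sigma\cdot(\Delta,\vec c,\vec\epsilon\,)$); $\operatorname{area}([P])$ is the common area of its members. Corners, edges and the numbers $\ell_i,\alpha_i$. Fix a representative $(\Delta,\vec c,\vec\epsilon\,)$. Label its hidden and Delzant corners $p_1,\dots,p_d$ in clockwise order starting with the lexicographically minimal vertex, indices taken cyclically ($p_{d+1}=p_1$). A semitoric edge is a maximal chain of consecutive edges of $\Delta$ joined through fake corners, so that its two ends are hidden or Delzant corners; let $\tilde e_i$ be the semitoric edge from $p_i$ to $p_{i+1}$ and $\ell_i$ its $\mathrm{SL}_2(\mathbb{Z})$-length. Let $v^i=(v^i_1,v^i_2)$, $w^i=(w^i_1,w^i_2)\in\mathbb{Z}^2$ be the primitive vectors directing the two edges of $\Delta$ emanating from $p_i$. Let $L_j$ be the vertical line through $c_j$. If $L_j$ meets exactly one of the two semitoric edges emanating from $p_i$, let $q_i^j$ be the intersection point; if it meets both, let $q_i^j$ be the intersection point for which the path from $p_i$ to it along that semitoric edge has minimal $\mathrm{SL}_2(\mathbb{Z})$-length (either one in case of a tie). Let $a_i^j$ be the $\mathrm{SL}_2(\mathbb{Z})$-length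 of the path in $\partial\Delta$ from $p_i$ to $q_i^j$ contained in a single semitoric edge, and $b_i^j$ the vertical distance from $c_j$ to $q_i^j$. Set $\alpha_i=\min_j\{a_i^j+b_i^j\,|v_1^i-w_1^i|\}$, the minimum over those $j\in\{1,\dots,m\}$ for which $L_j$ meets at least one of the semitoric edges emanating from $p_i$, and $\alpha_i=\infty$ if there is no such $j$. The numbers $d,\ell_i,\alpha_i$ and the $\mathrm{SL}_2(\mathbb{Z})$-sizes do not depend on the chosen representative. *)

theory Defs
  imports "HOL-Analysis.Analysis"
begin

definition lex_le :: "real^2 \<Rightarrow> real^2 \<Rightarrow> bool" where
  "lex_le p q \<longleftrightarrow> p$1 < q$1 \<or> (p$1 = q$1 \<and> p$2 \<le> q$2)"

definition det2 :: "real^2 \<Rightarrow> real^2 \<Rightarrow> real" where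
  "det2 u v = det (vector [u, v] :: real^2^2)"

definition primitive_vec :: "real^2 \<Rightarrow> bool" where
  "primitive_vec u \<longleftrightarrow> (\<exists>a b :: int. coprime a b \<and> u = vector [of_int a, of_int b])"

definition SL2Z :: "(real^2^2) set" where
  "SL2Z = {M. det M = 1 \<and> (\<forall>i j. M$i$j \<in> \<int>)}"

definition Tmat :: "real^2^2" where
  "Tmat = vector [vector [1, 0], vector [1, 1]]"

definition Tpow :: "nat \<Rightarrow> real^2 \<Rightarrow> real^2" where
  "Tpow k = (\<lambda>x. Tmat *v x) ^^ k"

text \<open>Total, but only meaningful when the segment is vertical or has rational slope.\<close>

definition sl2_length :: "real^2 \<Rightarrow> real^2 \<Rightarrow> real" where
  "sl2_length p q = (THE l. l \<ge> 0 \<and> (\<exists>M\<in>SL2Z. M *v (q - p) = vector [l, 0]))"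

definition rational_polygon :: "(real^2) set \<Rightarrow> bool" where
  "rational_polygon D \<longleftrightarrow> polytope D \<and> interior D \<noteq> {} \<and>
     (\<forall>a b. closed_segment a b edge_of D \<longrightarrow>
        (\<exists>(m::int) (n::int) t::real. b - a = t *\<^sub>R vector [of_int m, of_int n]))"

definition edge_dir :: "(real^2) set \<Rightarrow> real^2 \<Rightarrow> real^2 \<Rightarrow> bool" where
  "edge_dir D p u \<longleftrightarrow> primitive_vec u \<and> (\<exists>t>0. closed_segment p (p + t *\<^sub>R u) edge_of D)"

definition delzant_cond :: "(real^2) set \<Rightarrow> real^2 \<Rightarrow> bool" where
  "delzant_cond D p \<longleftrightarrow>
     (\<exists>u1 u2. edge_dir D p u1 \<and> edge_dir D p u2 \<and> det2 u1 u2 > 0 \<and> det2 u1 u2 = 1)"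

definition fake_cond :: "(real^2) set \<Rightarrow> nat \<Rightarrow> real^2 \<Rightarrow> bool" where
  "fake_cond D k p \<longleftrightarrow>
     (\<exists>u1 u2. edge_dir D p u1 \<and> edge_dir D p u2 \<and> det2 u1 u2 > 0 \<and> det2 u1 (Tpow k u2) = 0)"

definition hidden_cond :: "(real^2) set \<Rightarrow> nat \<Rightarrow> real^2 \<Rightarrow> bool" where
  "hidden_cond D k p \<longleftrightarrow>
     (\<exists>u1 u2. edge_dir D p u1 \<and> edge_dir D p u2 \<and> det2 u1 u2 > 0 \<and> det2 u1 (Tpow k u2) = 1)"

datatype srep = SRep (pgon: "(real^2) set") (marks: "(real^2) list") (signs: "int list")

definition cut :: "srep \<Rightarrow> nat \<Rightarrow> (real^2) set" where
  "cut R i = pgon R \<inter> {marks R ! i + t *\<^sub>R vector [0, of_int (signs R ! i)] |t. t \<ge> 0}"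

definition ncuts :: "srep \<Rightarrow> real^2 \<Rightarrow> nat" where
  "ncuts R p = card {i. i < length (marks R) \<and> p \<in> cut R i}"

definition is_rep :: "srep \<Rightarrow> bool" where
  "is_rep R \<longleftrightarrow>
     rational_polygon (pgon R) \<and>
     set (marks R) \<subseteq> interior (pgon R) \<and> sorted_wrt lex_le (marks R) \<and>
     length (signs R) = length (marks R) \<and> set (signs R) \<subseteq> {-1, 1} \<and>
     (\<forall>p\<in>frontier (pgon R). ncuts R p \<ge> 1 \<longrightarrow>
        p extreme_point_of pgon R \<and>
        (fake_cond (pgon R) (ncuts R p) p \<or> hidden_cond (pgon R) (ncuts R p) p)) \<and>
     (\<forall>p. p extreme_point_of pgon R \<and> ncuts R p = 0 \<longrightarrow> delzant_cond (pgon R) p)"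

text \<open>
  A vertex lying on a cut is never a Delzant corner, even if it happens to satisfy
  the Delzant condition (a fake corner for one cut may).
\<close>

definition delzant_corner :: "srep \<Rightarrow> real^2 \<Rightarrow> bool" where
  "delzant_corner R p \<longleftrightarrow>
     p extreme_point_of pgon R \<and> ncuts R p = 0 \<and> delzant_cond (pgon R) p"

definition hidden_corner :: "srep \<Rightarrow> real^2 \<Rightarrow> bool" where
  "hidden_corner R p \<longleftrightarrow>
     p extreme_point_of pgon R \<and> ncuts R p \<ge> 1 \<and> hidden_cond (pgon R) (ncuts R p) p"

definition true_corner :: "srep \<Rightarrow> real^2 \<Rightarrow> bool" where
  "true_corner R p \<longleftrightarrow> hidden_corner R p \<or> delzant_corner R p"

inductive_set shear_group :: "(real^2 \<Rightarrow> real^2) set" where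
  id: "id \<in> shear_group"
| T: "\<tau> \<in> shear_group \<Longrightarrow> (\<lambda>p. Tmat *v \<tau> p) \<in> shear_group"
| T_inv: "\<tau> \<in> shear_group \<Longrightarrow> (\<lambda>p. matrix_inv Tmat *v \<tau> p) \<in> shear_group"
| vert: "\<tau> \<in> shear_group \<Longrightarrow> (\<lambda>p. \<tau> p + vector [0, b]) \<in> shear_group"

definition pshear :: "real \<Rightarrow> real^2 \<Rightarrow> real^2" where
  "pshear j p = (if p$1 \<ge> j then vector [p$1, p$2 + p$1 - j] else p)"

definition ifunpow :: "('a \<Rightarrow> 'a) \<Rightarrow> int \<Rightarrow> 'a \<Rightarrow> 'a" where
  "ifunpow f u = (if u \<ge> 0 then f ^^ nat u else inv f ^^ nat (- u))"

type_synonym gelt = "(real^2 \<Rightarrow> real^2) \<times> int list"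

definition grp :: "nat \<Rightarrow> gelt set" where
  "grp m = {(\<tau>, e). \<tau> \<in> shear_group \<and> length e = m \<and> set e \<subseteq> {-1, 1}}"

definition act_map :: "gelt \<Rightarrow> srep \<Rightarrow> real^2 \<Rightarrow> real^2" where
  "act_map g R = fst g \<circ>
     foldr (\<lambda>k f. ifunpow (pshear (marks R ! k $ 1)) (signs R ! k * (1 - snd g ! k) div 2) \<circ> f)
       [0..<length (marks R)] id"

definition act :: "gelt \<Rightarrow> srep \<Rightarrow> srep" where
  "act g R = SRep (act_map g R ` pgon R) (map (act_map g R) (marks R))
                  (map2 (*) (snd g) (signs R))"

definition orbit :: "srep \<Rightarrow> srep set" where
  "orbit R = {act g R |g. g \<in> grp (length (marks R))}"

definition semitoric_polygon :: "srep set \<Rightarrow> bool" where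
  "semitoric_polygon S \<longleftrightarrow> (\<exists>R. is_rep R \<and> S = orbit R)"

definition std_triangle :: "real \<Rightarrow> (real^2) set" where
  "std_triangle l = {x. x$1 \<ge> 0 \<and> x$2 \<ge> 0 \<and> x$1 + x$2 < l}"

definition packed_triangle :: "srep \<Rightarrow> real^2 \<Rightarrow> real \<Rightarrow> (real^2) set \<Rightarrow> bool" where
  "packed_triangle R p l B \<longleftrightarrow>
     p extreme_point_of pgon R \<and> B \<subseteq> pgon R \<and> l > 0 \<and>
     (\<exists>g \<in> grp (length (marks R)). let \<sigma> = act_map g R in
        delzant_corner (act g R) (\<sigma> p) \<and>
        (\<forall>c \<in> set (marks R). \<sigma> c \<notin> \<sigma> ` B) \<and>
        (\<exists>M\<in>SL2Z. \<sigma> ` B = (\<lambda>x. M *v x + \<sigma> p) ` std_triangle l) \<and>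
        (\<exists>U. open U \<and> \<sigma> p \<in> U \<and> \<sigma> ` B \<inter> U = \<sigma> ` pgon R \<inter> U))"

definition packs :: "srep \<Rightarrow> (real^2) set set \<Rightarrow> (real^2) set \<Rightarrow> bool" where
  "packs R \<B> P \<longleftrightarrow>
     (\<forall>B\<in>\<B>. \<exists>p l. packed_triangle R p l B) \<and> pairwise disjnt \<B> \<and> P = \<Union>\<B>"

definition is_packing :: "srep \<Rightarrow> (real^2) set \<Rightarrow> bool" where
  "is_packing R P \<longleftrightarrow> (\<exists>\<B>. packs R \<B> P)"

text \<open>
  A packing of an orbit is a family of sets; each member is recorded together with the
  representative that it is a packing of.
\<close>

type_synonym packing_family = "(srep \<times> (real^2) set) set"

definition packing_class :: "srep \<Rightarrow> (real^2) set \<Rightarrow> packing_family" where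
  "packing_class R P = {(act g R, act_map g R ` P) |g. g \<in> grp (length (marks R))}"

definition packings :: "srep set \<Rightarrow> packing_family set" where
  "packings S = {packing_class R P |R P. R \<in> S \<and> is_packing R P}"

definition triangle_size :: "srep \<Rightarrow> (real^2) set \<Rightarrow> real^2 \<Rightarrow> real" where
  "triangle_size R P p =
     (if \<exists>l \<B> B. packs R \<B> P \<and> B \<in> \<B> \<and> packed_triangle R p l B
      then THE l. \<exists>\<B> B. packs R \<B> P \<and> B \<in> \<B> \<and> packed_triangle R p l B
      else 0)"

definition cw_next :: "(real^2) set \<Rightarrow> real^2 \<Rightarrow> real^2" where
  "cw_next D p = (THE q. q \<noteq> p \<and> closed_segment p q edge_of D \<and>
                         (\<forall>x\<in>D. det2 (q - p) (x - p) \<le> 0))"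

definition steps_to_corner :: "srep \<Rightarrow> real^2 \<Rightarrow> nat" where
  "steps_to_corner R p = (LEAST n. n \<ge> 1 \<and> true_corner R ((cw_next (pgon R) ^^ n) p))"

definition lexmin_vertex :: "(real^2) set \<Rightarrow> real^2" where
  "lexmin_vertex D = (THE p. p extreme_point_of D \<and> (\<forall>q. q extreme_point_of D \<longrightarrow> lex_le p q))"

definition ncorners :: "srep \<Rightarrow> nat" where
  "ncorners R = card {p. true_corner R p}"

text \<open>
  Corners are indexed from 0: \<open>corner R i\<close> is the corner usually called $p_{i+1}$, and
  indices live in \<open>{..<ncorners R}\<close>, modulo \<open>ncorners R\<close>.
\<close>

definition corner :: "srep \<Rightarrow> nat \<Rightarrow> real^2" where
  "corner R i = ((\<lambda>p. (cw_next (pgon R) ^^ steps_to_corner R p) p) ^^ i) (lexmin_vertex (pgon R))"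

text \<open>A semitoric edge is given by the list of vertices it passes through.\<close>

definition semi_edge :: "srep \<Rightarrow> nat \<Rightarrow> (real^2) list" where
  "semi_edge R i = map (\<lambda>n. (cw_next (pgon R) ^^ n) (corner R i))
                       [0..<Suc (steps_to_corner R (corner R i))]"

fun chain_length :: "(real^2) list \<Rightarrow> real" where
  "chain_length (a # b # vs) = sl2_length a b + chain_length (b # vs)"
| "chain_length _ = 0"

fun chain_set :: "(real^2) list \<Rightarrow> (real^2) set" where
  "chain_set (a # b # vs) = closed_segment a b \<union> chain_set (b # vs)"
| "chain_set _ = {}"

text \<open>Length of the path along a chain from its first vertex to a point \<open>q\<close> on it.\<close>

fun path_length_to :: "(real^2) list \<Rightarrow> real^2 \<Rightarrow> real" where
  "path_length_to (a # b # vs) q =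
     (if q \<in> closed_segment a b then sl2_length a q
      else sl2_length a b + path_length_to (b # vs) q)"
| "path_length_to _ q = 0"

definition edge_length :: "srep \<Rightarrow> nat \<Rightarrow> real" where
  "edge_length R i = chain_length (semi_edge R i)"

text \<open>The two semitoric edges at corner \<open>i\<close>, both oriented away from it.\<close>

definition emanating :: "srep \<Rightarrow> nat \<Rightarrow> (real^2) list set" where
  "emanating R i = {semi_edge R i, rev (semi_edge R ((i + ncorners R - 1) mod ncorners R))}"

text \<open>
  \<open>q\<close>, reached along the chain \<open>C\<close>, is a point of the vertical line through the \<open>j\<close>-th marked
  point on a semitoric edge at corner \<open>i\<close>, at minimal distance from that corner.  If the line
  meets only one of the two edges the minimality is vacuous; in case of a tie both points qualify.
\<close>

definition nearest_hit :: "srep \<Rightarrow> nat \<Rightarrow> nat \<Rightarrow> (real^2) list \<Rightarrow> real^2 \<Rightarrow> bool" where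
  "nearest_hit R i j C q \<longleftrightarrow>
     C \<in> emanating R i \<and> q \<in> chain_set C \<and> q$1 = marks R ! j $ 1 \<and>
     (\<forall>C' q'. C' \<in> emanating R i \<and> q' \<in> chain_set C' \<and> q'$1 = marks R ! j $ 1 \<longrightarrow>
        path_length_to C q \<le> path_length_to C' q')"

text \<open>The infimum is over a finite set; it is \<open>\<infinity>\<close> if no line meets an edge at the corner.\<close>

definition marked_bound :: "srep \<Rightarrow> nat \<Rightarrow> ereal" where
  "marked_bound R i =
     Inf {ereal (path_length_to C q + \<bar>marks R ! j $ 2 - q$2\<bar> * \<bar>v$1 - w$1\<bar>) |j C q v w.
            j < length (marks R) \<and> nearest_hit R i j C q \<and>
            edge_dir (pgon R) (corner R i) v \<and> edge_dir (pgon R) (corner R i) w \<and> v \<noteq> w}"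

text \<open>
  The coordinate space of dimension \<open>d\<close> is \<open>real^'n\<close>, where \<open>idx\<close> is a bijection from
  \<open>'n\<close> to the corner indices \<open>{..<d}\<close>.
\<close>

definition Lam :: "('n::finite \<Rightarrow> nat) \<Rightarrow> packing_family \<Rightarrow> real^'n" where
  "Lam idx F = (\<chi> k. THE s. \<forall>(R, P) \<in> F. s = triangle_size R P (corner R (idx k)))"

definition packing_polytope :: "srep \<Rightarrow> ('n::finite \<Rightarrow> nat) \<Rightarrow> (real^'n) set" where
  "packing_polytope R idx =
     {v. (\<forall>k. v$k \<ge> 0 \<and> ereal (v$k) \<le> marked_bound R (idx k)) \<and>
         (\<forall>k k'. idx k' = Suc (idx k) mod ncorners R \<longrightarrow> v$k + v$k' \<le> edge_length R (idx k))}"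

end

theory Submission
  imports Defs
begin

text \<open>
  Every map of the group is a vertical shear \<open>(x, y) \<mapsto> (x, y + F x)\<close> with \<open>F\<close> continuous and
  piecewise affine, whose kinks lie at the marked points.  Such a map keeps vertical slices and
  their ends and transports the two boundary directions at each boundary point.  The number
  \<open>det2 w (Tpow k v)\<close>, with \<open>v\<close> and \<open>w\<close> the clockwise and counterclockwise directions at \<open>p\<close> and
  \<open>k\<close> the number of cuts through \<open>p\<close>, is invariant; it is 1 at the true corners and 0 at all other
  boundary points.  Along a semitoric edge the first component of the direction is constant, so
  lengths are differences of first coordinates.

  After a suitable shear a packed triangle is the part of the polygon below a line.  It exists
  iff its size respects the two edge lengths and the marked points, and it is then determined by
  corner and size: flipping a cut across it would put a vertex of the polygon inside it.  Two
  packed triangles that meet are, over each vertical slice, an upper and a lower part of the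
  polygon; their overlap contains no marked point and its height is affine between the marked
  points, so it can be followed to the boundary.  Hence triangles meet only if they meet on the
  boundary, which the condition on adjacent sizes excludes.  In a packing the triangles are the
  relatively open connected pieces, so sizes are well defined, and the area is the sum of the
  triangles' areas.
\<close>

section \<open>Lattice vectors and chains of segments\<close>

text \<open>Flipping a cut creates and destroys fake corners, so neither edges nor vertices of the
  polygon are invariant. Corner types and semitoric edges are therefore described without faces, by
  support directions at arbitrary boundary points and by the ends of vertical slices.

  The invariance of the determinant has a simple source. A kink of size k over an upper boundary
  point adds k to the slope of the direction going right and changes nothing else there, while k
  cuts, counted with sign, leave that point. The two effects cancel; at a lower boundary point both
  signs are reversed.

  The bound a + b |v1 - w1| of a marked point comes from the affine function \<open>height\<close>,
  which is less than l exactly on the triangle. It measures the distance from the corner along both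
  edges and has slope w1 - v1 along verticals. As long as the edges are straight, the nearest hit is
  the end of the slice where this function is smaller, so the marked point has height a + b |v1 -
  w1|. For existence every cut is turned away from a nearest hit, which keeps fake corners off the
  two edges up to distance l.\<close>

lemma vec2_eq: "x = y \<longleftrightarrow> x$1 = y$1 \<and> x$2 = y$2" for x y :: "real^2"
  by (simp add: vec_eq_iff forall_2)

lemma det2_eq: "det2 u v = u$1 * v$2 - u$2 * v$1"
  by (simp add: det2_def det_2)

lemma inner2: "x \<bullet> y = x$1 * y$1 + x$2 * y$2" for x y :: "real^2"
  by (simp add: inner_vec_def sum_2)

lemma matrix_vector2:
  "((A::real^2^2) *v x)$1 = A$1$1 * x$1 + A$1$2 * x$2"
  "((A::real^2^2) *v x)$2 = A$2$1 * x$1 + A$2$2 * x$2"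
  by (simp_all add: matrix_vector_mult_def sum_2)

lemma Tmat_apply: "Tmat *v x = vector [x$1, x$2 + x$1]"
  by (simp add: vec2_eq matrix_vector2 Tmat_def)

lemma Tmat_inv_apply: "matrix_inv Tmat *v x = vector [x$1, x$2 - x$1]"
proof -
  define N :: "real^2^2" where "N = vector [vector [1, 0], vector [-1, 1]]"
  have N: "Tmat ** N = mat 1 \<and> N ** Tmat = mat 1"
    by (simp add: vec_eq_iff forall_2 matrix_matrix_mult_def sum_2 Tmat_def N_def mat_def)
  hence inv: "Tmat ** matrix_inv Tmat = mat 1 \<and> matrix_inv Tmat ** Tmat = mat 1"
    unfolding matrix_inv_def by (rule someI)
  have "matrix_inv Tmat = matrix_inv Tmat ** (Tmat ** N)" using N by (simp add: matrix_mul_rid)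
  also have "\<dots> = N" using inv by (simp add: matrix_mul_assoc matrix_mul_lid)
  finally have "matrix_inv Tmat = N" .
  thus ?thesis by (simp add: vec2_eq matrix_vector2 N_def)
qed

lemma Tpow_apply: "Tpow k x = vector [x$1, x$2 + real k * x$1]"
  by (induction k) (simp_all add: Tpow_def vec2_eq Tmat_apply algebra_simps)

lemma det2_Tpow: "det2 w (Tpow k v) = det2 w v + real k * w$1 * v$1"
  by (simp add: det2_eq Tpow_apply algebra_simps)

lemma primitive_vecE:
  assumes "primitive_vec u"
  obtains a b :: int where "coprime a b" "u$1 = of_int a" "u$2 = of_int b"
  using assms unfolding primitive_vec_def by auto

lemma primitive_vecI:
  "coprime a b \<Longrightarrow> u$1 = of_int a \<Longrightarrow> u$2 = of_int b \<Longrightarrow> primitive_vec u"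
  unfolding primitive_vec_def by (intro exI[of _ a] exI[of _ b]) (simp add: vec2_eq)

lemma primitive_vec_nonzero: "primitive_vec u \<Longrightarrow> u \<noteq> 0"
  unfolding primitive_vec_def by (auto simp: vec2_eq)

lemma primitive_vec_Ints: "primitive_vec u \<Longrightarrow> u$1 \<in> \<int> \<and> u$2 \<in> \<int>"
  by (erule primitive_vecE) auto

lemma primitive_vec_uminus: "primitive_vec u \<Longrightarrow> primitive_vec (- u)"
  by (erule primitive_vecE, rule_tac a="-a" and b="-b" in primitive_vecI) auto

lemma primitive_vec_shear:
  assumes "primitive_vec u" shows "primitive_vec (vector [u$1, u$2 + of_int c * u$1])"
proof -
  obtain a b where ab: "coprime a b" "u$1 = of_int a" "u$2 = of_int b" using assms by (rule primitive_vecE)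
  have "coprime a (b + c * a)" using ab(1) by (metis coprime_iff_gcd_eq_1 gcd_add_mult add.commute)
  thus ?thesis using ab by (intro primitive_vecI[of a "b + c * a"]) auto
qed

lemma primitive_vec_bezout:
  assumes "primitive_vec u"
  obtains a b :: int where "of_int a * u$1 + of_int b * u$2 = 1"
proof -
  obtain n m where nm: "coprime n m" "u$1 = of_int n" "u$2 = of_int m" using assms by (rule primitive_vecE)
  obtain a b where "a * n + b * m = 1" using nm(1) bezout_int[of n m] by (auto simp: coprime_iff_gcd_eq_1)
  hence "of_int a * u$1 + of_int b * u$2 = (1::real)" unfolding nm by (metis of_int_1 of_int_add of_int_mult)
  thus ?thesis by (rule that)
qed

text \<open>Bezout coefficients make the factor of proportionality an integer, and by symmetry its
  inverse as well, so it is a unit.\<close>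

lemma primitive_vec_parallel:
  assumes "primitive_vec u" "primitive_vec v" "det2 u v = 0"
  shows "v = u \<or> v = - u"
proof -
  obtain a b where ab: "of_int a * u$1 + of_int b * u$2 = 1" using assms(1) by (rule primitive_vec_bezout)
  obtain c d where cd: "of_int c * v$1 + of_int d * v$2 = 1" using assms(2) by (rule primitive_vec_bezout)
  define k where "k = of_int a * v$1 + of_int b * v$2"
  define l where "l = of_int c * u$1 + of_int d * u$2"
  have det: "u$1 * v$2 = u$2 * v$1" using assms(3) by (simp add: det2_eq)
  have "v$1 = k * u$1" "v$2 = k * u$2" using ab det unfolding k_def by - algebra+
  moreover have "k * l = 1" using calculation cd unfolding l_def by (simp add: algebra_simps)
  moreover have "k \<in> \<int>" "l \<in> \<int>" using assms primitive_vec_Ints unfolding k_def l_def by auto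
  ultimately have "k = 1 \<or> k = -1"
    by (smt (verit) Ints_cases of_int_mult of_int_eq_1_iff zmult_eq_1_iff of_int_minus of_int_1)
  thus ?thesis using \<open>v$1 = k * u$1\<close> \<open>v$2 = k * u$2\<close> by (auto simp: vec2_eq)
qed

lemma rational_direction_primitive:
  assumes "u \<noteq> 0" "u = t *\<^sub>R vector [of_int m, of_int n]"
  obtains c v where "c > 0" "primitive_vec v" "u = c *\<^sub>R v"
proof -
  define g where "g = gcd m n"
  have mn: "m \<noteq> 0 \<or> n \<noteq> 0" and t: "t \<noteq> 0" using assms by (auto simp: vec2_eq)
  have g: "g > 0" using mn unfolding g_def by (simp add: gcd_pos_int)
  obtain m' n' where 1: "m = m' * g" "n = n' * g" "coprime m' n'"
    using mn unfolding g_def by (metis gcd_coprime_exists gcd_eq_0_iff)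
  show ?thesis
  proof (cases "t > 0")
    case True
    show ?thesis
      by (rule that[of "t * of_int g" "vector [of_int m', of_int n']"])
         (use True g assms 1 in \<open>auto simp: vec2_eq primitive_vec_def\<close>)
  next
    case False
    show ?thesis
      by (rule that[of "- t * of_int g" "vector [of_int (-m'), of_int (-n')]"])
         (use False t g assms 1 in \<open>auto simp: vec2_eq mult_less_0_iff intro!: primitive_vecI[of "-m'" "-n'"]\<close>)
  qed
qed

lemma SL2Z_iff:
  "M \<in> SL2Z \<longleftrightarrow> M$1$1 * M$2$2 - M$1$2 * M$2$1 = 1 \<and> M$1$1 \<in> \<int> \<and> M$1$2 \<in> \<int> \<and> M$2$1 \<in> \<int> \<and> M$2$2 \<in> \<int>"
  by (auto simp: SL2Z_def det_2 forall_2)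

lemma Ints_mult_eq_1_pos: "x * y = 1 \<Longrightarrow> x \<in> \<int> \<Longrightarrow> y \<in> \<int> \<Longrightarrow> x \<ge> 0 \<Longrightarrow> x = (1::real)"
  by (smt (verit) Ints_cases of_int_mult of_int_eq_1_iff zmult_eq_1_iff of_int_minus of_int_1)

lemma unimodular_solve:
  fixes a b c d x y l :: real
  assumes "a * x + b * y = l" "c * x + d * y = 0" "a * d - b * c = 1"
  shows "x = l * d" "y = - l * c"
proof -
  have "x = (a * d - b * c) * x" "y = (a * d - b * c) * y" using assms(3) by auto
  also have "(a * d - b * c) * x = (a * x + b * y) * d - b * (c * x + d * y)"
    "(a * d - b * c) * y = a * (c * x + d * y) - c * (a * x + b * y)" by (simp_all add: algebra_simps)
  ultimately show "x = l * d" "y = - l * c" using assms by simp_all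
qed

text \<open>The integers \<open>k\<close> and \<open>k'\<close> are the upper left entries of N M^-1
  and M N^-1. They turn \<open>l\<close> into \<open>l'\<close> and back, so their product is 1
  unless both lengths vanish.\<close>

lemma sl2_length_unique:
  assumes "M \<in> SL2Z" "M *v x = vector [l, 0]" "l \<ge> 0" "N \<in> SL2Z" "N *v x = vector [l', 0]" "l' \<ge> 0"
  shows "l = l'"
proof -
  note M = assms(1)[unfolded SL2Z_iff] and N = assms(4)[unfolded SL2Z_iff]
  have eM: "M$1$1 * x$1 + M$1$2 * x$2 = l" "M$2$1 * x$1 + M$2$2 * x$2 = 0"
    and eN: "N$1$1 * x$1 + N$1$2 * x$2 = l'" "N$2$1 * x$1 + N$2$2 * x$2 = 0"
    using assms(2,5) by (simp_all add: vec2_eq matrix_vector2)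
  have xM: "x$1 = l * M$2$2" "x$2 = - l * M$2$1" using unimodular_solve[OF eM conjunct1[OF M]] .
  have xN: "x$1 = l' * N$2$2" "x$2 = - l' * N$2$1" using unimodular_solve[OF eN conjunct1[OF N]] .
  define k where "k = N$1$1 * M$2$2 - N$1$2 * M$2$1"
  define k' where "k' = M$1$1 * N$2$2 - M$1$2 * N$2$1"
  have l: "l' = k * l" "l = k' * l'" unfolding k_def k'_def
    by (rule trans[OF eN(1)[symmetric, unfolded xM]], simp add: algebra_simps)
       (rule trans[OF eM(1)[symmetric, unfolded xN]], simp add: algebra_simps)
  have int: "k \<in> \<int>" "k' \<in> \<int>" unfolding k_def k'_def using M N by auto
  show ?thesis
  proof (cases "l = 0")
    case True thus ?thesis using l(1) by simp
  next
    case False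
    have "l * (k * k') = l * 1" using l(2)[unfolded l(1)] by (simp add: mult.commute mult.left_commute)
    hence "k * k' = 1" unfolding mult_cancel_left using False by simp
    moreover have "k \<ge> 0" using l(1) assms(3,6) False by (simp add: zero_le_mult_iff)
    ultimately have "k = 1" using int Ints_mult_eq_1_pos by blast
    thus ?thesis using l(1) by simp
  qed
qed

lemma sl2_length_eq:
  assumes "primitive_vec u" "t \<ge> 0" "q - p = t *\<^sub>R u"
  shows "sl2_length p q = t"
proof -
  obtain a b where ab: "of_int a * u$1 + of_int b * u$2 = 1" using assms(1) by (rule primitive_vec_bezout)
  \<comment> \<open>The Bezout row sends \<open>u\<close> to 1 and the second row annihilates it;
    the Bezout identity is also the determinant.\<close>
  define M :: "real^2^2" where "M = vector [vector [of_int a, of_int b], vector [- u$2, u$1]]"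
  have "M \<in> SL2Z" using ab primitive_vec_Ints[OF assms(1)] by (simp add: SL2Z_iff M_def algebra_simps)
  moreover have "M *v (q - p) = vector [t, 0]"
  proof -
    have "of_int a * (t * u$1) + of_int b * (t * u$2) = t * (of_int a * u$1 + of_int b * u$2)"
      by (simp only: algebra_simps)
    thus ?thesis unfolding assms(3) using ab by (simp add: vec2_eq matrix_vector2 M_def)
  qed
  ultimately have "t \<ge> 0 \<and> (\<exists>M\<in>SL2Z. M *v (q - p) = vector [t, 0])" using assms(2) by auto
  thus ?thesis unfolding sl2_length_def
    by (rule the_equality) (use sl2_length_unique \<open>M \<in> SL2Z\<close> \<open>M *v (q - p) = vector [t, 0]\<close> assms(2) in metis)
qed

text \<open>The shape of a semitoric edge: at a fake corner the direction changes by a power of T,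
  which fixes the first component. For n different from 0 lengths can then be read off first
  coordinates, which no vertical shear alters.\<close>

fun nchain :: "real \<Rightarrow> (real^2) list \<Rightarrow> bool" where
  "nchain n (a # b # vs) \<longleftrightarrow>
     (\<exists>t>0. \<exists>u. primitive_vec u \<and> u$1 = n \<and> b - a = t *\<^sub>R u) \<and> nchain n (b # vs)"
| "nchain n _ \<longleftrightarrow> True"

lemma nchain_append:
  "nchain n (xs @ [a, b]) \<longleftrightarrow>
     nchain n (xs @ [a]) \<and> (\<exists>t>0. \<exists>u. primitive_vec u \<and> u$1 = n \<and> b - a = t *\<^sub>R u)"
proof (induction xs)
  case (Cons x xs) thus ?case by (cases xs) auto
qed simp

lemma nchain_rev: "nchain n vs \<Longrightarrow> nchain (- n) (rev vs)"
proof (induction n vs rule: nchain.induct)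
  case (1 n a b vs)
  obtain t u where u: "t > 0" "primitive_vec u" "u$1 = n" "b - a = t *\<^sub>R u" using 1 by auto
  have "a - b = t *\<^sub>R (- u)" using u(4) by (metis minus_diff_eq scaleR_minus_right)
  hence "\<exists>t>0. \<exists>u. primitive_vec u \<and> u$1 = - n \<and> a - b = t *\<^sub>R u"
    using u primitive_vec_uminus by (intro exI[of _ t] conjI exI[of _ "- u"]) auto
  thus ?case using 1 by (simp add: nchain_append)
qed auto

lemma chain_set_subset_hull: "length vs \<ge> 2 \<Longrightarrow> set vs \<subseteq> chain_set vs"
proof (induction vs rule: chain_set.induct)
  case (1 a b vs) thus ?case by (cases vs) auto
qed auto

lemma chain_set_append2: "chain_set (xs @ [a, b]) = chain_set (xs @ [a]) \<union> closed_segment a b"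
proof (induction xs)
  case (Cons x xs) thus ?case by (cases xs) auto
qed simp

lemma chain_set_rev: "chain_set (rev vs) = chain_set vs"
proof (induction vs rule: chain_set.induct)
  case (1 a b vs) thus ?case by (simp add: chain_set_append2 closed_segment_commute Un_commute)
qed auto

text \<open>Dividing by \<open>n\<close> lets chains running to the right and to the left share one
  statement; the quotients are lengths along the chain.\<close>

lemma nchain_mono_fst:
  assumes "n \<noteq> 0" "nchain n vs" "q \<in> chain_set vs"
  shows "(q$1 - hd vs$1) / n \<ge> 0 \<and> (last vs$1 - q$1) / n \<ge> 0"
  using assms(2,3)
proof (induction n vs arbitrary: q rule: nchain.induct)
  case (1 n a b vs)
  obtain t u where u: "t > 0" "primitive_vec u" "u$1 = n" "b - a = t *\<^sub>R u" using 1 by auto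
  have ba: "b$1 = a$1 + t * n" using u(3,4) by (metis add_diff_cancel_left' diff_add_cancel vector_minus_component vector_scaleR_component real_scaleR_def add.commute)
  have b: "(last (b#vs)$1 - b$1) / n \<ge> 0"
  proof (cases vs)
    case (Cons c cs)
    hence "b \<in> chain_set (b#vs)" by auto
    thus ?thesis using "1.IH" "1.prems"(1) by fastforce
  qed simp
  consider "q \<in> closed_segment a b" | "q \<in> chain_set (b # vs)" using 1 by auto
  thus ?case
  proof cases
    case 1
    then obtain s where s: "0 \<le> s" "s \<le> 1" "q = (1 - s) *\<^sub>R a + s *\<^sub>R b" by (auto simp: in_segment)
    have "q$1 = (1 - s) * a$1 + s * b$1" unfolding s(3) by simp
    hence q: "q$1 = a$1 + s * t * n" using ba by (simp add: algebra_simps)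
    have "(q$1 - a$1)/n = s * t \<or> n = 0" using q by auto
    moreover have "(b$1 - q$1) / n = (1 - s) * t \<or> n = 0" using q ba by (auto simp: field_simps)
    moreover have "(last (b#vs)$1 - q$1)/n = (last (b#vs)$1 - b$1)/n + (b$1 - q$1)/n" by (simp add: diff_divide_distrib)
    ultimately show ?thesis using s u(1) b by auto
  next
    case 2
    hence "(q$1 - b$1) / n \<ge> 0 \<and> (last (b#vs)$1 - q$1) / n \<ge> 0" using 1 by auto
    moreover have "(q$1 - a$1)/n = (q$1 - b$1)/n + t \<or> n = 0" using ba by (auto simp: field_simps)
    ultimately show ?thesis using u by auto
  qed
qed auto

lemma nchain_length:
  assumes "n \<noteq> 0" "nchain n vs" "vs \<noteq> []"
  shows "chain_length vs = (last vs$1 - hd vs$1) / n"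
  using assms
proof (induction n vs rule: nchain.induct)
  case (1 n a b vs)
  obtain t u where u: "t > 0" "primitive_vec u" "u$1 = n" "b - a = t *\<^sub>R u" using 1 by auto
  have ba: "b$1 - a$1 = t * n" using u(3,4) by (metis vector_minus_component vector_scaleR_component real_scaleR_def)
  have "sl2_length a b = t" using u by (intro sl2_length_eq) auto
  thus ?case using 1 ba by (auto simp: field_simps)
qed auto

text \<open>\<open>path_length_to\<close> depends on the first segment that contains
  \<open>q\<close>; the formula shows that the value depends only on \<open>q\<close>.\<close>

lemma nchain_path:
  assumes "n \<noteq> 0" "nchain n vs" "q \<in> chain_set vs"
  shows "path_length_to vs q = (q$1 - hd vs$1) / n"
  using assms
proof (induction n vs rule: nchain.induct)
  case (1 n a b vs)
  obtain t u where u: "t > 0" "primitive_vec u" "u$1 = n" "b - a = t *\<^sub>R u" using 1 by auto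
  have ba: "b$1 - a$1 = t * n" using u(3,4) by (metis vector_minus_component vector_scaleR_component real_scaleR_def)
  have l: "sl2_length a b = t" using u by (intro sl2_length_eq) auto
  show ?case
  proof (cases "q \<in> closed_segment a b")
    case True
    then obtain s where s: "0 \<le> s" "q = (1 - s) *\<^sub>R a + s *\<^sub>R b" by (auto simp: in_segment)
    have "q - a = s *\<^sub>R (b - a)" unfolding s by (simp add: algebra_simps)
    hence qa: "q - a = (s * t) *\<^sub>R u" using u(4) by simp
    hence "sl2_length a q = s * t" using u s by (intro sl2_length_eq) auto
    moreover have "q$1 - a$1 = s * t * n" using qa u(3) by (metis vector_minus_component vector_scaleR_component real_scaleR_def)
    ultimately show ?thesis using True 1 by simp
  next
    case False
    thus ?thesis using 1 l ba by (auto simp: field_simps)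
  qed
qed auto

lemma nchain_cover:
  assumes "n \<noteq> 0" "nchain n vs" "length vs \<ge> 2" "(x - hd vs$1) / n \<ge> 0" "(last vs$1 - x) / n \<ge> 0"
  shows "\<exists>q\<in>chain_set vs. q$1 = x"
  using assms
proof (induction n vs rule: nchain.induct)
  case (1 n a b vs)
  obtain t u where u: "t > 0" "primitive_vec u" "u$1 = n" "b - a = t *\<^sub>R u" using 1 by auto
  have ba: "b$1 - a$1 = t * n" using u(3,4) by (metis vector_minus_component vector_scaleR_component real_scaleR_def)
  show ?case
  proof (cases "(b$1 - x) / n \<ge> 0")
    case True
    define s where "s = (x - a$1) / (t * n)"
    have "s = ((x - a$1) / n) / t" unfolding s_def by simp
    moreover have "(x - a$1) / n \<ge> 0" using "1.prems"(4) by simp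
    ultimately have "s \<ge> 0" using u(1) by (metis divide_nonneg_pos)
    moreover have "1 - s = ((b$1 - x) / n) / t"
    proof -
      have "b$1 = a$1 + t * n" using ba by simp
      thus ?thesis using "1.prems"(1) u(1) unfolding s_def by (simp add: divide_simps)
    qed
    hence "s \<le> 1" using True u(1) by (smt (verit) divide_nonneg_pos)
    moreover have "((1 - s) *\<^sub>R a + s *\<^sub>R b)$1 = x"
    proof -
      have "((1 - s) *\<^sub>R a + s *\<^sub>R b)$1 = a$1 + s * (b$1 - a$1)" by (simp add: algebra_simps)
      thus ?thesis using ba "1.prems"(1) u(1) unfolding s_def by simp
    qed
    ultimately show ?thesis by (auto simp: in_segment intro!: bexI[of _ "(1 - s) *\<^sub>R a + s *\<^sub>R b"])
  next
    case False
    hence bx: "(x - b$1) / n \<ge> 0" by (metis (no_types, opaque_lifting) linorder_not_le minus_diff_eq minus_divide_left neg_0_le_iff_le order_less_le)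
    have "vs \<noteq> []" using False 1 by auto
    then obtain c cs where vs: "vs = c # cs" by (cases vs) auto
    have "\<exists>q\<in>chain_set (b # vs). q$1 = x" by (rule "1.IH") (use "1.prems" bx vs in auto)
    thus ?thesis by auto
  qed
qed auto

section \<open>Boundary directions of a rational polygon\<close>

text \<open>For \<open>r = 1\<close> the boundary is followed clockwise from \<open>p\<close>, for \<open>r = -1\<close> counterclockwise.\<close>

definition tangent :: "real \<Rightarrow> (real^2) set \<Rightarrow> real^2 \<Rightarrow> real^2 \<Rightarrow> bool" where
  "tangent r D p u \<longleftrightarrow> u \<noteq> 0 \<and> p \<in> D \<and> (\<exists>t>0. p + t *\<^sub>R u \<in> D) \<and> (\<forall>x\<in>D. r * det2 u (x - p) \<le> 0)"

lemma tangentD: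
  assumes "tangent r D p u"
  shows "u \<noteq> 0" "p \<in> D" "\<exists>t>0. p + t *\<^sub>R u \<in> D" "\<And>x. x \<in> D \<Longrightarrow> r * det2 u (x - p) \<le> 0"
  using assms unfolding tangent_def by auto

lemma interior_dir:
  fixes c d :: "real^2"
  assumes "c \<in> interior D"
  obtains e where "e > 0" "\<And>t. \<bar>t\<bar> \<le> e \<Longrightarrow> c + t *\<^sub>R d \<in> D"
proof -
  obtain e where e: "e > 0" "cball c e \<subseteq> D" using assms mem_interior_cball by blast
  have pos: "norm d + 1 > 0" by (smt (verit) norm_ge_zero)
  show ?thesis
  proof (rule that[of "e / (norm d + 1)"])
    show "e / (norm d + 1) > 0" using e pos by simp
    fix t assume "\<bar>t\<bar> \<le> e / (norm d + 1)"
    hence "\<bar>t\<bar> * (norm d + 1) \<le> e" using pos by (simp add: field_simps)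
    hence "\<bar>t\<bar> * norm d \<le> e" by (smt (verit) abs_ge_zero distrib_left mult_cancel_left2)
    thus "c + t *\<^sub>R d \<in> D" using e by (intro subsetD[OF e(2)]) (simp add: dist_norm)
  qed
qed

lemma det2_parallel:
  assumes "u \<noteq> 0" "det2 u x = 0" obtains c where "x = c *\<^sub>R u"
proof -
  have n: "u$1 * u$1 + u$2 * u$2 \<noteq> 0" using assms(1) by (simp add: vec2_eq sum_squares_eq_zero_iff)
  define c where "c = (u$1 * x$1 + u$2 * x$2) / (u$1 * u$1 + u$2 * u$2)"
  have e: "u$1 * x$2 = u$2 * x$1" using assms(2) by (simp add: det2_eq)
  have "x$1 * (u$1 * u$1 + u$2 * u$2) = (u$1 * x$1 + u$2 * x$2) * u$1"
    using e by (simp add: algebra_simps)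
  moreover have "x$2 * (u$1 * u$1 + u$2 * u$2) = (u$1 * x$1 + u$2 * x$2) * u$2"
    using e by (simp add: algebra_simps)
  ultimately have "x = c *\<^sub>R u" using n unfolding c_def by (simp add: vec2_eq field_simps)
  thus ?thesis by (rule that)
qed

lemma det2_simps:
  "det2 u (c *\<^sub>R v) = c * det2 u v" "det2 (c *\<^sub>R u) v = c * det2 u v"
  "det2 u (v + w) = det2 u v + det2 u w" "det2 (u + v) w = det2 u w + det2 v w"
  "det2 u (v - w) = det2 u v - det2 u w" "det2 (u - v) w = det2 u w - det2 v w"
  "det2 u (- v) = - det2 u v" "det2 (- u) v = - det2 u v" "det2 u u = 0" "det2 u 0 = 0" "det2 0 u = 0"
  by (simp_all add: det2_eq algebra_simps)

lemma tangent_scale: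
  assumes "c > 0" "tangent r D p u" shows "tangent r D p (c *\<^sub>R u)"
proof -
  obtain t where t: "t > 0" "p + t *\<^sub>R u \<in> D" using tangentD(3)[OF assms(2)] by auto
  have "r * det2 (c *\<^sub>R u) (x - p) \<le> 0" if "x \<in> D" for x
  proof -
    have "r * det2 (c *\<^sub>R u) (x - p) = c * (r * det2 u (x - p))" by (simp add: det2_simps(2))
    thus ?thesis using tangentD(4)[OF assms(2) that] assms(1) by (metis mult_le_0_iff less_imp_le)
  qed
  moreover have "t / c > 0" "p + (t / c) *\<^sub>R c *\<^sub>R u \<in> D" using t assms(1) by simp_all
  ultimately show ?thesis using tangentD[OF assms(2)] assms(1) unfolding tangent_def by (metis scaleR_eq_0_iff order_less_irrefl)
qed

lemma tangent_interior_strict: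
  assumes "tangent r D p u" "r \<noteq> 0" "c \<in> interior D"
  shows "r * det2 u (c - p) < 0"
proof -
  \<comment> \<open>\<open>u\<close> turned by a right angle towards the outer side. If
    \<open>c\<close> were on the support line, a small step along \<open>d\<close> would stay in
    \<open>D\<close> and cross it.\<close>
  define d where "d = r *\<^sub>R (vector [- u$2, u$1] :: real^2)"
  have "u$1 * u$1 + u$2 * u$2 > 0" using tangentD(1)[OF assms(1)]
    by (smt (verit) vec2_eq sum_squares_gt_zero_iff zero_index)
  hence d: "r * det2 u d > 0" using assms(2)
    unfolding d_def det2_simps by (auto simp: det2_eq mult.assoc[symmetric] zero_less_mult_iff)
  obtain e where e: "e > 0" "\<And>t. \<bar>t\<bar> \<le> e \<Longrightarrow> c + t *\<^sub>R d \<in> D" using interior_dir[OF assms(3)] by blast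
  have "r * det2 u (c + e *\<^sub>R d - p) \<le> 0" by (rule tangentD(4)[OF assms(1)]) (use e in auto)
  hence "r * det2 u (c - p) + e * (r * det2 u d) \<le> 0" by (simp add: det2_simps algebra_simps)
  thus ?thesis using mult_pos_pos[OF e(1) d] by linarith
qed

lemma tangent_frontier: "tangent r D p u \<Longrightarrow> r \<noteq> 0 \<Longrightarrow> p \<in> frontier D"
  using tangent_interior_strict[of r D p u p] tangentD(2)[of r D p u] closure_subset
  by (auto simp: frontier_def det2_simps)

lemma neg_factor_pos: "x < 0 \<Longrightarrow> c * x < 0 \<Longrightarrow> c > 0" for x c :: real
  by (metis mult_less_0_iff order_less_asym)

text \<open>Each direction lies weakly on the inner side of the other, so the determinant vanishes;
  an interior point, strictly inside both half-planes, rules out opposite directions.\<close>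

lemma tangent_unique_dir:
  assumes "tangent r D p u" "tangent r D p u'" "r \<noteq> 0" "interior D \<noteq> {}"
  obtains c where "c > 0" "u' = c *\<^sub>R u"
proof -
  obtain t where t: "t > 0" "p + t *\<^sub>R u \<in> D" using tangentD(3)[OF assms(1)] by auto
  obtain t' where t': "t' > 0" "p + t' *\<^sub>R u' \<in> D" using tangentD(3)[OF assms(2)] by auto
  have "t' * (r * det2 u u') \<le> 0" using tangentD(4)[OF assms(1) t'(2)] by (simp add: det2_simps mult.left_commute)
  hence 1: "r * det2 u u' \<le> 0" using t'(1) by (metis mult_le_0_iff not_less)
  have "t * (r * det2 u' u) \<le> 0" using tangentD(4)[OF assms(2) t(2)] by (simp add: det2_simps mult.left_commute)
  hence "r * det2 u' u \<le> 0" using t(1) by (metis mult_le_0_iff not_less)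
  moreover have "det2 u' u = - det2 u u'" by (simp add: det2_eq)
  ultimately have "r * det2 u u' = 0" using 1 by simp
  hence "det2 u u' = 0" using assms(3) by simp
  then obtain c where c: "u' = c *\<^sub>R u" using det2_parallel tangentD(1)[OF assms(1)] by blast
  obtain z where z: "z \<in> interior D" using assms(4) by blast
  have 2: "r * det2 u (z - p) < 0" "c * (r * det2 u (z - p)) < 0"
    using tangent_interior_strict[OF assms(1,3) z] tangent_interior_strict[OF assms(2,3) z]
    unfolding c by (simp_all add: det2_simps(2) mult.left_commute[of r c])
  have "c > 0" using neg_factor_pos[OF 2] .
  thus ?thesis using c that by blast
qed

lemma tangent_primitive_unique:
  assumes "tangent r D p u" "tangent r D p u'" "r \<noteq> 0" "interior D \<noteq> {}" "primitive_vec u" "primitive_vec u'"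
  shows "u' = u"
proof -
  obtain c where c: "c > 0" "u' = c *\<^sub>R u" using tangent_unique_dir[OF assms(1-4)] .
  have "det2 u u' = 0" using c by (simp add: det2_simps)
  hence "u' = u \<or> u' = - u" using primitive_vec_parallel assms by blast
  moreover have "u' \<noteq> - u"
  proof
    assume "u' = - u"
    hence "(c + 1) *\<^sub>R u = 0" using c(2) by (simp add: scaleR_add_left)
    thus False using c(1) tangentD(1)[OF assms(1)] by simp
  qed
  ultimately show ?thesis by blast
qed

text \<open>A vertex is exposed, so all other vertices are seen from \<open>p\<close> within an open
  half-plane. Among finitely many directions there is an extremal one, and it supports the whole
  hull.\<close>

lemma tangent_exists_extreme:
  assumes "polytope D" "interior D \<noteq> {}" "p extreme_point_of D" "r = 1 \<or> r = -1"
  shows "\<exists>u. tangent r D p u"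
proof -
  have "{p} exposed_face_of D"
    using assms(3) exposed_face_of_polyhedron[OF polytope_imp_polyhedron[OF assms(1)]] by (simp add: face_of_singleton)
  then obtain a b where ab: "D \<subseteq> {x. a \<bullet> x \<le> b}" "{p} = D \<inter> {x. a \<bullet> x = b}"
    unfolding exposed_face_of_def by blast
  define n where "n = - a"
  have pD: "p \<in> D" using assms(3) by (simp add: extreme_point_of_def)
  have n: "n \<bullet> (x - p) > 0" if "x \<in> D" "x \<noteq> p" for x
  proof -
    have "a \<bullet> x \<noteq> b" "a \<bullet> x \<le> b" "a \<bullet> p = b" using ab that by auto
    thus ?thesis unfolding n_def by (simp add: inner_diff_right)
  qed
  define V where "V = {v. v extreme_point_of D}"
  have V: "finite V" "D = convex hull V"
    unfolding V_def
    by (rule finite_polyhedron_extreme_points[OF polytope_imp_polyhedron[OF assms(1)]],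
        rule Krein_Milman_Minkowski[OF polytope_imp_compact[OF assms(1)] polytope_imp_convex[OF assms(1)]])
  have VD: "V \<subseteq> D" unfolding V_def extreme_point_of_def by blast
  \<comment> \<open>Up to the sign \<open>r\<close> this is the tangent of the angle from
    \<open>n\<close> to \<open>v - p\<close>, well defined because the inner product is
    positive.\<close>
  define \<rho> where "\<rho> v = r * det2 n (v - p) / (n \<bullet> (v - p))" for v
  have ne: "V - {p} \<noteq> {}"
  proof
    assume "V - {p} = {}"
    hence "D \<subseteq> {p}" using V(2) by (metis Diff_eq_empty_iff convex_hull_singleton hull_mono)
    hence "interior D \<subseteq> interior {p}" by (rule interior_mono)
    thus False using assms(2) by simp
  qed
  obtain v where v: "v \<in> V - {p}" "\<And>x. x \<in> V - {p} \<Longrightarrow> \<rho> x \<le> \<rho> v"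
  proof -
    have fin: "finite (\<rho> ` (V - {p}))" using V(1) by simp
    have "Max (\<rho> ` (V - {p})) \<in> \<rho> ` (V - {p})" using fin ne by (intro Max_in) auto
    then obtain v where "v \<in> V - {p}" "Max (\<rho> ` (V - {p})) = \<rho> v" by blast
    thus ?thesis using that[of v] Max_ge[OF fin] by auto
  qed
  have nn: "n$1 * n$1 + n$2 * n$2 > 0"
  proof -
    have "n \<bullet> (v - p) > 0" using n v(1) VD by blast
    hence "n \<noteq> 0" by auto
    thus ?thesis by (smt (verit) vec2_eq sum_squares_gt_zero_iff zero_index)
  qed
  have key: "r * det2 (v - p) (x - p) \<le> 0" if "x \<in> V" for x
  proof (cases "x = p")
    case False
    define y z where "y = v - p" and "z = x - p"
    have pos: "n \<bullet> y > 0" "n \<bullet> z > 0" using n v(1) VD that False unfolding y_def z_def by blast+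
    have "r * det2 n z / (n \<bullet> z) \<le> r * det2 n y / (n \<bullet> y)" using v(2) that False unfolding \<rho>_def y_def z_def by blast
    hence le: "r * det2 n z * (n \<bullet> y) \<le> r * det2 n y * (n \<bullet> z)" using pos by (simp add: field_simps)
    \<comment> \<open>The planar identity behind the difference of two tangents: comparing \<rho> at
      two vertices becomes the sign of their determinant.\<close>
    have "(n$1 * n$1 + n$2 * n$2) * det2 y z = (n \<bullet> y) * det2 n z - det2 n y * (n \<bullet> z)"
      by (simp add: inner2 det2_eq algebra_simps)
    hence "r * ((n$1 * n$1 + n$2 * n$2) * det2 y z) = r * ((n \<bullet> y) * det2 n z - det2 n y * (n \<bullet> z))" by simp
    hence "(n$1 * n$1 + n$2 * n$2) * (r * det2 y z) = r * det2 n z * (n \<bullet> y) - r * det2 n y * (n \<bullet> z)"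
      by (simp only: mult.left_commute[of r] right_diff_distrib mult.assoc mult.commute[of "n \<bullet> y"])
    hence "(n$1 * n$1 + n$2 * n$2) * (r * det2 y z) \<le> 0" using le by simp
    thus ?thesis using nn unfolding y_def z_def by (simp add: mult_le_0_iff)
  qed (simp add: det2_simps)
  have "D \<subseteq> {x. r * det2 (v - p) (x - p) \<le> 0}" unfolding V(2)
  proof (rule hull_minimal)
    show "V \<subseteq> {x. r * det2 (v - p) (x - p) \<le> 0}" using key by blast
    have "{x. r * det2 (v - p) (x - p) \<le> 0} =
        {x. (r *\<^sub>R vector [- (v - p)$2, (v - p)$1] :: real^2) \<bullet> x \<le> (r *\<^sub>R vector [- (v - p)$2, (v - p)$1] :: real^2) \<bullet> p}"
      by (auto simp: inner2 det2_eq algebra_simps)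
    thus "convex {x. r * det2 (v - p) (x - p) \<le> 0}" by (metis convex_halfspace_le)
  qed
  moreover have "p + 1 *\<^sub>R (v - p) \<in> D" using v(1) VD by auto
  ultimately have "tangent r D p (v - p)" unfolding tangent_def using v(1) pD
    by (auto intro!: exI[of _ "1::real"])
  thus ?thesis by blast
qed

lemma tangent_exists:
  assumes "polytope D" "interior D \<noteq> {}" "p \<in> frontier D" "r = 1 \<or> r = -1"
  shows "\<exists>u. tangent r D p u"
proof (cases "p extreme_point_of D")
  case True thus ?thesis using tangent_exists_extreme assms by blast
next
  case False
  have cl: "closed D" "convex D" using assms(1) polytope_imp_closed polytope_imp_convex by auto
  have pD: "p \<in> D" using assms(3) cl(1) frontier_subset_closed by blast
  then obtain a b where ab: "a \<in> D" "b \<in> D" "p \<in> open_segment a b" using False by (auto simp: extreme_point_of_def)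
  have rel: "rel_interior D = interior D" using assms(2) by (rule rel_interior_nonempty_interior)
  obtain n where n: "n \<noteq> 0" "\<And>y. y \<in> closure D \<Longrightarrow> n \<bullet> p \<le> n \<bullet> y"
    using supporting_hyperplane_relative_frontier[OF cl(2), of p] pD rel assms(3) closure_subset
    by (metis DiffD2 frontier_def subsetD)
  have nD: "n \<bullet> p \<le> n \<bullet> y" if "y \<in> D" for y using n(2) that closure_subset by blast
  obtain s where s: "0 < s" "s < 1" "p = (1 - s) *\<^sub>R a + s *\<^sub>R b" "a \<noteq> b" using ab(3) by (auto simp: in_segment)
  have pa: "p - a = s *\<^sub>R (b - a)" and bp: "b - p = (1 - s) *\<^sub>R (b - a)" unfolding s(3) by (simp_all add: algebra_simps)
  have "n \<bullet> (p - a) \<le> 0" "n \<bullet> (b - p) \<ge> 0" using nD ab by (auto simp: inner_diff_right)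
  hence nab: "n \<bullet> (b - a) = 0" unfolding pa bp using s by (simp add: mult_le_0_iff zero_le_mult_iff)
  \<comment> \<open>The support line at \<open>p\<close> must contain the segment from
    \<open>a\<close> to \<open>b\<close>. The normal is rotated so that \<open>D\<close> lies on the
    side required by \<open>r\<close>; then one of \<open>a\<close> and \<open>b\<close> lies ahead
    of \<open>p\<close>.\<close>
  define u where "u = r *\<^sub>R (vector [- n$2, n$1] :: real^2)"
  have u: "u \<noteq> 0" using n(1) assms(4) unfolding u_def by (auto simp: vec2_eq)
  have det: "det2 u d = - r * (n \<bullet> d)" for d unfolding u_def by (simp add: det2_eq inner2 algebra_simps)
  hence sup: "r * det2 u (x - p) \<le> 0" if "x \<in> D" for x
    using nD[OF that] assms(4) unfolding det by (auto simp: inner_diff_right)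
  have "det2 u (b - a) = 0" using nab unfolding det by simp
  then obtain c where c: "b - a = c *\<^sub>R u" using det2_parallel[OF u] by blast
  have "c \<noteq> 0" using c s(4) by auto
  have "\<exists>t>0. p + t *\<^sub>R u \<in> D"
  proof (cases "c > 0")
    case True
    have "p + ((1 - s) * c) *\<^sub>R u = b" using bp c by (metis add.commute diff_add_cancel scaleR_scaleR)
    thus ?thesis using True s ab by (intro exI[of _ "(1 - s) * c"]) auto
  next
    case False
    have "a = p - s *\<^sub>R (b - a)" using pa by (metis add_diff_cancel_left' diff_add_cancel)
    hence "p + (- s * c) *\<^sub>R u = a" using c by simp
    thus ?thesis using False \<open>c \<noteq> 0\<close> s ab by (intro exI[of _ "- s * c"]) (auto simp: mult_pos_neg)
  qed
  thus ?thesis using u pD sup unfolding tangent_def by blast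
qed

text \<open>Needed because rationality is assumed for edges only: the face cut out by the support
  line is an edge containing \<open>p\<close>.\<close>

lemma tangent_edge:
  assumes "polytope D" "tangent r D p u" "r \<noteq> 0"
  obtains a b where "a \<noteq> b" "closed_segment a b edge_of D" "p \<in> closed_segment a b"
    "closed_segment a b = D \<inter> {x. det2 u (x - p) = 0}"
proof -
  define n where "n = r *\<^sub>R (vector [- u$2, u$1] :: real^2)"
  define F where "F = D \<inter> {x. n \<bullet> x = n \<bullet> p}"
  have n: "n \<bullet> x - n \<bullet> p = r * det2 u (x - p)" for x unfolding n_def by (simp add: det2_eq inner2 algebra_simps)
  have face: "F face_of D" unfolding F_def
  proof (rule face_of_Int_supporting_hyperplane_le[OF polytope_imp_convex[OF assms(1)]])
    fix x assume "x \<in> D"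
    thus "n \<bullet> x \<le> n \<bullet> p" using tangentD(4)[OF assms(2), of x] n[of x] by linarith
  qed
  have F: "F = D \<inter> {x. det2 u (x - p) = 0}" 
  proof -
    have "n \<bullet> x = n \<bullet> p \<longleftrightarrow> det2 u (x - p) = 0" for x using n[of x] assms(3) by auto
    thus ?thesis unfolding F_def by simp
  qed
  have col: "collinear F" unfolding collinear_def
  proof (intro exI[of _ u] ballI)
    fix x y assume "x \<in> F" "y \<in> F"
    hence "det2 u (x - y) = 0" unfolding F by (simp add: det2_simps)
    then obtain c where "x - y = c *\<^sub>R u" by (rule det2_parallel[OF tangentD(1)[OF assms(2)]])
    thus "\<exists>c. x - y = c *\<^sub>R u" by blast
  qed
  have pF: "p \<in> F" using tangentD(2)[OF assms(2)] by (simp add: F_def)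
  obtain a b where ab: "F = closed_segment a b"
  proof (rule compact_convex_collinear_segment[OF _ _ _ col])
    show "F \<noteq> {}" using pF by auto
    show "compact F" by (rule face_of_imp_compact[OF polytope_imp_convex[OF assms(1)] polytope_imp_compact[OF assms(1)] face])
    show "convex F" by (rule face_of_imp_convex[OF face])
  qed
  obtain t where t: "t > 0" "p + t *\<^sub>R u \<in> D" using tangentD(3)[OF assms(2)] by auto
  hence "p + t *\<^sub>R u \<in> F" unfolding F by (simp add: det2_simps)
  hence "a \<noteq> b" using pF ab t tangentD(1)[OF assms(2)] by auto
  moreover have "aff_dim F = 1" unfolding ab segment_convex_hull using \<open>a \<noteq> b\<close> by (simp add: aff_dim_convex_hull aff_dim_2)
  ultimately have edge: "closed_segment a b edge_of D" using face unfolding edge_of_def ab[symmetric] by simp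
  show ?thesis by (rule that[OF \<open>a \<noteq> b\<close> edge pF[unfolded ab] F[unfolded ab]])
qed

lemma tangent_rational:
  assumes "rational_polygon D" "tangent r D p u" "r \<noteq> 0"
  obtains c v where "c > 0" "primitive_vec v" "u = c *\<^sub>R v"
proof -
  have "polytope D" using assms(1) by (simp add: rational_polygon_def)
  then obtain a b where ab: "a \<noteq> b" "closed_segment a b edge_of D" "closed_segment a b = D \<inter> {x. det2 u (x - p) = 0}"
    by (rule tangent_edge[OF _ assms(2,3)])
  obtain m n t where mn: "b - a = t *\<^sub>R vector [of_int m, of_int n]"
    using assms(1) ab(2) unfolding rational_polygon_def by blast
  have "a \<in> closed_segment a b" "b \<in> closed_segment a b" by auto
  hence "det2 u (a - p) = 0" "det2 u (b - p) = 0" using ab(3) by auto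
  hence "det2 u (b - a) = 0" by (simp add: det2_simps)
  then obtain c where c: "b - a = c *\<^sub>R u" using det2_parallel tangentD(1)[OF assms(2)] by blast
  have "c \<noteq> 0" using c ab(1) by auto
  hence "u = (1 / c) *\<^sub>R (b - a)" using c by simp
  hence "u = (t / c) *\<^sub>R vector [of_int m, of_int n]" using mn by simp
  thus ?thesis using rational_direction_primitive tangentD(1)[OF assms(2)] that by blast
qed

lemma primitive_tangent_exists:
  assumes "rational_polygon D" "p \<in> frontier D" "r = 1 \<or> r = -1"
  obtains u where "primitive_vec u" "tangent r D p u"
proof -
  obtain u where u: "tangent r D p u" using tangent_exists[of D p r] assms by (auto simp: rational_polygon_def)
  obtain c v where c: "c > 0" "primitive_vec v" "u = c *\<^sub>R v"
    using tangent_rational[OF assms(1) u] assms(3) by (metis zero_neq_neg_one zero_neq_one)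
  have "tangent r D p ((1/c) *\<^sub>R u)" using tangent_scale[of "1/c"] c(1) u by simp
  moreover have "(1/c) *\<^sub>R u = v" using c by simp
  ultimately show ?thesis using that c(2) by simp
qed

lemma tangent_det_nonneg: "tangent 1 D p v \<Longrightarrow> tangent (-1) D p w \<Longrightarrow> det2 w v \<ge> 0"
proof -
  assume v: "tangent 1 D p v" and w: "tangent (-1) D p w"
  obtain t where t: "t > 0" "p + t *\<^sub>R v \<in> D" using tangentD(3)[OF v] by auto
  have "-1 * det2 w (t *\<^sub>R v) \<le> 0" using tangentD(4)[OF w t(2)] by simp
  thus "det2 w v \<ge> 0" using t(1) by (simp add: det2_simps zero_le_mult_iff)
qed

text \<open>If the determinant is 0, the interior point forces opposite directions, and
  \<open>p\<close> is inside a boundary segment. If it is positive, a segment of \<open>D\<close>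
  through \<open>p\<close> would have to be parallel to both directions.\<close>

lemma extreme_iff_det:
  assumes "convex D" "interior D \<noteq> {}" "tangent 1 D p v" "tangent (-1) D p w"
  shows "p extreme_point_of D \<longleftrightarrow> det2 w v > 0"
proof
  assume L: "p extreme_point_of D"
  show "det2 w v > 0"
  proof (rule ccontr)
    assume "\<not> det2 w v > 0"
    hence "det2 w v = 0" using tangent_det_nonneg assms by fastforce
    then obtain c where c: "v = c *\<^sub>R w" using det2_parallel tangentD(1)[OF assms(4)] by blast
    obtain z where z: "z \<in> interior D" using assms(2) by blast
    have "c * det2 w (z - p) < 0" using tangent_interior_strict[OF assms(3) _ z] c by (simp add: det2_simps(2))
    moreover have "- det2 w (z - p) < 0" using tangent_interior_strict[OF assms(4) _ z] by simp
    ultimately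
    have "c < 0" by (simp add: mult_less_0_iff)
    obtain t where t: "t > 0" "p + t *\<^sub>R v \<in> D" using tangentD(3)[OF assms(3)] by auto
    obtain s where s: "s > 0" "p + s *\<^sub>R w \<in> D" using tangentD(3)[OF assms(4)] by auto
    \<comment> \<open>The weight for which the displacements along the opposite vectors
      \<open>v\<close> and \<open>w\<close> cancel.\<close>
    define \<theta> where "\<theta> = t * (- c) / (s + t * (-c))"
    have pos: "t * (- c) > 0" using t \<open>c < 0\<close> by (simp add: mult_pos_neg)
    hence pos2: "s + t * (-c) > 0" using s by linarith
    note pos = pos pos2
    have "\<theta> * s + (1 - \<theta>) * (t * c) = 0" unfolding \<theta>_def using pos by (simp add: field_simps)
    moreover have "(1 - \<theta>) *\<^sub>R (p + t *\<^sub>R v) + \<theta> *\<^sub>R (p + s *\<^sub>R w) = p + (\<theta> * s + (1 - \<theta>) * (t * c)) *\<^sub>R w"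
      unfolding c by (simp add: vec2_eq algebra_simps)
    ultimately have "p = (1 - \<theta>) *\<^sub>R (p + t *\<^sub>R v) + \<theta> *\<^sub>R (p + s *\<^sub>R w)" by simp
    moreover have "0 < \<theta>" "\<theta> < 1" unfolding \<theta>_def using pos s by (simp_all add: field_simps)
    moreover have "p + t *\<^sub>R v \<noteq> p + s *\<^sub>R w"
    proof
      assume "p + t *\<^sub>R v = p + s *\<^sub>R w"
      hence "(t * c - s) *\<^sub>R w = 0" unfolding c by (simp add: scaleR_left_diff_distrib)
      thus False using tangentD(1)[OF assms(4)] s pos by auto
    qed
    ultimately have "p \<in> open_segment (p + t *\<^sub>R v) (p + s *\<^sub>R w)" by (auto simp: in_segment)
    thus False using L t s by (auto simp: extreme_point_of_def)
  qed
next
  assume R: "det2 w v > 0"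
  show "p extreme_point_of D" unfolding extreme_point_of_def
  proof (intro conjI ballI notI)
    show "p \<in> D" using tangentD(2) assms by blast
    fix a b assume ab: "a \<in> D" "b \<in> D" "p \<in> open_segment a b"
    obtain s where s: "0 < s" "s < 1" "p = (1 - s) *\<^sub>R a + s *\<^sub>R b" "a \<noteq> b" using ab(3) by (auto simp: in_segment)
    have pa: "a - p = (-s) *\<^sub>R (b - a)" and bp: "b - p = (1 - s) *\<^sub>R (b - a)" unfolding s(3) by (simp_all add: algebra_simps)
    have 1: "(-s) * det2 v (b - a) \<le> 0" "(1 - s) * det2 v (b - a) \<le> 0"
      using tangentD(4)[OF assms(3) ab(1)] tangentD(4)[OF assms(3) ab(2)] unfolding pa bp by (simp_all add: det2_simps)
    hence v0: "det2 v (b - a) = 0" using s(1,2) by (simp add: mult_le_0_iff zero_le_mult_iff)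
    have "s * det2 w (b - a) \<le> 0" "- ((1 - s) * det2 w (b - a)) \<le> 0"
      using tangentD(4)[OF assms(4) ab(1)] tangentD(4)[OF assms(4) ab(2)] unfolding pa bp by (simp_all add: det2_simps)
    hence w0: "det2 w (b - a) = 0" using s(1,2) by (simp add: mult_le_0_iff zero_le_mult_iff)
    obtain c where "b - a = c *\<^sub>R v" using det2_parallel[OF tangentD(1)[OF assms(3)] v0] by blast
    hence "c = 0" using w0 R by (simp add: det2_simps)
    thus False using \<open>b - a = c *\<^sub>R v\<close> s(4) by simp
  qed
qed

lemma extreme_frontier: "interior D \<noteq> {} \<Longrightarrow> p extreme_point_of D \<Longrightarrow> p \<in> frontier (D::(real^2) set)"
proof -
  assume p: "p extreme_point_of D"
  have "p \<notin> interior D"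
  proof
    assume "p \<in> interior D"
    then obtain e where e: "e > 0" "\<And>t. \<bar>t\<bar> \<le> e \<Longrightarrow> p + t *\<^sub>R (vector [1,0]) \<in> D" using interior_dir by blast
    have "p \<in> open_segment (p + (-e) *\<^sub>R vector [1,0]) (p + e *\<^sub>R vector [1,0])"
      using e(1) by (auto simp: in_segment vec2_eq algebra_simps intro!: exI[of _ "1/2"])
    moreover have "p + (-e) *\<^sub>R vector [1,0] \<in> D" "p + e *\<^sub>R vector [1,0] \<in> D" using e by (metis abs_minus_cancel abs_of_pos order_refl)+
    ultimately show False using p unfolding extreme_point_of_def by blast
  qed
  thus ?thesis using p closure_subset by (auto simp: frontier_def extreme_point_of_def)
qed

section \<open>Edges at a vertex and the clockwise successor\<close>

lemma edge_at_extreme: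
  assumes "polytope D" "p extreme_point_of D" "tangent r D p u" "r \<noteq> 0"
  obtains s where "s > 0" "closed_segment p (p + s *\<^sub>R u) edge_of D" "\<And>t. p + t *\<^sub>R u \<in> D \<Longrightarrow> 0 \<le> t \<and> t \<le> s"
proof -
  obtain a b where ab: "a \<noteq> b" "closed_segment a b edge_of D" "p \<in> closed_segment a b"
    "closed_segment a b = D \<inter> {x. det2 u (x - p) = 0}" using tangent_edge[OF assms(1,3,4)] .
  have "p extreme_point_of closed_segment a b" using assms(2) ab(3,4) by (auto simp: extreme_point_of_def)
  hence "p = a \<or> p = b" by (simp add: extreme_point_of_segment)
  then obtain q where q: "closed_segment a b = closed_segment p q" "p \<noteq> q" using ab(1) closed_segment_commute by metis
  have "q \<in> closed_segment a b" unfolding q(1) by simp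
  hence "det2 u (q - p) = 0" unfolding ab(4) by simp
  then obtain s where s: "q - p = s *\<^sub>R u" using det2_parallel tangentD(1)[OF assms(3)] by blast
  have in_seg: "\<exists>l. 0 \<le> l \<and> l \<le> 1 \<and> t = l * s" if "p + t *\<^sub>R u \<in> D" for t
  proof -
    have "det2 u (p + t *\<^sub>R u - p) = 0" by (simp add: det2_simps)
    hence "p + t *\<^sub>R u \<in> closed_segment p q" unfolding q(1)[symmetric] ab(4) using that by blast
    then obtain l where l: "0 \<le> l" "l \<le> 1" "p + t *\<^sub>R u = (1 - l) *\<^sub>R p + l *\<^sub>R q" by (auto simp: in_segment)
    have "(1 - l) *\<^sub>R p + l *\<^sub>R q = p + l *\<^sub>R (q - p)" by (simp add: algebra_simps)
    hence "t *\<^sub>R u = (l * s) *\<^sub>R u" using l(3) s by simp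
    thus ?thesis using l tangentD(1)[OF assms(3)] by (intro exI[of _ l]) simp
  qed
  obtain t where t: "t > 0" "p + t *\<^sub>R u \<in> D" using tangentD(3)[OF assms(3)] by auto
  have "s > 0" using in_seg[OF t(2)] t(1) by (metis linorder_not_le mult_nonneg_nonpos order_less_le_trans order_less_irrefl)
  moreover have "p + s *\<^sub>R u = q" using s by (metis add.commute diff_add_cancel)
  ultimately show ?thesis using that[of s] ab(2) q(1) in_seg by (metis mult_left_le_one_le mult_nonneg_nonneg order_less_imp_le)
qed

lemma edge_tangent:
  assumes "polytope D" "interior D \<noteq> {}" "closed_segment p q edge_of D" "p \<noteq> q"
  shows "tangent 1 D p (q - p) \<or> tangent (-1) D p (q - p)"
proof -
  have face: "closed_segment p q face_of D" "aff_dim (closed_segment p q) = 1" using assms(3) by (auto simp: edge_of_def)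
  have sub: "closed_segment p q \<subseteq> D" using face face_of_imp_subset by blast
  obtain n b where nb: "D \<subseteq> {x. n \<bullet> x \<le> b}" "closed_segment p q = D \<inter> {x. n \<bullet> x = b}"
    using face(1) assms(1) exposed_face_of_polyhedron[of D "closed_segment p q"] polytope_imp_polyhedron
    unfolding exposed_face_of_def by blast
  have "p \<in> closed_segment p q" "q \<in> closed_segment p q" by auto
  hence pq: "n \<bullet> p = b" "n \<bullet> q = b" using nb by auto
  have "n \<noteq> 0"
  proof
    assume "n = 0"
    hence "closed_segment p q = D" using pq nb by auto
    thus False using face(2) aff_dim_nonempty_interior[OF assms(2)] by simp
  qed
  define d where "d = q - p"
  have d: "d \<noteq> 0" unfolding d_def using assms(4) by simp
  have "det2 (vector [- d$2, d$1]) n = 0" using pq unfolding d_def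
    by (simp add: det2_eq inner2 algebra_simps)
  moreover have "(vector [- d$2, d$1] :: real^2) \<noteq> 0" using d by (auto simp: vec2_eq)
  ultimately obtain c where c: "n = c *\<^sub>R vector [- d$2, d$1]" using det2_parallel by blast
  have "c \<noteq> 0" using c \<open>n \<noteq> 0\<close> by auto
  have le: "c * det2 d (x - p) \<le> 0" if "x \<in> D" for x
  proof -
    have "n \<bullet> x \<le> n \<bullet> p" using nb that pq by auto
    moreover have "n \<bullet> x - n \<bullet> p = c * det2 d (x - p)" unfolding c by (simp add: det2_eq inner2 algebra_simps)
    ultimately show ?thesis by simp
  qed
  have "p + 1 *\<^sub>R d \<in> D" "p \<in> D" unfolding d_def using sub by auto
  moreover have "(\<forall>x\<in>D. 1 * det2 d (x - p) \<le> 0) \<or> (\<forall>x\<in>D. -1 * det2 d (x - p) \<le> 0)"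
    using le \<open>c \<noteq> 0\<close> by (cases "c > 0") (fastforce simp: mult_le_0_iff)+
  ultimately show ?thesis using d unfolding tangent_def d_def[symmetric] by (meson zero_less_one)
qed

lemma edge_ends_extreme: "closed_segment p q edge_of D \<Longrightarrow> p extreme_point_of D \<and> q extreme_point_of D"
  unfolding edge_of_def using extreme_point_of_face extreme_point_of_segment by metis

lemma edge_dir_iff:
  assumes "rational_polygon D" "p extreme_point_of D"
  shows "edge_dir D p u \<longleftrightarrow> primitive_vec u \<and> (tangent 1 D p u \<or> tangent (-1) D p u)"
proof
  have D: "polytope D" "interior D \<noteq> {}" using assms(1) by (auto simp: rational_polygon_def)
  {
    assume "edge_dir D p u"
    then obtain t where t: "primitive_vec u" "t > 0" "closed_segment p (p + t *\<^sub>R u) edge_of D"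
      unfolding edge_dir_def by blast
    have "p \<noteq> p + t *\<^sub>R u" using t primitive_vec_nonzero by auto
    hence "tangent 1 D p (t *\<^sub>R u) \<or> tangent (-1) D p (t *\<^sub>R u)" using edge_tangent[OF D t(3)] by simp
    hence "tangent 1 D p ((1/t) *\<^sub>R t *\<^sub>R u) \<or> tangent (-1) D p ((1/t) *\<^sub>R t *\<^sub>R u)" using tangent_scale[of "1/t"] t(2) by (metis divide_pos_pos zero_less_one)
    thus "primitive_vec u \<and> (tangent 1 D p u \<or> tangent (-1) D p u)" using t by simp
  }
  assume "primitive_vec u \<and> (tangent 1 D p u \<or> tangent (-1) D p u)"
  then obtain r where r: "primitive_vec u" "tangent r D p u" "r \<noteq> 0" by force
  obtain s where "s > 0" "closed_segment p (p + s *\<^sub>R u) edge_of D" using edge_at_extreme[OF D(1) assms(2) r(2,3)] by blast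
  thus "edge_dir D p u" using r unfolding edge_dir_def by blast
qed

text \<open>Makes the definite description in \<open>cw_next\<close> usable: the successor is the
  last point of \<open>D\<close> on the clockwise ray.\<close>

lemma cw_next_tangent:
  assumes "polytope D" "interior D \<noteq> {}" "p extreme_point_of D" "tangent 1 D p u"
  obtains s where "s > 0" "cw_next D p = p + s *\<^sub>R u" "\<And>t. p + t *\<^sub>R u \<in> D \<Longrightarrow> 0 \<le> t \<and> t \<le> s"
    "cw_next D p extreme_point_of D" "tangent (-1) D (cw_next D p) (- u)" "closed_segment p (cw_next D p) \<subseteq> D"
proof -
  obtain s where s: "s > 0" "closed_segment p (p + s *\<^sub>R u) edge_of D" "\<And>t. p + t *\<^sub>R u \<in> D \<Longrightarrow> 0 \<le> t \<and> t \<le> s"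
    using edge_at_extreme[OF assms(1,3,4)] by auto
  have sub: "closed_segment p (p + s *\<^sub>R u) \<subseteq> D" using s(2) edge_of_imp_subset by blast
  have "cw_next D p = p + s *\<^sub>R u" unfolding cw_next_def
  proof (rule the_equality)
    show "p + s *\<^sub>R u \<noteq> p \<and> closed_segment p (p + s *\<^sub>R u) edge_of D \<and> (\<forall>x\<in>D. det2 (p + s *\<^sub>R u - p) (x - p) \<le> 0)"
      using s tangentD(1)[OF assms(4)] tangentD(4)[OF assms(4)] by (auto simp: det2_simps(2) mult_le_0_iff)
    fix q assume q: "q \<noteq> p \<and> closed_segment p q edge_of D \<and> (\<forall>x\<in>D. det2 (q - p) (x - p) \<le> 0)"
    have qD: "q \<in> D" using q edge_of_imp_subset by blast
    have "tangent 1 D p (q - p)" unfolding tangent_def using q qD tangentD(2)[OF assms(4)]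
      by (auto intro!: exI[of _ "1::real"])
    then obtain c where c: "c > 0" "q - p = c *\<^sub>R u" using tangent_unique_dir[OF assms(4) _ _ assms(2)] by (metis zero_neq_one)
    have qe: "q = p + c *\<^sub>R u" using c(2) by (metis add.commute diff_add_cancel)
    have "c \<le> s" using s(3)[of c] qD qe by blast
    \<comment> \<open>A shorter candidate would be an edge ending inside the true edge; being a
      face, it would have to contain the far end too.\<close>
    moreover have "\<not> c < s"
    proof
      assume "c < s"
      have "q = (1 - c / s) *\<^sub>R p + (c / s) *\<^sub>R (p + s *\<^sub>R u)" unfolding qe using s(1) by (simp add: algebra_simps)
      moreover have "p \<noteq> p + s *\<^sub>R u" using s(1) tangentD(1)[OF assms(4)] by simp
      ultimately have "q \<in> open_segment p (p + s *\<^sub>R u)" using c s(1) \<open>c < s\<close>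
        by (auto simp: in_segment intro!: exI[of _ "c / s"])
      hence "p + s *\<^sub>R u \<in> closed_segment p q" using q sub
        by (meson edge_of_def face_ofD ends_in_segment subsetD)
      then obtain l where l: "0 \<le> l" "l \<le> 1" "p + s *\<^sub>R u = (1 - l) *\<^sub>R p + l *\<^sub>R q" by (auto simp: in_segment)
      have "(1 - l) *\<^sub>R p + l *\<^sub>R q = p + (l * c) *\<^sub>R u" unfolding qe by (simp add: algebra_simps)
      hence "s = l * c" using l(3) tangentD(1)[OF assms(4)] by simp
      thus False using l \<open>c < s\<close> c(1) mult_left_le_one_le by (metis linorder_not_le order_less_imp_le)
    qed
    ultimately show "q = p + s *\<^sub>R u" using qe by simp
  qed
  moreover have "p + s *\<^sub>R u extreme_point_of D" using edge_ends_extreme[OF s(2)] by blast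
  moreover have "tangent (-1) D (p + s *\<^sub>R u) (- u)" unfolding tangent_def
  proof (intro conjI ballI exI[of _ s])
    fix x assume "x \<in> D"
    thus "- 1 * det2 (- u) (x - (p + s *\<^sub>R u)) \<le> 0" using tangentD(4)[OF assms(4)] by (simp add: det2_simps)
  qed (use tangentD[OF assms(4)] s sub in auto)
  ultimately show ?thesis using that s sub by metis
qed

section \<open>Vertical shears and the group action\<close>

definition vshear :: "(real \<Rightarrow> real) \<Rightarrow> real^2 \<Rightarrow> real^2" where
  "vshear f p = vector [p$1, p$2 + f (p$1)]"

lemma vshear_nth [simp]: "vshear f p $ 1 = p$1" "vshear f p $ 2 = p$2 + f (p$1)"
  by (simp_all add: vshear_def)

lemma vshear_comp: "vshear f \<circ> vshear g = vshear (\<lambda>x. g x + f x)"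
  by (simp add: fun_eq_iff vec2_eq)

lemma vshear_zero: "vshear (\<lambda>x. 0) = id"
  by (simp add: fun_eq_iff vec2_eq)

lemma vshear_inverse [simp]: "vshear (\<lambda>x. - f x) (vshear f p) = p" "vshear f (vshear (\<lambda>x. - f x) p) = p"
  by (simp_all add: vec2_eq)

lemma bij_vshear: "bij (vshear f)"
  by (rule o_bij[of "vshear (\<lambda>x. - f x)"]) (simp_all add: fun_eq_iff)

lemma inj_vshear: "inj (vshear f)"
  using bij_vshear bij_is_inj by blast

lemma vshear_eq_iff [simp]: "vshear f p = vshear f q \<longleftrightarrow> p = q"
  using inj_vshear by (rule inj_eq)

lemma inv_vshear: "inv (vshear f) = vshear (\<lambda>x. - f x)"
  by (rule inv_equality) simp_all

lemma mem_vshear_image: "z \<in> vshear f ` D \<longleftrightarrow> vshear (\<lambda>x. - f x) z \<in> D"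
  by (metis image_iff vshear_inverse)

lemma vshear_mem_image [simp]: "vshear f z \<in> vshear f ` D \<longleftrightarrow> z \<in> D"
  by (simp add: mem_vshear_image)

lemma vshear_image_vimage: "vshear f ` D = vshear (\<lambda>x. - f x) -` D"
  by (auto simp: mem_vshear_image)

lemma continuous_vshear: "continuous_on UNIV f \<Longrightarrow> continuous_on S (vshear f)"
proof -
  assume f: "continuous_on UNIV f"
  have "continuous_on S (\<lambda>p. f (p$1))"
    by (rule continuous_on_compose2[OF f]) (auto intro: continuous_intros)
  hence "continuous_on S (\<lambda>p. p$1 *\<^sub>R (vector [1,0] :: real^2) + (p$2 + f (p$1)) *\<^sub>R vector [0,1])"
    by (intro continuous_intros)
  moreover have "vshear f = (\<lambda>p. p$1 *\<^sub>R (vector [1,0] :: real^2) + (p$2 + f (p$1)) *\<^sub>R vector [0,1])"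
    by (simp add: fun_eq_iff vec2_eq)
  ultimately show ?thesis by simp
qed

lemma open_vshear_image: "continuous_on UNIV f \<Longrightarrow> open S \<Longrightarrow> open (vshear f ` S)"
  unfolding vshear_image_vimage by (intro open_vimage continuous_vshear continuous_on_minus)

lemma closed_vshear_image: "continuous_on UNIV f \<Longrightarrow> closed S \<Longrightarrow> closed (vshear f ` S)"
  unfolding vshear_image_vimage by (intro closed_vimage continuous_vshear continuous_on_minus)

lemma interior_vshear_image:
  assumes "continuous_on UNIV f" shows "interior (vshear f ` S) = vshear f ` interior S"
proof
  show "vshear f ` interior S \<subseteq> interior (vshear f ` S)"
    by (rule interior_maximal) (auto intro: open_vshear_image assms simp: interior_subset[THEN subsetD])
  have "vshear (\<lambda>x. - f x) ` interior (vshear f ` S) \<subseteq> interior S"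
  proof (rule interior_maximal)
    show "open (vshear (\<lambda>x. - f x) ` interior (vshear f ` S))"
      using assms by (intro open_vshear_image continuous_on_minus) auto
    show "vshear (\<lambda>x. - f x) ` interior (vshear f ` S) \<subseteq> S"
      using interior_subset[of "vshear f ` S"] by (auto simp: mem_vshear_image)
  qed
  thus "interior (vshear f ` S) \<subseteq> vshear f ` interior S" by (auto simp: mem_vshear_image)
qed

lemma frontier_vshear_image:
  assumes "continuous_on UNIV f" "closed S" shows "frontier (vshear f ` S) = vshear f ` frontier S"
  unfolding frontier_def
  using assms closed_vshear_image[OF assms] by (simp add: interior_vshear_image image_set_diff[OF inj_vshear] del: image_diff_subset)

section \<open>Preservation of area\<close>

definition measure_preserving :: "(real^2 \<Rightarrow> real^2) \<Rightarrow> bool" where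
  "measure_preserving f \<longleftrightarrow> (\<forall>S\<in>lmeasurable. f ` S \<in> lmeasurable \<and> measure lebesgue (f ` S) = measure lebesgue S)"

lemma measure_preserving_comp: "measure_preserving f \<Longrightarrow> measure_preserving g \<Longrightarrow> measure_preserving (f \<circ> g)"
  unfolding measure_preserving_def image_comp[symmetric] by simp

lemma measure_preserving_linear: "linear f \<Longrightarrow> \<bar>det (matrix f)\<bar> = 1 \<Longrightarrow> measure_preserving f"
  unfolding measure_preserving_def by (simp add: measurable_linear_image measure_linear_image)

lemma measure_preserving_translation: "measure_preserving (\<lambda>x. a + x)"
  unfolding measure_preserving_def by (auto intro: measurable_translation measure_translation)

lemma measure_preserving_affine_vshear: "measure_preserving (vshear (\<lambda>x. c * x + b))"
proof -
  have lin: "linear (vshear (\<lambda>x. c * x))" by (rule linearI) (simp_all add: vec2_eq algebra_simps)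
  have "matrix (vshear (\<lambda>x. c * x)) = vector [vector [1, 0], vector [c, 1]]"
    by (simp add: vec_eq_iff forall_2 matrix_def axis_def)
  hence "det (matrix (vshear (\<lambda>x. c * x))) = 1" by (simp add: det_2)
  hence "measure_preserving (vshear (\<lambda>x. c * x))" using measure_preserving_linear[OF lin] by simp
  hence "measure_preserving ((\<lambda>x. vector [0, b] + x) \<circ> vshear (\<lambda>x. c * x))" by (intro measure_preserving_comp measure_preserving_translation)
  moreover have "(\<lambda>x. vector [0, b] + x) \<circ> vshear (\<lambda>x. c * x) = vshear (\<lambda>x. c * x + b)"
    by (simp add: fun_eq_iff vec2_eq)
  ultimately show ?thesis by simp
qed

text \<open>The map is the identity on one side of the line x = j and affine of determinant 1 on the
  other, and it maps each side to itself.\<close>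

lemma measure_preserving_kink: "measure_preserving (vshear (\<lambda>x. c * max 0 (x - j)))"
  unfolding measure_preserving_def
proof
  fix S :: "(real^2) set" assume S: "S \<in> lmeasurable"
  define A where "A = S \<inter> {p. p$1 \<ge> j}"
  define B where "B = S \<inter> - {p. p$1 \<ge> j}"
  have "{p::real^2. p$1 \<ge> j} = {p. (vector [1,0] :: real^2) \<bullet> p \<ge> j}" by (simp add: inner2)
  hence "closed {p::real^2. p$1 \<ge> j}" by (metis closed_halfspace_ge)
  hence "{p::real^2. p$1 \<ge> j} \<in> sets lebesgue" by (auto intro: borel_closed)
  hence AB: "A \<in> lmeasurable" "B \<in> lmeasurable" unfolding A_def B_def using S
    by (auto intro!: fmeasurable_Int_fmeasurable simp: Compl_eq_Diff_UNIV)
  have S': "S = A \<union> B" "A \<inter> B = {}" unfolding A_def B_def by auto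
  let ?f = "vshear (\<lambda>x. c * max 0 (x - j))" and ?g = "vshear (\<lambda>x. c * x + (- c * j))"
  have fA: "?f ` A = ?g ` A" unfolding A_def by (rule image_cong) (auto simp: vec2_eq algebra_simps max_def)
  have "?f ` B = id ` B" unfolding B_def by (rule image_cong) (auto simp: vec2_eq)
  hence fB: "?f ` B = B" by simp
  have gA: "?g ` A \<in> lmeasurable" "measure lebesgue (?g ` A) = measure lebesgue A"
    using measure_preserving_affine_vshear AB unfolding measure_preserving_def by blast+
  have img: "?f ` S = ?g ` A \<union> B" unfolding S'(1) image_Un fA fB ..
  have disj: "?g ` A \<inter> B = {}" unfolding A_def B_def by auto
  show "?f ` S \<in> lmeasurable \<and> measure lebesgue (?f ` S) = measure lebesgue S"
    unfolding img using gA AB disj S' by (auto simp: measure_Un3 intro: fmeasurable.Un)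
qed

section \<open>Normal form of group elements and the group laws\<close>

lemma pshear_vshear: "pshear j = vshear (\<lambda>x. max 0 (x - j))"
  by (auto simp: fun_eq_iff vec2_eq pshear_def)

lemma funpow_vshear: "vshear f ^^ n = vshear (\<lambda>x. real n * f x)"
  by (induction n) (simp_all add: vshear_zero vshear_comp algebra_simps)

lemma ifunpow_pshear: "ifunpow (pshear j) u = vshear (\<lambda>x. of_int u * max 0 (x - j))"
  unfolding ifunpow_def pshear_vshear inv_vshear funpow_vshear by (auto simp: fun_eq_iff vec2_eq)

lemma shear_group_iff: "\<tau> \<in> shear_group \<longleftrightarrow> (\<exists>(n::int) b. \<tau> = vshear (\<lambda>x. of_int n * x + b))"
proof
  assume "\<tau> \<in> shear_group"
  thus "\<exists>(n::int) b. \<tau> = vshear (\<lambda>x. of_int n * x + b)"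
  proof induction
    case id show ?case by (intro exI[of _ 0]) (simp add: vshear_zero)
  next
    case (T \<tau>)
    then obtain n :: int and b where "\<tau> = vshear (\<lambda>x. of_int n * x + b)" by auto
    thus ?case by (intro exI[of _ "n + 1"] exI[of _ b]) (simp add: fun_eq_iff vec2_eq Tmat_apply algebra_simps)
  next
    case (T_inv \<tau>)
    then obtain n :: int and b where "\<tau> = vshear (\<lambda>x. of_int n * x + b)" by auto
    thus ?case by (intro exI[of _ "n - 1"] exI[of _ b]) (simp add: fun_eq_iff vec2_eq Tmat_inv_apply algebra_simps)
  next
    case (vert \<tau> b')
    then obtain n :: int and b where "\<tau> = vshear (\<lambda>x. of_int n * x + b)" by auto
    thus ?case by (intro exI[of _ n] exI[of _ "b + b'"]) (simp add: fun_eq_iff vec2_eq algebra_simps)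
  qed
next
  have nat: "vshear (\<lambda>x. real k * x) \<in> shear_group" for k
  proof (induction k)
    case 0 thus ?case using shear_group.id unfolding vshear_zero[symmetric] by simp
  next
    case (Suc k)
    have "(\<lambda>p. Tmat *v vshear (\<lambda>x. real k * x) p) = vshear (\<lambda>x. real (Suc k) * x)"
      by (simp add: fun_eq_iff vec2_eq Tmat_apply algebra_simps)
    thus ?case using shear_group.T[OF Suc] by simp
  qed
  have nat': "vshear (\<lambda>x. - real k * x) \<in> shear_group" for k
  proof (induction k)
    case 0 thus ?case using shear_group.id unfolding vshear_zero[symmetric] by simp
  next
    case (Suc k)
    have "(\<lambda>p. matrix_inv Tmat *v vshear (\<lambda>x. - real k * x) p) = vshear (\<lambda>x. - real (Suc k) * x)"
      by (simp add: fun_eq_iff vec2_eq Tmat_inv_apply algebra_simps)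
    thus ?case using shear_group.T_inv[OF Suc] by simp
  qed
  assume "\<exists>(n::int) b. \<tau> = vshear (\<lambda>x. of_int n * x + b)"
  then obtain n :: int and b where \<tau>: "\<tau> = vshear (\<lambda>x. of_int n * x + b)" by auto
  have "vshear (\<lambda>x. of_int n * x) \<in> shear_group"
  proof (cases "n \<ge> 0")
    case True thus ?thesis using nat[of "nat n"] by simp
  next
    case False thus ?thesis using nat'[of "nat (- n)"] by simp
  qed
  moreover have "(\<lambda>p. vshear (\<lambda>x. of_int n * x) p + vector [0, b]) = \<tau>"
    unfolding \<tau> by (simp add: fun_eq_iff vec2_eq)
  ultimately show "\<tau> \<in> shear_group" using shear_group.vert by metis
qed

definition group_elt :: "int \<Rightarrow> real \<Rightarrow> int list \<Rightarrow> gelt" where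
  "group_elt n b e = (vshear (\<lambda>x. of_int n * x + b), e)"

lemma group_elt_grp: "group_elt n b e \<in> grp m \<longleftrightarrow> length e = m \<and> set e \<subseteq> {-1, 1}"
  unfolding group_elt_def grp_def by (auto simp: shear_group_iff)

lemma grpE:
  assumes "g \<in> grp m"
  obtains n b e where "g = group_elt n b e" "length e = m" "set e \<subseteq> {-1, 1}"
proof -
  obtain \<tau> e where g: "g = (\<tau>, e)" "\<tau> \<in> shear_group" "length e = m" "set e \<subseteq> {-1, 1}"
    using assms unfolding grp_def by auto
  obtain n :: int and b where "\<tau> = vshear (\<lambda>x. of_int n * x + b)" using g(2) by (auto simp: shear_group_iff)
  thus ?thesis using that[of n b e] g by (simp add: group_elt_def)
qed

text \<open>The exponent of the piecewise shear belonging to the \<open>k\<close>-th cut: its old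
  sign if the cut is flipped, 0 if it is kept.\<close>

definition flip_exponent :: "srep \<Rightarrow> int list \<Rightarrow> nat \<Rightarrow> int" where
  "flip_exponent R e k = signs R ! k * (1 - e ! k) div 2"

text \<open>The vertical displacement as a function of the first coordinate, read off on the axis;
  \<open>act_map\<close> is the vertical shear with this profile.\<close>

definition act_shift :: "gelt \<Rightarrow> srep \<Rightarrow> real \<Rightarrow> real" where
  "act_shift g R x = act_map g R (vector [x, 0]) $ 2"

lemma foldr_vshear: "foldr (\<lambda>k f. vshear (a k) \<circ> f) ks id = vshear (\<lambda>x. \<Sum>k\<leftarrow>ks. a k x)"
proof (induction ks)
  case Nil thus ?case by (simp only: foldr.simps vshear_zero list.map sum_list.Nil id_apply)
next
  case (Cons k ks)
  have "foldr (\<lambda>k f. vshear (a k) \<circ> f) (k # ks) id = vshear (a k) \<circ> foldr (\<lambda>k f. vshear (a k) \<circ> f) ks id" by simp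
  also have "\<dots> = vshear (\<lambda>x. (\<Sum>k\<leftarrow>ks. a k x) + a k x)" unfolding Cons.IH vshear_comp ..
  finally show ?case unfolding list.map sum_list.Cons by (simp only: add.commute)
qed

lemma act_map_group_elt:
  "act_map (group_elt n b e) R = vshear (\<lambda>x. of_int n * x + b +
     (\<Sum>k<length (marks R). of_int (flip_exponent R e k) * max 0 (x - marks R ! k $ 1)))"
proof -
  have "foldr (\<lambda>k f. ifunpow (pshear (marks R ! k $ 1)) (signs R ! k * (1 - e ! k) div 2) \<circ> f) [0..<length (marks R)] id
     = vshear (\<lambda>x. \<Sum>k<length (marks R). of_int (flip_exponent R e k) * max 0 (x - marks R ! k $ 1))"
    unfolding ifunpow_pshear foldr_vshear flip_exponent_def
    by (simp add: interv_sum_list_conv_sum_set_nat atLeast0LessThan)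
  thus ?thesis unfolding act_map_def group_elt_def by (simp add: vshear_comp algebra_simps)
qed

lemma act_shift_group_elt: "act_shift (group_elt n b e) R x = of_int n * x + b +
     (\<Sum>k<length (marks R). of_int (flip_exponent R e k) * max 0 (x - marks R ! k $ 1))"
  unfolding act_shift_def act_map_group_elt by simp

lemma act_map_vshear:
  assumes "g \<in> grp m" shows "act_map g R = vshear (act_shift g R)"
proof -
  obtain n b e where g: "g = group_elt n b e" using grpE[OF assms] by metis
  show ?thesis unfolding g by (subst act_map_group_elt, rule arg_cong[of _ _ vshear]) (simp add: act_shift_group_elt fun_eq_iff)
qed

lemma continuous_act_shift: assumes "g \<in> grp m" shows "continuous_on S (act_shift g R)"
proof -
  obtain n b e where g: "g = group_elt n b e" using grpE[OF assms] by metis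
  show ?thesis unfolding g act_shift_group_elt by (intro continuous_intros)
qed

lemma measure_preserving_act_map: assumes "g \<in> grp m" shows "measure_preserving (act_map g R)"
proof -
  obtain n b e where g: "g = group_elt n b e" using grpE[OF assms] by metis
  have "measure_preserving (vshear (\<lambda>x. of_int n * x + b + (\<Sum>k<M. of_int (flip_exponent R e k) * max 0 (x - marks R ! k $ 1))))" for M
  proof (induction M)
    case 0 thus ?case using measure_preserving_affine_vshear by simp
  next
    case (Suc M)
    have "vshear (\<lambda>x. of_int n * x + b + (\<Sum>k<Suc M. of_int (flip_exponent R e k) * max 0 (x - marks R ! k $ 1)))
      = vshear (\<lambda>x. of_int (flip_exponent R e M) * max 0 (x - marks R ! M $ 1)) \<circ>
        vshear (\<lambda>x. of_int n * x + b + (\<Sum>k<M. of_int (flip_exponent R e k) * max 0 (x - marks R ! k $ 1)))"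
      unfolding vshear_comp by (simp add: algebra_simps)
    thus ?case by (rule ssubst) (rule measure_preserving_comp[OF measure_preserving_kink Suc])
  qed
  thus ?thesis unfolding g act_map_group_elt .
qed

definition wf_rep :: "srep \<Rightarrow> bool" where
  "wf_rep R \<longleftrightarrow> length (signs R) = length (marks R) \<and> set (signs R) \<subseteq> {-1, 1}"

lemma wf_repI: "is_rep R \<Longrightarrow> wf_rep R"
  by (simp add: wf_rep_def is_rep_def)

lemma pm1_nth: "set e \<subseteq> {-1, 1} \<Longrightarrow> k < length e \<Longrightarrow> e ! k = 1 \<or> e ! k = (-1::int)"
  using nth_mem by blast

lemma act_sel [simp]:
  "pgon (act g R) = act_map g R ` pgon R" "marks (act g R) = map (act_map g R) (marks R)"
  "signs (act g R) = map2 (*) (snd g) (signs R)"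
  by (simp_all add: act_def)

lemma snd_group_elt [simp]: "snd (group_elt n b e) = e" by (simp add: group_elt_def)

lemma map2_pm1:
  assumes "set e \<subseteq> {-1, 1}" "set e' \<subseteq> {-1, 1}" shows "set (map2 (*) e e') \<subseteq> {-1, 1 :: int}"
proof
  fix x assume "x \<in> set (map2 (*) e e')"
  then obtain a b where "(a, b) \<in> set (zip e e')" "x = a * b" by auto
  moreover have "a \<in> set e" "b \<in> set e'" using calculation(1) set_zip_leftD set_zip_rightD by fast+
  hence "a \<in> {-1, 1}" "b \<in> {-1, 1}" using assms by blast+
  ultimately show "x \<in> {-1, 1}" by auto
qed

lemma wf_rep_act:
  assumes "wf_rep R" "g \<in> grp (length (marks R))" shows "wf_rep (act g R)"
proof -
  obtain n b e where g: "g = group_elt n b e" "length e = length (marks R)" "set e \<subseteq> {-1, 1}" using grpE[OF assms(2)] .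
  show ?thesis using map2_pm1[OF g(3), of "signs R"] assms(1) g(2) unfolding wf_rep_def act_sel g(1) snd_group_elt
    by (simp del: set_map)
qed

text \<open>A second flip of the same cut starts from the reversed sign, so its exponent cancels the
  first one. The kinks stay in place because shears keep first coordinates.\<close>

lemma act_group_elt_group_elt:
  assumes "wf_rep R" "length e = length (marks R)" "set e \<subseteq> {-1, 1}" "length e' = length (marks R)" "set e' \<subseteq> {-1, 1}"
  shows "act_map (group_elt n' b' e') (act (group_elt n b e) R) \<circ> act_map (group_elt n b e) R =
           act_map (group_elt (n + n') (b + b') (map2 (*) e' e)) R" (is ?A)
    "act (group_elt n' b' e') (act (group_elt n b e) R) = act (group_elt (n + n') (b + b') (map2 (*) e' e)) R" (is ?B)
    "group_elt (n + n') (b + b') (map2 (*) e' e) \<in> grp (length (marks R))" (is ?C)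
proof -
  let ?m = "length (marks R)"
  have c: "flip_exponent R e k + flip_exponent (act (group_elt n b e) R) e' k = flip_exponent R (map2 (*) e' e) k" if k: "k < ?m" for k
  proof -
    have "e ! k = 1 \<or> e ! k = -1" "e' ! k = 1 \<or> e' ! k = -1" "signs R ! k = 1 \<or> signs R ! k = -1"
      using pm1_nth assms k unfolding wf_rep_def by metis+
    thus ?thesis using assms k unfolding flip_exponent_def wf_rep_def by auto
  qed
  have m: "marks (act (group_elt n b e) R) ! k $ 1 = marks R ! k $ 1" if "k < ?m" for k
    using that by (simp add: act_map_group_elt)
  have "act_map (group_elt n' b' e') (act (group_elt n b e) R) = vshear (\<lambda>x. of_int n' * x + b' +
     (\<Sum>k<?m. of_int (flip_exponent (act (group_elt n b e) R) e' k) * max 0 (x - marks R ! k $ 1)))"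
    unfolding act_map_group_elt[of n' b' e'] using m by (auto intro!: arg_cong[of _ _ vshear] ext sum.cong)
  moreover have "(\<Sum>k<?m. of_int (flip_exponent R e k) * max 0 (x - marks R ! k $ 1)) +
      (\<Sum>k<?m. of_int (flip_exponent (act (group_elt n b e) R) e' k) * max 0 (x - marks R ! k $ 1)) =
      (\<Sum>k<?m. of_int (flip_exponent R (map2 (*) e' e) k) * max 0 (x - marks R ! k $ 1))" for x
    unfolding sum.distrib[symmetric] by (rule sum.cong) (auto simp: c[symmetric] algebra_simps)
  ultimately show A: ?A unfolding act_map_group_elt[of n] act_map_group_elt[of "n + n'"]
    by (auto simp: vshear_comp fun_eq_iff vec2_eq algebra_simps)
  have sg: "map2 (*) e' (map2 (*) e (signs R)) = map2 (*) (map2 (*) e' e) (signs R)"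
    using assms by (intro nth_equalityI) (auto simp: wf_rep_def)
  show ?B unfolding act_def[of "group_elt n' b' e'"] act_def[of "group_elt (n + n') _ _"] A[symmetric]
    using sg by (simp add: image_comp)
  have "set (map2 (*) e' e) \<subseteq> {-1, 1}"
    using assms by (intro map2_pm1)
  thus ?C using assms by (simp add: group_elt_grp)
qed

lemma act_compose:
  assumes "wf_rep R" "g \<in> grp (length (marks R))" "g' \<in> grp (length (marks R))"
  obtains h where "h \<in> grp (length (marks R))" "act g' (act g R) = act h R"
    "act_map g' (act g R) \<circ> act_map g R = act_map h R"
proof -
  obtain n b e where g: "g = group_elt n b e" "length e = length (marks R)" "set e \<subseteq> {-1, 1}" using grpE[OF assms(2)] .
  obtain n' b' e' where g': "g' = group_elt n' b' e'" "length e' = length (marks R)" "set e' \<subseteq> {-1, 1}" using grpE[OF assms(3)] .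
  note a = act_group_elt_group_elt[OF assms(1) g(2,3) g'(2,3), where n = n and b = b and n' = n' and b' = b']
  show ?thesis by (rule that[OF a(3)]) (use a g g' in simp_all)
qed

lemma act_unit:
  assumes "wf_rep R"
  shows "act (group_elt 0 0 (replicate (length (marks R)) 1)) R = R"
    "act_map (group_elt 0 0 (replicate (length (marks R)) 1)) R = id"
    "group_elt 0 0 (replicate (length (marks R)) 1) \<in> grp (length (marks R))"
proof -
  show 1: "act_map (group_elt 0 0 (replicate (length (marks R)) 1)) R = id"
    unfolding act_map_group_elt by (simp add: flip_exponent_def vshear_zero)
  have "map2 (*) (replicate (length (marks R)) 1) (signs R) = signs R"
    using assms by (intro nth_equalityI) (auto simp: wf_rep_def)
  thus "act (group_elt 0 0 (replicate (length (marks R)) 1)) R = R"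
    unfolding act_def 1 by (simp add: srep.expand)
  show "group_elt 0 0 (replicate (length (marks R)) 1) \<in> grp (length (marks R))"
    by (auto simp: group_elt_grp set_replicate_conv_if)
qed

lemma act_inverse:
  assumes "wf_rep R" "g \<in> grp (length (marks R))"
  obtains h where "h \<in> grp (length (marks R))" "act h (act g R) = R"
    "act_map h (act g R) \<circ> act_map g R = id"
proof -
  obtain n b e where g: "g = group_elt n b e" "length e = length (marks R)" "set e \<subseteq> {-1, 1}" using grpE[OF assms(2)] .
  have "map2 (*) e e = replicate (length (marks R)) 1"
    using g pm1_nth[OF g(3)] by (intro nth_equalityI) (auto, fastforce)
  hence a: "act (group_elt (-n) (-b) e) (act g R) = R" "act_map (group_elt (-n) (-b) e) (act g R) \<circ> act_map g R = id"
    using act_group_elt_group_elt[OF assms(1) g(2,3) g(2,3), where n = n and b = b and n' = "-n" and b' = "-b"] act_unit[OF assms(1)] g by simp_all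
  show ?thesis by (rule that[OF _ a]) (use g in \<open>simp add: group_elt_grp\<close>)
qed

section \<open>Local and affine form of the shear profile\<close>

lemma local_kink:
  fixes x0 j :: real
  shows "\<exists>d>0. \<forall>h. \<bar>h\<bar> \<le> d \<longrightarrow> max 0 (x0 + h - j) =
     max 0 (x0 - j) + ((if j < x0 then 1 else 0) + (if h \<ge> 0 \<and> j = x0 then 1 else 0)) * h"
proof (cases "j = x0")
  case True thus ?thesis by (intro exI[of _ 1]) (auto simp: max_def)
next
  case False thus ?thesis by (intro exI[of _ "\<bar>x0 - j\<bar>"]) (auto simp: max_def)
qed

text \<open>Kinks left of \<open>x0\<close> contribute to the slope on both sides, those right of it
  to neither, and those at \<open>x0\<close> on the right side only. The integer \<open>c\<close>
  keeps the transported directions integral.\<close>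

lemma local_kink_sum:
  fixes x0 :: real and J :: "nat \<Rightarrow> real" and a :: "nat \<Rightarrow> int"
  shows "\<exists>d>0. \<exists>c::int. \<forall>h. \<bar>h\<bar> \<le> d \<longrightarrow> (\<Sum>k<m. of_int (a k) * max 0 (x0 + h - J k)) =
     (\<Sum>k<m. of_int (a k) * max 0 (x0 - J k)) +
       (of_int c + (if h \<ge> 0 then of_int (\<Sum>k | k < m \<and> J k = x0. a k) else 0)) * h"
proof (induction m)
  case 0 show ?case by (intro exI[of _ 1] conjI exI[of _ 0]) auto
next
  case (Suc m)
  then obtain d c where d: "d > 0" and IH: "\<And>h. \<bar>h\<bar> \<le> d \<Longrightarrow> (\<Sum>k<m. of_int (a k) * max 0 (x0 + h - J k)) =
     (\<Sum>k<m. of_int (a k) * max 0 (x0 - J k)) +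
       (of_int c + (if h \<ge> 0 then of_int (\<Sum>k | k < m \<and> J k = x0. a k) else 0)) * h" by blast
  obtain d' where d': "d' > 0" and k: "\<And>h. \<bar>h\<bar> \<le> d' \<Longrightarrow> max 0 (x0 + h - J m) =
     max 0 (x0 - J m) + ((if J m < x0 then 1 else 0) + (if h \<ge> 0 \<and> J m = x0 then 1 else 0)) * h"
    using local_kink[of x0 "J m"] by blast
  have "{k. k < Suc m \<and> J k = x0} = (if J m = x0 then insert m {k. k < m \<and> J k = x0} else {k. k < m \<and> J k = x0})"
    by (auto simp: less_Suc_eq)
  hence s: "(\<Sum>k | k < Suc m \<and> J k = x0. a k) = (if J m = x0 then a m else 0) + (\<Sum>k | k < m \<and> J k = x0. a k)"
    by simp
  show ?case
  proof (intro exI[of _ "min d d'"] conjI exI[of _ "c + (if J m < x0 then a m else 0)"] allI impI)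
    fix h assume "\<bar>h\<bar> \<le> min d d'"
    hence h: "\<bar>h\<bar> \<le> d" "\<bar>h\<bar> \<le> d'" by auto
    show "(\<Sum>k<Suc m. of_int (a k) * max 0 (x0 + h - J k)) = (\<Sum>k<Suc m. of_int (a k) * max 0 (x0 - J k)) +
      (of_int (c + (if J m < x0 then a m else 0)) + (if h \<ge> 0 then of_int (\<Sum>k | k < Suc m \<and> J k = x0. a k) else 0)) * h"
      unfolding sum.lessThan_Suc IH[OF h(1)] k[OF h(2)] s by (auto simp: algebra_simps)
  qed (use d d' in auto)
qed

lemma act_shift_local:
  assumes "g \<in> grp (length (marks R))"
  obtains c :: int and d where "d > 0" "\<And>h. \<bar>h\<bar> \<le> d \<Longrightarrow> act_shift g R (x0 + h) = act_shift g R x0 +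
     (of_int c + (if h \<ge> 0 then of_int (\<Sum>k | k < length (marks R) \<and> marks R ! k $ 1 = x0. flip_exponent R (snd g) k) else 0)) * h"
proof -
  obtain n b e where g: "g = group_elt n b e" using grpE[OF assms] by metis
  obtain d c where d: "d > 0" and *: "\<forall>h. \<bar>h\<bar> \<le> d \<longrightarrow> (\<Sum>k<length (marks R). of_int (flip_exponent R e k) * max 0 (x0 + h - marks R ! k $ 1)) =
     (\<Sum>k<length (marks R). of_int (flip_exponent R e k) * max 0 (x0 - marks R ! k $ 1)) +
       (of_int c + (if h \<ge> 0 then of_int (\<Sum>k | k < length (marks R) \<and> marks R ! k $ 1 = x0. flip_exponent R e k) else 0)) * h"
    using local_kink_sum[where a = "flip_exponent R e" and J = "\<lambda>k. marks R ! k $ 1"] by blast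
  show ?thesis
  proof (rule that[OF d, of "n + c"])
    fix h assume h: "\<bar>h\<bar> \<le> d"
    show "act_shift g R (x0 + h) = act_shift g R x0 + (of_int (n + c) + (if h \<ge> 0 then
      of_int (\<Sum>k | k < length (marks R) \<and> marks R ! k $ 1 = x0. flip_exponent R (snd g) k) else 0)) * h"
      unfolding g act_shift_group_elt snd_group_elt *[rule_format, OF h] by (auto simp: algebra_simps)
  qed
qed

lemma kink_affine:
  fixes J :: "nat \<Rightarrow> real" and a :: "nat \<Rightarrow> int"
  assumes "\<And>k. k < m \<Longrightarrow> a k \<noteq> 0 \<Longrightarrow> J k \<le> \<alpha> \<or> \<beta> \<le> J k"
  shows "\<exists>c d. \<forall>x. \<alpha> \<le> x \<and> x \<le> \<beta> \<longrightarrow> (\<Sum>k<m. of_int (a k) * max 0 (x - J k)) = of_int (c::int) * x + d"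
  using assms
proof (induction m)
  case 0 show ?case by (intro exI[of _ 0]) auto
next
  case (Suc m)
  then obtain c d where IH: "\<And>x. \<alpha> \<le> x \<and> x \<le> \<beta> \<Longrightarrow> (\<Sum>k<m. of_int (a k) * max 0 (x - J k)) = of_int (c::int) * x + d"
    by force
  show ?case
  proof (cases "a m = 0 \<or> \<beta> \<le> J m")
    case True
    hence "of_int (a m) * max 0 (x - J m) = 0" if "x \<le> \<beta>" for x using that by (auto simp: max_def)
    thus ?thesis by (intro exI[of _ c] exI[of _ d]) (simp add: IH)
  next
    case False
    hence "J m \<le> \<alpha>" using Suc.prems[of m] by auto
    hence "max 0 (x - J m) = x - J m" if "\<alpha> \<le> x" for x using that by simp
    thus ?thesis 
      by (intro exI[of _ "c + a m"] exI[of _ "d - of_int (a m) * J m"] allI impI, unfold sum.lessThan_Suc)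
         (simp add: IH, simp add: algebra_simps)
  qed
qed

lemma act_shift_affine:
  assumes "g \<in> grp (length (marks R))"
    "\<And>k. k < length (marks R) \<Longrightarrow> flip_exponent R (snd g) k \<noteq> 0 \<Longrightarrow> marks R ! k $ 1 \<le> \<alpha> \<or> \<beta> \<le> marks R ! k $ 1"
  obtains c :: int and d where "\<And>x. \<alpha> \<le> x \<Longrightarrow> x \<le> \<beta> \<Longrightarrow> act_shift g R x = of_int c * x + d"
proof -
  obtain n b e where g: "g = group_elt n b e" using grpE[OF assms(1)] by metis
  obtain c d where *: "\<forall>x. \<alpha> \<le> x \<and> x \<le> \<beta> \<longrightarrow>
      (\<Sum>k<length (marks R). of_int (flip_exponent R e k) * max 0 (x - marks R ! k $ 1)) = of_int (c::int) * x + d"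
    using kink_affine[where a = "flip_exponent R e" and J = "\<lambda>k. marks R ! k $ 1" and m = "length (marks R)",
      OF assms(2)[unfolded g snd_group_elt]] by blast
  show ?thesis by (rule that[of "n + c" "b + d"]) (simp add: g act_shift_group_elt * algebra_simps)
qed

section \<open>Invariance of the corner types\<close>

text \<open>The upper end of a vertical slice for \<open>s = 1\<close> and the lower end for
  \<open>s = -1\<close>; the sign lets both be treated at once. Every vertical shear preserves this
  notion, whether or not the image is convex.\<close>

definition vtop :: "real \<Rightarrow> (real^2) set \<Rightarrow> real^2 \<Rightarrow> bool" where
  "vtop s D p \<longleftrightarrow> p \<in> D \<and> (\<forall>x\<in>D. x$1 = p$1 \<longrightarrow> s * x$2 \<le> s * p$2)"

lemma vtopD: "vtop s D p \<Longrightarrow> x \<in> D \<Longrightarrow> x$1 = p$1 \<Longrightarrow> s * x$2 \<le> s * p$2"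
  by (simp add: vtop_def)

lemma vtop_vshear [simp]: "vtop s (vshear f ` D) (vshear f p) \<longleftrightarrow> vtop s D p"
  unfolding vtop_def by (auto simp: algebra_simps)

lemma vtop_unique:
  assumes "vtop s D p" "vtop s D q" "p$1 = q$1" "s = 1 \<or> s = -1" shows "p = q"
  using vtopD[OF assms(1), of q] vtopD[OF assms(2), of p] assms by (force simp: vec2_eq vtop_def)

lemma vtop_interior:
  assumes "vtop s D p" "c \<in> interior D" "c$1 = p$1" "s = 1 \<or> s = -1"
  shows "s * (p$2 - c$2) > 0"
proof -
  obtain e where e: "e > 0" "\<And>t. \<bar>t\<bar> \<le> e \<Longrightarrow> c + t *\<^sub>R vector [0, 1] \<in> D"
    using interior_dir[OF assms(2)] by blast
  have "\<bar>s * e\<bar> \<le> e" using e(1) assms(4) by auto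
  hence "c + (s * e) *\<^sub>R vector [0, 1] \<in> D" by (rule e(2))
  hence "s * (c + (s * e) *\<^sub>R vector [0, 1])$2 \<le> s * p$2" by (rule vtopD[OF assms(1)]) (use assms(3) in simp)
  thus ?thesis using e(1) assms(4) by (auto simp: algebra_simps)
qed

lemma vtop_both_interior:
  assumes "vtop 1 D p" "vtop (-1) D p" "c \<in> interior D" "c$1 = p$1" shows False
  using vtop_interior[OF assms(1,3,4)] vtop_interior[OF assms(2,3,4)] by simp

text \<open>Clockwise, the upper boundary is followed to the right and the lower one to the left;
  this is the origin of the sign \<open>r * sgn (u$1)\<close>.\<close>

lemma tangent_vtop:
  assumes "tangent r D p u" "u$1 \<noteq> 0" "p + t *\<^sub>R u \<in> D"
  shows "vtop (r * sgn (u$1)) D (p + t *\<^sub>R u)"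
  unfolding vtop_def
proof (intro conjI ballI impI)
  show "p + t *\<^sub>R u \<in> D" by fact
  fix x assume x: "x \<in> D" "x$1 = (p + t *\<^sub>R u)$1"
  have "r * det2 u (x - p) \<le> 0" using tangentD(4)[OF assms(1) x(1)] .
  moreover have "det2 u (x - p) = u$1 * (x$2 - (p + t *\<^sub>R u)$2)" using x(2) by (simp add: det2_eq algebra_simps)
  ultimately have "r * u$1 * (x$2 - (p + t *\<^sub>R u)$2) \<le> 0" by (simp only: mult.assoc)
  thus "r * sgn (u$1) * x$2 \<le> r * sgn (u$1) * (p + t *\<^sub>R u)$2"
    using assms(2) by (cases "u$1 > 0") (auto simp: mult_le_0_iff zero_le_mult_iff mult_le_cancel_left mult_less_0_iff zero_less_mult_iff)
qed

lemma tangent_vtop0: "tangent r D p u \<Longrightarrow> u$1 \<noteq> 0 \<Longrightarrow> vtop (r * sgn (u$1)) D p"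
  using tangent_vtop[of r D p u 0] tangentD(2) by simp

text \<open>A kinked shear may destroy a support line, so convexity of the image is assumed. Near
  \<open>p\<close> the image of the boundary ray is again straight and consists of slice ends, which
  gives the support inequality over a short interval; convexity extends it to all of the
  image.\<close>

lemma tangent_shear:
  assumes "convex D" "convex (vshear f ` D)" "tangent r D p u" "r = 1 \<or> r = -1" "d > 0"
    and loc: "\<And>h. \<bar>h\<bar> \<le> d \<Longrightarrow> f (p$1 + h) = f (p$1) + (c + (if h \<ge> 0 then k else 0)) * h"
  shows "tangent r (vshear f ` D) (vshear f p) (vector [u$1, u$2 + (c + (if u$1 \<ge> 0 then k else 0)) * u$1])"
proof -
  define cu where "cu = c + (if u$1 \<ge> 0 then k else 0)"
  define u' :: "real^2" where "u' = vector [u$1, u$2 + cu * u$1]"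
  have u'n: "u'$1 = u$1" "u'$2 = u$2 + cu * u$1" by (simp_all add: u'_def)
  obtain t0 where t0: "t0 > 0" "p + t0 *\<^sub>R u \<in> D" using tangentD(3)[OF assms(3)] by auto
  have pos: "\<bar>u$1\<bar> + 1 > 0" by linarith
  \<comment> \<open>Short enough for the ray to stay in \<open>D\<close> and in the range where the
    profile is known; the added 1 avoids division by 0 for vertical \<open>u\<close>.\<close>
  define t where "t = min t0 (d / (\<bar>u$1\<bar> + 1))"
  have t: "t > 0" "t \<le> t0" "t * \<bar>u$1\<bar> \<le> d"
  proof -
    show "t > 0" "t \<le> t0" using t0 assms(5) pos unfolding t_def by auto
    have "t \<le> d / (\<bar>u$1\<bar> + 1)" unfolding t_def by simp
    hence "t * (\<bar>u$1\<bar> + 1) \<le> d" using pos by (simp add: field_simps)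
    thus "t * \<bar>u$1\<bar> \<le> d" using \<open>t > 0\<close> by (simp add: algebra_simps)
  qed
  have inD: "p + \<tau> *\<^sub>R u \<in> D" if "0 \<le> \<tau>" "\<tau> \<le> t" for \<tau>
  proof -
    have "p + \<tau> *\<^sub>R u = (1 - \<tau> / t0) *\<^sub>R p + (\<tau> / t0) *\<^sub>R (p + t0 *\<^sub>R u)" using t0 by (simp add: algebra_simps)
    thus ?thesis using convexD_alt[OF assms(1) tangentD(2)[OF assms(3)] t0(2), of "\<tau> / t0"] that t t0 by simp
  qed
  have im: "vshear f (p + \<tau> *\<^sub>R u) = vshear f p + \<tau> *\<^sub>R u'" if "0 \<le> \<tau>" "\<tau> \<le> t" for \<tau>
  proof -
    have "\<tau> * \<bar>u$1\<bar> \<le> t * \<bar>u$1\<bar>" using that by (intro mult_right_mono) auto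
    hence "\<bar>\<tau> * u$1\<bar> \<le> d" using t that by (simp add: abs_mult)
    hence "f (p$1 + \<tau> * u$1) = f (p$1) + (c + (if \<tau> * u$1 \<ge> 0 then k else 0)) * (\<tau> * u$1)" by (rule loc)
    moreover have "(c + (if \<tau> * u$1 \<ge> 0 then k else 0)) * (\<tau> * u$1) = cu * (\<tau> * u$1)"
      unfolding cu_def using that by (auto simp: zero_le_mult_iff)
    ultimately show ?thesis by (simp add: vec2_eq u'n algebra_simps)
  qed
  have sup: "r * det2 u' (z - vshear f p) \<le> 0" if z: "z \<in> vshear f ` D" for z
  proof (cases "u$1 = 0")
    case True
    obtain x where x: "x \<in> D" "z = vshear f x" using z by auto
    have "det2 u' (z - vshear f p) = det2 u (x - p)" using True x(2) by (simp add: det2_eq u'n)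
    thus ?thesis using tangentD(4)[OF assms(3) x(1)] by simp
  next
    case False
    show ?thesis
    proof (rule ccontr)
      assume neg: "\<not> r * det2 u' (z - vshear f p) \<le> 0"
      \<comment> \<open>The midpoint of the sheared boundary piece. Moving from it towards an
        offending \<open>z\<close> by the small fraction \<epsilon> stays over the piece, where
        slice ends can be compared.\<close>
      define y0 where "y0 = vshear f p + (t/2) *\<^sub>R u'"
      define \<epsilon> where "\<epsilon> = min 1 ((t/2) * \<bar>u$1\<bar> / (\<bar>z$1 - y0$1\<bar> + 1))"
      have p1: "\<bar>z$1 - y0$1\<bar> + 1 > 0" by linarith
      have e: "\<epsilon> > 0" "\<epsilon> \<le> 1" "\<epsilon> * \<bar>z$1 - y0$1\<bar> \<le> (t/2) * \<bar>u$1\<bar>"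
      proof -
        show e0: "\<epsilon> > 0" "\<epsilon> \<le> 1" unfolding \<epsilon>_def using t False p1 by auto
        have "\<epsilon> \<le> (t/2) * \<bar>u$1\<bar> / (\<bar>z$1 - y0$1\<bar> + 1)" unfolding \<epsilon>_def by simp
        hence "\<epsilon> * (\<bar>z$1 - y0$1\<bar> + 1) \<le> (t/2) * \<bar>u$1\<bar>" using pos_le_divide_eq[OF p1] by blast
        thus "\<epsilon> * \<bar>z$1 - y0$1\<bar> \<le> (t/2) * \<bar>u$1\<bar>" using e0 by (simp add: algebra_simps)
      qed
      have "y0 = vshear f (p + (t/2) *\<^sub>R u)" unfolding y0_def using im[of "t/2"] t by simp
      hence y0D: "y0 \<in> vshear f ` D" using inD[of "t/2"] t by auto
      define y where "y = (1 - \<epsilon>) *\<^sub>R y0 + \<epsilon> *\<^sub>R z"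
      have yD: "y \<in> vshear f ` D" unfolding y_def using convexD_alt[OF assms(2) y0D z, of \<epsilon>] e by simp
      define \<tau> where "\<tau> = t/2 + \<epsilon> * (z$1 - y0$1) / u$1"
      have "\<bar>\<epsilon> * (z$1 - y0$1) / u$1\<bar> \<le> t/2"
        using e False by (simp add: abs_mult abs_divide pos_divide_le_eq)
      hence \<tau>: "0 \<le> \<tau>" "\<tau> \<le> t" unfolding \<tau>_def by linarith+
      have "\<tau> * u$1 = t/2 * u$1 + \<epsilon> * (z$1 - y0$1)" unfolding \<tau>_def using False by (simp add: distrib_right)
      moreover have "y$1 = y0$1 + \<epsilon> * (z$1 - y0$1)" unfolding y_def by (simp add: algebra_simps)
      moreover have "y0$1 = p$1 + t/2 * u$1" unfolding y0_def using u'n by simp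
      ultimately have y1: "y$1 = (p + \<tau> *\<^sub>R u)$1" by simp
      have "vtop (r * sgn (u$1)) D (p + \<tau> *\<^sub>R u)" by (rule tangent_vtop[OF assms(3) False inD[OF \<tau>]])
      hence "vtop (r * sgn (u$1)) (vshear f ` D) (vshear f p + \<tau> *\<^sub>R u')" using vtop_vshear im[OF \<tau>] by metis
      hence le: "r * sgn (u$1) * y$2 \<le> r * sgn (u$1) * (vshear f p + \<tau> *\<^sub>R u')$2"
        by (rule vtopD[OF _ yD]) (use y1 u'n in simp)
      have "det2 u' (y - vshear f p) = u$1 * (y$2 - (vshear f p + \<tau> *\<^sub>R u')$2)"
        using y1 by (simp add: det2_eq u'n algebra_simps)
      moreover have "u$1 = \<bar>u$1\<bar> * sgn (u$1)" by (metis mult_sgn_abs mult.commute)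
      ultimately have "r * det2 u' (y - vshear f p) = \<bar>u$1\<bar> * (r * sgn (u$1) * y$2 - r * sgn (u$1) * (vshear f p + \<tau> *\<^sub>R u')$2)"
        by (metis (no_types, opaque_lifting) mult.assoc mult.commute right_diff_distrib)
      hence "r * det2 u' (y - vshear f p) \<le> 0" using le by (simp add: mult_nonneg_nonpos)
      \<comment> \<open>\<open>y0\<close> lies on the ray itself, so the determinant at
        \<open>y\<close> is \<epsilon> times the one at \<open>z\<close>, with the same
        sign.\<close>
      moreover have "y - vshear f p = ((1 - \<epsilon>) * (t/2)) *\<^sub>R u' + \<epsilon> *\<^sub>R (z - vshear f p)"
        unfolding y_def y0_def by (simp add: algebra_simps)
      hence "r * det2 u' (y - vshear f p) = \<epsilon> * (r * det2 u' (z - vshear f p))" by (simp add: det2_simps)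
      ultimately show False using neg e(1) by (metis mult_le_0_iff not_less order_less_imp_le)
    qed
  qed
  have "u' \<noteq> 0" using tangentD(1)[OF assms(3)] by (auto simp: vec2_eq u'n)
  moreover have "vshear f p + t *\<^sub>R u' \<in> vshear f ` D" using im[of t] inD[of t] t by (metis image_eqI order_refl less_imp_le)
  ultimately have "tangent r (vshear f ` D) (vshear f p) u'"
    unfolding tangent_def using sup tangentD(2)[OF assms(3)] t(1) by blast
  thus ?thesis unfolding u'_def cu_def .
qed

section \<open>Cuts over a boundary point and the invariance of the defect\<close>

lemma cut_iff:
  assumes "p \<in> pgon R" "i < length (marks R)" "wf_rep R"
  shows "p \<in> cut R i \<longleftrightarrow> marks R ! i $ 1 = p$1 \<and> of_int (signs R ! i) * (p$2 - marks R ! i $ 2) \<ge> 0"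
proof -
  have s: "signs R ! i = 1 \<or> signs R ! i = -1" using pm1_nth assms(2,3) unfolding wf_rep_def by metis
  show ?thesis
  proof
    assume "p \<in> cut R i"
    then obtain t where "t \<ge> 0" "p = marks R ! i + t *\<^sub>R vector [0, of_int (signs R ! i)]" unfolding cut_def by auto
    thus "marks R ! i $ 1 = p$1 \<and> of_int (signs R ! i) * (p$2 - marks R ! i $ 2) \<ge> 0" using s by auto
  next
    assume *: "marks R ! i $ 1 = p$1 \<and> of_int (signs R ! i) * (p$2 - marks R ! i $ 2) \<ge> 0"
    define t where "t = of_int (signs R ! i) * (p$2 - marks R ! i $ 2)"
    have "t \<ge> 0" "p = marks R ! i + t *\<^sub>R vector [0, of_int (signs R ! i)]"
      using * s unfolding t_def by (auto simp: vec2_eq)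
    thus "p \<in> cut R i" using assms(1) unfolding cut_def by blast
  qed
qed

lemma cut_vtop_iff:
  assumes "vtop s (pgon R) p" "s = 1 \<or> s = -1" "i < length (marks R)" "wf_rep R" "set (marks R) \<subseteq> interior (pgon R)"
  shows "p \<in> cut R i \<longleftrightarrow> marks R ! i $ 1 = p$1 \<and> of_int (signs R ! i) = s"
proof -
  have s: "signs R ! i = 1 \<or> signs R ! i = -1" using pm1_nth assms(3,4) unfolding wf_rep_def by metis
  have "s * (p$2 - marks R ! i $ 2) > 0" if "marks R ! i $ 1 = p$1"
    by (rule vtop_interior[OF assms(1) _ that assms(2)]) (use assms in auto)
  moreover have "p \<in> pgon R" using assms(1) by (simp add: vtop_def)
  ultimately show ?thesis using cut_iff[OF _ assms(3,4)] s assms(2) by auto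
qed

text \<open>The jump of the slope of \<open>act_shift\<close> at the first coordinate
  \<open>x\<close>.\<close>

definition net_flip :: "srep \<Rightarrow> int list \<Rightarrow> real \<Rightarrow> int" where
  "net_flip R e x = (\<Sum>k | k < length (marks R) \<and> marks R ! k $ 1 = x. flip_exponent R e k)"

text \<open>A flipped cut of sign \<open>s\<close> leaves this end of the slice and one of sign
  \<open>-s\<close> arrives; in both cases the count drops by \<open>s\<close> times the
  exponent.\<close>

lemma ncuts_act:
  assumes "vtop s (pgon R) p" "s = 1 \<or> s = -1" "wf_rep R" "set (marks R) \<subseteq> interior (pgon R)"
    "g \<in> grp (length (marks R))"
  shows "real (ncuts R p) - real (ncuts (act g R) (act_map g R p)) = s * of_int (net_flip R (snd g) (p$1))"
proof -
  let ?m = "length (marks R)" and ?R = "act g R" and ?q = "act_map g R p"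
  let ?A = "{k. k < ?m \<and> marks R ! k $ 1 = p$1}"
  obtain n b e where g: "g = group_elt n b e" "length e = ?m" "set e \<subseteq> {-1, 1}" using grpE[OF assms(5)] .
  have am: "act_map g R = vshear (act_shift g R)" by (rule act_map_vshear[OF assms(5)])
  have 1: "ncuts R p = (\<Sum>k\<in>?A. if of_int (signs R ! k) = s then 1 else 0)"
  proof -
    have "{i. i < ?m \<and> p \<in> cut R i} = {k\<in>?A. of_int (signs R ! k) = s}"
      using cut_vtop_iff[OF assms(1,2) _ assms(3,4)] by auto
    thus ?thesis unfolding ncuts_def by (simp add: sum.If_cases Int_def)
  qed
  have 2: "ncuts ?R ?q = (\<Sum>k\<in>?A. if of_int (e ! k * signs R ! k) = s then 1 else 0)"
  proof -
    have v: "vtop s (pgon ?R) ?q" using assms(1) by (simp add: am)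
    have mi: "set (marks ?R) \<subseteq> interior (pgon ?R)"
      using assms(4) by (auto simp: am interior_vshear_image continuous_act_shift[OF assms(5)])
    have "{i. i < ?m \<and> ?q \<in> cut ?R i} = {k\<in>?A. of_int (e ! k * signs R ! k) = s}"
      using cut_vtop_iff[OF v assms(2) _ wf_rep_act[OF assms(3,5)] mi] g(2,3) assms(3)
      by (auto simp: wf_rep_def g(1) act_map_group_elt)
    thus ?thesis unfolding ncuts_def by (simp add: sum.If_cases Int_def)
  qed
  have "real (ncuts R p) - real (ncuts ?R ?q) = (\<Sum>k\<in>?A. s * of_int (flip_exponent R e k))"
    unfolding 1 2 of_nat_sum sum_subtractf[symmetric]
  proof (rule sum.cong[OF refl])
    fix k assume k: "k \<in> ?A"
    have "e ! k = 1 \<or> e ! k = -1" "signs R ! k = 1 \<or> signs R ! k = -1"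
      using pm1_nth assms g k unfolding wf_rep_def by auto
    thus "real (if of_int (signs R ! k) = s then 1 else 0) - real (if of_int (e ! k * signs R ! k) = s then 1 else 0)
      = s * of_int (flip_exponent R e k)" using assms(2) unfolding flip_exponent_def by auto
  qed
  thus ?thesis unfolding net_flip_def g(1) snd_group_elt by (simp add: sum_distrib_left)
qed

text \<open>\<open>c\<close> is the slope of the profile to the left and \<open>k\<close> its jump,
  felt only by directions going right; for vertical \<open>u\<close> the choice has no
  effect.\<close>

definition sheared_dir :: "int \<Rightarrow> int \<Rightarrow> real^2 \<Rightarrow> real^2" where
  "sheared_dir c k u = vector [u$1, u$2 + of_int (c + (if u$1 \<ge> 0 then k else 0)) * u$1]"

lemma sheared_dir_nth [simp]: "sheared_dir c k u $ 1 = u$1"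
  by (simp add: sheared_dir_def)

lemma primitive_sheared_dir: "primitive_vec u \<Longrightarrow> primitive_vec (sheared_dir c k u)"
  unfolding sheared_dir_def by (rule primitive_vec_shear)

text \<open>One and the same \<open>c\<close> serves all points over \<open>x0\<close> and both
  senses, so the two directions at a point can be compared after the shear.\<close>

lemma tangent_act:
  assumes "convex (pgon R)" "g \<in> grp (length (marks R))" "convex (pgon (act g R))"
  obtains c where "\<And>p u r. p$1 = x0 \<Longrightarrow> r = 1 \<or> r = -1 \<Longrightarrow> tangent r (pgon R) p u \<Longrightarrow>
     tangent r (pgon (act g R)) (act_map g R p) (sheared_dir c (net_flip R (snd g) x0) u)"
proof -
  have am: "act_map g R = vshear (act_shift g R)" by (rule act_map_vshear[OF assms(2)])
  show ?thesis
  proof (rule act_shift_local[OF assms(2), where ?x0.0 = x0])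
  fix c :: int and d assume cd: "d > (0::real)" "\<And>h. \<bar>h\<bar> \<le> d \<Longrightarrow> act_shift g R (x0 + h) = act_shift g R x0 +
     (of_int c + (if h \<ge> 0 then of_int (\<Sum>k | k < length (marks R) \<and> marks R ! k $ 1 = x0. flip_exponent R (snd g) k) else 0)) * h"
  show ?thesis
  proof (rule that[of c])
    fix p u :: "real^2" and r :: real
    assume p: "p$1 = x0" "r = 1 \<or> r = -1" "tangent r (pgon R) p u"
    have "tangent r (vshear (act_shift g R) ` pgon R) (vshear (act_shift g R) p)
      (vector [u$1, u$2 + (of_int c + (if u$1 \<ge> 0 then of_int (net_flip R (snd g) x0) else 0)) * u$1])"
      by (rule tangent_shear[OF assms(1) _ p(3,2) cd(1)]) (use assms(3) cd(2) p(1) in \<open>auto simp: am net_flip_def\<close>)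
    moreover have "of_int c + (if u$1 \<ge> 0 then of_int (net_flip R (snd g) x0) else 0) =
        (of_int (c + (if u$1 \<ge> 0 then net_flip R (snd g) x0 else 0)) :: real)" by simp
    ultimately show "tangent r (pgon (act g R)) (act_map g R p) (sheared_dir c (net_flip R (snd g) x0) u)"
      unfolding sheared_dir_def act_sel am by simp
  qed
  qed
qed

text \<open>The \<open>k\<close>-cut conditions say that the defect is 0 (fake) or 1 (hidden); for \<open>k = 0\<close>, 1 is Delzant.\<close>

definition defect :: "srep \<Rightarrow> real^2 \<Rightarrow> real^2 \<Rightarrow> real^2 \<Rightarrow> real" where
  "defect R p w v = det2 w (Tpow (ncuts R p) v)"

text \<open>If both directions go to the same side, \<open>p\<close> is the upper and the lower end
  of its slice, which then has no room for an interior point.\<close>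

lemma no_cuts_same_side:
  assumes "tangent 1 D p v" "tangent (-1) D p w" "v$1 * w$1 > 0" "c \<in> interior D" shows "c$1 \<noteq> p$1"
proof
  assume c: "c$1 = p$1"
  have nz: "v$1 \<noteq> 0" "w$1 \<noteq> 0" using assms(3) by auto
  have "sgn (w$1) = sgn (v$1)" using assms(3) by (auto simp: zero_less_mult_iff)
  hence "vtop (sgn (v$1)) D p" "vtop (- sgn (v$1)) D p"
    using tangent_vtop0[OF assms(1) nz(1)] tangent_vtop0[OF assms(2) nz(2)] by simp_all
  thus False using vtop_both_interior[OF _ _ assms(4) c] nz(1) by (cases "v$1 > 0") auto
qed

lemma ncuts_0:
  assumes "\<And>i. i < length (marks R) \<Longrightarrow> marks R ! i $ 1 \<noteq> p$1" shows "ncuts R p = 0"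
proof -
  have "{i. i < length (marks R) \<and> p \<in> cut R i} = {}" using assms unfolding cut_def by fastforce
  thus ?thesis unfolding ncuts_def by simp
qed

text \<open>If the directions lie on opposite sides of the vertical, only one feels the jump, and
  the change of the determinant is the change in the number of cuts times \<open>w$1 * v$1\<close>.
  If they lie on the same side, there is no marked point over \<open>p\<close> and no jump. If one
  is vertical, the product is 0.\<close>

lemma defect_act:
  assumes "wf_rep R" "set (marks R) \<subseteq> interior (pgon R)" "g \<in> grp (length (marks R))"
    "tangent 1 (pgon R) p v" "tangent (-1) (pgon R) p w" "k = net_flip R (snd g) (p$1)"
  shows "defect (act g R) (act_map g R p) (sheared_dir c k w) (sheared_dir c k v) = defect R p w v"
proof -
  let ?n = "real (ncuts R p)" and ?n' = "real (ncuts (act g R) (act_map g R p))"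
  define cv where "cv = c + (if v$1 \<ge> 0 then k else 0)"
  define cw where "cw = c + (if w$1 \<ge> 0 then k else 0)"
  have v2: "sheared_dir c k v $ 2 = v$2 + of_int cv * v$1" "sheared_dir c k w $ 2 = w$2 + of_int cw * w$1"
    by (simp_all add: sheared_dir_def cv_def cw_def)
  have "(?n - ?n') * (w$1 * v$1) = (of_int cv - of_int cw) * (w$1 * v$1)"
  proof -
    consider "w$1 * v$1 = 0" | "v$1 > 0" "w$1 < 0" | "v$1 < 0" "w$1 > 0" | "v$1 * w$1 > 0"
      by (metis less_linear mult_eq_0_iff mult_neg_neg mult_pos_pos)
    thus ?thesis
    proof cases
      case 2
      hence "vtop 1 (pgon R) p" using tangent_vtop0[OF assms(4)] by simp
      hence "?n - ?n' = of_int k" using ncuts_act[OF _ _ assms(1-3)] assms(6) by simp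
      thus ?thesis using 2 unfolding cv_def cw_def by simp
    next
      case 3
      hence "vtop (-1) (pgon R) p" using tangent_vtop0[OF assms(4)] by simp
      hence "?n - ?n' = - of_int k" using ncuts_act[OF _ _ assms(1-3)] assms(6) by simp
      thus ?thesis using 3 unfolding cv_def cw_def by simp
    next
      case 4
      have no: "marks R ! i $ 1 \<noteq> p$1" if "i < length (marks R)" for i
        using no_cuts_same_side[OF assms(4,5) 4] assms(2) that by (metis nth_mem subsetD)
      have "ncuts R p = 0" by (rule ncuts_0[OF no])
      moreover have "ncuts (act g R) (act_map g R p) = 0"
        by (rule ncuts_0) (use no in \<open>auto simp: act_map_vshear[OF assms(3)]\<close>)
      moreover have "k = 0" unfolding assms(6) net_flip_def using no by (intro sum.neutral) auto
      ultimately show ?thesis by (simp add: cv_def cw_def)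
    qed auto
  qed
  thus ?thesis unfolding defect_def det2_Tpow by (simp add: det2_eq v2 algebra_simps)
qed

lemma mark_at_frontier:
  assumes "tangent 1 D p v" "tangent (-1) D p w" "c \<in> interior D" "c$1 = p$1"
  shows "w$1 * v$1 < 0"
proof -
  have "1 * det2 v (c - p) < 0" "-1 * det2 w (c - p) < 0"
    using tangent_interior_strict[OF assms(1) _ assms(3)] tangent_interior_strict[OF assms(2) _ assms(3)] by auto
  hence "v$1 \<noteq> 0" "w$1 \<noteq> 0" using assms(4) by (auto simp: det2_eq)
  moreover have "\<not> v$1 * w$1 > 0" using no_cuts_same_side[OF assms(1-2) _ assms(3)] assms(4) by blast
  ultimately show ?thesis by (auto simp: mult_less_0_iff zero_less_mult_iff)
qed

lemma ncuts_pos: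
  assumes "ncuts R p \<ge> 1" obtains i where "i < length (marks R)" "marks R ! i $ 1 = p$1" "p \<in> cut R i"
proof -
  have "{i. i < length (marks R) \<and> p \<in> cut R i} \<noteq> {}" using assms unfolding ncuts_def by (metis card.empty not_one_le_zero)
  then obtain i where "i < length (marks R)" "p \<in> cut R i" by blast
  thus ?thesis using that[of i] unfolding cut_def by auto
qed

text \<open>Swapping the two edge directions reverses the sign of the determinant, so the positivity
  requirement alone fixes their order.\<close>

lemma edge_dir_pair:
  assumes "rational_polygon D" "p extreme_point_of D" "tangent 1 D p v" "tangent (-1) D p w" "primitive_vec v" "primitive_vec w"
  shows "edge_dir D p u1 \<and> edge_dir D p u2 \<and> det2 u1 u2 > 0 \<longleftrightarrow> u1 = w \<and> u2 = v"
proof -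
  have D: "convex D" "interior D \<noteq> {}" using assms(1) polytope_imp_convex by (auto simp: rational_polygon_def)
  have pos: "det2 w v > 0" using extreme_iff_det[OF D assms(3,4)] assms(2) by blast
  have ed: "edge_dir D p u \<longleftrightarrow> u = v \<or> u = w" for u
    using edge_dir_iff[OF assms(1,2)] tangent_primitive_unique[of 1 D p v u] tangent_primitive_unique[of "-1" D p w u] assms D
    by (metis zero_neq_one zero_neq_neg_one)
  have "det2 v w = - det2 w v" by (simp add: det2_eq)
  thus ?thesis unfolding ed using pos by (auto simp: det2_simps)
qed

text \<open>Merges the vertex, fake, hidden and Delzant conditions into one number. Without cuts the
  defect is the plain determinant: 0 at a point inside an edge, 1 at a Delzant corner.\<close>

lemma rep_conditions_iff_defect:
  assumes "rational_polygon (pgon R)" "wf_rep R" "set (marks R) \<subseteq> interior (pgon R)" "p \<in> frontier (pgon R)"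
    "tangent 1 (pgon R) p v" "tangent (-1) (pgon R) p w" "primitive_vec v" "primitive_vec w"
  shows "((ncuts R p \<ge> 1 \<longrightarrow> p extreme_point_of pgon R \<and>
        (fake_cond (pgon R) (ncuts R p) p \<or> hidden_cond (pgon R) (ncuts R p) p)) \<and>
      (p extreme_point_of pgon R \<and> ncuts R p = 0 \<longrightarrow> delzant_cond (pgon R) p)) \<longleftrightarrow> defect R p w v \<in> {0, 1}" (is ?A)
    and "true_corner R p \<longleftrightarrow> defect R p w v = 1" (is ?B)
proof -
  let ?D = "pgon R"
  have D: "convex ?D" "interior ?D \<noteq> {}" using assms(1) polytope_imp_convex by (auto simp: rational_polygon_def)
  note ex = extreme_iff_det[OF D assms(5,6)]
  have nn: "det2 w v \<ge> 0" by (rule tangent_det_nonneg[OF assms(5,6)])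
  have c: "fake_cond ?D k p \<longleftrightarrow> det2 w (Tpow k v) = 0" "hidden_cond ?D k p \<longleftrightarrow> det2 w (Tpow k v) = 1"
    "delzant_cond ?D p \<longleftrightarrow> det2 w v = 1" if "p extreme_point_of ?D" for k
    unfolding fake_cond_def hidden_cond_def delzant_cond_def
    using edge_dir_pair[OF assms(1) that assms(5-8)] by metis+
  \<comment> \<open>A cut ends here only if a marked point lies in the slice, so
    \<open>w$1 * v$1\<close> is negative; a nonnegative defect then needs a positive determinant,
    that is, a vertex.\<close>
  have pos: "det2 w v > 0" if "ncuts R p \<ge> 1" "defect R p w v \<ge> 0"
  proof -
    note n1 = that(1)
    obtain i where i: "i < length (marks R)" "marks R ! i $ 1 = p$1" using ncuts_pos[OF n1] by blast
    hence "marks R ! i \<in> interior ?D" using assms(3) by auto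
    hence "w$1 * v$1 < 0" using mark_at_frontier[OF assms(5,6) _ i(2)] by blast
    hence "real (ncuts R p) * (w$1 * v$1) < 0" using that(1) by (simp add: mult_less_0_iff)
    thus ?thesis using that(2) unfolding defect_def det2_Tpow by (simp add: mult.assoc)
  qed
  have T0: "Tpow 0 v = v" by (simp add: Tpow_def)
  show ?A
  proof (cases "ncuts R p = 0")
    case True
    thus ?thesis using ex c(3) nn by (auto simp: defect_def T0)
  next
    case False
    thus ?thesis using ex c pos by (auto simp: defect_def)
  qed
  show ?B unfolding true_corner_def hidden_corner_def delzant_corner_def
  proof (cases "ncuts R p = 0")
    case True
    thus "p extreme_point_of ?D \<and> 1 \<le> ncuts R p \<and> hidden_cond ?D (ncuts R p) p \<or>
       p extreme_point_of ?D \<and> ncuts R p = 0 \<and> delzant_cond ?D p \<longleftrightarrow> defect R p w v = 1"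
      using ex c(3) nn by (auto simp: defect_def T0)
  next
    case False
    thus "p extreme_point_of ?D \<and> 1 \<le> ncuts R p \<and> hidden_cond ?D (ncuts R p) p \<or>
       p extreme_point_of ?D \<and> ncuts R p = 0 \<and> delzant_cond ?D p \<longleftrightarrow> defect R p w v = 1"
      using ex c pos by (auto simp: defect_def)
  qed
qed

lemma is_repD:
  assumes "is_rep R"
  shows "rational_polygon (pgon R)" "polytope (pgon R)" "convex (pgon R)" "interior (pgon R) \<noteq> {}" "closed (pgon R)"
    "compact (pgon R)" "wf_rep R" "set (marks R) \<subseteq> interior (pgon R)" "sorted_wrt lex_le (marks R)"
  using assms wf_repI polytope_imp_convex polytope_imp_closed polytope_imp_compact unfolding is_rep_def rational_polygon_def by auto

text \<open>The form in which being a representative is transported: it mentions support directions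
  at all boundary points, whereas vertices come and go under the action.\<close>

lemma is_rep_iff_defect:
  "is_rep R \<longleftrightarrow> rational_polygon (pgon R) \<and> wf_rep R \<and> set (marks R) \<subseteq> interior (pgon R) \<and> sorted_wrt lex_le (marks R) \<and>
     (\<forall>p\<in>frontier (pgon R). \<forall>v w. tangent 1 (pgon R) p v \<and> tangent (-1) (pgon R) p w \<and> primitive_vec v \<and> primitive_vec w
        \<longrightarrow> defect R p w v \<in> {0, 1})"
proof
  assume R: "is_rep R"
  note r = is_repD[OF R]
  {
    fix p v w assume p: "p \<in> frontier (pgon R)" "tangent 1 (pgon R) p v" "tangent (-1) (pgon R) p w" "primitive_vec v" "primitive_vec w"
    have "defect R p w v \<in> {0, 1}"
      using rep_conditions_iff_defect(1)[OF r(1,7,8) p] R p(1) unfolding is_rep_def by blast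
  }
  thus "rational_polygon (pgon R) \<and> wf_rep R \<and> set (marks R) \<subseteq> interior (pgon R) \<and> sorted_wrt lex_le (marks R) \<and>
     (\<forall>p\<in>frontier (pgon R). \<forall>v w. tangent 1 (pgon R) p v \<and> tangent (-1) (pgon R) p w \<and> primitive_vec v \<and> primitive_vec w
        \<longrightarrow> defect R p w v \<in> {0, 1})" using r by blast
next
  assume R: "rational_polygon (pgon R) \<and> wf_rep R \<and> set (marks R) \<subseteq> interior (pgon R) \<and> sorted_wrt lex_le (marks R) \<and>
     (\<forall>p\<in>frontier (pgon R). \<forall>v w. tangent 1 (pgon R) p v \<and> tangent (-1) (pgon R) p w \<and> primitive_vec v \<and> primitive_vec w
        \<longrightarrow> defect R p w v \<in> {0, 1})"
  hence r: "rational_polygon (pgon R)" "wf_rep R" "set (marks R) \<subseteq> interior (pgon R)" by auto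
  have key: "(ncuts R p \<ge> 1 \<longrightarrow> p extreme_point_of pgon R \<and>
        (fake_cond (pgon R) (ncuts R p) p \<or> hidden_cond (pgon R) (ncuts R p) p)) \<and>
      (p extreme_point_of pgon R \<and> ncuts R p = 0 \<longrightarrow> delzant_cond (pgon R) p)" if p: "p \<in> frontier (pgon R)" for p
  proof -
    obtain v where v: "primitive_vec v" "tangent 1 (pgon R) p v" using primitive_tangent_exists[OF r(1) p] by blast
    obtain w where w: "primitive_vec w" "tangent (-1) (pgon R) p w" using primitive_tangent_exists[OF r(1) p] by blast
    show ?thesis using rep_conditions_iff_defect(1)[OF r p v(2) w(2) v(1) w(1)] R p v w by blast
  qed
  have "interior (pgon R) \<noteq> {}" using r(1) by (simp add: rational_polygon_def)
  hence "p \<in> frontier (pgon R)" if "p extreme_point_of pgon R" for p using extreme_frontier that by blast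
  thus "is_rep R" unfolding is_rep_def using key R unfolding wf_rep_def by blast
qed

lemma lex_le_vshear: "lex_le (vshear f p) (vshear f q) \<longleftrightarrow> lex_le p q"
  by (auto simp: lex_le_def)

text \<open>Everything except convexity and polyhedrality of the image follows formally from the
  transport of directions, so that one property is isolated as a hypothesis.\<close>

lemma is_rep_act_polytope:
  assumes "is_rep R" "g \<in> grp (length (marks R))" "polytope (pgon (act g R))"
  shows "is_rep (act g R)"
proof -
  note r = is_repD[OF assms(1)]
  let ?R = "act g R" and ?\<sigma> = "act_map g R"
  have am: "?\<sigma> = vshear (act_shift g R)" by (rule act_map_vshear[OF assms(2)])
  have int: "interior (pgon ?R) = ?\<sigma> ` interior (pgon R)" by (simp add: am interior_vshear_image continuous_act_shift[OF assms(2)])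
  have fr: "frontier (pgon ?R) = ?\<sigma> ` frontier (pgon R)" by (simp add: am frontier_vshear_image continuous_act_shift[OF assms(2)] r(5))
  have cv: "convex (pgon ?R)" using assms(3) polytope_imp_convex by blast
  have intne: "interior (pgon ?R) \<noteq> {}" using int r(4) by simp
  have dirs: "\<exists>v w c k. k = net_flip R (snd g) (p$1) \<and> primitive_vec v \<and> primitive_vec w \<and> tangent 1 (pgon R) p v \<and> tangent (-1) (pgon R) p w \<and>
      tangent 1 (pgon ?R) (?\<sigma> p) (sheared_dir c k v) \<and> tangent (-1) (pgon ?R) (?\<sigma> p) (sheared_dir c k w)"
    if p: "p \<in> frontier (pgon R)" for p
  proof -
    obtain v where v: "primitive_vec v" "tangent 1 (pgon R) p v" using primitive_tangent_exists[OF r(1) p] by blast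
    obtain w where w: "primitive_vec w" "tangent (-1) (pgon R) p w" using primitive_tangent_exists[OF r(1) p] by blast
    obtain c where "\<And>q u r. q$1 = p$1 \<Longrightarrow> r = 1 \<or> r = -1 \<Longrightarrow> tangent r (pgon R) q u \<Longrightarrow>
     tangent r (pgon ?R) (?\<sigma> q) (sheared_dir c (net_flip R (snd g) (p$1)) u)" using tangent_act[OF r(3) assms(2) cv, where ?x0.0 = "p$1"] by blast
    thus ?thesis using v w by blast
  qed
  have "rational_polygon (pgon ?R)" unfolding rational_polygon_def
  proof (intro conjI allI impI)
    fix a b assume ab: "closed_segment a b edge_of pgon ?R"
    have neq: "a \<noteq> b" using ab by (auto simp: edge_of_def)
    have "a \<in> frontier (pgon ?R)" using extreme_frontier[OF intne] edge_ends_extreme[OF ab] by blast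
    then obtain p where p: "p \<in> frontier (pgon R)" "a = ?\<sigma> p" using fr by auto
    obtain v w c k where d: "primitive_vec v" "primitive_vec w"
      "tangent 1 (pgon ?R) a (sheared_dir c k v)" "tangent (-1) (pgon ?R) a (sheared_dir c k w)" using dirs[OF p(1)] p(2) by blast
    have "\<exists>u t. primitive_vec u \<and> b - a = t *\<^sub>R u"
    proof (cases "tangent 1 (pgon ?R) a (b - a)")
      case True
      thus ?thesis using tangent_unique_dir[OF d(3) True _ intne] primitive_sheared_dir[OF d(1)] by (metis zero_neq_one)
    next
      case False
      hence "tangent (-1) (pgon ?R) a (b - a)" using edge_tangent[OF assms(3) intne ab neq] by blast
      thus ?thesis using tangent_unique_dir[OF d(4) _ _ intne] primitive_sheared_dir[OF d(2)] by (metis zero_neq_neg_one)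
    qed
    thus "\<exists>m n t. b - a = t *\<^sub>R vector [of_int m, of_int n]" unfolding primitive_vec_def by blast
  qed (use assms(3) intne in auto)
  moreover have "wf_rep ?R" by (rule wf_rep_act[OF r(7) assms(2)])
  moreover have "set (marks ?R) \<subseteq> interior (pgon ?R)" using r(8) int by auto
  moreover have "sorted_wrt lex_le (marks ?R)" using r(9) by (simp add: am sorted_wrt_map lex_le_vshear)
  moreover have "defect ?R q w' v' \<in> {0, 1}"
    if q: "q \<in> frontier (pgon ?R)" "tangent 1 (pgon ?R) q v'" "tangent (-1) (pgon ?R) q w'" "primitive_vec v'" "primitive_vec w'" for q v' w'
  proof -
    obtain p where p: "p \<in> frontier (pgon R)" "q = ?\<sigma> p" using q(1) fr by auto
    obtain v w c k where d: "k = net_flip R (snd g) (p$1)" "primitive_vec v" "primitive_vec w" "tangent 1 (pgon R) p v" "tangent (-1) (pgon R) p w"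
      "tangent 1 (pgon ?R) q (sheared_dir c k v)" "tangent (-1) (pgon ?R) q (sheared_dir c k w)" using dirs[OF p(1)] p(2) by blast
    have "v' = sheared_dir c k v" by (rule tangent_primitive_unique[OF d(6) q(2) _ intne]) (use q d primitive_sheared_dir in auto)
    moreover have "w' = sheared_dir c k w" by (rule tangent_primitive_unique[OF d(7) q(3) _ intne]) (use q d primitive_sheared_dir in auto)
    ultimately have "defect ?R q w' v' = defect R p w v" using defect_act[OF r(7,8) assms(2) d(4,5,1)] p(2) by simp
    moreover have "defect R p w v \<in> {0, 1}" using assms(1) d p(1) unfolding is_rep_iff_defect by blast
    ultimately show ?thesis by simp
  qed
  ultimately show ?thesis unfolding is_rep_iff_defect by blast
qed

section \<open>Representatives under the action\<close>

lemma vtop_exists: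
  assumes "compact D" "c \<in> D"
  obtains p where "vtop s D p" "p$1 = c$1"
proof -
  have "{x::real^2. x$1 = c$1} = {x. (vector [1, 0] :: real^2) \<bullet> x = c$1}" by (simp add: inner2)
  hence "closed {x::real^2. x$1 = c$1}" by (metis closed_hyperplane)
  hence "compact (D \<inter> {x. x$1 = c$1})" using assms(1) by (rule compact_Int_closed[rotated])
  moreover have "D \<inter> {x. x$1 = c$1} \<noteq> {}" using assms(2) by auto
  moreover have "continuous_on (D \<inter> {x. x$1 = c$1}) (\<lambda>x. s * x$2)" by (intro continuous_intros)
  ultimately obtain p where p: "p \<in> D \<inter> {x. x$1 = c$1}" "\<forall>x\<in>D \<inter> {x. x$1 = c$1}. s * x$2 \<le> s * p$2"
    using continuous_attains_sup by blast
  show ?thesis by (rule that[of p]) (use p in \<open>auto simp: vtop_def\<close>)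
qed

lemma vtop_frontier:
  assumes "vtop s D p" "s = 1 \<or> s = -1" shows "p \<in> frontier D"
proof -
  have "p \<notin> interior D" using vtop_interior[OF assms(1) _ refl assms(2)] by auto
  thus ?thesis using assms(1) closure_subset by (auto simp: frontier_def vtop_def)
qed

lemma vertical_between:
  fixes p r z :: "real^2"
  assumes "convex D" "p \<in> D" "r \<in> D" "r$1 = p$1" "z$1 = p$1" "s * r$2 \<le> s * z$2" "s * z$2 \<le> s * p$2" "s = 1 \<or> s = -1"
  shows "z \<in> D"
proof (cases "r$2 = p$2")
  case True
  hence "z = p" using assms by (auto simp: vec2_eq)
  thus ?thesis using assms by simp
next
  case False
  define l where "l = (z$2 - r$2) / (p$2 - r$2)"
  have "l = (s * z$2 - s * r$2) / (s * p$2 - s * r$2)" 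
  proof -
    have "s \<noteq> 0" using assms(8) by auto
    thus ?thesis unfolding l_def right_diff_distrib[symmetric] by simp
  qed
  moreover have "s * p$2 - s * r$2 > 0" using assms(6-8) False by auto
  ultimately have l: "0 \<le> l" "l \<le> 1" using assms(6,7) by (auto simp: field_simps)
  have "l * (p$2 - r$2) = z$2 - r$2" unfolding l_def using False by simp
  hence "z = (1 - l) *\<^sub>R r + l *\<^sub>R p" using assms(4,5) by (auto simp: vec2_eq algebra_simps)
  thus ?thesis using convexD_alt[OF assms(1,3,2) l] by simp
qed

lemma polytope_affine_vshear: "polytope P \<Longrightarrow> polytope (vshear (\<lambda>x. c * x + b) ` P)"
proof -
  assume P: "polytope P"
  have "linear (vshear (\<lambda>x. c * x))" by (rule linearI) (simp_all add: vec2_eq algebra_simps)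
  hence "polytope (vshear (\<lambda>x. c * x) ` P)" using P polytope_linear_image by blast
  hence "polytope ((+) (vector [0, b]) ` vshear (\<lambda>x. c * x) ` P)" by (simp add: polytope_translation_eq)
  moreover have "(+) (vector [0, b]) ` vshear (\<lambda>x. c * x) ` P = vshear (\<lambda>x. c * x + b) ` P"
    unfolding image_image by (rule image_cong) (simp_all add: vec2_eq)
  ultimately show ?thesis by simp
qed

text \<open>The hypothesis says that \<open>w\<close> and T applied to \<open>v\<close> still
  enclose a convex angle. Then shearing a point \<open>X\<close> that lies to the right and on the
  inner side of \<open>v\<close> keeps it on the inner side of \<open>w\<close>.\<close>

lemma kink_fold_bound:
  fixes w v X :: "real^2"
  assumes "w$1 < 0" "v$1 > 0" "X$1 \<ge> 0" "det2 v X \<le> 0" "det2 w v + w$1 * v$1 \<ge> 0"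
  shows "det2 w (vector [X$1, X$2 + X$1]) \<ge> 0"
proof -
  have "v$1 * X$2 \<le> v$2 * X$1" using assms(4) by (simp add: det2_eq)
  hence "w$1 * (v$2 * X$1) \<le> w$1 * (v$1 * X$2)" using assms(1) by (simp add: mult_left_mono_neg)
  moreover have "X$1 * (det2 w v + w$1 * v$1) \<ge> 0" using assms by simp
  moreover have "v$1 * det2 w (vector [X$1, X$2 + X$1]) = w$1 * (v$1 * X$2) - w$1 * (v$2 * X$1) + X$1 * (det2 w v + w$1 * v$1)"
    by (simp add: det2_eq algebra_simps)
  ultimately have "v$1 * det2 w (vector [X$1, X$2 + X$1]) \<ge> 0" by linarith
  thus ?thesis using assms(2) by (simp add: zero_le_mult_iff)
qed

text \<open>The same at the lower end of a slice, where the shear is the inverse of T and the two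
  directions exchange their roles.\<close>

lemma kink_fold_bound':
  fixes w v X :: "real^2"
  assumes "v$1 < 0" "w$1 > 0" "X$1 \<ge> 0" "det2 w X \<ge> 0" "det2 w v + w$1 * v$1 \<ge> 0"
  shows "det2 v (vector [X$1, X$2 - X$1]) \<le> 0"
proof -
  have "w$2 * X$1 \<le> w$1 * X$2" using assms(4) by (simp add: det2_eq)
  hence "v$1 * (w$1 * X$2) \<le> v$1 * (w$2 * X$1)" using assms(1) by (simp add: mult_left_mono_neg)
  moreover have "X$1 * (det2 w v + w$1 * v$1) \<ge> 0" using assms by simp
  moreover have "w$1 * det2 v (vector [X$1, X$2 - X$1]) = v$1 * (w$1 * X$2) - v$1 * (w$2 * X$1) - X$1 * (det2 w v + w$1 * v$1)"
    by (simp add: det2_eq algebra_simps)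
  ultimately have "w$1 * det2 v (vector [X$1, X$2 - X$1]) \<le> 0" by linarith
  thus ?thesis using assms(2) by (simp add: mult_le_0_iff)
qed

text \<open>
  Only the slope inequality at the end of one cut makes the sheared polygon convex, so
  the cuts are flipped one at a time, every intermediate stage being a representative again.
\<close>

lemma polytope_single_flip:
  assumes "is_rep R" "k < length (marks R)" "s = of_int (signs R ! k)" "x0 = marks R ! k $ 1"
  shows "polytope (vshear (\<lambda>x. s * max 0 (x - x0)) ` pgon R)"
proof -
  note r = is_repD[OF assms(1)]
  let ?D = "pgon R" and ?\<sigma> = "vshear (\<lambda>x. s * max 0 (x - x0))" and ?\<tau> = "vshear (\<lambda>x. s * x + (- s * x0))"
  have "signs R ! k = 1 \<or> signs R ! k = -1" using pm1_nth r(7) assms(2) unfolding wf_rep_def by metis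
  hence s: "s = 1 \<or> s = -1" using assms(3) by auto
  define c where "c = marks R ! k"
  have c: "c \<in> interior ?D" "c$1 = x0" using r(8) assms(2,4) by (auto simp: c_def)
  have cD: "c \<in> ?D" using c(1) interior_subset by blast
  obtain p where p: "vtop s ?D p" "p$1 = x0" using vtop_exists[OF r(6) cD] c(2) by metis
  obtain q where q: "vtop (-s) ?D q" "q$1 = x0" using vtop_exists[OF r(6) cD] c(2) by metis
  have pf: "p \<in> frontier ?D" using vtop_frontier[OF p(1) s] .
  have qf: "q \<in> frontier ?D" using vtop_frontier[OF q(1)] s by auto
  obtain v where v: "primitive_vec v" "tangent 1 ?D p v" using primitive_tangent_exists[OF r(1) pf] by blast
  obtain w where w: "primitive_vec w" "tangent (-1) ?D p w" using primitive_tangent_exists[OF r(1) pf] by blast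
  have wv: "w$1 * v$1 < 0" using mark_at_frontier[OF v(2) w(2) c(1)] c(2) p(2) by simp
  have "p \<in> cut R k" using cut_vtop_iff[OF p(1) s assms(2) r(7,8)] p(2) assms by simp
  hence "{i. i < length (marks R) \<and> p \<in> cut R i} \<noteq> {}" using assms(2) by blast
  hence n: "ncuts R p \<ge> 1" unfolding ncuts_def by (simp add: Suc_le_eq card_gt_0_iff)
  have "defect R p w v \<ge> 0" using assms(1) pf v w unfolding is_rep_iff_defect by force
  hence "det2 w v + real (ncuts R p) * (w$1 * v$1) \<ge> 0" unfolding defect_def det2_Tpow by (simp add: mult.assoc)
  \<comment> \<open>The defect allows for all cuts ending at \<open>p\<close>. As
    \<open>w$1 * v$1\<close> is negative, allowing for only one of them leaves the value
    nonnegative.\<close>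
  moreover have "real (ncuts R p) * (w$1 * v$1) \<le> 1 * (w$1 * v$1)" using n wv by (intro mult_right_mono_neg) auto
  ultimately have fold: "det2 w v + w$1 * v$1 \<ge> 0" by linarith
  have sv: "sgn (v$1) = s"
  proof (rule ccontr)
    assume "sgn (v$1) \<noteq> s"
    hence "sgn (v$1) = - s" using s wv by (cases "v$1 > 0"; cases "v$1 = 0") auto
    moreover have "v$1 \<noteq> 0" using wv by auto
    ultimately have "vtop (- s) ?D p" using tangent_vtop0[OF v(2)] by simp
    thus False using vtop_both_interior[of ?D p, OF _ _ c(1)] p s c(2) by auto
  qed
  obtain u where u: "primitive_vec u" "tangent 1 ?D q u" using primitive_tangent_exists[OF r(1) qf] by blast
  have "1 * det2 u (c - q) < 0" using tangent_interior_strict[OF u(2) _ c(1)] by simp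
  hence u1: "u$1 \<noteq> 0" using c(2) q(2) by (auto simp: det2_eq)
  have su: "sgn (u$1) = - s"
  proof (rule ccontr)
    assume "sgn (u$1) \<noteq> - s"
    hence "sgn (u$1) = s" using s u1 by (cases "u$1 > 0") auto
    hence "vtop s ?D q" using tangent_vtop0[OF u(2) u1] by simp
    thus False using vtop_both_interior[of ?D q, OF _ _ c(1)] q s c(2) by auto
  qed
  define A where "A = ?D \<inter> {x. x$1 \<le> x0}"
  define B where "B = ?D \<inter> {x. x$1 \<ge> x0}"
  have half: "{x::real^2. x$1 \<le> x0} = {x. (vector [1, 0] :: real^2) \<bullet> x \<le> x0}"
    "{x::real^2. x$1 \<ge> x0} = {x. (vector [1, 0] :: real^2) \<bullet> x \<ge> x0}" by (simp_all add: inner2)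
  have pA: "polytope A" unfolding A_def half by (intro polytope_Int_polyhedron r(2) polyhedron_halfspace_le)
  have "polytope B" unfolding B_def half by (intro polytope_Int_polyhedron r(2) polyhedron_halfspace_ge)
  hence pB: "polytope (?\<tau> ` B)" by (rule polytope_affine_vshear)
  have img: "?\<sigma> ` ?D = A \<union> ?\<tau> ` B"
  proof -
    have "?D = A \<union> B" unfolding A_def B_def by auto
    moreover have "?\<sigma> ` A = id ` A" unfolding A_def by (rule image_cong) (auto simp: vec2_eq)
    moreover have "?\<sigma> ` B = ?\<tau> ` B" unfolding B_def by (rule image_cong) (auto simp: vec2_eq algebra_simps)
    ultimately have "?\<sigma> ` (A \<union> B) = A \<union> ?\<tau> ` B" unfolding image_Un by simp
    thus ?thesis using \<open>?D = A \<union> B\<close> by simp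
  qed
  \<comment> \<open>Both halves are convex, so only segments crossing the line x = \<open>x0\<close>
    matter. Such a segment is split at its point \<open>z\<close> on the line, and \<open>z\<close>
    has to be shown to lie between the two ends of the slice.\<close>
  have seg: "closed_segment a b \<subseteq> A \<union> ?\<tau> ` B" if a: "a \<in> A" and b: "b \<in> ?\<tau> ` B" for a b
  proof (cases "a$1 = x0 \<or> b$1 = x0")
    case True
    have fixed: "?\<tau> x = x" if "x$1 = x0" for x using that by (simp add: vec2_eq)
    show ?thesis
    proof (cases "a$1 = x0")
      case True
      hence "a \<in> ?\<tau> ` B" using a fixed[of a] unfolding A_def B_def by (intro image_eqI[of _ _ a]) auto
      thus ?thesis using closed_segment_subset[OF _ b polytope_imp_convex[OF pB]] by auto
    next
      case False
      hence bx: "b$1 = x0" using \<open>a$1 = x0 \<or> b$1 = x0\<close> by simp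
      obtain y where y: "y \<in> B" "b = ?\<tau> y" using b by auto
      hence "b = y" using bx fixed[of y] by simp
      hence "b \<in> A" using y(1) bx unfolding A_def B_def by auto
      thus ?thesis using closed_segment_subset[OF a _ polytope_imp_convex[OF pA]] by auto
    qed
  next
    case False
    obtain y where y: "y \<in> B" "b = ?\<tau> y" using b by auto
    have aD: "a \<in> ?D" "a$1 < x0" and yD: "y \<in> ?D" "y$1 > x0" using a y False unfolding A_def B_def by auto
    define l where "l = (x0 - a$1) / (b$1 - a$1)"
    have b1: "b$1 = y$1" "b$2 = y$2 + s * (y$1 - x0)" using y(2) by (auto simp: algebra_simps)
    have l: "0 \<le> l" "l \<le> 1" unfolding l_def using aD yD b1 by auto
    define z where "z = (1 - l) *\<^sub>R a + l *\<^sub>R b"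
    have "l * (b$1 - a$1) = x0 - a$1" unfolding l_def using aD yD b1 by simp
    hence z1: "z$1 = x0" unfolding z_def by (simp add: algebra_simps)
    have zdet: "det2 d (z - e) = (1 - l) * det2 d (a - e) + l * det2 d (b - e)" for d e
      unfolding z_def by (simp add: det2_eq algebra_simps)
    \<comment> \<open>The end towards which the cut points. Here the shear opens the angle, and the
      inequality \<open>fold\<close> keeps the sheared points inside.\<close>
    have up: "s * z$2 \<le> s * p$2"
    proof (cases "s = 1")
      case True
      have sg: "v$1 > 0" "w$1 < 0" using sv wv True by (auto simp: sgn_if mult_less_0_iff split: if_splits)
      have 1: "det2 w (a - p) \<ge> 0" using tangentD(4)[OF w(2) aD(1)] by simp
      have "det2 w (vector [(y - p)$1, (y - p)$2 + (y - p)$1]) \<ge> 0"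
        by (rule kink_fold_bound[OF sg(2,1) _ _ fold]) (use tangentD(4)[OF v(2) yD(1)] yD p(2) in auto)
      moreover have "vector [(y - p)$1, (y - p)$2 + (y - p)$1] = b - p" using True b1 p(2) by (simp add: vec2_eq)
      ultimately have 2: "det2 w (b - p) \<ge> 0" by simp
      have "det2 w (z - p) \<ge> 0" unfolding zdet using 1 2 l by (intro add_nonneg_nonneg mult_nonneg_nonneg) auto
      hence "w$1 * (z$2 - p$2) \<ge> 0" using z1 p(2) by (simp add: det2_eq)
      thus ?thesis using sg True by (auto simp: zero_le_mult_iff)
    next
      case False
      hence sm: "s = -1" using s by simp
      have sg: "v$1 < 0" "w$1 > 0" using sv wv sm by (auto simp: sgn_if mult_less_0_iff split: if_splits)
      have 1: "det2 v (a - p) \<le> 0" using tangentD(4)[OF v(2) aD(1)] by simp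
      have "det2 v (vector [(y - p)$1, (y - p)$2 - (y - p)$1]) \<le> 0"
        by (rule kink_fold_bound'[OF sg _ _ fold]) (use tangentD(4)[OF w(2) yD(1)] yD p(2) in auto)
      moreover have "vector [(y - p)$1, (y - p)$2 - (y - p)$1] = b - p" using sm b1 p(2) by (simp add: vec2_eq)
      ultimately have 2: "det2 v (b - p) \<le> 0" by simp
      have "det2 v (z - p) \<le> 0" unfolding zdet using 1 2 l by (intro add_nonpos_nonpos mult_nonneg_nonpos) auto
      hence "v$1 * (z$2 - p$2) \<le> 0" using z1 p(2) by (simp add: det2_eq)
      thus ?thesis using sg sm by (auto simp: mult_le_0_iff)
    qed
    \<comment> \<open>At the opposite end the shear moves the right half further inside, so the old
      support line still works.\<close>
    have lo: "s * q$2 \<le> s * z$2"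
    proof -
      have 1: "det2 u (a - q) \<le> 0" "det2 u (y - q) \<le> 0" using tangentD(4)[OF u(2) aD(1)] tangentD(4)[OF u(2) yD(1)] by auto
      have "u$1 * s \<le> 0" using su s by (auto simp: sgn_if split: if_splits)
      moreover have "det2 u (b - q) = det2 u (y - q) + u$1 * s * (y$1 - x0)" 
        by (simp only: det2_eq b1 vector_minus_component) (simp add: algebra_simps)
      ultimately have 2: "det2 u (b - q) \<le> 0" using 1 yD by (simp add: add_nonpos_nonpos mult_nonpos_nonneg)
      have "det2 u (z - q) \<le> 0" unfolding zdet using 1 2 l by (intro add_nonpos_nonpos mult_nonneg_nonpos) auto
      hence "u$1 * (z$2 - q$2) \<le> 0" using z1 q(2) by (simp add: det2_eq)
      thus ?thesis using su s u1 by (auto simp: mult_le_0_iff sgn_if split: if_splits)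
    qed
    have "z \<in> ?D" by (rule vertical_between[OF r(3) _ _ _ _ lo up s]) (use p q z1 in \<open>auto simp: vtop_def\<close>)
    hence zA: "z \<in> A" "z \<in> B" unfolding A_def B_def using z1 by auto
    have "?\<tau> z = z" using z1 by (simp add: vec2_eq)
    hence zB: "z \<in> ?\<tau> ` B" using zA(2) by (metis image_eqI)
    have "z \<in> closed_segment a b" unfolding z_def using l by (auto simp: in_segment)
    hence "closed_segment a b = closed_segment a z \<union> closed_segment z b" by (simp add: Un_closed_segment)
    thus ?thesis using closed_segment_subset[OF a zA(1) polytope_imp_convex[OF pA]]
      closed_segment_subset[OF zB b polytope_imp_convex[OF pB]] by blast
  qed
  have conv: "convex (A \<union> ?\<tau> ` B)" unfolding convex_contains_segment
  proof (intro ballI)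
    fix a b assume "a \<in> A \<union> ?\<tau> ` B" "b \<in> A \<union> ?\<tau> ` B"
    thus "closed_segment a b \<subseteq> A \<union> ?\<tau> ` B"
      using seg[of a b] seg[of b a] closed_segment_commute[of a b]
        closed_segment_subset[OF _ _ polytope_imp_convex[OF pA], of a b]
        closed_segment_subset[OF _ _ polytope_imp_convex[OF pB], of a b] by blast
  qed
  obtain SA SB where S: "finite SA" "A = convex hull SA" "finite SB" "?\<tau> ` B = convex hull SB"
    using pA pB unfolding polytope_def by metis
  have "convex hull (SA \<union> SB) = convex hull (A \<union> ?\<tau> ` B)" unfolding S(2,4)
    by (rule hull_Un) (simp add: convex_Inter)
  also have "\<dots> = A \<union> ?\<tau> ` B" using conv by (simp add: convex_hull_eq)
  finally have "polytope (A \<union> ?\<tau> ` B)" unfolding polytope_def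
    using S(1,3) by (intro exI[of _ "SA \<union> SB"]) auto
  thus ?thesis using img by simp
qed

lemma is_rep_act:
  assumes "is_rep R" "g \<in> grp (length (marks R))" shows "is_rep (act g R)"
proof -
  let ?m = "length (marks R)"
  note wf = is_repD(7)[OF assms(1)]
  obtain n b e where g: "g = group_elt n b e" "length e = ?m" "set e \<subseteq> {-1, 1}" using grpE[OF assms(2)] .
  \<comment> \<open>The first \<open>k\<close> flips of \<open>e\<close>. The affine part
    \<open>n\<close>, \<open>b\<close> is applied at stage 0 and every later stage is a pure
    flip.\<close>
  define E where "E k = take k e @ replicate (?m - k) 1" for k
  have E: "length (E k) = ?m" "set (E k) \<subseteq> {-1, 1}" if "k \<le> ?m" for k
    using that g set_take_subset[of k e] unfolding E_def by (auto simp: set_replicate_conv_if)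
  have "is_rep (act (group_elt n b (E k)) R)" if "k \<le> ?m" for k using that
  proof (induction k)
    case 0
    have "act_map (group_elt n b (E 0)) R = vshear (\<lambda>x. of_int n * x + b)"
      unfolding act_map_group_elt by (simp add: flip_exponent_def E_def)
    hence "polytope (pgon (act (group_elt n b (E 0)) R))" using polytope_affine_vshear is_repD(2)[OF assms(1)] by simp
    thus ?case using is_rep_act_polytope[OF assms(1)] E[of 0] by (simp add: group_elt_grp)
  next
    case (Suc k)
    hence k: "k < ?m" by simp
    let ?R = "act (group_elt n b (E k)) R"
    have IH: "is_rep ?R" using Suc by simp
    define f where "f = (replicate ?m 1)[k := e ! k]"
    have ek: "e ! k = 1 \<or> e ! k = -1" using pm1_nth g k by metis
    have f: "length f = ?m" "set f \<subseteq> {-1, 1}" unfolding f_def using ek set_update_subset_insert[of "replicate ?m 1" k "e ! k"]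
      by (auto simp: set_replicate_conv_if split: if_splits)
    have mE: "map2 (*) f (E k) = E (Suc k)"
    proof (rule nth_equalityI)
      show "length (map2 (*) f (E k)) = length (E (Suc k))" using f E k by simp
      fix i assume "i < length (map2 (*) f (E k))"
      hence i: "i < ?m" using f E k by simp
      have "f ! i = (if i = k then e ! k else 1)" using i unfolding f_def by (auto simp: nth_list_update)
      thus "map2 (*) f (E k) ! i = E (Suc k) ! i" using i k g f E[of k]
        by (auto simp: E_def nth_append less_Suc_eq)
    qed
    have comp: "act (group_elt 0 0 f) ?R = act (group_elt n b (E (Suc k))) R"
      using act_group_elt_group_elt(2)[OF wf E(1,2) f, of k 0 0 n b] k mE by simp
    have gf: "group_elt 0 0 f \<in> grp (length (marks ?R))" using f by (simp add: group_elt_grp)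
    have "polytope (pgon (act (group_elt 0 0 f) ?R))"
    proof (cases "e ! k = 1")
      case True
      have "f = replicate ?m 1" unfolding f_def using True k by (simp add: list_update_same_conv)
      hence "act_map (group_elt 0 0 f) ?R = id" using act_unit(2)[OF is_repD(7)[OF IH]] by simp
      thus ?thesis using is_repD(2)[OF IH] by simp
    next
      case False
      have fl: "flip_exponent ?R f i = (if i = k then signs ?R ! k else 0)" if "i < ?m" for i
        using that ek False unfolding flip_exponent_def f_def by (auto simp: nth_list_update)
      have "act_map (group_elt 0 0 f) ?R = vshear (\<lambda>x. of_int (signs ?R ! k) * max 0 (x - marks ?R ! k $ 1))"
        unfolding act_map_group_elt
      proof (intro arg_cong[of _ _ vshear] ext)
        fix x
        have "(\<Sum>i<length (marks ?R). of_int (flip_exponent ?R f i) * max 0 (x - marks ?R ! i $ 1)) =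
          (\<Sum>i<length (marks ?R). if i = k then of_int (signs ?R ! k) * max 0 (x - marks ?R ! k $ 1) else 0)"
          using fl by (intro sum.cong) auto
        also have "\<dots> = of_int (signs ?R ! k) * max 0 (x - marks ?R ! k $ 1)" using k by simp
        finally show "real_of_int 0 * x + 0 + (\<Sum>i<length (marks ?R). of_int (flip_exponent ?R f i) * max 0 (x - marks ?R ! i $ 1))
          = of_int (signs ?R ! k) * max 0 (x - marks ?R ! k $ 1)" by simp
      qed
      moreover have "polytope (vshear (\<lambda>x. of_int (signs ?R ! k) * max 0 (x - marks ?R ! k $ 1)) ` pgon ?R)"
        by (rule polytope_single_flip[OF IH _ refl refl]) (use k in simp)
      ultimately show ?thesis by simp
    qed
    hence "is_rep (act (group_elt 0 0 f) ?R)" by (rule is_rep_act_polytope[OF IH gf])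
    thus ?case using comp by simp
  qed
  moreover have "E ?m = e" using g unfolding E_def by simp
  ultimately show ?thesis using g(1) by (metis order_refl)
qed

lemma rep_dirs:
  assumes "is_rep R" "p \<in> frontier (pgon R)"
  obtains v w where "primitive_vec v" "tangent 1 (pgon R) p v" "primitive_vec w" "tangent (-1) (pgon R) p w"
  using primitive_tangent_exists[OF is_repD(1)[OF assms(1)] assms(2)] that by metis

lemma true_corner_iff_defect:
  assumes "is_rep R" "primitive_vec v" "tangent 1 (pgon R) p v" "primitive_vec w" "tangent (-1) (pgon R) p w"
  shows "true_corner R p \<longleftrightarrow> defect R p w v = 1"
  using rep_conditions_iff_defect(2)[OF is_repD(1,7,8)[OF assms(1)] tangent_frontier[OF assms(3)]] assms by simp

lemma true_corner_extreme: "true_corner R p \<Longrightarrow> p extreme_point_of pgon R"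
  by (auto simp: true_corner_def hidden_corner_def delzant_corner_def)

lemma true_corner_frontier: "is_rep R \<Longrightarrow> true_corner R p \<Longrightarrow> p \<in> frontier (pgon R)"
  using true_corner_extreme extreme_frontier is_repD(4) by blast

lemma frontier_act:
  assumes "is_rep R" "g \<in> grp (length (marks R))"
  shows "frontier (pgon (act g R)) = act_map g R ` frontier (pgon R)"
  using is_repD(5)[OF assms(1)] by (simp add: act_map_vshear[OF assms(2)] frontier_vshear_image continuous_act_shift[OF assms(2)])

lemma true_corner_act:
  assumes "is_rep R" "g \<in> grp (length (marks R))"
  shows "true_corner (act g R) (act_map g R p) \<longleftrightarrow> true_corner R p"
proof (cases "p \<in> frontier (pgon R)")
  case True
  note r = is_repD[OF assms(1)]
  have R': "is_rep (act g R)" by (rule is_rep_act[OF assms])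
  obtain v w where vw: "primitive_vec v" "tangent 1 (pgon R) p v" "primitive_vec w" "tangent (-1) (pgon R) p w"
    using rep_dirs[OF assms(1) True] .
  obtain c where c: "\<And>q u r. q$1 = p$1 \<Longrightarrow> r = 1 \<or> r = -1 \<Longrightarrow> tangent r (pgon R) q u \<Longrightarrow>
     tangent r (pgon (act g R)) (act_map g R q) (sheared_dir c (net_flip R (snd g) (p$1)) u)"
    using tangent_act[OF r(3) assms(2) is_repD(3)[OF R'], where ?x0.0 = "p$1"] by blast
  show ?thesis
    using true_corner_iff_defect[OF assms(1) vw]
      true_corner_iff_defect[OF R' primitive_sheared_dir[OF vw(1)] c[OF refl _ vw(2)] primitive_sheared_dir[OF vw(3)] c[OF refl _ vw(4)]]
      defect_act[OF r(7,8) assms(2) vw(2,4) refl, of c] by simp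
next
  case False
  have "act_map g R p \<notin> frontier (pgon (act g R))"
    unfolding frontier_act[OF assms] using False by (auto simp: act_map_vshear[OF assms(2)])
  thus ?thesis using False true_corner_frontier assms is_rep_act by blast
qed

section \<open>From a vertex to the next true corner\<close>

lemma nchainI:
  assumes "\<And>k. Suc k < length vs \<Longrightarrow> \<exists>t>0. \<exists>u. primitive_vec u \<and> u$1 = n \<and> vs ! Suc k - vs ! k = t *\<^sub>R u"
  shows "nchain n vs"
  using assms
proof (induction n vs rule: nchain.induct)
  case (1 n a b vs)
  have "\<exists>t>0. \<exists>u. primitive_vec u \<and> u$1 = n \<and> b - a = t *\<^sub>R u" using 1(2)[of 0] by simp
  moreover have "nchain n (b # vs)"
  proof (rule 1(1))
    fix k assume "Suc k < length (b # vs)"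
    thus "\<exists>t>0. \<exists>u. primitive_vec u \<and> u$1 = n \<and> (b # vs) ! Suc k - (b # vs) ! k = t *\<^sub>R u" using 1(2)[of "Suc k"] by simp
  qed
  ultimately show ?case by simp
qed auto

lemma chain_set_nth: "q \<in> chain_set vs \<longleftrightarrow> (\<exists>k. Suc k < length vs \<and> q \<in> closed_segment (vs ! k) (vs ! Suc k))"
proof (induction vs rule: chain_set.induct)
  case (1 a b vs)
  have "(\<exists>k. Suc k < length (a # b # vs) \<and> q \<in> closed_segment ((a # b # vs) ! k) ((a # b # vs) ! Suc k)) \<longleftrightarrow>
    q \<in> closed_segment a b \<or> (\<exists>k. Suc k < length (b # vs) \<and> q \<in> closed_segment ((b # vs) ! k) ((b # vs) ! Suc k))"
    (is "(\<exists>k. ?P k) \<longleftrightarrow> _ \<or> (\<exists>k. ?Q k)")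
  proof -
    have "?P 0 \<longleftrightarrow> q \<in> closed_segment a b" "\<And>k. ?P (Suc k) \<longleftrightarrow> ?Q k" by auto
    thus ?thesis by (metis not0_implies_Suc)
  qed
  thus ?case using 1 by simp
qed auto

text \<open>At a vertex that is not a true corner the defect is 0, so a power of T makes the
  outgoing direction parallel to the incoming one. Both are primitive and T fixes first components;
  the positive determinant excludes a reversal and shows that a cut ends here.\<close>

lemma fake_step:
  assumes "is_rep R" "z extreme_point_of pgon R" "primitive_vec v" "tangent 1 (pgon R) z v"
    "\<not> true_corner R (cw_next (pgon R) z)" "primitive_vec v'" "tangent 1 (pgon R) (cw_next (pgon R) z) v'"
  shows "v'$1 = v$1" "v$1 \<noteq> 0" "ncuts R (cw_next (pgon R) z) \<ge> 1"
proof -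
  note r = is_repD[OF assms(1)]
  let ?z = "cw_next (pgon R) z" and ?n = "ncuts R (cw_next (pgon R) z)"
  obtain s where z: "?z extreme_point_of pgon R" "tangent (-1) (pgon R) ?z (- v)"
    using cw_next_tangent[OF r(2,4) assms(2,4)] by metis
  have "defect R ?z (- v) v' \<in> {0, 1}"
    using assms(1) tangent_frontier[OF assms(7)] assms(3,6,7) z(2) primitive_vec_uminus unfolding is_rep_iff_defect by simp
  hence d0: "defect R ?z (- v) v' = 0"
    using true_corner_iff_defect[OF assms(1,6,7) primitive_vec_uminus[OF assms(3)] z(2)] assms(5) by auto
  have "det2 (- v) v' > 0" using extreme_iff_det[OF r(3,4) assms(7) z(2)] z(1) by blast
  hence pos: "real ?n * (v$1 * v'$1) > 0" using d0 unfolding defect_def det2_Tpow by (simp add: mult.assoc)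
  hence vv: "v$1 * v'$1 > 0" by (simp add: zero_less_mult_iff)
  show "?n \<ge> 1" using pos by (cases ?n) auto
  show "v$1 \<noteq> 0" using vv by auto
  have T: "Tpow ?n v' = vector [v'$1, v'$2 + of_int (int ?n) * v'$1]" by (simp add: Tpow_apply)
  have "primitive_vec (Tpow ?n v')" unfolding T by (rule primitive_vec_shear[OF assms(6)])
  hence "Tpow ?n v' = - v \<or> Tpow ?n v' = - (- v)"
    using primitive_vec_parallel[OF primitive_vec_uminus[OF assms(3)]] d0 unfolding defect_def by blast
  hence "v'$1 = - v$1 \<or> v'$1 = v$1" by (auto simp: vec2_eq Tpow_apply)
  thus "v'$1 = v$1" using vv by (auto simp: zero_less_mult_iff)
qed

lemma vertices_step:
  assumes "is_rep R" "p extreme_point_of pgon R" "primitive_vec v" "tangent 1 (pgon R) p v"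
    "\<And>j. 0 < j \<Longrightarrow> j \<le> k \<Longrightarrow> \<not> true_corner R ((cw_next (pgon R) ^^ j) p)"
  shows "(cw_next (pgon R) ^^ k) p extreme_point_of pgon R \<and>
    (\<exists>u. primitive_vec u \<and> u$1 = v$1 \<and> tangent 1 (pgon R) ((cw_next (pgon R) ^^ k) p) u)"
  using assms(5)
proof (induction k)
  case 0 thus ?case using assms by auto
next
  case (Suc k)
  note r = is_repD[OF assms(1)]
  let ?z = "(cw_next (pgon R) ^^ k) p"
  obtain u where u: "?z extreme_point_of pgon R" "primitive_vec u" "u$1 = v$1" "tangent 1 (pgon R) ?z u" using Suc by auto
  have z: "cw_next (pgon R) ?z extreme_point_of pgon R" using cw_next_tangent[OF r(2,4) u(1,4)] by metis
  obtain u' where u': "primitive_vec u'" "tangent 1 (pgon R) (cw_next (pgon R) ?z) u'"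
    using rep_dirs[OF assms(1) extreme_frontier[OF r(4) z]] by metis
  have "\<not> true_corner R (cw_next (pgon R) ?z)" using Suc.prems[of "Suc k"] by simp
  hence "u'$1 = u$1" using fake_step[OF assms(1) u(1,2,4) _ u'] by blast
  thus ?case using u u' z by auto
qed

text \<open>Otherwise the first component of the direction would be constant and nonzero along all
  successors, and their first coordinates would be strictly monotone forever, against the finiteness
  of the vertex set.\<close>

lemma steps_exist:
  assumes "is_rep R" "p extreme_point_of pgon R"
  shows "\<exists>n\<ge>1. true_corner R ((cw_next (pgon R) ^^ n) p)"
proof (rule ccontr)
  assume no: "\<not> (\<exists>n\<ge>1. true_corner R ((cw_next (pgon R) ^^ n) p))"
  note r = is_repD[OF assms(1)]
  let ?z = "\<lambda>k. (cw_next (pgon R) ^^ k) p"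
  obtain v where v: "primitive_vec v" "tangent 1 (pgon R) p v" using rep_dirs[OF assms(1) extreme_frontier[OF r(4) assms(2)]] by metis
  have nt: "\<not> true_corner R (?z j)" if "0 < j" for j using no that by (metis One_nat_def Suc_leI)
  have st: "?z k extreme_point_of pgon R \<and> (\<exists>u. primitive_vec u \<and> u$1 = v$1 \<and> tangent 1 (pgon R) (?z k) u)" for k
    using vertices_step[OF assms v] nt by blast
  have "?z 1 extreme_point_of pgon R" "\<exists>u. primitive_vec u \<and> u$1 = v$1 \<and> tangent 1 (pgon R) (?z 1) u" using st[of 1] by auto
  then obtain u1 where "primitive_vec u1" "tangent 1 (pgon R) (cw_next (pgon R) p) u1" by auto
  hence v1: "v$1 \<noteq> 0" using fake_step[OF assms v] nt[of 1] by simp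
  have inc: "?z k $ 1 * v$1 < ?z (Suc k) $ 1 * v$1" for k
  proof -
    obtain u where u: "primitive_vec u" "u$1 = v$1" "tangent 1 (pgon R) (?z k) u" using st by blast
    obtain s where s: "s > 0" "cw_next (pgon R) (?z k) = ?z k + s *\<^sub>R u" using cw_next_tangent[OF r(2,4) _ u(3)] st by metis
    have "?z (Suc k) $ 1 * v$1 = ?z k $ 1 * v$1 + s * (v$1 * v$1)" using s(2) u(2) by (simp add: algebra_simps)
    moreover have "v$1 * v$1 > 0" using v1 by (auto simp: zero_less_mult_iff linorder_neq_iff)
    ultimately show ?thesis using s(1) by simp
  qed
  have "strict_mono (\<lambda>k. ?z k $ 1 * v$1)" by (rule strict_mono_Suc_iff[THEN iffD2]) (use inc in blast)
  hence "inj (\<lambda>k. ?z k $ 1 * v$1)" by (rule strict_mono_imp_inj_on)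
  hence "inj ?z" by (auto simp: inj_def)
  moreover have "range ?z \<subseteq> {x. x extreme_point_of pgon R}" using st by auto
  moreover have "finite {x. x extreme_point_of pgon R}"
    using finite_polyhedron_extreme_points polytope_imp_polyhedron r(2) by blast
  ultimately show False using finite_subset range_inj_infinite by blast
qed

section \<open>Semitoric edges\<close>

definition next_corner :: "srep \<Rightarrow> real^2 \<Rightarrow> real^2" where
  "next_corner R p = (cw_next (pgon R) ^^ steps_to_corner R p) p"

definition edge_chain :: "srep \<Rightarrow> real^2 \<Rightarrow> (real^2) list" where
  "edge_chain R p = map (\<lambda>n. (cw_next (pgon R) ^^ n) p) [0..<Suc (steps_to_corner R p)]"

lemma steps_to_corner_props:
  assumes "is_rep R" "p extreme_point_of pgon R"
  shows "steps_to_corner R p \<ge> 1" "true_corner R (next_corner R p)"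
    "\<And>j. 0 < j \<Longrightarrow> j < steps_to_corner R p \<Longrightarrow> \<not> true_corner R ((cw_next (pgon R) ^^ j) p)"
proof -
  have "steps_to_corner R p \<ge> 1 \<and> true_corner R (next_corner R p)" unfolding steps_to_corner_def next_corner_def
    by (rule LeastI_ex) (use steps_exist[OF assms] in blast)
  thus "steps_to_corner R p \<ge> 1" "true_corner R (next_corner R p)" by auto
  show "\<not> true_corner R ((cw_next (pgon R) ^^ j) p)" if "0 < j" "j < steps_to_corner R p" for j
    using not_less_Least[of j "\<lambda>n. n \<ge> 1 \<and> true_corner R ((cw_next (pgon R) ^^ n) p)"] that
    unfolding steps_to_corner_def by auto
qed

text \<open>
  What the argument needs to know about a semitoric edge seen from one of its ends: both
  \<open>edge_chain R p\<close> and the reverse of the chain ending at \<open>p\<close> are of this kind.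
\<close>

definition emanates :: "srep \<Rightarrow> real^2 \<Rightarrow> real \<Rightarrow> real^2 \<Rightarrow> (real^2) list \<Rightarrow> bool" where
  "emanates R p r u C \<longleftrightarrow> primitive_vec u \<and> tangent r (pgon R) p u \<and> length C \<ge> 2 \<and> C ! 0 = p \<and>
     (\<exists>t>0. C ! 1 = p + t *\<^sub>R u \<and> C ! 1 \<in> pgon R \<and> (\<forall>s. p + s *\<^sub>R u \<in> pgon R \<longrightarrow> 0 \<le> s \<and> s \<le> t)) \<and>
     (length C > 2 \<longrightarrow> ncuts R (C ! 1) \<ge> 1) \<and>
     (u$1 \<noteq> 0 \<longrightarrow> nchain (u$1) C \<and> (\<forall>q\<in>chain_set C. vtop (r * sgn (u$1)) (pgon R) q)) \<and>
     (u$1 = 0 \<longrightarrow> length C = 2)"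

text \<open>All vertices strictly between the ends are fake, so \<open>fake_step\<close> applies at
  each: the first component of the direction never changes, and a vertical edge has no such vertex
  and is a single segment.\<close>

lemma edge_chain_props:
  assumes "is_rep R" "p extreme_point_of pgon R" "primitive_vec v" "tangent 1 (pgon R) p v"
  shows "emanates R p 1 v (edge_chain R p)"
    "\<exists>w. w$1 = - v$1 \<and> emanates R (next_corner R p) (-1) w (rev (edge_chain R p))"
    "\<And>q. q \<in> chain_set (edge_chain R p) \<Longrightarrow> true_corner R q \<Longrightarrow> q = p \<or> q = next_corner R p"
    "last (edge_chain R p) = next_corner R p"
proof -
  note r = is_repD[OF assms(1)]
  let ?D = "pgon R" and ?z = "\<lambda>k. (cw_next (pgon R) ^^ k) p" and ?C = "edge_chain R p"
  define N where "N = steps_to_corner R p"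
  note st = steps_to_corner_props[OF assms(1,2), folded N_def]
  have len: "length ?C = Suc N" unfolding edge_chain_def N_def by simp
  have nth: "?C ! k = ?z k" if "k \<le> N" for k unfolding edge_chain_def N_def[symmetric] using that by (auto simp: nth_append)
  have dir: "\<exists>u s. primitive_vec u \<and> u$1 = v$1 \<and> tangent 1 ?D (?z k) u \<and> s > 0 \<and> ?z (Suc k) = ?z k + s *\<^sub>R u \<and>
      (\<forall>t. ?z k + t *\<^sub>R u \<in> ?D \<longrightarrow> 0 \<le> t \<and> t \<le> s) \<and> tangent (-1) ?D (?z (Suc k)) (- u) \<and>
      closed_segment (?z k) (?z (Suc k)) \<subseteq> ?D \<and> ?z k extreme_point_of ?D" if "k < N" for k
  proof -
    obtain u where u: "?z k extreme_point_of ?D" "primitive_vec u" "u$1 = v$1" "tangent 1 ?D (?z k) u"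
    proof -
      have "\<And>j. 0 < j \<Longrightarrow> j \<le> k \<Longrightarrow> \<not> true_corner R (?z j)" using st(3) \<open>k < N\<close> by auto
      from vertices_step[OF assms this] show ?thesis using that by blast
    qed
    have Sk: "?z (Suc k) = cw_next ?D (?z k)" by simp
    show ?thesis unfolding Sk
    proof (rule cw_next_tangent[OF r(2,4) u(1,4)])
      fix s assume s: "s > 0" "cw_next ?D (?z k) = ?z k + s *\<^sub>R u" "\<And>t. ?z k + t *\<^sub>R u \<in> ?D \<Longrightarrow> 0 \<le> t \<and> t \<le> s"
        "cw_next ?D (?z k) extreme_point_of ?D"
        "tangent (-1) ?D (cw_next ?D (?z k)) (- u)" "closed_segment (?z k) (cw_next ?D (?z k)) \<subseteq> ?D"
      show "\<exists>u s. primitive_vec u \<and> u$1 = v$1 \<and> tangent 1 ?D (?z k) u \<and> s > 0 \<and> cw_next ?D (?z k) = ?z k + s *\<^sub>R u \<and>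
        (\<forall>t. ?z k + t *\<^sub>R u \<in> ?D \<longrightarrow> 0 \<le> t \<and> t \<le> s) \<and> tangent (-1) ?D (cw_next ?D (?z k)) (- u) \<and>
        closed_segment (?z k) (cw_next ?D (?z k)) \<subseteq> ?D \<and> ?z k extreme_point_of ?D"
        by (intro exI[of _ u] exI[of _ s] conjI allI impI s u) (use s(3) in auto)
    qed
  qed
  have ncut: "ncuts R (?z k) \<ge> 1 \<and> v$1 \<noteq> 0" if k0: "0 < k" "k < N" for k
  proof -
    obtain j where j: "k = Suc j" using k0(1) by (cases k) auto
    obtain u s where u: "primitive_vec u" "u$1 = v$1" "tangent 1 ?D (?z j) u" "?z j extreme_point_of ?D" using dir[of j] k0 j by auto
    obtain u' where u': "primitive_vec u'" "tangent 1 ?D (?z k) u'" using dir[OF k0(2)] by blast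
    show ?thesis using fake_step[OF assms(1) u(4,1,3) _ u'(1)] u' st(3)[OF k0] u(2) j by simp
  qed
  have nch: "nchain (v$1) ?C"
  proof (rule nchainI)
    fix k assume "Suc k < length ?C"
    hence k: "k < N" using len by simp
    obtain u s where u: "primitive_vec u" "u$1 = v$1" "s > 0" "?z (Suc k) = ?z k + s *\<^sub>R u" using dir[OF k] by auto
    thus "\<exists>t>0. \<exists>u. primitive_vec u \<and> u$1 = v$1 \<and> ?C ! Suc k - ?C ! k = t *\<^sub>R u"
      using nth[of k] nth[of "Suc k"] k by (intro exI[of _ s] conjI exI[of _ u]) auto
  qed
  have vt: "vtop (sgn (v$1)) ?D q" if qC: "q \<in> chain_set ?C" "v$1 \<noteq> 0" for q
  proof -
    obtain k where k: "Suc k < length ?C" "q \<in> closed_segment (?C ! k) (?C ! Suc k)" using qC(1) chain_set_nth by blast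
    hence k': "k < N" using len by simp
    obtain u s where u: "primitive_vec u" "u$1 = v$1" "tangent 1 ?D (?z k) u" "s > 0" "?z (Suc k) = ?z k + s *\<^sub>R u"
      "closed_segment (?z k) (?z (Suc k)) \<subseteq> ?D" using dir[OF k'] by auto
    have q: "q \<in> closed_segment (?z k) (?z (Suc k))" using k(2) nth[of k] nth[of "Suc k"] k' by simp
    then obtain l where "q = (1 - l) *\<^sub>R ?z k + l *\<^sub>R ?z (Suc k)" by (auto simp: in_segment)
    hence "q = ?z k + (l * s) *\<^sub>R u" unfolding u(5) by (simp add: algebra_simps)
    thus ?thesis using tangent_vtop[OF u(3), of "l * s"] u(2) qC(2) q u(6) by auto
  qed
  have lenC: "length ?C \<ge> 2" using len st(1) by simp
  show "emanates R p 1 v ?C" unfolding emanates_def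
  proof (intro conjI impI ballI)
    obtain u s where u: "primitive_vec u" "u$1 = v$1" "tangent 1 ?D p u" "s > 0" "?z 1 = p + s *\<^sub>R u"
      "\<forall>t. p + t *\<^sub>R u \<in> ?D \<longrightarrow> 0 \<le> t \<and> t \<le> s" "closed_segment p (?z 1) \<subseteq> ?D" using dir[of 0] st(1) by auto
    have "u = v" by (rule tangent_primitive_unique[OF assms(4) u(3) _ r(4) assms(3) u(1)]) simp
    thus "\<exists>t>0. ?C ! 1 = p + t *\<^sub>R v \<and> ?C ! 1 \<in> ?D \<and> (\<forall>s. p + s *\<^sub>R v \<in> ?D \<longrightarrow> 0 \<le> s \<and> s \<le> t)"
      using u nth[of 1] st(1) subsetD[OF u(7) ends_in_segment(2)] by (intro exI[of _ s]) simp
    show "?C ! 0 = p" using nth[of 0] by simp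
    show "ncuts R (?C ! 1) \<ge> 1" if "length ?C > 2" using ncut[of 1] nth[of 1] that len st(1) by simp
    show "length ?C = 2" if "v$1 = 0" using ncut[of 1] that len st(1) by (cases "N = 1") auto
  qed (use assms lenC nch vt in auto)
  show last: "last ?C = next_corner R p" unfolding next_corner_def N_def[symmetric]
    using nth[of N] len by (metis last_conv_nth diff_Suc_1 length_0_conv nat.distinct(1) order_refl)
  show "q = p \<or> q = next_corner R p" if q: "q \<in> chain_set ?C" "true_corner R q" for q
  proof -
    obtain k where k: "Suc k < length ?C" "q \<in> closed_segment (?C ! k) (?C ! Suc k)" using q(1) chain_set_nth by blast
    hence k': "k < N" using len by simp
    obtain u s where u: "closed_segment (?z k) (?z (Suc k)) \<subseteq> ?D" using dir[OF k'] by auto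
    have qs: "q \<in> closed_segment (?z k) (?z (Suc k))" using k(2) nth[of k] nth[of "Suc k"] k' by simp
    have "q extreme_point_of closed_segment (?z k) (?z (Suc k))"
      using true_corner_extreme[OF q(2)] qs u by (auto simp: extreme_point_of_def)
    hence "q = ?z k \<or> q = ?z (Suc k)" by (simp add: extreme_point_of_segment)
    then obtain j where j: "j \<le> N" "q = ?z j" using k' by (metis Suc_leI less_imp_le)
    hence "j = 0 \<or> j = N" using st(3)[of j] q(2) by fastforce
    thus ?thesis using j(2) unfolding next_corner_def N_def[symmetric] by auto
  qed
  obtain M where M: "N = Suc M" using st(1) by (cases N) auto
  obtain u s where u: "primitive_vec u" "u$1 = v$1" "s > 0" "?z N = ?z M + s *\<^sub>R u" "tangent (-1) ?D (?z N) (- u)"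
     "?z M extreme_point_of ?D" "tangent 1 ?D (?z M) u" "\<forall>t. ?z M + t *\<^sub>R u \<in> ?D \<longrightarrow> 0 \<le> t \<and> t \<le> s" using dir[of M] M by auto
  have zN: "next_corner R p = ?z N" by (simp add: next_corner_def N_def)
  have rnth: "rev ?C ! 0 = ?z N" "rev ?C ! 1 = ?z M" using len nth[of N] nth[of M] M by (simp_all add: rev_nth)
  have "emanates R (next_corner R p) (-1) (- u) (rev ?C)" unfolding emanates_def zN
  proof (intro conjI impI ballI)
    have "0 \<le> t \<and> t \<le> s" if "?z N + t *\<^sub>R - u \<in> ?D" for t
    proof -
      have e: "?z N + t *\<^sub>R - u = ?z M + (s - t) *\<^sub>R u" using u(4) by (simp add: algebra_simps)
      have "0 \<le> s - t \<and> s - t \<le> s" using u(8) that unfolding e by blast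
      thus ?thesis by simp
    qed
    thus "\<exists>t>0. rev ?C ! 1 = ?z N + t *\<^sub>R - u \<and> rev ?C ! 1 \<in> ?D \<and> (\<forall>s. ?z N + s *\<^sub>R - u \<in> ?D \<longrightarrow> 0 \<le> s \<and> s \<le> t)"
      using u(3,4,6) rnth by (intro exI[of _ s]) (auto simp: extreme_point_of_def)
    show "primitive_vec (- u)" by (rule primitive_vec_uminus[OF u(1)])
    show "ncuts R (rev ?C ! 1) \<ge> 1" if "length (rev ?C) > 2" using that len M ncut[of M] rnth by simp
    show "nchain ((- u)$1) (rev ?C)" using nchain_rev[OF nch] u(2) by simp
    show "length (rev ?C) = 2" if "(- u)$1 = 0" using ncut[of 1] that u(2) len st(1) by (cases "N = 1") auto
    show "vtop (- 1 * sgn ((- u)$1)) ?D q" if "(- u)$1 \<noteq> 0" "q \<in> chain_set (rev ?C)" for q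
      using vt[of q] that u(2) by (simp add: chain_set_rev sgn_minus)
  qed (use u rnth lenC in auto)
  thus "\<exists>w. w$1 = - v$1 \<and> emanates R (next_corner R p) (-1) w (rev ?C)" using u(2) by (intro exI[of _ "- u"]) simp
qed

lemma emanatesD:
  assumes "emanates R p r u C"
  shows "primitive_vec u" "tangent r (pgon R) p u" "length C \<ge> 2" "C ! 0 = p" "hd C = p" "C \<noteq> []"
    "u$1 \<noteq> 0 \<Longrightarrow> nchain (u$1) C" "\<And>q. u$1 \<noteq> 0 \<Longrightarrow> q \<in> chain_set C \<Longrightarrow> vtop (r * sgn (u$1)) (pgon R) q"
    "u$1 = 0 \<Longrightarrow> C = [p, C ! 1]"
proof -
  show "primitive_vec u" "tangent r (pgon R) p u" and l: "length C \<ge> 2" and p: "C ! 0 = p"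
    "u$1 \<noteq> 0 \<Longrightarrow> nchain (u$1) C" "\<And>q. u$1 \<noteq> 0 \<Longrightarrow> q \<in> chain_set C \<Longrightarrow> vtop (r * sgn (u$1)) (pgon R) q"
    using assms unfolding emanates_def by auto
  show "C \<noteq> []" using l by auto
  thus "hd C = p" using p by (simp add: hd_conv_nth)
  assume "u$1 = 0"
  hence "length C = 2" using assms unfolding emanates_def by auto
  then obtain a b where "C = [a, b]" by (auto simp: length_Suc_conv numeral_2_eq_2)
  thus "C = [p, C ! 1]" using p by simp
qed

lemma emanates_first_edge:
  assumes "emanates R p r u C"
  obtains t where "t > 0" "C ! 1 = p + t *\<^sub>R u" "p + t *\<^sub>R u \<in> pgon R"
    "\<And>s. p + s *\<^sub>R u \<in> pgon R \<Longrightarrow> 0 \<le> s \<and> s \<le> t"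
  using assms unfolding emanates_def by fastforce

lemma sl2_length_ray:
  assumes "primitive_vec u" "t \<ge> 0" shows "sl2_length p (p + t *\<^sub>R u) = t"
  by (rule sl2_length_eq[OF assms]) simp

text \<open>The vertical case, where first coordinates carry no information and points are
  parametrised by the ray instead.\<close>

definition single_edge :: "(real^2) set \<Rightarrow> real^2 \<Rightarrow> real^2 \<Rightarrow> (real^2) list \<Rightarrow> real \<Rightarrow> bool" where
  "single_edge D p u C L \<longleftrightarrow> L > 0 \<and> C = [p, p + L *\<^sub>R u] \<and> chain_length C = L \<and> p + L *\<^sub>R u \<in> D \<and>
    (\<forall>q. q \<in> chain_set C \<longleftrightarrow> (\<exists>s. 0 \<le> s \<and> s \<le> L \<and> q = p + s *\<^sub>R u)) \<and>
    (\<forall>s. 0 \<le> s \<longrightarrow> s \<le> L \<longrightarrow> path_length_to C (p + s *\<^sub>R u) = s) \<and>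
    (\<forall>s. p + s *\<^sub>R u \<in> D \<longrightarrow> 0 \<le> s \<and> s \<le> L)"

lemma single_edgeD:
  assumes "single_edge D p u C L"
  shows "L > 0" "C = [p, p + L *\<^sub>R u]" "chain_length C = L" "p + L *\<^sub>R u \<in> D"
    "\<And>q. q \<in> chain_set C \<longleftrightarrow> (\<exists>s. 0 \<le> s \<and> s \<le> L \<and> q = p + s *\<^sub>R u)"
    "\<And>s. 0 \<le> s \<Longrightarrow> s \<le> L \<Longrightarrow> path_length_to C (p + s *\<^sub>R u) = s"
    "\<And>s. p + s *\<^sub>R u \<in> D \<Longrightarrow> 0 \<le> s \<and> s \<le> L"
  using assms unfolding single_edge_def by (blast+)

lemma emanates_short:
  assumes "emanates R p r u C" "u$1 = 0"
  shows "\<exists>L. single_edge (pgon R) p u C L"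
proof -
  obtain t where t: "t > 0" "C ! 1 = p + t *\<^sub>R u" "p + t *\<^sub>R u \<in> pgon R"
    "\<And>s. p + s *\<^sub>R u \<in> pgon R \<Longrightarrow> 0 \<le> s \<and> s \<le> t" using emanates_first_edge[OF assms(1)] by metis
  note e = emanatesD[OF assms(1)]
  have C: "C = [p, p + t *\<^sub>R u]" using e(9)[OF assms(2)] t(2) by simp
  have len: "chain_length C = t" unfolding C using sl2_length_ray[OF e(1), of t p] t(1) by simp
  have seg: "q \<in> closed_segment p (p + t *\<^sub>R u) \<longleftrightarrow> (\<exists>s. 0 \<le> s \<and> s \<le> t \<and> q = p + s *\<^sub>R u)" for q
  proof
    assume "q \<in> closed_segment p (p + t *\<^sub>R u)"
    then obtain l where l: "0 \<le> l" "l \<le> 1" "q = (1 - l) *\<^sub>R p + l *\<^sub>R (p + t *\<^sub>R u)" by (auto simp: in_segment)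
    have "q = p + (l * t) *\<^sub>R u" unfolding l(3) by (simp add: algebra_simps)
    thus "\<exists>s. 0 \<le> s \<and> s \<le> t \<and> q = p + s *\<^sub>R u" using l t(1) by (intro exI[of _ "l * t"]) (auto simp: mult_left_le_one_le)
  next
    assume "\<exists>s. 0 \<le> s \<and> s \<le> t \<and> q = p + s *\<^sub>R u"
    then obtain s where s: "0 \<le> s" "s \<le> t" "q = p + s *\<^sub>R u" by blast
    have "q = (1 - s / t) *\<^sub>R p + (s / t) *\<^sub>R (p + t *\<^sub>R u)" unfolding s(3) using t(1) by (simp add: algebra_simps)
    thus "q \<in> closed_segment p (p + t *\<^sub>R u)" using s t(1) by (auto simp: in_segment intro!: exI[of _ "s / t"])
  qed
  have set: "chain_set C = closed_segment p (p + t *\<^sub>R u)" unfolding C by simp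
  have path: "path_length_to C (p + s *\<^sub>R u) = s" if "0 \<le> s" "s \<le> t" for s
  proof -
    have "p + s *\<^sub>R u \<in> closed_segment p (p + t *\<^sub>R u)" using seg that by blast
    thus ?thesis unfolding C using sl2_length_ray[OF e(1) that(1), of p] by simp
  qed
  have "single_edge (pgon R) p u C t" unfolding single_edge_def set
    by (intro conjI allI impI t(1) C len t(3) seg path) (use t(4) in auto)
  thus ?thesis ..
qed

lemma emanates_path:
  assumes "emanates R p r u C" "u$1 \<noteq> 0" "q \<in> chain_set C"
  shows "path_length_to C q = (q$1 - p$1) / u$1"
  using nchain_path[OF assms(2) _ assms(3)] emanatesD(5,7)[OF assms(1)] assms(2) by simp

lemma emanates_length:
  assumes "emanates R p r u C" "u$1 \<noteq> 0"
  shows "chain_length C = (last C$1 - p$1) / u$1"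
  using nchain_length[OF assms(2)] emanatesD(5-7)[OF assms(1)] assms(2) by simp

lemma emanates_path_bounds:
  assumes "emanates R p r u C" "q \<in> chain_set C"
  shows "0 \<le> path_length_to C q \<and> path_length_to C q \<le> chain_length C"
proof (cases "u$1 = 0")
  case True
  obtain t where t0: "single_edge (pgon R) (p) u (C) t" using emanates_short[OF assms(1) True] by blast
  note t = single_edgeD[OF t0]
  obtain s where "0 \<le> s" "s \<le> t" "q = p + s *\<^sub>R u" using t(5) assms(2) by blast
  thus ?thesis using t(3,6) by simp
next
  case False
  have "0 \<le> (q$1 - p$1) / u$1" "0 \<le> (last C$1 - q$1) / u$1"
    using nchain_mono_fst[OF False emanatesD(7)[OF assms(1) False] assms(2)] emanatesD(5)[OF assms(1)] by auto
  moreover have "(last C$1 - p$1) / u$1 = (last C$1 - q$1) / u$1 + (q$1 - p$1) / u$1" by (simp add: diff_divide_distrib)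
  ultimately show ?thesis using emanates_path[OF assms(1) False assms(2)] emanates_length[OF assms(1) False] by simp
qed

lemma emanates_ray:
  assumes "emanates R p r u C" "p + s *\<^sub>R u \<in> pgon R"
  shows "p + s *\<^sub>R u \<in> chain_set C" "path_length_to C (p + s *\<^sub>R u) = s" "0 \<le> s" "s \<le> chain_length C"
proof -
  obtain t where t: "t > 0" "C ! 1 = p + t *\<^sub>R u" "\<And>s. p + s *\<^sub>R u \<in> pgon R \<Longrightarrow> 0 \<le> s \<and> s \<le> t"
    using emanates_first_edge[OF assms(1)] by metis
  note e = emanatesD[OF assms(1)]
  have s: "0 \<le> s" "s \<le> t" using t(3) assms(2) by auto
  obtain c cs where C: "C = p # c # cs" using e(3,4) by (cases C; cases "tl C") auto
  have c: "c = p + t *\<^sub>R u" using t(2) C by simp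
  have "p + s *\<^sub>R u = (1 - s / t) *\<^sub>R p + (s / t) *\<^sub>R c" unfolding c using t(1) by (simp add: algebra_simps)
  hence seg: "p + s *\<^sub>R u \<in> closed_segment p c" using s t(1) by (auto simp: in_segment intro!: exI[of _ "s / t"])
  show 1: "p + s *\<^sub>R u \<in> chain_set C" using seg C by simp
  show 2: "path_length_to C (p + s *\<^sub>R u) = s" using seg C sl2_length_ray[OF e(1) s(1)] by simp
  show "0 \<le> s" by fact
  show "s \<le> chain_length C" using emanates_path_bounds[OF assms(1) 1] 2 by simp
qed

text \<open>A semitoric edge follows its initial ray for as long as that ray stays in the polygon:
  the point of the chain and the point of the ray over the same abscissa are the same end of the
  same slice.\<close>

lemma emanates_point:
  assumes "emanates R p r u C" "r = 1 \<or> r = -1" "q \<in> chain_set C" "path_length_to C q \<le> s" "p + s *\<^sub>R u \<in> pgon R" "convex (pgon R)"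
  shows "q = p + path_length_to C q *\<^sub>R u" "q \<in> pgon R"
proof -
  define a where "a = path_length_to C q"
  have a0: "0 \<le> a" using emanates_path_bounds[OF assms(1,3)] unfolding a_def by simp
  have aD: "p + a *\<^sub>R u \<in> pgon R"
  proof (cases "s = 0")
    case True thus ?thesis using assms(4,5) a0 unfolding a_def by simp
  next
    case False
    hence s: "s > 0" using a0 assms(4) unfolding a_def by simp
    have "p + a *\<^sub>R u = (1 - a / s) *\<^sub>R p + (a / s) *\<^sub>R (p + s *\<^sub>R u)" using s by (simp add: algebra_simps)
    thus ?thesis using convexD_alt[OF assms(6) tangentD(2)[OF emanatesD(2)[OF assms(1)]] assms(5), of "a / s"] a0 s assms(4)
      unfolding a_def by simp
  qed
  have "q = p + a *\<^sub>R u"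
  proof (cases "u$1 = 0")
    case True
    obtain t where t0: "single_edge (pgon R) (p) u (C) t" using emanates_short[OF assms(1) True] by blast
    note t = single_edgeD[OF t0]
    obtain s' where "0 \<le> s'" "s' \<le> t" "q = p + s' *\<^sub>R u" using t(5) assms(3) by blast
    thus ?thesis using t(6) unfolding a_def by simp
  next
    case False
    have "a = (q$1 - p$1) / u$1" unfolding a_def by (rule emanates_path[OF assms(1) False assms(3)])
    hence "q$1 = (p + a *\<^sub>R u)$1" using False by simp
    moreover have "r * sgn (u$1) = 1 \<or> r * sgn (u$1) = -1" using assms(2) False by (auto simp: sgn_if)
    ultimately show ?thesis
      using vtop_unique[OF emanatesD(8)[OF assms(1) False assms(3)]
        emanatesD(8)[OF assms(1) False emanates_ray(1)[OF assms(1) aD]]] by blast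
  qed
  thus "q = p + path_length_to C q *\<^sub>R u" "q \<in> pgon R" using aD unfolding a_def by auto
qed

text \<open>The initial straight segment is either the whole semitoric edge or ends at a fake
  corner, where a cut arrives.\<close>

lemma emanates_max:
  assumes "emanates R p r u C"
  obtains t where "t > 0" "p + t *\<^sub>R u \<in> pgon R" "\<And>s. p + s *\<^sub>R u \<in> pgon R \<Longrightarrow> 0 \<le> s \<and> s \<le> t"
    "t < chain_length C \<Longrightarrow> ncuts R (p + t *\<^sub>R u) \<ge> 1"
proof -
  obtain t where t: "t > 0" "C ! 1 = p + t *\<^sub>R u" "p + t *\<^sub>R u \<in> pgon R" "\<And>s. p + s *\<^sub>R u \<in> pgon R \<Longrightarrow> 0 \<le> s \<and> s \<le> t"
    using emanates_first_edge[OF assms(1)] by metis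
  note e = emanatesD[OF assms(1)]
  obtain c cs where C: "C = p # c # cs" using e(3,4) by (cases C; cases "tl C") auto
  have c: "c = p + t *\<^sub>R u" using t(2) C by simp
  have "ncuts R (p + t *\<^sub>R u) \<ge> 1" if lt: "t < chain_length C"
  proof -
    have "cs \<noteq> []"
    proof
      assume "cs = []"
      hence "chain_length C = t" unfolding C c using sl2_length_ray[OF e(1), of t p] t(1) by simp
      thus False using lt by simp
    qed
    hence "length C > 2" unfolding C by (cases cs) auto
    thus ?thesis using assms t(2) unfolding emanates_def by auto
  qed
  thus ?thesis using that t by blast
qed

text \<open>A semitoric edge is the part of the upper or lower boundary between two abscissae. This
  description does not mention fake corners and is visibly compatible with shears.\<close>

lemma emanates_chain_set:
  assumes "emanates R p r u C" "u$1 \<noteq> 0" "r = 1 \<or> r = -1"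
  shows "chain_set C = {q. vtop (r * sgn (u$1)) (pgon R) q \<and> (q$1 - p$1) / u$1 \<ge> 0 \<and> (last C$1 - q$1) / u$1 \<ge> 0}"
proof -
  note e = emanatesD[OF assms(1)]
  have s: "r * sgn (u$1) = 1 \<or> r * sgn (u$1) = -1" using assms(2,3) by (auto simp: sgn_if)
  show ?thesis
  proof (intro equalityI subsetI)
    fix q assume q: "q \<in> chain_set C"
    show "q \<in> {q. vtop (r * sgn (u$1)) (pgon R) q \<and> (q$1 - p$1) / u$1 \<ge> 0 \<and> (last C$1 - q$1) / u$1 \<ge> 0}"
      using e(8)[OF assms(2) q] nchain_mono_fst[OF assms(2) e(7)[OF assms(2)] q] e(5) by simp
  next
    fix q assume "q \<in> {q. vtop (r * sgn (u$1)) (pgon R) q \<and> (q$1 - p$1) / u$1 \<ge> 0 \<and> (last C$1 - q$1) / u$1 \<ge> 0}"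
    hence q: "vtop (r * sgn (u$1)) (pgon R) q" "(q$1 - p$1) / u$1 \<ge> 0" "(last C$1 - q$1) / u$1 \<ge> 0" by auto
    obtain q' where q': "q' \<in> chain_set C" "q'$1 = q$1"
      using nchain_cover[OF assms(2) e(7)[OF assms(2)] e(3), of "q$1"] q e(5) by auto
    have "q' = q" by (rule vtop_unique[OF e(8)[OF assms(2) q'(1)] q(1) q'(2) s])
    thus "q \<in> chain_set C" using q' by simp
  qed
qed

lemma chain_length_rev_edge_chain:
  assumes "is_rep R" "p extreme_point_of pgon R" "q \<in> chain_set (edge_chain R p)"
  shows "chain_length (rev (edge_chain R p)) = chain_length (edge_chain R p)"
    "path_length_to (edge_chain R p) q + path_length_to (rev (edge_chain R p)) q = chain_length (edge_chain R p)"
proof -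
  note r = is_repD[OF assms(1)]
  let ?C = "edge_chain R p" and ?e = "next_corner R p"
  obtain v where v: "primitive_vec v" "tangent 1 (pgon R) p v" using rep_dirs[OF assms(1) extreme_frontier[OF r(4) assms(2)]] by metis
  note ec = edge_chain_props[OF assms(1,2) v]
  obtain w where w: "w$1 = - v$1" "emanates R ?e (-1) w (rev ?C)" using ec(2) by blast
  have q': "q \<in> chain_set (rev ?C)" using assms(3) by (simp add: chain_set_rev)
  have "chain_length (rev ?C) = chain_length ?C \<and>
    path_length_to ?C q + path_length_to (rev ?C) q = chain_length ?C"
  proof (cases "v$1 = 0")
    case True
    obtain t where t0: "single_edge (pgon R) (p) v (?C) t" using emanates_short[OF ec(1) True] by blast
    note t = single_edgeD[OF t0]
    have w0: "w$1 = 0" using w(1) True by simp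
    obtain t' where t'0: "single_edge (pgon R) (?e) w (rev ?C) t'" using emanates_short[OF w(2) w0] by blast
    note t' = single_edgeD[OF t'0]
    have ep: "?e = p + t *\<^sub>R v" "p = ?e + t' *\<^sub>R w" using t(2) t'(2) by auto
    have pw: "primitive_vec w" "primitive_vec v" using emanatesD(1)[OF w(2)] v(1) by auto
    have "det2 v w = 0" using True w0 by (simp add: det2_eq)
    hence "w = v \<or> w = - v" using primitive_vec_parallel[OF v(1) pw(1)] by blast
    moreover have "p + (t *\<^sub>R v + t' *\<^sub>R w) = p + 0" using ep(2)[unfolded ep(1)] by (simp only: add.assoc add_0_right)
    hence "t *\<^sub>R v + t' *\<^sub>R w = 0" by (simp only: add_left_cancel)
    moreover have "t *\<^sub>R v + t' *\<^sub>R v \<noteq> 0" using t(1) t'(1) primitive_vec_nonzero[OF v(1)]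
      by (simp add: scaleR_add_left[symmetric])
    ultimately have wv: "w = - v" using \<open>t *\<^sub>R v + t' *\<^sub>R w = 0\<close> by blast
    hence "(t - t') *\<^sub>R v = 0" using \<open>t *\<^sub>R v + t' *\<^sub>R w = 0\<close> by (simp add: algebra_simps)
    hence tt: "t' = t" using primitive_vec_nonzero[OF v(1)] by simp
    obtain s where s: "0 \<le> s" "s \<le> t" "q = p + s *\<^sub>R v" using t(5) assms(3) by blast
    have "q = ?e + (t - s) *\<^sub>R w" unfolding s(3) ep(1) wv by (simp add: algebra_simps)
    thus ?thesis using t(3) t'(3) tt t(6)[of s] t'(6)[of "t - s"] s by simp
  next
    case False
    hence w0: "w$1 \<noteq> 0" using w(1) by simp
    have "last (rev ?C) = p" using emanatesD(3,4)[OF ec(1)] by (metis emanatesD(5,6) ec(1) last_rev)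
    hence "chain_length (rev ?C) = (?e$1 - p$1) / v$1" using emanates_length[OF w(2) w0] w(1)
      by (simp add: minus_divide_right[symmetric] diff_divide_distrib)
    moreover have "chain_length ?C = (?e$1 - p$1) / v$1" using emanates_length[OF ec(1) False] ec(4) by simp
    moreover have "path_length_to (rev ?C) q = (?e$1 - q$1) / v$1" using emanates_path[OF w(2) w0 q'] w(1)
      by (simp add: minus_divide_right[symmetric] diff_divide_distrib)
    ultimately show ?thesis using emanates_path[OF ec(1) False assms(3)] by (simp add: diff_divide_distrib)
  qed
  thus "chain_length (rev ?C) = chain_length ?C"
    "path_length_to ?C q + path_length_to (rev ?C) q = chain_length ?C" by auto
qed

text \<open>Characterises the next corner as the nearest true corner ahead on the same half of the
  boundary. The iteration of \<open>cw_next\<close> cannot be compared across representatives, since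
  fake corners appear and vanish, but this description can.\<close>

lemma next_corner_least:
  assumes "is_rep R" "p extreme_point_of pgon R" "primitive_vec v" "tangent 1 (pgon R) p v" "v$1 \<noteq> 0"
  shows "vtop (sgn (v$1)) (pgon R) (next_corner R p)" "(next_corner R p$1 - p$1) / v$1 > 0"
    "\<And>q. true_corner R q \<Longrightarrow> vtop (sgn (v$1)) (pgon R) q \<Longrightarrow> (q$1 - p$1) / v$1 > 0 \<Longrightarrow>
       (next_corner R p$1 - p$1) / v$1 \<le> (q$1 - p$1) / v$1"
proof -
  let ?e = "next_corner R p" and ?C = "edge_chain R p"
  note ec = edge_chain_props[OF assms(1-4)]
  note e = emanatesD[OF ec(1)]
  have "?C \<noteq> []" "length ?C \<ge> 2" using e by auto
  hence "?e \<in> set ?C" using ec(4) by (metis last_in_set)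
  hence eC: "?e \<in> chain_set ?C" using chain_set_subset_hull[OF e(3)] by blast
  show "vtop (sgn (v$1)) (pgon R) ?e" using e(8)[OF assms(5) eC] by simp
  obtain t where t: "t > 0" "p + t *\<^sub>R v \<in> pgon R" using emanates_max[OF ec(1)] by metis
  have "t \<le> chain_length ?C" using emanates_ray(4)[OF ec(1) t(2)] .
  thus pos: "(?e$1 - p$1) / v$1 > 0" using emanates_length[OF ec(1) assms(5)] ec(4) t(1) by simp
  fix q assume q: "true_corner R q" "vtop (sgn (v$1)) (pgon R) q" "(q$1 - p$1) / v$1 > 0"
  show "(?e$1 - p$1) / v$1 \<le> (q$1 - p$1) / v$1"
  proof (rule ccontr)
    assume lt: "\<not> (?e$1 - p$1) / v$1 \<le> (q$1 - p$1) / v$1"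
    hence "(last ?C$1 - q$1) / v$1 \<ge> 0" unfolding ec(4) by (simp add: diff_divide_distrib)
    hence "q \<in> chain_set ?C" using emanates_chain_set[OF ec(1) assms(5)] q by simp
    hence "q = p \<or> q = ?e" using ec(3) q(1) by blast
    thus False using lt q(3) by auto
  qed
qed

section \<open>Semitoric edges under the group\<close>

lemma act_dirs:
  assumes "is_rep R" "g \<in> grp (length (marks R))" "primitive_vec u" "tangent r (pgon R) p u" "r = 1 \<or> r = -1"
  obtains u' where "primitive_vec u'" "tangent r (pgon (act g R)) (act_map g R p) u'" "u'$1 = u$1" "u$1 = 0 \<Longrightarrow> u' = u"
proof -
  obtain c where c: "\<And>q u r. q$1 = p$1 \<Longrightarrow> r = 1 \<or> r = -1 \<Longrightarrow> tangent r (pgon R) q u \<Longrightarrow>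
     tangent r (pgon (act g R)) (act_map g R q) (sheared_dir c (net_flip R (snd g) (p$1)) u)"
    using tangent_act[OF is_repD(3)[OF assms(1)] assms(2) is_repD(3)[OF is_rep_act[OF assms(1,2)]], where ?x0.0 = "p$1"] by blast
  show ?thesis
    by (rule that[OF primitive_sheared_dir[OF assms(3)] c[OF refl assms(5,4)]]) (auto simp: sheared_dir_def vec2_eq)
qed

text \<open>For non-vertical directions the minimality in \<open>next_corner_least\<close> is used
  in both polygons, giving one inequality each way. A vertical edge is only translated, so the
  lengths of the two rays agree.\<close>

lemma next_corner_act:
  assumes "is_rep R" "g \<in> grp (length (marks R))" "true_corner R p"
  shows "next_corner (act g R) (act_map g R p) = act_map g R (next_corner R p)"
proof -
  let ?R = "act g R" and ?\<sigma> = "act_map g R"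
  note r = is_repD[OF assms(1)]
  have R': "is_rep ?R" by (rule is_rep_act[OF assms(1,2)])
  have am: "?\<sigma> = vshear (act_shift g R)" by (rule act_map_vshear[OF assms(2)])
  note p = true_corner_extreme[OF assms(3)]
  have p': "?\<sigma> p extreme_point_of pgon ?R" using true_corner_extreme true_corner_act[OF assms(1,2)] assms(3) by blast
  obtain v where v: "primitive_vec v" "tangent 1 (pgon R) p v" using rep_dirs[OF assms(1) extreme_frontier[OF r(4) p]] by metis
  obtain v' where v': "primitive_vec v'" "tangent 1 (pgon ?R) (?\<sigma> p) v'" "v'$1 = v$1" "v$1 = 0 \<Longrightarrow> v' = v"
    using act_dirs[OF assms(1,2) v] by blast
  note te = steps_to_corner_props(2)[OF assms(1) p] steps_to_corner_props(2)[OF R' p']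
  show ?thesis
  proof (cases "v$1 = 0")
    case True
    hence vv: "v' = v" using v'(4) by simp
    note ec = edge_chain_props[OF assms(1) p v] and ec' = edge_chain_props[OF R' p' v'(1,2)]
    obtain t where t0: "single_edge (pgon R) (p) v (edge_chain R p) t" using emanates_short[OF ec(1) True] by blast
    note t = single_edgeD[OF t0]
    obtain t' where t'0: "single_edge (pgon ?R) (?\<sigma> p) v (edge_chain ?R (?\<sigma> p)) t'" using emanates_short[OF ec'(1)[unfolded vv] True] by blast
    note t' = single_edgeD[OF t'0]
    have sv: "?\<sigma> (p + s *\<^sub>R v) = ?\<sigma> p + s *\<^sub>R v" for s using True by (simp add: am vec2_eq)
    have mem: "?\<sigma> p + s *\<^sub>R v \<in> pgon ?R \<longleftrightarrow> p + s *\<^sub>R v \<in> pgon R" for s unfolding sv[symmetric] by (simp add: am)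
    have "t' \<le> t" using t(7)[of t'] t'(4) mem by blast
    moreover have "t \<le> t'" using t'(7)[of t] t(4) mem by blast
    ultimately show ?thesis using ec(4) ec'(4) t(2) t'(2) sv[of t] by simp
  next
    case False
    note n = next_corner_least[OF assms(1) p v False]
    note n' = next_corner_least[OF R' p' v'(1,2), unfolded v'(3), OF False]
    obtain q where q: "next_corner ?R (?\<sigma> p) = ?\<sigma> q" using n'(1) unfolding vtop_def by auto
    have tq: "true_corner R q" using te(2) true_corner_act[OF assms(1,2)] q by simp
    have vq: "vtop (sgn (v$1)) (pgon R) q" using n'(1) unfolding q by (simp add: am)
    have "(q$1 - p$1) / v$1 > 0" using n'(2) unfolding q by (simp add: am)
    hence "(next_corner R p$1 - p$1) / v$1 \<le> (q$1 - p$1) / v$1" by (rule n(3)[OF tq vq])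
    moreover have "(?\<sigma> q$1 - ?\<sigma> p$1) / v$1 \<le> (?\<sigma> (next_corner R p)$1 - ?\<sigma> p$1) / v$1" unfolding q[symmetric]
    proof (rule n'(3))
      show "true_corner ?R (?\<sigma> (next_corner R p))" using te(1) true_corner_act[OF assms(1,2)] by simp
      show "vtop (sgn (v$1)) (pgon ?R) (?\<sigma> (next_corner R p))" using n(1) by (simp add: am)
      show "(?\<sigma> (next_corner R p)$1 - ?\<sigma> p$1) / v$1 > 0" using n(2) by (simp add: am)
    qed
    ultimately have "(q$1 - p$1) / v$1 = (next_corner R p$1 - p$1) / v$1" by (simp add: am)
    hence "q$1 = next_corner R p$1" using False by simp
    hence "q = next_corner R p" by (rule vtop_unique[OF vq n(1)]) (use False in \<open>auto simp: sgn_if\<close>)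
    thus ?thesis using q by simp
  qed
qed

lemma edge_chain_act:
  assumes "is_rep R" "g \<in> grp (length (marks R))" "true_corner R p"
  shows "chain_set (edge_chain (act g R) (act_map g R p)) = act_map g R ` chain_set (edge_chain R p)"
    "chain_length (edge_chain (act g R) (act_map g R p)) = chain_length (edge_chain R p)"
    "\<And>q. q \<in> chain_set (edge_chain R p) \<Longrightarrow>
       path_length_to (edge_chain (act g R) (act_map g R p)) (act_map g R q) = path_length_to (edge_chain R p) q"
proof -
  let ?R = "act g R" and ?\<sigma> = "act_map g R" and ?C = "edge_chain R p" and ?C' = "edge_chain (act g R) (act_map g R p)"
  note r = is_repD[OF assms(1)]
  have R': "is_rep ?R" by (rule is_rep_act[OF assms(1,2)])
  have am: "?\<sigma> = vshear (act_shift g R)" by (rule act_map_vshear[OF assms(2)])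
  note p = true_corner_extreme[OF assms(3)]
  have p': "?\<sigma> p extreme_point_of pgon ?R" using true_corner_extreme true_corner_act[OF assms(1,2)] assms(3) by blast
  obtain v where v: "primitive_vec v" "tangent 1 (pgon R) p v" using rep_dirs[OF assms(1) extreme_frontier[OF r(4) p]] by metis
  obtain v' where v': "primitive_vec v'" "tangent 1 (pgon ?R) (?\<sigma> p) v'" "v'$1 = v$1" "v$1 = 0 \<Longrightarrow> v' = v"
    using act_dirs[OF assms(1,2) v] by blast
  note ec = edge_chain_props[OF assms(1) p v] and ec' = edge_chain_props[OF R' p' v'(1,2)]
  have last: "last ?C' = ?\<sigma> (last ?C)" unfolding ec(4) ec'(4) by (rule next_corner_act[OF assms])
  have "chain_set ?C' = ?\<sigma> ` chain_set ?C \<and> chain_length ?C' = chain_length ?C \<and>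
    (\<forall>q\<in>chain_set ?C. path_length_to ?C' (?\<sigma> q) = path_length_to ?C q)"
  proof (cases "v$1 = 0")
    case True
    hence vv: "v' = v" using v'(4) by simp
    obtain t where t0: "single_edge (pgon R) (p) v (?C) t" using emanates_short[OF ec(1) True] by blast
    note t = single_edgeD[OF t0]
    obtain t' where t'0: "single_edge (pgon ?R) (?\<sigma> p) v (?C') t'" using emanates_short[OF ec'(1)[unfolded vv] True] by blast
    note t' = single_edgeD[OF t'0]
    have sv: "?\<sigma> (p + s *\<^sub>R v) = ?\<sigma> p + s *\<^sub>R v" for s using True by (simp add: am vec2_eq)
    have "?\<sigma> p + t' *\<^sub>R v = ?\<sigma> p + t *\<^sub>R v" using last t(2) t'(2) sv[of t] by simp
    hence tt: "t' = t" using primitive_vec_nonzero[OF v(1)] by simp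
    have "chain_set ?C' = ?\<sigma> ` chain_set ?C"
      unfolding set_eq_iff image_iff t'(5) Bex_def t(5) sv[symmetric] tt by blast
    moreover have "path_length_to ?C' (?\<sigma> q) = path_length_to ?C q" if q: "q \<in> chain_set ?C" for q
    proof -
      obtain s where s: "0 \<le> s" "s \<le> t" "q = p + s *\<^sub>R v" using t(5) q by blast
      show ?thesis using t(6)[OF s(1,2)] t'(6)[OF s(1)] s tt sv[of s] by simp
    qed
    ultimately show ?thesis using t(3) t'(3) tt by simp
  next
    case False
    hence F': "v'$1 \<noteq> 0" using v'(3) by simp
    have set: "chain_set ?C' = ?\<sigma> ` chain_set ?C"
    proof (rule set_eqI)
      fix z
      obtain q where z: "z = ?\<sigma> q" using vshear_inverse(2)[of "act_shift g R" z] unfolding am by metis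
      show "z \<in> chain_set ?C' \<longleftrightarrow> z \<in> ?\<sigma> ` chain_set ?C"
        unfolding emanates_chain_set[OF ec(1) False disjI1[OF refl]] emanates_chain_set[OF ec'(1) F' disjI1[OF refl]] last z
        by (simp add: am v'(3))
    qed
    moreover have "path_length_to ?C' (?\<sigma> q) = path_length_to ?C q" if q: "q \<in> chain_set ?C" for q
      using emanates_path[OF ec(1) False q] emanates_path[OF ec'(1) F', of "?\<sigma> q"] set q by (simp add: am v'(3))
    moreover have "chain_length ?C' = chain_length ?C"
      using emanates_length[OF ec(1) False] emanates_length[OF ec'(1) F'] last by (simp add: am v'(3))
    ultimately show ?thesis by blast
  qed
  thus "chain_set ?C' = ?\<sigma> ` chain_set ?C" "chain_length ?C' = chain_length ?C"
    "\<And>q. q \<in> chain_set ?C \<Longrightarrow> path_length_to ?C' (?\<sigma> q) = path_length_to ?C q" by auto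
qed

section \<open>The cyclic enumeration of the true corners\<close>

lemma lex_le_antisym: "lex_le p q \<Longrightarrow> lex_le q p \<Longrightarrow> p = q"
  by (auto simp: lex_le_def vec2_eq)

lemma lexmin_exists:
  assumes "compact D" "D \<noteq> {}"
  obtains m where "m \<in> D" "\<And>q. q \<in> D \<Longrightarrow> lex_le m q"
proof -
  have "continuous_on D (\<lambda>x. x$1)" by (intro continuous_intros)
  then obtain a where a: "a \<in> D" "\<forall>x\<in>D. a$1 \<le> x$1" using continuous_attains_inf[OF assms] by blast
  obtain m where m: "vtop (-1) D m" "m$1 = a$1" using vtop_exists[OF assms(1) a(1)] by metis
  show ?thesis
  proof (rule that[of m])
    show "m \<in> D" using m(1) by (simp add: vtop_def)
    fix q assume q: "q \<in> D"
    show "lex_le m q" using vtopD[OF m(1) q] a(2) q m(2) unfolding lex_le_def by force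
  qed
qed

lemma lexmin_extreme:
  assumes "m \<in> D" "\<And>q. q \<in> D \<Longrightarrow> lex_le m q" shows "m extreme_point_of D"
  unfolding extreme_point_of_def
proof (intro conjI ballI notI)
  fix a b assume ab: "a \<in> D" "b \<in> D" "m \<in> open_segment a b"
  obtain s where s: "0 < s" "s < 1" "m = (1 - s) *\<^sub>R a + s *\<^sub>R b" "a \<noteq> b" using ab(3) by (auto simp: in_segment)
  have e: "(1 - s) * (a$1 - m$1) + s * (b$1 - m$1) = 0" "(1 - s) * (a$2 - m$2) + s * (b$2 - m$2) = 0"
    unfolding s(3) by (simp_all add: algebra_simps)
  have pos: "1 - s > 0" using s by simp
  have ge: "a$1 - m$1 \<ge> 0" "b$1 - m$1 \<ge> 0" using assms(2)[OF ab(1)] assms(2)[OF ab(2)] by (auto simp: lex_le_def)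
  hence "(1 - s) * (a$1 - m$1) = 0" "s * (b$1 - m$1) = 0" using e(1) pos s(1)
    by (smt (verit) mult_nonneg_nonneg)+
  hence 1: "a$1 = m$1" "b$1 = m$1" using pos s(1) by auto
  hence ge: "a$2 - m$2 \<ge> 0" "b$2 - m$2 \<ge> 0" using assms(2)[OF ab(1)] assms(2)[OF ab(2)] by (auto simp: lex_le_def)
  hence "(1 - s) * (a$2 - m$2) = 0" "s * (b$2 - m$2) = 0" using e(2) pos s(1)
    by (smt (verit) mult_nonneg_nonneg)+
  hence "a$2 = m$2" "b$2 = m$2" using pos s(1) by auto
  thus False using 1 s(4) by (simp add: vec2_eq)
qed fact

lemma lexmin_vertex_eq:
  assumes "m \<in> D" "\<And>q. q \<in> D \<Longrightarrow> lex_le m q" shows "lexmin_vertex D = m"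
  unfolding lexmin_vertex_def
proof (rule the_equality)
  show "m extreme_point_of D \<and> (\<forall>q. q extreme_point_of D \<longrightarrow> lex_le m q)"
    using lexmin_extreme[OF assms] assms(2) by (auto simp: extreme_point_of_def)
  fix p assume "p extreme_point_of D \<and> (\<forall>q. q extreme_point_of D \<longrightarrow> lex_le p q)"
  thus "p = m" using lexmin_extreme[OF assms] assms(2) lex_le_antisym by (auto simp: extreme_point_of_def)
qed

lemma rep_lexmin:
  assumes "is_rep R"
  shows "lexmin_vertex (pgon R) \<in> pgon R" "\<And>q. q \<in> pgon R \<Longrightarrow> lex_le (lexmin_vertex (pgon R)) q"
proof -
  note r = is_repD[OF assms]
  have "pgon R \<noteq> {}" using r(4) interior_subset by blast
  then obtain m where m: "m \<in> pgon R" "\<And>q. q \<in> pgon R \<Longrightarrow> lex_le m q" using lexmin_exists[OF r(6)] by blast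
  thus "lexmin_vertex (pgon R) \<in> pgon R" "\<And>q. q \<in> pgon R \<Longrightarrow> lex_le (lexmin_vertex (pgon R)) q"
    using lexmin_vertex_eq[OF m] by auto
qed

lemma lexmin_act:
  assumes "is_rep R" "g \<in> grp (length (marks R))"
  shows "lexmin_vertex (pgon (act g R)) = act_map g R (lexmin_vertex (pgon R))"
  by (rule lexmin_vertex_eq) (use rep_lexmin[OF assms(1)] in \<open>auto simp: act_map_vshear[OF assms(2)] lex_le_vshear\<close>)

lemma mark_not_end:
  fixes p c :: "real^2"
  assumes "c \<in> interior D" "\<And>x. x \<in> D \<Longrightarrow> s * p$1 \<le> s * x$1" "s = 1 \<or> s = -1" shows "c$1 \<noteq> p$1"
proof
  assume c: "c$1 = p$1"
  obtain e where e: "e > 0" "\<And>t. \<bar>t\<bar> \<le> e \<Longrightarrow> c + t *\<^sub>R vector [1, 0] \<in> D" using interior_dir[OF assms(1)] by blast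
  have "\<bar>- s * e\<bar> \<le> e" using e(1) assms(3) by auto
  hence "s * p$1 \<le> s * (c + (- s * e) *\<^sub>R vector [1, 0])$1" using e(2) assms(2) by blast
  thus False using c e(1) assms(3) by auto
qed

text \<open>The leftmost and rightmost slices contain no marked point and hence meet no cut; their
  ends are vertices, thus Delzant corners.\<close>

lemma end_true_corner:
  assumes "is_rep R" "vtop t (pgon R) q" "t = 1 \<or> t = -1" "\<And>x. x \<in> pgon R \<Longrightarrow> s * q$1 \<le> s * x$1" "s = 1 \<or> s = -1"
  shows "true_corner R q"
proof -
  note r = is_repD[OF assms(1)]
  have ex: "q extreme_point_of pgon R" unfolding extreme_point_of_def
  proof (intro conjI ballI notI)
    show "q \<in> pgon R" using assms(2) by (simp add: vtop_def)
    fix a b assume ab: "a \<in> pgon R" "b \<in> pgon R" "q \<in> open_segment a b"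
    obtain l where l: "0 < l" "l < 1" "q = (1 - l) *\<^sub>R a + l *\<^sub>R b" "a \<noteq> b" using ab(3) by (auto simp: in_segment)
    have e: "(1 - l) * (s * a$1 - s * q$1) + l * (s * b$1 - s * q$1) = 0"
      "(1 - l) * (t * q$2 - t * a$2) + l * (t * q$2 - t * b$2) = 0"
      unfolding l(3) by (simp_all add: algebra_simps)
    have pos: "1 - l > 0" using l by simp
    have "s * a$1 - s * q$1 \<ge> 0" "s * b$1 - s * q$1 \<ge> 0" using assms(4)[OF ab(1)] assms(4)[OF ab(2)] by auto
    hence "(1 - l) * (s * a$1 - s * q$1) = 0" "l * (s * b$1 - s * q$1) = 0" using e(1) pos l(1)
      by (smt (verit) mult_nonneg_nonneg)+
    hence 1: "a$1 = q$1" "b$1 = q$1" using pos l(1) assms(5) by auto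
    have "t * q$2 - t * a$2 \<ge> 0" "t * q$2 - t * b$2 \<ge> 0" using vtopD[OF assms(2) ab(1) 1(1)] vtopD[OF assms(2) ab(2) 1(2)] by auto
    hence "(1 - l) * (t * q$2 - t * a$2) = 0" "l * (t * q$2 - t * b$2) = 0" using e(2) pos l(1)
      by (smt (verit) mult_nonneg_nonneg)+
    hence "a$2 = q$2" "b$2 = q$2" using pos l(1) assms(3) by auto
    thus False using 1 l(4) by (simp add: vec2_eq)
  qed
  have "ncuts R q = 0"
  proof (rule ncuts_0)
    fix i assume "i < length (marks R)"
    hence "marks R ! i \<in> interior (pgon R)" using r(8) by auto
    thus "marks R ! i $ 1 \<noteq> q$1" by (rule mark_not_end[OF _ assms(4,5)])
  qed
  thus ?thesis using ex assms(1) unfolding true_corner_def delzant_corner_def is_rep_def by blast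
qed

lemma interior_slice:
  fixes a b :: "real^2"
  assumes "convex D" "a \<in> D" "b \<in> D" "a$1 < x0" "x0 < b$1" "interior D \<noteq> {}"
  obtains c where "c \<in> interior D" "c$1 = x0"
proof -
  obtain c where c: "c \<in> interior D" using assms(6) by blast
  have key: "\<exists>z\<in>interior D. z$1 = x0" if y: "y \<in> D" "(c$1 < x0 \<and> x0 < y$1) \<or> (y$1 < x0 \<and> x0 < c$1)" for y
  proof -
    define e where "e = (y$1 - x0) / (y$1 - c$1)"
    have e: "0 < e" "e \<le> 1" unfolding e_def using y(2) by (auto simp: field_simps)
    have "e * (y$1 - c$1) = y$1 - x0" unfolding e_def using y(2) by auto
    hence "(y - e *\<^sub>R (y - c))$1 = x0" by simp
    thus ?thesis using mem_interior_convex_shrink[OF assms(1) c y(1) e] by blast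
  qed
  consider "c$1 = x0" | "c$1 < x0" | "c$1 > x0" by linarith
  thus ?thesis
  proof cases
    case 1 thus ?thesis using that c by blast
  next
    case 2 thus ?thesis using key[OF assms(3)] assms(5) that by blast
  next
    case 3 thus ?thesis using key[OF assms(2)] assms(4) that by blast
  qed
qed

lemma cw_dir_sign:
  assumes "convex D" "interior D \<noteq> {}" "tangent 1 D p v" "vtop s D p" "s = 1 \<or> s = -1" "x \<in> D" "s * p$1 < s * x$1"
  shows "s * v$1 > 0"
proof (rule ccontr)
  assume neg: "\<not> s * v$1 > 0"
  obtain t where t: "t > 0" "p + t *\<^sub>R v \<in> D" using tangentD(3)[OF assms(3)] by auto
  show False
  proof (cases "v$1 = 0")
    case True
    hence "s * (p + t *\<^sub>R v)$2 \<le> s * p$2" using vtopD[OF assms(4) t(2)] by simp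
    hence "t * (s * v$2) \<le> 0" by (simp add: algebra_simps)
    hence "s * v$2 \<le> 0" using t(1) by (simp add: mult_le_0_iff)
    moreover have "v$2 \<noteq> 0" using tangentD(1)[OF assms(3)] True by (auto simp: vec2_eq)
    moreover have "v$2 * (x$1 - p$1) \<ge> 0" using tangentD(4)[OF assms(3,6)] True by (simp add: det2_eq)
    ultimately show False using assms(5,7) by (auto simp: zero_le_mult_iff)
  next
    case False
    hence sg: "sgn (v$1) = - s" using neg assms(5) by (auto simp: sgn_if)
    hence "vtop (- s) D p" using tangent_vtop0[OF assms(3) False] by simp
    hence both: "vtop 1 D p" "vtop (-1) D p" using assms(4,5) by auto
    have "s * (t * v$1) < 0" using neg False t(1) assms(5) by (auto simp: mult_pos_neg zero_less_mult_iff)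
    hence side: "s * (p + t *\<^sub>R v)$1 < s * p$1" by (simp add: algebra_simps)
    obtain c where "c \<in> interior D" "c$1 = p$1"
    proof (cases "s = 1")
      case True
      show ?thesis using interior_slice[OF assms(1) t(2) assms(6) _ _ assms(2), of "p$1"] that side assms(7) True by auto
    next
      case False
      hence "s = -1" using assms(5) by simp
      thus ?thesis using interior_slice[OF assms(1,6) t(2) _ _ assms(2), of "p$1"] that side assms(7) by auto
    qed
    thus False using vtop_both_interior[OF both] by blast
  qed
qed

lemma true_corner_vtop:
  assumes "is_rep R" "true_corner R p" shows "vtop 1 (pgon R) p \<or> vtop (-1) (pgon R) p"
proof -
  note r = is_repD[OF assms(1)]
  note ex = true_corner_extreme[OF assms(2)]
  obtain v w where vw: "tangent 1 (pgon R) p v" "tangent (-1) (pgon R) p w"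
    using rep_dirs[OF assms(1) extreme_frontier[OF r(4) ex]] by metis
  have "det2 w v > 0" using extreme_iff_det[OF r(3,4) vw] ex by blast
  hence "v$1 \<noteq> 0 \<or> w$1 \<noteq> 0" by (auto simp: det2_eq)
  thus ?thesis using tangent_vtop0[OF vw(1)] tangent_vtop0[OF vw(2)] by (auto simp: sgn_if split: if_splits)
qed

lemma vertical_next_corner:
  assumes "is_rep R" "true_corner R q" "true_corner R p" "p \<noteq> q" "tangent 1 (pgon R) q (p - q)" "p$1 = q$1"
  shows "next_corner R q = p"
proof -
  note r = is_repD[OF assms(1)]
  note ex = true_corner_extreme[OF assms(2)]
  obtain v where v: "primitive_vec v" "tangent 1 (pgon R) q v" using rep_dirs[OF assms(1) extreme_frontier[OF r(4) ex]] by metis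
  obtain c where c: "c > 0" "p - q = c *\<^sub>R v" using tangent_unique_dir[OF v(2) assms(5) _ r(4)] by auto
  have pe: "p = q + c *\<^sub>R v" using c(2) by (metis add.commute diff_add_cancel)
  note ec = edge_chain_props[OF assms(1) ex v]
  have "q + c *\<^sub>R v \<in> pgon R" using true_corner_extreme[OF assms(3)] pe by (auto simp: extreme_point_of_def)
  hence "p \<in> chain_set (edge_chain R q)" using emanates_ray(1)[OF ec(1)] pe by simp
  thus ?thesis using ec(3) assms(3,4) by blast
qed

text \<open>Take the nearest true corner behind \<open>p\<close> on the same half of the boundary;
  one exists because the extreme slice ends in a true corner. Its successor cannot lie before
  \<open>p\<close> by this choice, nor beyond \<open>p\<close> by
  \<open>next_corner_least\<close>.\<close>

lemma corner_predecessor: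
  assumes "is_rep R" "true_corner R p" "vtop s (pgon R) p" "s = 1 \<or> s = -1" "y \<in> pgon R" "s * y$1 < s * p$1"
  obtains q where "true_corner R q" "vtop s (pgon R) q" "s * q$1 < s * p$1" "next_corner R q = p"
proof -
  note r = is_repD[OF assms(1)]
  let ?D = "pgon R"
  define Q where "Q = {q. true_corner R q \<and> vtop s ?D q \<and> s * q$1 < s * p$1}"
  have "finite {x. x extreme_point_of ?D}" using finite_polyhedron_extreme_points polytope_imp_polyhedron r(2) by blast
  hence fin: "finite Q" by (rule finite_subset[rotated]) (auto simp: Q_def true_corner_extreme)
  have "?D \<noteq> {}" using assms(5) by auto
  moreover have "continuous_on ?D (\<lambda>x. s * x$1)" by (intro continuous_intros)
  ultimately obtain a where a: "a \<in> ?D" "\<forall>x\<in>?D. s * a$1 \<le> s * x$1" using continuous_attains_inf[OF r(6)] by blast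
  obtain q0 where q0: "vtop s ?D q0" "q0$1 = a$1" using vtop_exists[OF r(6) a(1)] by metis
  have "true_corner R q0" by (rule end_true_corner[OF assms(1) q0(1) assms(4) _ assms(4)]) (use a q0 in auto)
  moreover have "s * q0$1 < s * p$1" using a(2) assms(5,6) q0(2) by (metis order_le_less_trans)
  ultimately have ne: "Q \<noteq> {}" using q0(1) unfolding Q_def by blast
  have "Max ((\<lambda>q. s * q$1) ` Q) \<in> (\<lambda>q. s * q$1) ` Q" using fin ne by (intro Max_in) auto
  then obtain q where q: "q \<in> Q" "Max ((\<lambda>q. s * q$1) ` Q) = s * q$1" by blast
  have qmax: "s * x$1 \<le> s * q$1" if "x \<in> Q" for x unfolding q(2)[symmetric] using fin that by (intro Max_ge) auto
  have q': "true_corner R q" "vtop s ?D q" "s * q$1 < s * p$1" using q(1) unfolding Q_def by auto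
  note ex = true_corner_extreme[OF q'(1)]
  obtain v where v: "primitive_vec v" "tangent 1 ?D q v" using rep_dirs[OF assms(1) extreme_frontier[OF r(4) ex]] by metis
  have pD: "p \<in> ?D" using assms(3) by (simp add: vtop_def)
  have sv: "s * v$1 > 0" by (rule cw_dir_sign[OF r(3,4) v(2) q'(2) assms(4) pD q'(3)])
  hence v1: "v$1 \<noteq> 0" "sgn (v$1) = s" using assms(4) by (auto simp: sgn_if)
  let ?e = "next_corner R q"
  note n = next_corner_least[OF assms(1) ex v v1(1), unfolded v1(2)]
  have div: "x / v$1 = (s * x) / (s * v$1)" for x using assms(4) by auto
  have te: "true_corner R ?e" by (rule steps_to_corner_props(2)[OF assms(1) ex])
  have "(p$1 - q$1) / v$1 > 0" unfolding div using q'(3) sv by (simp add: right_diff_distrib)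
  hence "(?e$1 - q$1) / v$1 \<le> (p$1 - q$1) / v$1" by (rule n(3)[OF assms(2,3)])
  hence le: "s * ?e$1 \<le> s * p$1" unfolding div using sv by (simp add: divide_le_cancel right_diff_distrib)
  have gt: "s * ?e$1 > s * q$1" using n(2) sv unfolding div[of "?e$1 - q$1"] by (simp add: zero_less_divide_iff right_diff_distrib)
  have "\<not> s * ?e$1 < s * p$1"
  proof
    assume "s * ?e$1 < s * p$1"
    hence "?e \<in> Q" using te n(1) unfolding Q_def by blast
    thus False using qmax gt by force
  qed
  hence "?e$1 = p$1" using le assms(4) by auto
  hence "?e = p" by (rule vtop_unique[OF n(1) assms(3) _ assms(4)])
  thus ?thesis using that q' by blast
qed

text \<open>Every element has a predecessor, so \<open>N\<close> is onto the finite set and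
  therefore injective. The orbit of \<open>m\<close> can then close only at \<open>m\<close> itself,
  and it does so after running through all of \<open>T\<close> once.\<close>

lemma cycle_enumeration:
  fixes N :: "'a \<Rightarrow> 'a"
  assumes "finite T" "m \<in> T" "\<And>x. x \<in> T \<Longrightarrow> N x \<in> T" "\<And>x. x \<in> T \<Longrightarrow> \<exists>i. x = (N ^^ i) m" "q \<in> T" "N q = m"
  shows "bij_betw (\<lambda>i. (N ^^ i) m) {..<card T} T" "(N ^^ card T) m = m"
proof -
  have it: "(N ^^ i) m \<in> T" for i by (induction i) (use assms in auto)
  have "T \<subseteq> N ` T"
  proof
    fix x assume "x \<in> T"
    then obtain i where i: "x = (N ^^ i) m" using assms(4) by blast
    show "x \<in> N ` T" using i it assms(5,6) by (cases i) auto
  qed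
  hence "N ` T = T" using assms(3) by auto
  hence inj: "inj_on N T" using assms(1) by (metis eq_card_imp_inj_on)
  have cancel: "(N ^^ (i + k)) m = (N ^^ i) m \<Longrightarrow> (N ^^ k) m = m" for i k
  proof (induction i)
    case (Suc i)
    hence "N ((N ^^ (i + k)) m) = N ((N ^^ i) m)" by simp
    hence "(N ^^ (i + k)) m = (N ^^ i) m" using inj it by (meson inj_onD)
    thus ?case by (rule Suc.IH)
  qed simp
  obtain j where "q = (N ^^ j) m" using assms(4,5) by blast
  hence ex: "\<exists>k>0. (N ^^ k) m = m" using assms(6) by (intro exI[of _ "Suc j"]) auto
  define k where "k = (LEAST k. k > 0 \<and> (N ^^ k) m = m)"
  have k: "k > 0" "(N ^^ k) m = m" using LeastI_ex[OF ex] unfolding k_def by auto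
  have least: "\<not> (j > 0 \<and> (N ^^ j) m = m)" if "j < k" for j using not_less_Least that unfolding k_def by blast
  have inj': "inj_on (\<lambda>i. (N ^^ i) m) {..<k}"
  proof (rule linorder_inj_onI)
    fix i j assume ij: "i < j" "i \<in> {..<k}" "j \<in> {..<k}"
    show "(N ^^ i) m \<noteq> (N ^^ j) m"
    proof
      assume "(N ^^ i) m = (N ^^ j) m"
      hence "(N ^^ (i + (j - i))) m = (N ^^ i) m" using ij by simp
      hence "(N ^^ (j - i)) m = m" by (rule cancel)
      moreover have "j - i < k" "j - i > 0" using ij by auto
      ultimately show False using least by blast
    qed
  qed auto
  have per: "(N ^^ (i + k * n)) m = (N ^^ i) m" for i n
  proof (induction n)
    case (Suc n)
    have "(N ^^ (i + k * Suc n)) m = (N ^^ (i + k * n)) ((N ^^ k) m)"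
      by (simp add: funpow_add[symmetric] comp_def flip: funpow_add add.assoc) (metis add.assoc add.commute comp_apply funpow_add)
    thus ?case using Suc k(2) by simp
  qed simp
  have "(\<lambda>i. (N ^^ i) m) ` {..<k} = T"
  proof
    show "(\<lambda>i. (N ^^ i) m) ` {..<k} \<subseteq> T" using it by auto
    show "T \<subseteq> (\<lambda>i. (N ^^ i) m) ` {..<k}"
    proof
      fix x assume "x \<in> T"
      then obtain i where "x = (N ^^ i) m" using assms(4) by blast
      hence "x = (N ^^ (i mod k)) m" using per[of "i mod k" "i div k"] by simp
      thus "x \<in> (\<lambda>i. (N ^^ i) m) ` {..<k}" using k(1) by auto
    qed
  qed
  hence bij: "bij_betw (\<lambda>i. (N ^^ i) m) {..<k} T" using inj' by (simp add: bij_betw_def)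
  hence "card T = k" using bij_betw_same_card by fastforce
  thus "bij_betw (\<lambda>i. (N ^^ i) m) {..<card T} T" "(N ^^ card T) m = m" using bij k(2) by auto
qed

lemma corner_eq: "corner R i = (next_corner R ^^ i) (lexmin_vertex (pgon R))"
proof -
  have "(\<lambda>p. (cw_next (pgon R) ^^ steps_to_corner R p) p) = next_corner R" by (simp add: fun_eq_iff next_corner_def)
  thus ?thesis unfolding corner_def by simp
qed

lemma corner_Suc: "corner R (Suc i) = next_corner R (corner R i)"
  by (simp add: corner_eq)

lemma semi_edge_eq: "semi_edge R i = edge_chain R (corner R i)"
  by (simp add: semi_edge_def edge_chain_def)

lemma lexmin_true_corner:
  assumes "is_rep R" shows "true_corner R (lexmin_vertex (pgon R))"
proof -
  let ?m = "lexmin_vertex (pgon R)"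
  note m = rep_lexmin[OF assms]
  have "vtop (-1) (pgon R) ?m" unfolding vtop_def using m by (force simp: lex_le_def)
  moreover have "1 * ?m$1 \<le> 1 * x$1" if "x \<in> pgon R" for x using m(2)[OF that] by (auto simp: lex_le_def)
  ultimately show ?thesis using end_true_corner[OF assms, of "-1" ?m 1] by blast
qed

lemma corner_true:
  assumes "is_rep R" shows "true_corner R (corner R i)"
proof (induction i)
  case 0 thus ?case using lexmin_true_corner[OF assms] by (simp add: corner_eq)
next
  case (Suc i) thus ?case using steps_to_corner_props(2)[OF assms true_corner_extreme] by (simp add: corner_Suc)
qed

text \<open>Reachability from the minimal vertex follows the clockwise order. Upper corners go back
  to the top of the leftmost slice, which is the minimal vertex or its successor; lower corners go
  back to the bottom of the rightmost slice, which is its top or the successor of its top. A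
  predecessor of the minimal vertex closes the cycle.\<close>

lemma corner_enumeration:
  assumes "is_rep R"
  shows "bij_betw (corner R) {..<ncorners R} {p. true_corner R p}" "corner R (ncorners R) = corner R 0" "ncorners R > 0"
proof -
  note r = is_repD[OF assms]
  let ?D = "pgon R" and ?m = "lexmin_vertex (pgon R)" and ?N = "next_corner R"
  define T where "T = {p. true_corner R p}"
  define reach where "reach p \<longleftrightarrow> (\<exists>i. p = (?N ^^ i) ?m)" for p
  have reachN: "reach (?N p)" if "reach p" for p using that unfolding reach_def by (metis funpow.simps(2) o_apply)
  have m0: "reach ?m" unfolding reach_def by (intro exI[of _ 0]) simp
  note m = rep_lexmin[OF assms]
  have mT: "true_corner R ?m" by (rule lexmin_true_corner[OF assms])
  have mx: "?m$1 \<le> x$1" if "x \<in> ?D" for x using m(2)[OF that] by (auto simp: lex_le_def)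
  have mv: "vtop (-1) ?D ?m" unfolding vtop_def using m by (force simp: lex_le_def)
  have "finite {x. x extreme_point_of ?D}" using finite_polyhedron_extreme_points polytope_imp_polyhedron r(2) by blast
  hence fin: "finite T" by (rule finite_subset[rotated]) (auto simp: T_def true_corner_extreme)
  have side: "reach p" if start0: "\<And>p. true_corner R p \<Longrightarrow> vtop s ?D p \<Longrightarrow> (\<forall>x\<in>?D. s * p$1 \<le> s * x$1) \<Longrightarrow> reach p"
      and s: "s = 1 \<or> s = -1" and pT: "true_corner R p" "vtop s ?D p" for s p
    using pT
  \<comment> \<open>Induction on the number of true corners strictly behind \<open>p\<close>; the
    corners on the extreme slice are supplied by \<open>start0\<close>.\<close>
  proof (induction "card {q\<in>T. s * q$1 < s * p$1}" arbitrary: p rule: less_induct)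
    case less
    show ?case
    proof (cases "\<forall>x\<in>?D. s * p$1 \<le> s * x$1")
      case True thus ?thesis using start0 less.prems by blast
    next
      case False
      then obtain y where y: "y \<in> ?D" "s * y$1 < s * p$1" by force
      obtain q where q: "true_corner R q" "vtop s ?D q" "s * q$1 < s * p$1" "?N q = p"
        using corner_predecessor[OF assms less.prems s y] by blast
      have "{x\<in>T. s * x$1 < s * q$1} \<subset> {x\<in>T. s * x$1 < s * p$1}" using q(1,3) unfolding T_def by fastforce
      hence "card {x\<in>T. s * x$1 < s * q$1} < card {x\<in>T. s * x$1 < s * p$1}" using fin by (intro psubset_card_mono) auto
      hence "reach q" using less.hyps q by blast
      thus ?thesis using reachN q(4) by metis
    qed
  qed
  have up: "reach p" if "true_corner R p" "vtop 1 ?D p" for p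
  proof (rule side[OF _ _ that])
    fix p assume p: "true_corner R p" "vtop 1 ?D p" "\<forall>x\<in>?D. 1 * p$1 \<le> 1 * x$1"
    show "reach p"
    proof (cases "p = ?m")
      case True thus ?thesis using m0 by simp
    next
      case False
      have pD: "p \<in> ?D" using p(2) by (simp add: vtop_def)
      have x: "p$1 = ?m$1" using p(3) m(1) mx[OF pD] by force
      have lt: "?m$2 < p$2" using vtopD[OF mv pD x] False x by (auto simp: vec2_eq)
      have "tangent 1 ?D ?m (p - ?m)" unfolding tangent_def
      proof (intro conjI ballI exI[of _ "1::real"])
        fix y assume "y \<in> ?D"
        thus "1 * det2 (p - ?m) (y - ?m) \<le> 0" using mx lt x by (simp add: det2_eq)
      qed (use False m(1) pD in auto)
      hence "?N ?m = p" using vertical_next_corner[OF assms mT p(1) False _ x] by blast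
      thus ?thesis using reachN[OF m0] by simp
    qed
  qed simp
  have down: "reach p" if "true_corner R p" "vtop (-1) ?D p" for p
  proof (rule side[OF _ _ that])
    fix p assume p: "true_corner R p" "vtop (-1) ?D p" "\<forall>x\<in>?D. (-1) * p$1 \<le> (-1) * x$1"
    have pD: "p \<in> ?D" using p(2) by (simp add: vtop_def)
    obtain q where q: "vtop 1 ?D q" "q$1 = p$1" using vtop_exists[OF r(6) pD] by metis
    have qT: "true_corner R q" by (rule end_true_corner[OF assms q(1), of "-1"]) (use p(3) q(2) in auto)
    hence rq: "reach q" using up q(1) by blast
    show "reach p"
    proof (cases "p = q")
      case True thus ?thesis using rq by simp
    next
      case False
      have lt: "p$2 < q$2" using vtopD[OF q(1) pD] q(2) False by (force simp: vec2_eq)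
      have qD: "q \<in> ?D" using q(1) by (simp add: vtop_def)
      have "tangent 1 ?D q (p - q)" unfolding tangent_def
      proof (intro conjI ballI exI[of _ "1::real"])
        fix y assume "y \<in> ?D"
        hence "y$1 \<le> q$1" using p(3) q(2) by auto
        thus "1 * det2 (p - q) (y - q) \<le> 0" using lt q(2) by (simp add: det2_eq mult_nonpos_nonpos)
      qed (use False qD pD in auto)
      hence "?N q = p" using vertical_next_corner[OF assms qT p(1) False] q(2) by simp
      thus ?thesis using reachN[OF rq] by simp
    qed
  qed simp
  obtain y where "y \<in> ?D" "-1 * y$1 < -1 * ?m$1"
  proof -
    obtain c where c: "c \<in> interior ?D" using r(4) by blast
    have "c$1 \<noteq> ?m$1" by (rule mark_not_end[OF c, of 1]) (use mx in auto)
    thus ?thesis using that[of c] mx[of c] c interior_subset by force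
  qed
  then obtain q where q: "true_corner R q" "?N q = ?m" using corner_predecessor[OF assms mT mv] by metis
  have "\<exists>i. x = (?N ^^ i) ?m" if "x \<in> T" for x
    using true_corner_vtop[OF assms] up down that unfolding T_def reach_def by blast
  moreover have "?N x \<in> T" if "x \<in> T" for x
    using that steps_to_corner_props(2)[OF assms true_corner_extreme] unfolding T_def by blast
  ultimately have c: "bij_betw (\<lambda>i. (?N ^^ i) ?m) {..<card T} T" "(?N ^^ card T) ?m = ?m"
    using cycle_enumeration[where N = ?N and T = T and m = ?m and q = q] fin mT q unfolding T_def mem_Collect_eq by simp_all
  have eq: "corner R = (\<lambda>i. (?N ^^ i) ?m)" by (simp add: fun_eq_iff corner_eq)
  show "bij_betw (corner R) {..<ncorners R} {p. true_corner R p}" "corner R (ncorners R) = corner R 0"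
    using c unfolding eq ncorners_def T_def by auto
  have "T \<noteq> {}" using mT unfolding T_def by blast
  thus "ncorners R > 0" using fin unfolding ncorners_def T_def[symmetric] by (simp add: card_gt_0_iff)
qed

lemma corner_act:
  assumes "is_rep R" "g \<in> grp (length (marks R))"
  shows "corner (act g R) i = act_map g R (corner R i)"
proof (induction i)
  case 0 thus ?case using lexmin_act[OF assms] by (simp add: corner_eq)
next
  case (Suc i) thus ?case using next_corner_act[OF assms corner_true[OF assms(1)]] by (simp add: corner_Suc)
qed

lemma ncorners_act:
  assumes "is_rep R" "g \<in> grp (length (marks R))" shows "ncorners (act g R) = ncorners R"
proof -
  have "{p. true_corner (act g R) p} = act_map g R ` {p. true_corner R p}"
  proof (rule set_eqI)
    fix z
    obtain q where z: "z = act_map g R q" using vshear_inverse(2)[of "act_shift g R" z] unfolding act_map_vshear[OF assms(2)] by metis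
    show "z \<in> {p. true_corner (act g R) p} \<longleftrightarrow> z \<in> act_map g R ` {p. true_corner R p}"
      using true_corner_act[OF assms, of q] unfolding z by (auto simp: act_map_vshear[OF assms(2)])
  qed
  thus ?thesis unfolding ncorners_def using inj_vshear
    by (simp add: card_image act_map_vshear[OF assms(2)] inj_on_def)
qed

lemma edge_length_act:
  assumes "is_rep R" "g \<in> grp (length (marks R))" shows "edge_length (act g R) i = edge_length R i"
  unfolding edge_length_def semi_edge_eq corner_act[OF assms]
  by (rule edge_chain_act(2)[OF assms corner_true[OF assms(1)]])

section \<open>Packed triangles\<close>

text \<open>If \<open>det2 w v = 1\<close>, the two determinants are the coordinates of
  \<open>z - p\<close> in the basis \<open>w\<close>, \<open>v\<close>. Their sum is less than
  \<open>l\<close> exactly in the part of the corner cut off by a triangle of size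
  \<open>l\<close>.\<close>

definition height :: "real^2 \<Rightarrow> real^2 \<Rightarrow> real^2 \<Rightarrow> real^2 \<Rightarrow> real" where
  "height p w v z = det2 (z - p) v + det2 w (z - p)"

lemma height_eq: "height p w v z = (v$2 - w$2) * (z$1 - p$1) + (w$1 - v$1) * (z$2 - p$2)"
  by (simp add: height_def det2_eq algebra_simps)

lemma height_ray: "det2 w v = 1 \<Longrightarrow> height p w v (p + s *\<^sub>R v) = s" "det2 w v = 1 \<Longrightarrow> height p w v (p + s *\<^sub>R w) = s"
  by (simp_all add: height_def det2_simps)

lemma height_comb: "det2 w v = 1 \<Longrightarrow> height p w v (p + s *\<^sub>R w + t *\<^sub>R v) = s + t"
  by (simp add: height_def det2_simps)

lemma height_scale: "height p w v (p + l *\<^sub>R (z - p)) = l * height p w v z"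
  by (simp add: height_eq algebra_simps)

lemma continuous_height: "continuous_on S (height p w v)"
  unfolding height_eq by (intro continuous_intros)

lemma cone_coordinates:
  assumes "det2 w v = 1" shows "z = p + det2 (z - p) v *\<^sub>R w + det2 w (z - p) *\<^sub>R v"
proof -
  define d where "d = z - p"
  have wv: "w$1 * v$2 - w$2 * v$1 = 1" using assms by (simp add: det2_eq)
  have "d$1 = (w$1 * v$2 - w$2 * v$1) * d$1" "d$2 = (w$1 * v$2 - w$2 * v$1) * d$2" unfolding wv by simp_all
  hence "d = det2 d v *\<^sub>R w + det2 w d *\<^sub>R v" by (simp add: vec2_eq det2_eq algebra_simps)
  thus ?thesis unfolding d_def by (metis add.assoc add_diff_cancel_left' diff_add_cancel add.commute)
qed

lemma cone_nonneg:
  assumes "tangent 1 D p v" "tangent (-1) D p w" "z \<in> D" shows "det2 (z - p) v \<ge> 0" "det2 w (z - p) \<ge> 0"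
proof -
  have "det2 (z - p) v = - det2 v (z - p)" by (simp add: det2_eq)
  thus "det2 (z - p) v \<ge> 0" "det2 w (z - p) \<ge> 0" using tangentD(4)[OF assms(1,3)] tangentD(4)[OF assms(2,3)] by auto
qed

lemma ray_mem:
  assumes "convex D" "p \<in> D" "p + l *\<^sub>R u \<in> D" "0 \<le> s" "s \<le> l" shows "p + s *\<^sub>R u \<in> D"
proof (cases "l = 0")
  case True thus ?thesis using assms by simp
next
  case False
  have "p + s *\<^sub>R u = (1 - s / l) *\<^sub>R p + (s / l) *\<^sub>R (p + l *\<^sub>R u)" using False by (simp add: algebra_simps)
  thus ?thesis using convexD_alt[OF assms(1-3), of "s / l"] assms(4,5) False by (simp add: divide_le_eq_1)
qed

lemma corner_triangle_eq:
  assumes "convex D" "tangent 1 D p v" "tangent (-1) D p w" "det2 w v = 1" "p + l *\<^sub>R v \<in> D" "p + l *\<^sub>R w \<in> D"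
  shows "{z\<in>D. height p w v z < l} = {p + s *\<^sub>R w + t *\<^sub>R v |s t. 0 \<le> s \<and> 0 \<le> t \<and> s + t < l}"
proof (intro equalityI subsetI)
  fix z assume z: "z \<in> {z\<in>D. height p w v z < l}"
  hence "det2 (z - p) v \<ge> 0" "det2 w (z - p) \<ge> 0" "det2 (z - p) v + det2 w (z - p) < l"
    using cone_nonneg[OF assms(2,3)] unfolding height_def by auto
  thus "z \<in> {p + s *\<^sub>R w + t *\<^sub>R v |s t. 0 \<le> s \<and> 0 \<le> t \<and> s + t < l}"
    using cone_coordinates[OF assms(4), of z p] by blast
next
  fix z assume "z \<in> {p + s *\<^sub>R w + t *\<^sub>R v |s t. 0 \<le> s \<and> 0 \<le> t \<and> s + t < l}"
  then obtain s t where st: "z = p + s *\<^sub>R w + t *\<^sub>R v" "0 \<le> s" "0 \<le> t" "s + t < l" by blast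
  note pD = tangentD(2)[OF assms(2)]
  have "z \<in> D"
  proof (cases "s + t = 0")
    case True
    hence "s = 0" "t = 0" using st by auto
    thus ?thesis using st(1) pD by simp
  next
    case False
    hence pos: "s + t > 0" using st by auto
    have 1: "p + (s + t) *\<^sub>R w \<in> D" "p + (s + t) *\<^sub>R v \<in> D" using ray_mem[OF assms(1) pD] assms(5,6) st by auto
    have d: "1 - t / (s + t) = s / (s + t)" using pos by (simp add: field_simps)
    have m: "s / (s + t) * (s + t) = s" "t / (s + t) * (s + t) = t" using pos by auto
    have "(1 - t / (s + t)) *\<^sub>R (p + (s + t) *\<^sub>R w) + (t / (s + t)) *\<^sub>R (p + (s + t) *\<^sub>R v) =
      (s / (s + t) + t / (s + t)) *\<^sub>R p + s *\<^sub>R w + t *\<^sub>R v"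
      unfolding d scaleR_add_right scaleR_scaleR m by (simp add: scaleR_add_left algebra_simps)
    also have "s / (s + t) + t / (s + t) = 1" using pos by (simp add: add_divide_distrib[symmetric])
    finally have "(1 - t / (s + t)) *\<^sub>R (p + (s + t) *\<^sub>R w) + (t / (s + t)) *\<^sub>R (p + (s + t) *\<^sub>R v) = z"
      unfolding st(1) by simp
    thus ?thesis using convexD_alt[OF assms(1) 1, of "t / (s + t)"] st pos by simp
  qed
  thus "z \<in> {z\<in>D. height p w v z < l}" using height_comb[OF assms(4)] st by simp
qed

lemma triangle_memI:
  fixes p u v :: "'a::real_vector"
  assumes "0 \<le> s" "0 \<le> t" "s + t < l"
  shows "p + s *\<^sub>R u + t *\<^sub>R v \<in> {p + s *\<^sub>R u + t *\<^sub>R v |s t. 0 \<le> s \<and> 0 \<le> t \<and> s + t < l}"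
  using assms by blast

text \<open>\<open>packed_triangle\<close> for a representative in which the triangle already is a
  lattice triangle, so that no group element has to be applied.\<close>

definition straight_triangle :: "srep \<Rightarrow> real^2 \<Rightarrow> real \<Rightarrow> (real^2) set \<Rightarrow> bool" where
  "straight_triangle R p l B \<longleftrightarrow> delzant_corner R p \<and> l > 0 \<and> B \<subseteq> pgon R \<and> (\<forall>c\<in>set (marks R). c \<notin> B) \<and>
     (\<exists>M\<in>SL2Z. B = (\<lambda>x. M *v x + p) ` std_triangle l) \<and> (\<exists>U. open U \<and> p \<in> U \<and> B \<inter> U = pgon R \<inter> U)"

lemma packed_triangle_iff:
  assumes "is_rep R"
  shows "packed_triangle R p l B \<longleftrightarrow>
    (\<exists>g\<in>grp (length (marks R)). straight_triangle (act g R) (act_map g R p) l (act_map g R ` B))"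
proof -
  have "p extreme_point_of pgon R \<and> B \<subseteq> pgon R"
    if g: "g \<in> grp (length (marks R))" and st: "straight_triangle (act g R) (act_map g R p) l (act_map g R ` B)" for g
  proof -
    have "true_corner (act g R) (act_map g R p)" using st unfolding straight_triangle_def true_corner_def by blast
    hence "p extreme_point_of pgon R" using true_corner_act[OF assms g] true_corner_extreme by blast
    moreover have "act_map g R ` B \<subseteq> act_map g R ` pgon R" using st unfolding straight_triangle_def by simp
    hence "B \<subseteq> pgon R" by (auto simp: act_map_vshear[OF g] image_subset_iff)
    ultimately show ?thesis by blast
  qed
  note conv = this
  show ?thesis
  proof
    assume L: "packed_triangle R p l B"
    note L' = L[unfolded packed_triangle_def Let_def, THEN conjunct2, THEN conjunct2, THEN conjunct2]
    from L' obtain g where g: "g \<in> grp (length (marks R))" and a: "delzant_corner (act g R) (act_map g R p) \<and>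
      (\<forall>c\<in>set (marks R). act_map g R c \<notin> act_map g R ` B) \<and>
      (\<exists>M\<in>SL2Z. act_map g R ` B = (\<lambda>x. M *v x + act_map g R p) ` std_triangle l) \<and>
      (\<exists>U. open U \<and> act_map g R p \<in> U \<and> act_map g R ` B \<inter> U = act_map g R ` pgon R \<inter> U)"
      by (rule bexE)
    have b: "B \<subseteq> pgon R" "l > 0" using L unfolding packed_triangle_def by auto
    have "straight_triangle (act g R) (act_map g R p) l (act_map g R ` B)"
      unfolding straight_triangle_def act_sel set_map ball_simps(9)
      by (insert a, elim conjE, intro conjI image_mono b, assumption+)
    thus "\<exists>g\<in>grp (length (marks R)). straight_triangle (act g R) (act_map g R p) l (act_map g R ` B)" using g by blast
  next
    assume "\<exists>g\<in>grp (length (marks R)). straight_triangle (act g R) (act_map g R p) l (act_map g R ` B)"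
    then obtain g where g: "g \<in> grp (length (marks R))" "straight_triangle (act g R) (act_map g R p) l (act_map g R ` B)" by blast
    note h = g(2)[unfolded straight_triangle_def act_sel set_map ball_simps(9)]
    show "packed_triangle R p l B" unfolding packed_triangle_def Let_def 
      by (insert conv[OF g] h, elim conjE, intro conjI bexI[OF _ g(1)], assumption+)
  qed
qed

lemma packed_triangle_act:
  assumes "is_rep R" "g \<in> grp (length (marks R))"
  shows "packed_triangle (act g R) (act_map g R p) l (act_map g R ` B) \<longleftrightarrow> packed_triangle R p l B"
proof
  note wf = is_repD(7)[OF assms(1)]
  have R': "is_rep (act g R)" by (rule is_rep_act[OF assms])
  {
    assume "packed_triangle (act g R) (act_map g R p) l (act_map g R ` B)"
    then obtain h where h: "h \<in> grp (length (marks R))"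
      "straight_triangle (act h (act g R)) (act_map h (act g R) (act_map g R p)) l (act_map h (act g R) ` act_map g R ` B)"
      unfolding packed_triangle_iff[OF R'] by auto
    obtain k where k: "k \<in> grp (length (marks R))" "act h (act g R) = act k R" "act_map h (act g R) \<circ> act_map g R = act_map k R"
      using act_compose[OF wf assms(2) h(1)] .
    have "act_map h (act g R) ` act_map g R ` B = act_map k R ` B" "act_map h (act g R) (act_map g R p) = act_map k R p"
      using k(3) by (metis image_comp) (metis comp_apply k(3))
    thus "packed_triangle R p l B" using h k unfolding packed_triangle_iff[OF assms(1)] by metis
  }
  assume "packed_triangle R p l B"
  then obtain h where h: "h \<in> grp (length (marks R))" "straight_triangle (act h R) (act_map h R p) l (act_map h R ` B)"
    unfolding packed_triangle_iff[OF assms(1)] by auto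
  obtain i where i: "i \<in> grp (length (marks R))" "act i (act g R) = R" "act_map i (act g R) \<circ> act_map g R = id"
    using act_inverse[OF wf assms(2)] .
  have wf': "wf_rep (act g R)" by (rule is_repD(7)[OF R'])
  obtain k where k: "k \<in> grp (length (marks (act g R)))" "act h (act i (act g R)) = act k (act g R)"
    "act_map h (act i (act g R)) \<circ> act_map i (act g R) = act_map k (act g R)"
    using act_compose[OF wf', of i h] i(1) h(1) by (metis act_sel(2) length_map)
  have net_flip: "act_map k (act g R) (act_map g R z) = act_map h R z" for z
  proof -
    have "act_map k (act g R) (act_map g R z) = act_map h R ((act_map i (act g R) \<circ> act_map g R) z)"
      unfolding k(3)[symmetric] i(2) by simp
    thus ?thesis unfolding i(3) by simp
  qed
  have "act_map k (act g R) ` act_map g R ` B = act_map h R ` B" unfolding image_image net_flip ..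
  thus "packed_triangle (act g R) (act_map g R p) l (act_map g R ` B)"
    unfolding packed_triangle_iff[OF R'] using h k i(2) net_flip by metis
qed

section \<open>Straight triangles as corners cut off by a line\<close>

lemma delzant_corner_dirs:
  assumes "is_rep R" "delzant_corner R p"
  obtains v w where "primitive_vec v" "tangent 1 (pgon R) p v" "primitive_vec w" "tangent (-1) (pgon R) p w" "det2 w v = 1"
proof -
  have t: "true_corner R p" and n: "ncuts R p = 0" using assms(2) unfolding true_corner_def delzant_corner_def by auto
  obtain v w where vw: "primitive_vec v" "tangent 1 (pgon R) p v" "primitive_vec w" "tangent (-1) (pgon R) p w"
    using rep_dirs[OF assms(1) true_corner_frontier[OF assms(1) t]] .
  have "defect R p w v = 1" using true_corner_iff_defect[OF assms(1) vw] t by simp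
  hence "det2 w v = 1" unfolding defect_def n by (simp add: Tpow_def)
  thus ?thesis using that vw by blast
qed

lemma delzant_det:
  assumes "is_rep R" "delzant_corner R p" "primitive_vec v" "tangent 1 (pgon R) p v" "primitive_vec w" "tangent (-1) (pgon R) p w"
  shows "det2 w v = 1"
proof -
  obtain v' w' where d: "primitive_vec v'" "tangent 1 (pgon R) p v'" "primitive_vec w'" "tangent (-1) (pgon R) p w'" "det2 w' v' = 1"
    using delzant_corner_dirs[OF assms(1,2)] .
  note r = is_repD[OF assms(1)]
  have "v' = v" by (rule tangent_primitive_unique[OF assms(4) d(2) _ r(4) assms(3) d(1)]) simp
  moreover have "w' = w" by (rule tangent_primitive_unique[OF assms(6) d(4) _ r(4) assms(5) d(3)]) simp
  ultimately show ?thesis using d by simp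
qed

lemma SL2Z_columns:
  assumes "M \<in> SL2Z"
  defines "a \<equiv> vector [M$1$1, M$2$1] :: real^2" and "b \<equiv> vector [M$1$2, M$2$2] :: real^2"
  shows "primitive_vec a" "primitive_vec b" "det2 a b = 1" "M *v x = x$1 *\<^sub>R a + x$2 *\<^sub>R b"
proof -
  note M = assms(1)[unfolded SL2Z_iff]
  obtain m11 m12 m21 m22 :: int where m: "M$1$1 = of_int m11" "M$1$2 = of_int m12" "M$2$1 = of_int m21" "M$2$2 = of_int m22"
    using M by (metis Ints_cases)
  have "of_int (m11 * m22 - m12 * m21) = (1::real)" using M m by simp
  hence e: "m11 * m22 - m12 * m21 = 1" by (simp only: of_int_eq_1_iff)
  have "coprime m11 m21"
  proof (rule coprimeI)
    fix c assume "c dvd m11" "c dvd m21"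
    hence "c dvd m11 * m22 - m12 * m21" by (intro dvd_diff) auto
    thus "is_unit c" using e by simp
  qed
  thus "primitive_vec a" by (rule primitive_vecI) (simp_all add: a_def m)
  have "coprime m12 m22"
  proof (rule coprimeI)
    fix c assume "c dvd m12" "c dvd m22"
    hence "c dvd m11 * m22 - m12 * m21" by (intro dvd_diff) auto
    thus "is_unit c" using e by simp
  qed
  thus "primitive_vec b" by (rule primitive_vecI) (simp_all add: b_def m)
  show "det2 a b = 1" using M by (simp add: det2_eq a_def b_def algebra_simps)
  show "M *v x = x$1 *\<^sub>R a + x$2 *\<^sub>R b" by (simp add: vec2_eq matrix_vector2 a_def b_def algebra_simps)
qed

lemma open_ray:
  assumes "open U" "p \<in> U" "l > 0" obtains e where "0 < e" "e < l" "p + e *\<^sub>R (d::real^2) \<in> U"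
proof -
  have "p \<in> interior U" using assms(1,2) by (simp add: interior_open)
  then obtain e where e: "e > 0" "\<And>t. \<bar>t\<bar> \<le> e \<Longrightarrow> p + t *\<^sub>R d \<in> U" using interior_dir by blast
  show ?thesis by (rule that[of "min e (l / 2)"]) (use e assms(3) in auto)
qed

lemma straight_triangle_image:
  assumes "M \<in> SL2Z"
  shows "(\<lambda>x. M *v x + p) ` std_triangle l = {p + s *\<^sub>R (vector [M$1$1, M$2$1]) + t *\<^sub>R (vector [M$1$2, M$2$2]) |s t. 0 \<le> s \<and> 0 \<le> t \<and> s + t < l}"
proof (intro equalityI subsetI)
  fix z assume "z \<in> (\<lambda>x. M *v x + p) ` std_triangle l"
  then obtain x where x: "x \<in> std_triangle l" "z = M *v x + p" by blast
  thus "z \<in> {p + s *\<^sub>R (vector [M$1$1, M$2$1]) + t *\<^sub>R (vector [M$1$2, M$2$2]) |s t. 0 \<le> s \<and> 0 \<le> t \<and> s + t < l}"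
    unfolding SL2Z_columns(4)[OF assms] std_triangle_def by (auto simp: algebra_simps)
next
  fix z assume "z \<in> {p + s *\<^sub>R (vector [M$1$1, M$2$1]) + t *\<^sub>R (vector [M$1$2, M$2$2]) |s t. 0 \<le> s \<and> 0 \<le> t \<and> s + t < l}"
  then obtain s t where st: "z = p + s *\<^sub>R (vector [M$1$1, M$2$1]) + t *\<^sub>R (vector [M$1$2, M$2$2])" "0 \<le> s" "0 \<le> t" "s + t < l" by blast
  have "z = M *v (vector [s, t]) + p" unfolding SL2Z_columns(4)[OF assms] st(1) by (simp add: algebra_simps)
  moreover have "vector [s, t] \<in> std_triangle l" using st by (simp add: std_triangle_def)
  ultimately show "z \<in> (\<lambda>x. M *v x + p) ` std_triangle l" by blast
qed

text \<open>The matrix in the definition is forced: near \<open>p\<close> the cone over its columns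
  and the cone over the two edges contain each other, and primitive vectors on the same ray are
  equal.\<close>

lemma straight_triangle_iff:
  assumes "is_rep R" "delzant_corner R p" "primitive_vec v" "tangent 1 (pgon R) p v" "primitive_vec w" "tangent (-1) (pgon R) p w"
  shows "straight_triangle R p l B \<longleftrightarrow> l > 0 \<and> p + l *\<^sub>R v \<in> pgon R \<and> p + l *\<^sub>R w \<in> pgon R \<and>
    B = {z\<in>pgon R. height p w v z < l} \<and> (\<forall>c\<in>set (marks R). c \<notin> B)"
proof
  note r = is_repD[OF assms(1)]
  note det = delzant_det[OF assms]
  let ?D = "pgon R"
  {
    assume st: "straight_triangle R p l B"
    obtain M U where M: "M \<in> SL2Z" "B = (\<lambda>x. M *v x + p) ` std_triangle l" and U: "open U" "p \<in> U" "B \<inter> U = ?D \<inter> U"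
      and l: "l > 0" and BD: "B \<subseteq> ?D" and mk: "\<forall>c\<in>set (marks R). c \<notin> B"
      using st unfolding straight_triangle_def by blast
    define a b where "a = (vector [M$1$1, M$2$1] :: real^2)" and "b = (vector [M$1$2, M$2$2] :: real^2)"
    note ab = SL2Z_columns(1-3)[OF M(1), folded a_def b_def]
    have B: "B = {p + s *\<^sub>R a + t *\<^sub>R b |s t. 0 \<le> s \<and> 0 \<le> t \<and> s + t < l}"
      unfolding M(2) straight_triangle_image[OF M(1)] a_def b_def ..
    have inB: "p + s *\<^sub>R a \<in> B" "p + s *\<^sub>R b \<in> B" if "0 \<le> s" "s < l" for s
      unfolding B using triangle_memI[of s 0 l p a b] triangle_memI[of 0 s l p a b] that by simp_all
    have cone: "det2 d v \<ge> 0 \<and> det2 w d \<ge> 0" if "p + (l/2) *\<^sub>R d \<in> B" for d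
    proof -
      have "p + (l/2) *\<^sub>R d \<in> ?D" using that BD by blast
      from cone_nonneg[OF assms(4,6) this] l show ?thesis by (simp add: det2_simps zero_le_mult_iff)
    qed
    have ca: "det2 a v \<ge> 0" "det2 w a \<ge> 0" and cb: "det2 b v \<ge> 0" "det2 w b \<ge> 0"
      using cone[of a] cone[of b] inB[of "l/2"] l by auto
    \<comment> \<open>Here the common neighbourhood of triangle and polygon enters: short initial
      pieces of the polygon's edges belong to \<open>B\<close> and so have nonnegative coordinates
      with respect to \<open>a\<close> and \<open>b\<close>.\<close>
    have cone': "det2 u b \<ge> 0 \<and> det2 a u \<ge> 0" if u: "tangent r ?D p u" for u r
    proof -
      obtain t where t: "t > 0" "p + t *\<^sub>R u \<in> ?D" using tangentD(3)[OF u] by auto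
      obtain e where e: "0 < e" "e < t" "p + e *\<^sub>R u \<in> U" using open_ray[OF U(1,2) t(1)] by blast
      have "p + e *\<^sub>R u \<in> ?D" using ray_mem[OF r(3) tangentD(2)[OF u] t(2)] e by simp
      hence "p + e *\<^sub>R u \<in> B" using U(3) e(3) by blast
      then obtain s t where st: "p + e *\<^sub>R u = p + s *\<^sub>R a + t *\<^sub>R b" "0 \<le> s" "0 \<le> t" unfolding B by blast
      hence eu: "e *\<^sub>R u = s *\<^sub>R a + t *\<^sub>R b" by (simp add: add.assoc)
      have "e * det2 u b = s" using arg_cong[OF eu, of "\<lambda>x. det2 x b"] ab(3) by (simp add: det2_simps)
      moreover have "e * det2 a u = t" using arg_cong[OF eu, of "det2 a"] ab(3) by (simp add: det2_simps)
      ultimately show ?thesis using st e(1) by (metis zero_le_mult_iff not_less)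
    qed
    have cv: "det2 v b \<ge> 0" "det2 a v \<ge> 0" and cw: "det2 w b \<ge> 0" "det2 a w \<ge> 0" using cone'[OF assms(4)] cone'[OF assms(6)] by auto
    have anti: "det2 x y = - det2 y x" for x y by (simp add: det2_eq)
    have "det2 v b = 0" using cv(1) cb(1) anti[of v b] by simp
    hence "b = v \<or> b = - v" using primitive_vec_parallel[OF assms(3) ab(2)] by blast
    moreover have "b \<noteq> - v" using ab(3) cv(2) by (auto simp: det2_simps)
    ultimately have bv: "b = v" by blast
    have "det2 w a = 0" using cw(2) ca(2) anti[of w a] by simp
    hence "a = w \<or> a = - w" using primitive_vec_parallel[OF assms(5) ab(1)] by blast
    moreover have "a \<noteq> - w" using ab(3) cw(1) by (auto simp: det2_simps)
    ultimately have aw: "a = w" by blast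
    \<comment> \<open>The triangle omits its third side; the two vertices on that side are limits of
      points of \<open>B\<close>, and the polygon is closed.\<close>
    have lim: "p + l *\<^sub>R u \<in> ?D" if "\<And>s. 0 \<le> s \<Longrightarrow> s < l \<Longrightarrow> p + s *\<^sub>R u \<in> B" for u
    proof -
      have "(\<lambda>n. p + (l - l / real (Suc n)) *\<^sub>R u) \<longlonglongrightarrow> p + (l - 0) *\<^sub>R u"
        by (intro tendsto_intros LIMSEQ_Suc[OF lim_const_over_n])
      moreover have "p + (l - l / real (Suc n)) *\<^sub>R u \<in> ?D" for n
        using that[of "l - l / real (Suc n)"] l BD by (auto simp: field_simps)
      ultimately show ?thesis using closed_sequentially[OF r(5)] by fastforce
    qed
    have ends: "p + l *\<^sub>R v \<in> ?D" "p + l *\<^sub>R w \<in> ?D" using lim inB bv aw by auto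
    have "B = {z\<in>?D. height p w v z < l}" unfolding B bv aw corner_triangle_eq[OF r(3) assms(4,6) det ends] ..
    thus "l > 0 \<and> p + l *\<^sub>R v \<in> ?D \<and> p + l *\<^sub>R w \<in> ?D \<and> B = {z\<in>?D. height p w v z < l} \<and> (\<forall>c\<in>set (marks R). c \<notin> B)"
      using l ends mk by blast
  }
  assume A: "l > 0 \<and> p + l *\<^sub>R v \<in> ?D \<and> p + l *\<^sub>R w \<in> ?D \<and> B = {z\<in>?D. height p w v z < l} \<and> (\<forall>c\<in>set (marks R). c \<notin> B)"
  define M :: "real^2^2" where "M = vector [vector [w$1, v$1], vector [w$2, v$2]]"
  have M: "M \<in> SL2Z" unfolding SL2Z_iff M_def using det primitive_vec_Ints[OF assms(3)] primitive_vec_Ints[OF assms(5)]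
    by (simp add: det2_eq algebra_simps)
  have col: "vector [M$1$1, M$2$1] = w" "vector [M$1$2, M$2$2] = v" by (simp_all add: M_def vec2_eq)
  have "B = (\<lambda>x. M *v x + p) ` std_triangle l"
    unfolding straight_triangle_image[OF M] col using corner_triangle_eq[OF r(3) assms(4,6) det] A by blast
  moreover have "open {z. height p w v z < l}"
    using open_Collect_less[OF continuous_height continuous_on_const] by blast
  moreover have "p \<in> {z. height p w v z < l}" using height_ray(1)[OF det, of p 0] A by simp
  moreover have "B \<inter> {z. height p w v z < l} = ?D \<inter> {z. height p w v z < l}" using A by blast
  ultimately show "straight_triangle R p l B" unfolding straight_triangle_def using A M assms(2) by blast
qed

definition cuts_off :: "srep \<Rightarrow> real^2 \<Rightarrow> real \<Rightarrow> (real^2) set \<Rightarrow> real^2 \<Rightarrow> real^2 \<Rightarrow> bool" where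
  "cuts_off R p l B v w \<longleftrightarrow> primitive_vec v \<and> tangent 1 (pgon R) p v \<and> primitive_vec w \<and> tangent (-1) (pgon R) p w \<and> det2 w v = 1 \<and>
    l > 0 \<and> p + l *\<^sub>R v \<in> pgon R \<and> p + l *\<^sub>R w \<in> pgon R \<and> B = {z\<in>pgon R. height p w v z < l} \<and>
    B = {p + s *\<^sub>R w + t *\<^sub>R v |s t. 0 \<le> s \<and> 0 \<le> t \<and> s + t < l} \<and> (\<forall>c\<in>set (marks R). c \<notin> B) \<and> delzant_corner R p"

lemma straight_triangle_cuts_off:
  assumes "is_rep R" "straight_triangle R p l B" obtains v w where "cuts_off R p l B v w"
proof -
  have d: "delzant_corner R p" using assms(2) by (simp add: straight_triangle_def)
  obtain v w where vw: "primitive_vec v" "tangent 1 (pgon R) p v" "primitive_vec w" "tangent (-1) (pgon R) p w" "det2 w v = 1"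
    using delzant_corner_dirs[OF assms(1) d] .
  have A: "l > 0 \<and> p + l *\<^sub>R v \<in> pgon R \<and> p + l *\<^sub>R w \<in> pgon R \<and> B = {z\<in>pgon R. height p w v z < l} \<and> (\<forall>c\<in>set (marks R). c \<notin> B)"
    using straight_triangle_iff[OF assms(1) d vw(1-4)] assms(2) by blast
  show ?thesis by (rule that[of v w]) (use A vw d corner_triangle_eq[OF is_repD(3)[OF assms(1)] vw(2,4,5)] in \<open>auto simp: cuts_off_def\<close>)
qed

lemma cuts_offD:
  assumes "cuts_off R p l B v w"
  shows "primitive_vec v" "tangent 1 (pgon R) p v" "primitive_vec w" "tangent (-1) (pgon R) p w" "det2 w v = 1"
    "l > 0" "p + l *\<^sub>R v \<in> pgon R" "p + l *\<^sub>R w \<in> pgon R" "B = {z\<in>pgon R. height p w v z < l}"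
    "B = {p + s *\<^sub>R w + t *\<^sub>R v |s t. 0 \<le> s \<and> 0 \<le> t \<and> s + t < l}" "\<And>c. c \<in> set (marks R) \<Longrightarrow> c \<notin> B" "delzant_corner R p"
  using assms unfolding cuts_off_def by (blast+)

text \<open>The strict inequality on the height leaves room to push any point other than
  \<open>p\<close> a little further from \<open>p\<close>, so it lies inside a segment of the
  polygon.\<close>

lemma cuts_off_extreme:
  assumes "cuts_off R p l B v w" "z \<in> B" "z extreme_point_of pgon R" shows "z = p"
proof (rule ccontr)
  assume neq: "z \<noteq> p"
  note t = cuts_offD[OF assms(1)]
  obtain a b where ab: "z = p + a *\<^sub>R w + b *\<^sub>R v" "0 \<le> a" "0 \<le> b" "a + b < l" using assms(2) t(10) by blast
  have pos: "a + b > 0"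
  proof (rule ccontr)
    assume "\<not> a + b > 0"
    hence "a = 0" "b = 0" using ab by auto
    thus False using neq ab(1) by simp
  qed
  have lk: "l / (a + b) > 1" using ab(4) pos by simp
  then obtain k where k: "k > 1" "k < l / (a + b)" using dense by blast
  have kl: "k * a + k * b < l" using k(2) pos by (simp add: pos_less_divide_eq algebra_simps)
  define y where "y = p + (k * a) *\<^sub>R w + (k * b) *\<^sub>R v"
  have "y \<in> B" unfolding t(10) y_def by (rule triangle_memI) (use k kl ab in auto)
  moreover have "p \<in> B" unfolding t(10) using t(6) by (auto intro!: exI[of _ "0::real"])
  ultimately have yp: "y \<in> pgon R" "p \<in> pgon R" using t(9) by auto
  have "y = p + k *\<^sub>R (z - p)" unfolding y_def ab(1) by (simp add: algebra_simps)
  hence "(1 / k) *\<^sub>R (y - p) = z - p" using k(1) by simp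
  moreover have "(1 - 1 / k) *\<^sub>R p + (1 / k) *\<^sub>R y = p + (1 / k) *\<^sub>R (y - p)" by (simp add: algebra_simps)
  ultimately have z: "z = (1 - 1 / k) *\<^sub>R p + (1 / k) *\<^sub>R y" by simp
  have "y \<noteq> p" using \<open>y = p + k *\<^sub>R (z - p)\<close> neq k(1) by simp
  hence "z \<in> open_segment p y" using k(1) unfolding in_segment by (intro conjI exI[of _ "1 / k"] z) auto
  thus False using assms(3) yp by (auto simp: extreme_point_of_def)
qed

text \<open>Points of the triangle with two positive coordinates lie in an open subset of the
  polygon, so a boundary point has one coordinate 0.\<close>

lemma cuts_off_interior:
  assumes "cuts_off R p l B v w" "z \<in> B" "z \<in> frontier (pgon R)"
  obtains u a where "u = v \<or> u = w" "0 \<le> a" "a < l" "z = p + a *\<^sub>R u"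
proof -
  note t = cuts_offD[OF assms(1)]
  let ?O = "{z. 0 < det2 (z - p) v} \<inter> {z. 0 < det2 w (z - p)} \<inter> {z. height p w v z < l}"
  have "continuous_on UNIV (\<lambda>z. det2 (z - p) v)" "continuous_on UNIV (\<lambda>z. det2 w (z - p))"
    unfolding det2_eq by (intro continuous_intros)+
  hence O: "open ?O" using continuous_height by (intro open_Int open_Collect_less continuous_on_const) auto
  have "?O \<subseteq> pgon R"
  proof
    fix x assume x: "x \<in> ?O"
    have "x = p + det2 (x - p) v *\<^sub>R w + det2 w (x - p) *\<^sub>R v" by (rule cone_coordinates[OF t(5)])
    moreover have "det2 (x - p) v + det2 w (x - p) < l" using x by (simp add: height_def)
    moreover have "0 \<le> det2 (x - p) v" "0 \<le> det2 w (x - p)" using x by auto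
    ultimately have "x \<in> B" unfolding t(10) by blast
    thus "x \<in> pgon R" using t(9) by blast
  qed
  hence "?O \<subseteq> interior (pgon R)" using O by (rule interior_maximal)
  hence nO: "z \<notin> ?O" using assms(3) by (auto simp: frontier_def)
  obtain a b where ab: "z = p + a *\<^sub>R w + b *\<^sub>R v" "0 \<le> a" "0 \<le> b" "a + b < l" using assms(2) t(10) by blast
  have "det2 (z - p) v = a" "det2 w (z - p) = b" unfolding ab(1) using t(5) by (simp_all add: det2_simps)
  hence "a = 0 \<or> b = 0" using nO ab height_comb[OF t(5), of p a b] by auto
  thus ?thesis
  proof
    assume "a = 0" thus ?thesis using that[of v b] ab by simp
  next
    assume "b = 0" thus ?thesis using that[of w a] ab by simp
  qed
qed

section \<open>Uniqueness of the triangle with given corner and size\<close>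

lemma opposite_boundary:
  assumes "r \<in> frontier D" "q \<in> frontier D" "c \<in> interior D" "r$1 = c$1" "q$1 = c$1" "r \<noteq> q" "rational_polygon D"
  obtains s where "s = 1 \<or> s = -1" "s * r$2 > s * c$2" "s * c$2 > s * q$2"
proof -
  have vt: "\<exists>s. (s = 1 \<or> s = -1) \<and> vtop s D x" if x: "x \<in> frontier D" "x$1 = c$1" for x
  proof -
    obtain v where v: "tangent 1 D x v" using primitive_tangent_exists[OF assms(7) x(1)] by blast
    have "1 * det2 v (c - x) < 0" by (rule tangent_interior_strict[OF v _ assms(3)]) simp
    hence "v$1 \<noteq> 0" using x(2) by (auto simp: det2_eq)
    hence "vtop (sgn (v$1)) D x" "sgn (v$1) = 1 \<or> sgn (v$1) = -1" using tangent_vtop0[OF v] by (auto simp: sgn_if)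
    thus ?thesis by blast
  qed
  obtain s where s: "s = 1 \<or> s = -1" "vtop s D r" using vt[OF assms(1,4)] by blast
  obtain s' where s': "s' = 1 \<or> s' = -1" "vtop s' D q" using vt[OF assms(2,5)] by blast
  have "s' \<noteq> s" using vtop_unique[of s D r q] s s' assms(4-6) by auto
  hence s's: "s' = - s" using s s' by auto
  have "s * (r$2 - c$2) > 0" by (rule vtop_interior[OF s(2) assms(3) _ s(1)]) (use assms in simp)
  moreover have "s' * (q$2 - c$2) > 0" by (rule vtop_interior[OF s'(2) assms(3) _ s'(1)]) (use assms in simp)
  ultimately show ?thesis using that[OF s(1)] s's by (simp add: algebra_simps)
qed

text \<open>
  A flipped cut starts at a marked point outside the triangle.  If its line crossed the triangle,
  the boundary point on the triangle's side would end a cut in one of the two representatives,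
  hence be a vertex inside a straight triangle.
\<close>

lemma no_flip_across:
  assumes "is_rep R" "cuts_off R p l B v w" "g \<in> grp (length (marks R))" "cuts_off (act g R) (act_map g R p) l B' v' w'"
    "k < length (marks R)" "flip_exponent R (snd g) k \<noteq> 0" "marks R ! k $ 1 \<noteq> p$1"
    "\<And>z. z \<in> pgon R \<Longrightarrow> z$1 = marks R ! k $ 1 \<Longrightarrow> height (act_map g R p) w' v' (act_map g R z) = height p w v z"
    "y \<in> B" "y$1 = marks R ! k $ 1"
  shows False
proof -
  note r = is_repD[OF assms(1)] and t = cuts_offD[OF assms(2)] and t' = cuts_offD[OF assms(4)]
  let ?c = "marks R ! k" and ?R = "act g R" and ?\<sigma> = "act_map g R"
  have R': "is_rep ?R" by (rule is_rep_act[OF assms(1,3)])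
  have am: "?\<sigma> = vshear (act_shift g R)" by (rule act_map_vshear[OF assms(3)])
  have c: "?c \<in> interior (pgon R)" "?c \<in> set (marks R)" using r(8) assms(5) by auto
  have yD: "y \<in> pgon R" "height p w v y < l" using assms(9) t(9) by auto
  have "?c \<notin> B" using t(11) c(2) by blast
  hence hc: "height p w v ?c \<ge> l" using c(1) interior_subset t(9) by force
  have e: "height p w v z = height p w v ?c + (w$1 - v$1) * (z$2 - ?c$2)" if "z$1 = ?c$1" for z
    using that by (simp add: height_eq algebra_simps)
  \<comment> \<open>The vertical side on which \<open>y\<close> lies as seen from the marked point.
    The marked point is above the line and \<open>y\<close> below it, so the height decreases in
    this direction.\<close>
  define s where "s = sgn (y$2 - ?c$2)"
  have "y$2 \<noteq> ?c$2" using e[OF assms(10)] yD(2) hc by auto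
  hence s: "s = 1 \<or> s = -1" unfolding s_def by (auto simp: sgn_if)
  have sy: "s * (y$2 - ?c$2) > 0" unfolding s_def using \<open>y$2 \<noteq> ?c$2\<close> by (auto simp: sgn_if)
  have "(w$1 - v$1) * (y$2 - ?c$2) < 0" using e[OF assms(10)] yD(2) hc by simp
  hence ks: "(w$1 - v$1) * s < 0" using sy s by (auto simp: mult_less_0_iff)
  \<comment> \<open>Going on in that direction to the boundary lowers the height further, so this
    end of the slice is in the triangle; it must not lie on a cut.\<close>
  obtain q where q: "vtop s (pgon R) q" "q$1 = y$1" using vtop_exists[OF r(6) yD(1)] by metis
  have qx: "q$1 = ?c$1" using q(2) assms(10) by simp
  have "s * (q$2 - y$2) \<ge> 0" using vtopD[OF q(1) yD(1)] q(2) by (simp add: algebra_simps)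
  hence "(w$1 - v$1) * (q$2 - y$2) \<le> 0" using ks s by (auto simp: mult_le_0_iff mult_less_0_iff)
  hence hq: "height p w v q < l" using e[OF qx] e[OF assms(10)] yD(2) by (simp add: algebra_simps)
  have qD: "q \<in> pgon R" using q(1) by (simp add: vtop_def)
  have qB: "q \<in> B" using hq qD t(9) by blast
  have qp: "q \<noteq> p" using qx assms(7) by auto
  have "q \<notin> cut R k"
  proof
    assume "q \<in> cut R k"
    hence "ncuts R q \<ge> 1" using assms(5) unfolding ncuts_def by (auto simp: Suc_le_eq card_gt_0_iff)
    moreover have "q \<in> frontier (pgon R)" by (rule vtop_frontier[OF q(1) s])
    ultimately have "q extreme_point_of pgon R" using assms(1) unfolding is_rep_def by blast
    thus False using cuts_off_extreme[OF assms(2) qB] qp by blast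
  qed
  hence s1: "of_int (signs R ! k) \<noteq> s" using cut_vtop_iff[OF q(1) s assms(5) r(7,8)] qx by simp
  have q': "vtop s (pgon ?R) (?\<sigma> q)" using q(1) by (simp add: am)
  have "height (?\<sigma> p) w' v' (?\<sigma> q) < l" using assms(8)[OF qD qx] hq by simp
  hence qB': "?\<sigma> q \<in> B'" unfolding t'(9) using qD by simp
  have "?\<sigma> q \<notin> cut ?R k"
  proof
    assume "?\<sigma> q \<in> cut ?R k"
    hence "ncuts ?R (?\<sigma> q) \<ge> 1" using assms(5) unfolding ncuts_def by (auto simp: Suc_le_eq card_gt_0_iff)
    moreover have "?\<sigma> q \<in> frontier (pgon ?R)" by (rule vtop_frontier[OF q' s])
    ultimately have "?\<sigma> q extreme_point_of pgon ?R" using R' unfolding is_rep_def by blast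
    hence "?\<sigma> q = ?\<sigma> p" using cuts_off_extreme[OF assms(4) qB'] by blast
    thus False using qp by (simp add: am)
  qed
  hence s2: "of_int (signs ?R ! k) \<noteq> s"
    using cut_vtop_iff[OF q' s _ is_repD(7,8)[OF R'], of k] qx assms(5) by (simp add: am)
  obtain n b e where g: "g = group_elt n b e" "length e = length (marks R)" "set e \<subseteq> {-1, 1}" using grpE[OF assms(3)] .
  \<comment> \<open>The flip reverses the sign, so in one of the two representatives the cut points
    towards this end of the slice.\<close>
  have "e ! k = -1" using assms(6) pm1_nth[OF g(3), of k] g assms(5) by (auto simp: flip_exponent_def)
  hence "signs ?R ! k = - signs R ! k" using g assms(5) r(7) by (simp add: wf_rep_def)
  moreover have "signs R ! k = 1 \<or> signs R ! k = -1" using pm1_nth assms(5) r(7) unfolding wf_rep_def by metis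
  ultimately show False using s1 s2 s by auto
qed

text \<open>A Delzant corner is an end of its slice and lies on no cut, here in both
  representatives. A flipped cut over it would reach it in one of the two.\<close>

lemma delzant_no_flip:
  assumes "is_rep R" "g \<in> grp (length (marks R))" "delzant_corner R p" "delzant_corner (act g R) (act_map g R p)"
    "k < length (marks R)" "marks R ! k $ 1 = p$1"
  shows "flip_exponent R (snd g) k = 0"
proof -
  note r = is_repD[OF assms(1)]
  let ?R = "act g R" and ?\<sigma> = "act_map g R"
  have R': "is_rep ?R" by (rule is_rep_act[OF assms(1,2)])
  have am: "?\<sigma> = vshear (act_shift g R)" by (rule act_map_vshear[OF assms(2)])
  have t: "true_corner R p" using assms(3) by (simp add: true_corner_def)
  obtain s where s: "s = 1 \<or> s = -1" "vtop s (pgon R) p" using true_corner_vtop[OF assms(1) t] by blast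
  have s': "vtop s (pgon ?R) (?\<sigma> p)" using s(2) by (simp add: am)
  have n: "x \<notin> cut R0 k" if "ncuts R0 x = 0" "k < length (marks R0)" for x R0
  proof
    assume "x \<in> cut R0 k"
    hence "{i. i < length (marks R0) \<and> x \<in> cut R0 i} \<noteq> {}" using that(2) by blast
    hence "card {i. i < length (marks R0) \<and> x \<in> cut R0 i} > 0" by (simp add: card_gt_0_iff)
    thus False using that(1)[unfolded ncuts_def] by linarith
  qed
  have "p \<notin> cut R k" "?\<sigma> p \<notin> cut ?R k" using n assms(3-5) by (auto simp: delzant_corner_def)
  hence "of_int (signs R ! k) \<noteq> s" "of_int (signs ?R ! k) \<noteq> s"
    using cut_vtop_iff[OF s(2,1) assms(5) r(7,8)] cut_vtop_iff[OF s' s(1) _ is_repD(7,8)[OF R'], of k] assms(5,6) by (simp_all add: am)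
  moreover obtain n b e where g: "g = group_elt n b e" "length e = length (marks R)" "set e \<subseteq> {-1, 1}" using grpE[OF assms(2)] .
  moreover have "signs R ! k = 1 \<or> signs R ! k = -1" using pm1_nth assms(5) r(7) unfolding wf_rep_def by metis
  moreover have "e ! k = 1 \<or> e ! k = -1" using pm1_nth g assms(5) by metis
  ultimately show ?thesis using s(1) assms(5) r(7) by (auto simp: flip_exponent_def wf_rep_def)
qed

text \<open>On the strip around \<open>p\<close> reaching to the nearest flipped marked points the
  map is affine, so the two height functions agree there. Both triangles are star-shaped about
  \<open>p\<close>; leaving the strip they would cross a slice that \<open>no_flip_across\<close>
  forbids. Inside the strip they are given by the same inequality.\<close>

lemma straight_triangle_unique:
  assumes "is_rep R" "g \<in> grp (length (marks R))" "straight_triangle R p l B"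
    "straight_triangle (act g R) (act_map g R p) l (act_map g R ` B')"
  shows "B' = B"
proof -
  note r = is_repD[OF assms(1)]
  let ?R = "act g R" and ?\<sigma> = "act_map g R" and ?m = "length (marks R)" and ?x = "\<lambda>k. marks R ! k $ 1"
  have R': "is_rep ?R" by (rule is_rep_act[OF assms(1,2)])
  note r' = is_repD[OF R']
  have am: "?\<sigma> = vshear (act_shift g R)" by (rule act_map_vshear[OF assms(2)])
  obtain v w where co: "cuts_off R p l B v w" using straight_triangle_cuts_off[OF assms(1,3)] .
  note t = cuts_offD[OF co]
  note d' = assms(4)[unfolded straight_triangle_def, THEN conjunct1]
  define K where "K = {k. k < ?m \<and> flip_exponent R (snd g) k \<noteq> 0}"
  have finK: "finite K" unfolding K_def by simp
  have Kp: "?x k \<noteq> p$1" if "k \<in> K" for k using delzant_no_flip[OF assms(1,2) t(12) d'] that unfolding K_def by blast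
  have pD: "p \<in> pgon R" by (rule tangentD(2)[OF t(2)])
  \<comment> \<open>A bound for the polygon. The values \<open>e + 1\<close> and
    \<open>- e - 1\<close> stand in for a missing flipped marked point on either side; no point of
    the polygon has them as first coordinate.\<close>
  obtain e where e: "\<And>z. z \<in> pgon R \<Longrightarrow> norm z \<le> e" using polytope_imp_bounded[OF r(2)] bounded_iff by blast
  have ez: "\<bar>z$1\<bar> \<le> e" if "z \<in> pgon R" for z using component_le_norm_cart[of z 1] e[OF that] by linarith
  define \<beta> where "\<beta> = Min (insert (e + 1) (?x ` {k\<in>K. ?x k > p$1}))"
  define \<alpha> where "\<alpha> = Max (insert (- e - 1) (?x ` {k\<in>K. ?x k < p$1}))"
  have f1: "finite (insert (e + 1) (?x ` {k\<in>K. ?x k > p$1}))" "finite (insert (- e - 1) (?x ` {k\<in>K. ?x k < p$1}))" using finK by auto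
  have \<beta>in: "\<beta> \<in> insert (e + 1) (?x ` {k\<in>K. ?x k > p$1})" unfolding \<beta>_def using f1 by (intro Min_in) auto
  have \<alpha>in: "\<alpha> \<in> insert (- e - 1) (?x ` {k\<in>K. ?x k < p$1})" unfolding \<alpha>_def using f1 by (intro Max_in) auto
  have \<beta>p: "p$1 < \<beta>" using \<beta>in ez[OF pD] by auto
  have \<alpha>p: "\<alpha> < p$1" using \<alpha>in ez[OF pD] by auto
  have gap: "?x k \<le> \<alpha> \<or> \<beta> \<le> ?x k" if k: "k < ?m" "flip_exponent R (snd g) k \<noteq> 0" for k
  proof -
    have kK: "k \<in> K" using k unfolding K_def by blast
    show ?thesis
    proof (cases "?x k < p$1")
      case True
      thus ?thesis unfolding \<alpha>_def using kK f1 by (intro disjI1 Max_ge) auto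
    next
      case False
      hence "?x k > p$1" using Kp[OF kK] by simp
      thus ?thesis unfolding \<beta>_def using kK f1 by (intro disjI2 Min_le) auto
    qed
  qed
  obtain c b where af: "\<And>x. \<alpha> \<le> x \<Longrightarrow> x \<le> \<beta> \<Longrightarrow> act_shift g R x = of_int c * x + b"
    using act_shift_affine[OF assms(2) gap] by blast
  \<comment> \<open>The linear part of the map on the strip. It preserves determinants and primitive
    vectors, hence also the height.\<close>
  define T where "T u = (vector [u$1, u$2 + of_int c * u$1] :: real^2)" for u :: "real^2"
  have Tdir: "tangent r' (pgon ?R) (?\<sigma> p) (T u)" if u: "tangent r' (pgon R) p u" "r' = 1 \<or> r' = -1" for r' u
  proof -
    have "tangent r' (vshear (act_shift g R) ` pgon R) (vshear (act_shift g R) p) (vector [u$1, u$2 + (of_int c + (if u$1 \<ge> 0 then 0 else 0)) * u$1])"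
    proof (rule tangent_shear[OF r(3) _ u, of "act_shift g R" "min (p$1 - \<alpha>) (\<beta> - p$1)"])
      show "convex (vshear (act_shift g R) ` pgon R)" using r'(3) by (simp add: am)
      show "min (p$1 - \<alpha>) (\<beta> - p$1) > 0" using \<alpha>p \<beta>p by simp
      fix h assume h: "\<bar>h\<bar> \<le> min (p$1 - \<alpha>) (\<beta> - p$1)"
      have "act_shift g R (p$1 + h) = of_int c * (p$1 + h) + b" by (rule af) (use h in auto)
      moreover have "act_shift g R (p$1) = of_int c * p$1 + b" by (rule af) (use \<alpha>p \<beta>p in auto)
      ultimately show "act_shift g R (p$1 + h) = act_shift g R (p$1) + (of_int c + (if h \<ge> 0 then 0 else 0)) * h" by (simp add: algebra_simps)
    qed
    thus ?thesis unfolding T_def by (simp add: am)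
  qed
  have Tp: "primitive_vec (T u)" if "primitive_vec u" for u unfolding T_def by (rule primitive_vec_shear[OF that])
  have dT: "det2 (T x) (T y) = det2 x y" for x y by (simp add: det2_eq T_def algebra_simps)
  have co': "cuts_off ?R (?\<sigma> p) l (?\<sigma> ` B') (T v) (T w)"
  proof -
    obtain v' w' where c': "cuts_off ?R (?\<sigma> p) l (?\<sigma> ` B') v' w'" using straight_triangle_cuts_off[OF R' assms(4)] .
    note t' = cuts_offD[OF c']
    have "T v = v'" by (rule tangent_primitive_unique[OF t'(2) Tdir[OF t(2)] _ r'(4) t'(1) Tp[OF t(1)]]) auto
    moreover have "T w = w'" by (rule tangent_primitive_unique[OF t'(4) Tdir[OF t(4)] _ r'(4) t'(3) Tp[OF t(3)]]) auto
    ultimately show ?thesis using c' by simp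
  qed
  note t' = cuts_offD[OF co']
  have hfe: "height (?\<sigma> p) (T w) (T v) (?\<sigma> z) = height p w v z" if z: "\<alpha> \<le> z$1" "z$1 \<le> \<beta>" for z
  proof -
    have "act_shift g R (z$1) = of_int c * z$1 + b" "act_shift g R (p$1) = of_int c * p$1 + b" using af z \<alpha>p \<beta>p by auto
    hence "?\<sigma> z - ?\<sigma> p = T (z - p)" by (simp add: am vec2_eq T_def algebra_simps)
    thus ?thesis unfolding height_def by (simp add: dT)
  qed
  have edge: False if y: "y \<in> pgon R" "height p w v y < l" "y$1 = \<alpha> \<or> y$1 = \<beta>" for y
  proof -
    have "\<alpha> \<noteq> y$1 \<or> \<alpha> \<noteq> - e - 1" "\<beta> \<noteq> y$1 \<or> \<beta> \<noteq> e + 1" using ez[OF y(1)] by auto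
    then obtain k where k: "k \<in> K" "?x k = y$1" using \<alpha>in \<beta>in y(3) by auto
    have yB: "y \<in> B" using y t(9) by blast
    have net_flip: "k < ?m" "flip_exponent R (snd g) k \<noteq> 0" using k unfolding K_def by auto
    show False
    proof (rule no_flip_across[OF assms(1) co assms(2) co' net_flip Kp[OF k(1)] _ yB])
      show "y$1 = ?x k" using k by simp
      fix z assume "z \<in> pgon R" "z$1 = ?x k"
      thus "height (?\<sigma> p) (T w) (T v) (?\<sigma> z) = height p w v z" using hfe[of z] k(2) y(3) \<alpha>p \<beta>p by auto
    qed
  qed
  \<comment> \<open>The parameter at which the segment from \<open>p\<close> first meets a border of
    the strip.\<close>
  have cross: "\<exists>\<theta>. 0 \<le> \<theta> \<and> \<theta> \<le> 1 \<and> (p$1 + \<theta> * (x - p$1) = \<alpha> \<or> p$1 + \<theta> * (x - p$1) = \<beta>)"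
    if "\<not> (\<alpha> < x \<and> x < \<beta>)" for x
  proof (cases "x \<ge> \<beta>")
    case True
    thus ?thesis using \<beta>p by (intro exI[of _ "(\<beta> - p$1) / (x - p$1)"]) (auto simp: field_simps)
  next
    case False
    hence "x \<le> \<alpha>" using that by auto
    thus ?thesis using \<alpha>p by (intro exI[of _ "(\<alpha> - p$1) / (x - p$1)"]) (auto simp: field_simps)
  qed
  have strip: "\<alpha> < z$1 \<and> z$1 < \<beta>" if z: "z \<in> B" for z
  proof (rule ccontr)
    assume "\<not> (\<alpha> < z$1 \<and> z$1 < \<beta>)"
    then obtain \<theta> where \<theta>: "0 \<le> \<theta>" "\<theta> \<le> 1" "p$1 + \<theta> * (z$1 - p$1) = \<alpha> \<or> p$1 + \<theta> * (z$1 - p$1) = \<beta>" using cross by blast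
    define y where "y = p + \<theta> *\<^sub>R (z - p)"
    have zD: "z \<in> pgon R" "height p w v z < l" using z t(9) by auto
    have "y = (1 - \<theta>) *\<^sub>R p + \<theta> *\<^sub>R z" unfolding y_def by (simp add: algebra_simps)
    hence "y \<in> pgon R" using convexD_alt[OF r(3) pD zD(1) \<theta>(1,2)] by simp
    moreover have "height p w v y < l" unfolding y_def height_scale using \<theta> zD(2) t(6)
      by (smt (verit) mult_left_le_one_le mult_nonneg_nonpos)
    ultimately show False using edge[of y] \<theta>(3) by (simp add: y_def)
  qed
  have strip': "\<alpha> < z$1 \<and> z$1 < \<beta>" if z: "z \<in> B'" for z
  proof (rule ccontr)
    assume "\<not> (\<alpha> < z$1 \<and> z$1 < \<beta>)"
    then obtain \<theta> where \<theta>: "0 \<le> \<theta>" "\<theta> \<le> 1" "p$1 + \<theta> * (z$1 - p$1) = \<alpha> \<or> p$1 + \<theta> * (z$1 - p$1) = \<beta>" using cross by blast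
    define y' where "y' = ?\<sigma> p + \<theta> *\<^sub>R (?\<sigma> z - ?\<sigma> p)"
    obtain y where y: "y' = ?\<sigma> y" using vshear_inverse(2)[of "act_shift g R" y'] unfolding am by metis
    have "?\<sigma> z \<in> ?\<sigma> ` B'" using z by blast
    hence zD: "?\<sigma> z \<in> pgon ?R" "height (?\<sigma> p) (T w) (T v) (?\<sigma> z) < l" using t'(9) by blast+
    have "y' = (1 - \<theta>) *\<^sub>R ?\<sigma> p + \<theta> *\<^sub>R ?\<sigma> z" unfolding y'_def by (simp add: algebra_simps)
    moreover have "?\<sigma> p \<in> pgon ?R" using pD by simp
    ultimately have "y' \<in> pgon ?R" using convexD_alt[OF r'(3) _ zD(1) \<theta>(1,2)] by simp
    hence yD: "y \<in> pgon R" unfolding y by (simp add: am)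
    have "height (?\<sigma> p) (T w) (T v) y' < l" unfolding y'_def height_scale using \<theta> zD(2) t(6)
      by (smt (verit) mult_left_le_one_le mult_nonneg_nonpos)
    moreover have yx: "y$1 = p$1 + \<theta> * (z$1 - p$1)" using arg_cong[OF y, of "\<lambda>x. x$1"] unfolding y'_def by (simp add: am)
    moreover have "\<alpha> \<le> y$1" "y$1 \<le> \<beta>" using yx \<theta>(3) \<alpha>p \<beta>p by auto
    ultimately have "height p w v y < l" using hfe[of y] y by simp
    thus False using edge[OF yD] yx \<theta>(3) by simp
  qed
  show "B' = B"
  proof (intro equalityI subsetI)
    fix z assume z: "z \<in> B'"
    hence "?\<sigma> z \<in> ?\<sigma> ` B'" by blast
    hence "?\<sigma> z \<in> pgon ?R" "height (?\<sigma> p) (T w) (T v) (?\<sigma> z) < l" using t'(9) by blast+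
    moreover have "height (?\<sigma> p) (T w) (T v) (?\<sigma> z) = height p w v z" using hfe strip'[OF z] by simp
    ultimately show "z \<in> B" unfolding t(9) by (simp add: am)
  next
    fix z assume z: "z \<in> B"
    hence "z \<in> pgon R" "height p w v z < l" using t(9) by auto
    moreover have "height (?\<sigma> p) (T w) (T v) (?\<sigma> z) = height p w v z" using hfe strip[OF z] by simp
    ultimately have "?\<sigma> z \<in> ?\<sigma> ` B'" unfolding t'(9) by simp
    thus "z \<in> B'" by (simp add: am)
  qed
qed

lemma packed_triangle_unique:
  assumes "is_rep R" "packed_triangle R p l B" "packed_triangle R p l B'" shows "B' = B"
proof -
  obtain g where g: "g \<in> grp (length (marks R))" "straight_triangle (act g R) (act_map g R p) l (act_map g R ` B)"
    using assms(2) packed_triangle_iff[OF assms(1)] by blast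
  have R': "is_rep (act g R)" by (rule is_rep_act[OF assms(1) g(1)])
  have "packed_triangle (act g R) (act_map g R p) l (act_map g R ` B')" using packed_triangle_act[OF assms(1) g(1)] assms(3) by blast
  then obtain h where h: "h \<in> grp (length (marks (act g R)))"
    "straight_triangle (act h (act g R)) (act_map h (act g R) (act_map g R p)) l (act_map h (act g R) ` act_map g R ` B')"
    using packed_triangle_iff[OF R'] by blast
  have "act_map g R ` B' = act_map g R ` B" by (rule straight_triangle_unique[OF R' h(1) g(2) h(2)])
  thus ?thesis using inj_vshear by (simp add: act_map_vshear[OF g(1)] inj_image_eq_iff)
qed

section \<open>Necessary and sufficient bounds for a single triangle\<close>

definition prev_index :: "srep \<Rightarrow> nat \<Rightarrow> nat" where
  "prev_index R i = (i + ncorners R - 1) mod ncorners R"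

definition chain_at :: "srep \<Rightarrow> nat \<Rightarrow> bool \<Rightarrow> (real^2) list" where
  "chain_at R i cw = (if cw then semi_edge R i else rev (semi_edge R (prev_index R i)))"

lemma emanating_eq: "emanating R i = {chain_at R i True, chain_at R i False}"
  by (simp add: emanating_def chain_at_def prev_index_def)

lemma corner_mod:
  assumes "is_rep R" "i < ncorners R"
  shows "corner R (Suc i mod ncorners R) = next_corner R (corner R i)"
proof (cases "Suc i = ncorners R")
  case True
  hence "next_corner R (corner R i) = corner R 0" using corner_enumeration(2)[OF assms(1)] by (metis corner_Suc)
  thus ?thesis using True by simp
next
  case False
  hence "Suc i mod ncorners R = Suc i" using assms(2) by simp
  thus ?thesis by (simp add: corner_Suc)
qed

lemma prev_index:
  assumes "is_rep R" "i < ncorners R"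
  shows "prev_index R i < ncorners R" "Suc (prev_index R i) mod ncorners R = i" "corner R i = next_corner R (corner R (prev_index R i))"
proof -
  have d: "ncorners R > 0" using assms(2) by simp
  show lt: "prev_index R i < ncorners R" unfolding prev_index_def using d by simp
  show e: "Suc (prev_index R i) mod ncorners R = i"
  proof (cases i)
    case 0 thus ?thesis unfolding prev_index_def using d by simp
  next
    case (Suc j)
    hence "prev_index R i = j" unfolding prev_index_def using assms(2) by simp
    thus ?thesis using Suc assms(2) by simp
  qed
  show "corner R i = next_corner R (corner R (prev_index R i))" using corner_mod[OF assms(1) lt] e by simp
qed

lemma prev_index_Suc:
  assumes "is_rep R" "i < ncorners R" shows "prev_index R (Suc i mod ncorners R) = i"
proof (cases "Suc i = ncorners R")
  case True thus ?thesis using assms(2) by (simp add: prev_index_def)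
next
  case False
  hence "Suc i < ncorners R" using assms(2) by simp
  thus ?thesis by (simp add: prev_index_def)
qed

lemma chain_at_emanates:
  assumes "is_rep R" "i < ncorners R" "primitive_vec v" "tangent 1 (pgon R) (corner R i) v" "primitive_vec w" "tangent (-1) (pgon R) (corner R i) w"
  shows "emanates R (corner R i) 1 v (chain_at R i True)" "emanates R (corner R i) (-1) w (chain_at R i False)"
proof -
  note r = is_repD[OF assms(1)]
  show "emanates R (corner R i) 1 v (chain_at R i True)" unfolding chain_at_def semi_edge_eq
    using edge_chain_props(1)[OF assms(1) true_corner_extreme[OF corner_true[OF assms(1)]] assms(3,4)] by simp
  let ?q = "corner R (prev_index R i)"
  have ex: "?q extreme_point_of pgon R" by (rule true_corner_extreme[OF corner_true[OF assms(1)]])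
  obtain v' where v': "primitive_vec v'" "tangent 1 (pgon R) ?q v'" using rep_dirs[OF assms(1) extreme_frontier[OF r(4) ex]] by metis
  obtain w' where w': "emanates R (next_corner R ?q) (-1) w' (rev (edge_chain R ?q))" using edge_chain_props(2)[OF assms(1) ex v'] by blast
  have em: "emanates R (corner R i) (-1) w' (rev (edge_chain R ?q))" using w' prev_index(3)[OF assms(1,2)] by simp
  have "w' = w" by (rule tangent_primitive_unique[OF assms(6) emanatesD(2)[OF em] _ r(4) assms(5) emanatesD(1)[OF em]]) simp
  thus "emanates R (corner R i) (-1) w (chain_at R i False)" using em by (simp add: chain_at_def semi_edge_eq)
qed

lemma chain_at_rev:
  assumes "is_rep R" "q \<in> chain_set (semi_edge R i)"
  shows "chain_length (rev (semi_edge R i)) = edge_length R i"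
    "path_length_to (semi_edge R i) q + path_length_to (rev (semi_edge R i)) q = edge_length R i"
  using chain_length_rev_edge_chain[OF assms(1) true_corner_extreme[OF corner_true[OF assms(1)]] assms(2)[unfolded semi_edge_eq]]
  unfolding edge_length_def semi_edge_eq by auto

lemma semi_edge_nonempty:
  assumes "is_rep R" shows "corner R i \<in> chain_set (semi_edge R i)"
proof -
  note ex = true_corner_extreme[OF corner_true[OF assms]]
  obtain v where v: "primitive_vec v" "tangent 1 (pgon R) (corner R i) v"
    using rep_dirs[OF assms extreme_frontier[OF is_repD(4)[OF assms] ex]] by metis
  note e = edge_chain_props(1)[OF assms ex v]
  show ?thesis unfolding semi_edge_eq using emanates_ray(1)[OF e, of 0] tangentD(2)[OF v(2)] by simp
qed

text \<open>\<open>edge_chain_act\<close> covers the forward orientation; on the reversed chain the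
  path length is the edge length minus the forward one, and both are invariant.\<close>

lemma chain_at_act:
  assumes "is_rep R" "g \<in> grp (length (marks R))"
  shows "chain_set (chain_at (act g R) i c) = act_map g R ` chain_set (chain_at R i c)"
    "\<And>q. q \<in> chain_set (chain_at R i c) \<Longrightarrow> path_length_to (chain_at (act g R) i c) (act_map g R q) = path_length_to (chain_at R i c) q"
proof -
  have R': "is_rep (act g R)" by (rule is_rep_act[OF assms])
  have pr: "prev_index (act g R) i = prev_index R i" by (simp add: prev_index_def ncorners_act[OF assms])
  note ea = edge_chain_act[OF assms corner_true[OF assms(1)], folded corner_act[OF assms] semi_edge_eq]
  show set: "chain_set (chain_at (act g R) i c) = act_map g R ` chain_set (chain_at R i c)"
    unfolding chain_at_def pr using ea(1) by (simp add: chain_set_rev)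
  fix q assume q: "q \<in> chain_set (chain_at R i c)"
  show "path_length_to (chain_at (act g R) i c) (act_map g R q) = path_length_to (chain_at R i c) q"
  proof (cases c)
    case True thus ?thesis using ea(3) q by (simp add: chain_at_def)
  next
    case False
    hence q': "q \<in> chain_set (semi_edge R (prev_index R i))" using q by (simp add: chain_at_def chain_set_rev)
    hence gq: "act_map g R q \<in> chain_set (semi_edge (act g R) (prev_index R i))" using ea(1) by blast
    have "path_length_to (rev (semi_edge (act g R) (prev_index R i))) (act_map g R q) = path_length_to (rev (semi_edge R (prev_index R i))) q"
      using chain_at_rev(2)[OF assms(1) q'] chain_at_rev(2)[OF R' gq] ea(3)[OF q'] edge_length_act[OF assms, of "prev_index R i"] by linarith
    thus ?thesis using False by (simp add: chain_at_def pr)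
  qed
qed

lemma nearest_hit_iff:
  "nearest_hit R i j C q \<longleftrightarrow> (\<exists>c. C = chain_at R i c) \<and> q \<in> chain_set C \<and> q$1 = marks R ! j $ 1 \<and>
     (\<forall>c q'. q' \<in> chain_set (chain_at R i c) \<and> q'$1 = marks R ! j $ 1 \<longrightarrow> path_length_to C q \<le> path_length_to (chain_at R i c) q')"
proof -
  have E: "emanating R i = range (chain_at R i)" by (auto simp: emanating_eq UNIV_bool)
  have "(\<forall>C' q'. C' \<in> emanating R i \<and> X C' q' \<longrightarrow> Y C' q') \<longleftrightarrow> (\<forall>c q'. X (chain_at R i c) q' \<longrightarrow> Y (chain_at R i c) q')"
    for X Y :: "(real^2) list \<Rightarrow> real^2 \<Rightarrow> bool" unfolding E by auto
  from this[of "\<lambda>C' q'. q' \<in> chain_set C' \<and> q'$1 = marks R ! j $ 1" "\<lambda>C' q'. path_length_to C q \<le> path_length_to C' q'"]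
  show ?thesis unfolding nearest_hit_def E by (simp only: conj_assoc) (auto simp: image_iff)
qed

lemma nearest_hit_act:
  assumes "is_rep R" "g \<in> grp (length (marks R))" "j < length (marks R)" "nearest_hit R i j (chain_at R i c) q"
  shows "nearest_hit (act g R) i j (chain_at (act g R) i c) (act_map g R q)"
  unfolding nearest_hit_iff
proof (intro conjI allI impI)
  note ca = chain_at_act[OF assms(1,2)]
  have am: "act_map g R = vshear (act_shift g R)" by (rule act_map_vshear[OF assms(2)])
  note n = assms(4)[unfolded nearest_hit_iff]
  show "\<exists>c'. chain_at (act g R) i c = chain_at (act g R) i c'" by blast
  show "act_map g R q \<in> chain_set (chain_at (act g R) i c)" using n ca(1) by blast
  show "act_map g R q $ 1 = marks (act g R) ! j $ 1" using n assms(3) by (simp add: am)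
  fix c' q' assume q': "q' \<in> chain_set (chain_at (act g R) i c') \<and> q'$1 = marks (act g R) ! j $ 1"
  then obtain x where x: "q' = act_map g R x" "x \<in> chain_set (chain_at R i c')" using ca(1) by blast
  have "x$1 = marks R ! j $ 1" using q' x(1) assms(3) by (simp add: am)
  hence "path_length_to (chain_at R i c) q \<le> path_length_to (chain_at R i c') x" using n x(2) by blast
  thus "path_length_to (chain_at (act g R) i c) (act_map g R q) \<le> path_length_to (chain_at (act g R) i c') q'"
    using ca(2) x n by simp
qed

lemma edge_dir_corner:
  assumes "is_rep R" "p extreme_point_of pgon R" "primitive_vec v" "tangent 1 (pgon R) p v" "primitive_vec w" "tangent (-1) (pgon R) p w"
  shows "edge_dir (pgon R) p u \<longleftrightarrow> u = v \<or> u = w" "v \<noteq> w"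
proof -
  note r = is_repD[OF assms(1)]
  show "edge_dir (pgon R) p u \<longleftrightarrow> u = v \<or> u = w"
    using edge_dir_iff[OF r(1) assms(2)] tangent_primitive_unique[OF assms(4) _ _ r(4) assms(3), of u]
      tangent_primitive_unique[OF assms(6) _ _ r(4) assms(5), of u] assms by auto
  have "det2 w v > 0" using extreme_iff_det[OF r(3,4) assms(4,6)] assms(2) by blast
  thus "v \<noteq> w" by (auto simp: det2_simps)
qed

text \<open>Replaces the extended infimum by real inequalities with fixed directions. The absolute
  value makes the order of the two directions immaterial, and an empty infimum imposes
  nothing.\<close>

lemma marked_bound_iff:
  assumes "is_rep R" "primitive_vec v" "tangent 1 (pgon R) (corner R i) v" "primitive_vec w" "tangent (-1) (pgon R) (corner R i) w"
  shows "ereal l \<le> marked_bound R i \<longleftrightarrow> (\<forall>j c q. j < length (marks R) \<and> nearest_hit R i j (chain_at R i c) q \<longrightarrow>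
    l \<le> path_length_to (chain_at R i c) q + \<bar>marks R ! j $ 2 - q$2\<bar> * \<bar>v$1 - w$1\<bar>)"
proof -
  let ?p = "corner R i"
  have ex: "?p extreme_point_of pgon R" by (rule true_corner_extreme[OF corner_true[OF assms(1)]])
  note ed = edge_dir_corner[OF assms(1) ex assms(2-5)]
  define A where "A = {ereal (path_length_to C q + \<bar>marks R ! j $ 2 - q$2\<bar> * \<bar>v$1 - w$1\<bar>) |j C q v w.
            j < length (marks R) \<and> nearest_hit R i j C q \<and>
            edge_dir (pgon R) (corner R i) v \<and> edge_dir (pgon R) (corner R i) w \<and> v \<noteq> w}"
  have "x \<in> A \<longleftrightarrow> (\<exists>j c q. x = ereal (path_length_to (chain_at R i c) q + \<bar>marks R ! j $ 2 - q$2\<bar> * \<bar>v$1 - w$1\<bar>) \<and>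
      j < length (marks R) \<and> nearest_hit R i j (chain_at R i c) q)" for x
  proof
    assume "x \<in> A"
    then obtain j C q v' w' where a: "x = ereal (path_length_to C q + \<bar>marks R ! j $ 2 - q$2\<bar> * \<bar>v'$1 - w'$1\<bar>)"
      "j < length (marks R)" "nearest_hit R i j C q" "edge_dir (pgon R) ?p v'" "edge_dir (pgon R) ?p w'" "v' \<noteq> w'"
      unfolding A_def by blast
    have "\<bar>v'$1 - w'$1\<bar> = \<bar>v$1 - w$1\<bar>" using a(4-6) ed(1)[of v'] ed(1)[of w'] by (auto simp: abs_minus_commute)
    moreover obtain c where "C = chain_at R i c" using a(3) unfolding nearest_hit_iff by blast
    ultimately show "\<exists>j c q. x = ereal (path_length_to (chain_at R i c) q + \<bar>marks R ! j $ 2 - q$2\<bar> * \<bar>v$1 - w$1\<bar>) \<and>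
      j < length (marks R) \<and> nearest_hit R i j (chain_at R i c) q" using a(1-3) by auto
  next
    assume "\<exists>j c q. x = ereal (path_length_to (chain_at R i c) q + \<bar>marks R ! j $ 2 - q$2\<bar> * \<bar>v$1 - w$1\<bar>) \<and>
      j < length (marks R) \<and> nearest_hit R i j (chain_at R i c) q"
    thus "x \<in> A" unfolding A_def using ed by blast
  qed
  hence A: "A = {x. \<exists>j c q. x = ereal (path_length_to (chain_at R i c) q + \<bar>marks R ! j $ 2 - q$2\<bar> * \<bar>v$1 - w$1\<bar>) \<and>
      j < length (marks R) \<and> nearest_hit R i j (chain_at R i c) q}" by blast
  have "ereal l \<le> marked_bound R i \<longleftrightarrow> (\<forall>x\<in>A. ereal l \<le> x)" unfolding marked_bound_def A_def[symmetric] by (rule le_Inf_iff)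
  also have "\<dots> \<longleftrightarrow> (\<forall>j c q. j < length (marks R) \<and> nearest_hit R i j (chain_at R i c) q \<longrightarrow>
    ereal l \<le> ereal (path_length_to (chain_at R i c) q + \<bar>marks R ! j $ 2 - q$2\<bar> * \<bar>v$1 - w$1\<bar>))" unfolding A by blast
  finally show ?thesis by simp
qed

lemma corner_dirs:
  assumes "is_rep R"
  obtains v w where "primitive_vec v" "tangent 1 (pgon R) (corner R i) v" "primitive_vec w" "tangent (-1) (pgon R) (corner R i) w"
  using rep_dirs[OF assms true_corner_frontier[OF assms corner_true[OF assms]]] .

lemma marked_bound_act_le:
  assumes "is_rep R" "g \<in> grp (length (marks R))" "ereal l \<le> marked_bound (act g R) i"
  shows "ereal l \<le> marked_bound R i"
proof -
  have R': "is_rep (act g R)" by (rule is_rep_act[OF assms(1,2)])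
  have am: "act_map g R = vshear (act_shift g R)" by (rule act_map_vshear[OF assms(2)])
  obtain v w where d: "primitive_vec v" "tangent 1 (pgon R) (corner R i) v" "primitive_vec w" "tangent (-1) (pgon R) (corner R i) w"
    using corner_dirs[OF assms(1)] .
  obtain v' where v': "primitive_vec v'" "tangent 1 (pgon (act g R)) (corner (act g R) i) v'" "v'$1 = v$1"
    unfolding corner_act[OF assms(1,2)] using act_dirs[OF assms(1,2) d(1,2)] by metis
  obtain w' where w': "primitive_vec w'" "tangent (-1) (pgon (act g R)) (corner (act g R) i) w'" "w'$1 = w$1"
    unfolding corner_act[OF assms(1,2)] using act_dirs[OF assms(1,2) d(3,4)] by metis
  show ?thesis unfolding marked_bound_iff[OF assms(1) d]
  proof (intro allI impI)
    fix j c q assume jq: "j < length (marks R) \<and> nearest_hit R i j (chain_at R i c) q"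
    hence "q \<in> chain_set (chain_at R i c)" unfolding nearest_hit_iff by blast
    note p = chain_at_act(2)[OF assms(1,2) this]
    have "nearest_hit (act g R) i j (chain_at (act g R) i c) (act_map g R q)" using nearest_hit_act[OF assms(1,2)] jq by blast
    hence "l \<le> path_length_to (chain_at (act g R) i c) (act_map g R q) + \<bar>marks (act g R) ! j $ 2 - act_map g R q $ 2\<bar> * \<bar>v'$1 - w'$1\<bar>"
      using marked_bound_iff[OF R' v'(1,2) w'(1,2)] assms(3) jq by simp
    moreover have "marks R ! j $ 1 = q$1" using jq unfolding nearest_hit_iff by auto
    ultimately show "l \<le> path_length_to (chain_at R i c) q + \<bar>marks R ! j $ 2 - q$2\<bar> * \<bar>v$1 - w$1\<bar>"
      unfolding p v'(3) w'(3) using jq by (simp add: am)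
  qed
qed

lemma marked_bound_act:
  assumes "is_rep R" "g \<in> grp (length (marks R))"
  shows "ereal l \<le> marked_bound (act g R) i \<longleftrightarrow> ereal l \<le> marked_bound R i"
proof
  assume l: "ereal l \<le> marked_bound R i"
  obtain h where h: "h \<in> grp (length (marks R))" "act h (act g R) = R" using act_inverse[OF is_repD(7)[OF assms(1)] assms(2)] by metis
  show "ereal l \<le> marked_bound (act g R) i"
    by (rule marked_bound_act_le[OF is_rep_act[OF assms], of h]) (use h l in auto)
qed (rule marked_bound_act_le[OF assms])

section \<open>Necessity of the bounds\<close>

lemma height_vertical:
  assumes "z$1 = y$1" shows "height p w v z = height p w v y + (w$1 - v$1) * (z$2 - y$2)"
  using assms by (simp add: height_eq algebra_simps)

text \<open>At a nearest hit the height equals the path length, and along the vertical it changes at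
  rate \<open>w$1 - v$1\<close>. If the bound failed, the marked point would have height less than
  \<open>l\<close> and lie in the triangle.\<close>

lemma cuts_off_bounds:
  assumes "is_rep R" "i < ncorners R" "cuts_off R (corner R i) l B v w"
  shows "l \<le> edge_length R i" "l \<le> edge_length R (prev_index R i)" "ereal l \<le> marked_bound R i"
proof -
  note r = is_repD[OF assms(1)] and t = cuts_offD[OF assms(3)]
  note em = chain_at_emanates[OF assms(1,2) t(1-4)]
  show "l \<le> edge_length R i" using emanates_ray(4)[OF em(1) t(7)] by (simp add: chain_at_def edge_length_def)
  show "l \<le> edge_length R (prev_index R i)" using emanates_ray(4)[OF em(2) t(8)]
      chain_at_rev(1)[OF assms(1) semi_edge_nonempty[OF assms(1)]] by (simp add: chain_at_def)
  show "ereal l \<le> marked_bound R i" unfolding marked_bound_iff[OF assms(1) t(1-4)]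
  proof (intro allI impI, rule ccontr)
    fix j c q assume jq: "j < length (marks R) \<and> nearest_hit R i j (chain_at R i c) q"
    let ?a = "path_length_to (chain_at R i c) q" and ?c = "marks R ! j"
    assume "\<not> l \<le> ?a + \<bar>?c$2 - q$2\<bar> * \<bar>v$1 - w$1\<bar>"
    hence lt: "?a + \<bar>?c$2 - q$2\<bar> * \<bar>v$1 - w$1\<bar> < l" by simp
    have q: "q \<in> chain_set (chain_at R i c)" "q$1 = ?c$1" using jq unfolding nearest_hit_iff by auto
    have "\<bar>?c$2 - q$2\<bar> * \<bar>v$1 - w$1\<bar> \<ge> 0" by simp
    hence al: "?a \<le> l" using lt by linarith
    have "height (corner R i) w v q = ?a"
    proof (cases c)
      case True
      hence "q = corner R i + ?a *\<^sub>R v" using emanates_point(1)[OF em(1) _ _ _ t(7) r(3)] q(1) al by simp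
      thus ?thesis using height_ray(1)[OF t(5)] by metis
    next
      case False
      hence "q = corner R i + ?a *\<^sub>R w" using emanates_point(1)[OF em(2) _ _ _ t(8) r(3)] q(1) al by simp
      thus ?thesis using height_ray(2)[OF t(5)] by metis
    qed
    hence "height (corner R i) w v ?c = ?a + (w$1 - v$1) * (?c$2 - q$2)" using height_vertical[of ?c q] q(2) by simp
    moreover have "(w$1 - v$1) * (?c$2 - q$2) \<le> \<bar>?c$2 - q$2\<bar> * \<bar>v$1 - w$1\<bar>"
      using abs_ge_self[of "(w$1 - v$1) * (?c$2 - q$2)"] by (simp add: abs_mult abs_minus_commute mult.commute)
    ultimately have "height (corner R i) w v ?c < l" using lt by linarith
    moreover have "?c \<in> pgon R" using jq r(8) interior_subset by (meson nth_mem subsetD)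
    ultimately have "?c \<in> B" using t(9) by blast
    thus False using t(11) jq by auto
  qed
qed

lemma packed_triangle_bounds:
  assumes "is_rep R" "i < ncorners R" "packed_triangle R (corner R i) l B"
  shows "l > 0" "l \<le> edge_length R i" "l \<le> edge_length R (prev_index R i)" "ereal l \<le> marked_bound R i"
proof -
  obtain g where g: "g \<in> grp (length (marks R))" "straight_triangle (act g R) (act_map g R (corner R i)) l (act_map g R ` B)"
    using assms(3) packed_triangle_iff[OF assms(1)] by blast
  have R': "is_rep (act g R)" by (rule is_rep_act[OF assms(1) g(1)])
  obtain v w where co: "cuts_off (act g R) (corner (act g R) i) l (act_map g R ` B) v w"
    using straight_triangle_cuts_off[OF R' g(2)] unfolding corner_act[OF assms(1) g(1)] by blast
  have i': "i < ncorners (act g R)" using assms(2) by (simp add: ncorners_act[OF assms(1) g(1)])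
  have pr: "prev_index (act g R) i = prev_index R i" by (simp add: prev_index_def ncorners_act[OF assms(1) g(1)])
  show "l > 0" using cuts_offD(6)[OF co] .
  show "l \<le> edge_length R i" "l \<le> edge_length R (prev_index R i)" "ereal l \<le> marked_bound R i"
    using cuts_off_bounds[OF R' i' co] edge_length_act[OF assms(1) g(1)] pr marked_bound_act[OF assms(1) g(1)] by auto
qed

section \<open>Sufficiency of the bounds\<close>

lemma chain_frontier:
  assumes "is_rep R" "i < ncorners R" "q \<in> chain_set (chain_at R i c)" "j < length (marks R)" "q$1 = marks R ! j $ 1"
    "primitive_vec u" "emanates R (corner R i) r u (chain_at R i c)" "r = 1 \<or> r = -1"
  shows "u$1 \<noteq> 0" "q \<in> frontier (pgon R)" "path_length_to (chain_at R i c) q = (q$1 - corner R i$1) / u$1"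
proof -
  let ?p = "corner R i"
  note rr = is_repD[OF assms(1)]
  have c: "marks R ! j \<in> interior (pgon R)" using rr(8) assms(4) by auto
  show u1: "u$1 \<noteq> 0"
  proof
    assume u0: "u$1 = 0"
    then obtain L where L: "single_edge (pgon R) ?p u (chain_at R i c) L" using emanates_short[OF assms(7)] by blast
    obtain s where "q = ?p + s *\<^sub>R u" using single_edgeD(5)[OF L] assms(3) by blast
    hence "marks R ! j $ 1 = ?p$1" using assms(5) u0 by simp
    moreover have "r * det2 u (marks R ! j - ?p) < 0"
      by (rule tangent_interior_strict[OF emanatesD(2)[OF assms(7)] _ c]) (use assms(8) in auto)
    ultimately show False using u0 by (simp add: det2_eq)
  qed
  have "vtop (r * sgn (u$1)) (pgon R) q" by (rule emanatesD(8)[OF assms(7) u1 assms(3)])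
  thus "q \<in> frontier (pgon R)" by (rule vtop_frontier) (use assms(8) u1 in \<open>auto simp: sgn_if\<close>)
  show "path_length_to (chain_at R i c) q = (q$1 - ?p$1) / u$1" by (rule emanates_path[OF assms(7) u1 assms(3)])
qed

text \<open>Each of the two edges meets the vertical line at one path length only, since it is not
  vertical itself; the smaller of at most two values is attained.\<close>

lemma nearest_hit_exists:
  assumes "is_rep R" "i < ncorners R" "j < length (marks R)" "q \<in> chain_set (chain_at R i c)" "q$1 = marks R ! j $ 1"
  shows "\<exists>c q. nearest_hit R i j (chain_at R i c) q"
proof -
  obtain v w where d: "primitive_vec v" "tangent 1 (pgon R) (corner R i) v" "primitive_vec w" "tangent (-1) (pgon R) (corner R i) w"
    using corner_dirs[OF assms(1)] .
  note em = chain_at_emanates[OF assms(1,2) d]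
  define a where "a c = (marks R ! j $ 1 - corner R i$1) / (if c then v$1 else w$1)" for c
  have pa: "path_length_to (chain_at R i c) q = a c" if "q \<in> chain_set (chain_at R i c)" "q$1 = marks R ! j $ 1" for q c
  proof (cases c)
    case True
    thus ?thesis using chain_frontier(3)[OF assms(1,2) that(1) assms(3) that(2) d(1)] em(1) that(2) unfolding a_def by simp
  next
    case False
    thus ?thesis using chain_frontier(3)[OF assms(1,2) that(1) assms(3) that(2) d(3)] em(2) that(2) unfolding a_def by simp
  qed
  show ?thesis
  proof (cases "\<exists>q'. q' \<in> chain_set (chain_at R i (\<not> c)) \<and> q'$1 = marks R ! j $ 1 \<and> a (\<not> c) < a c")
    case True
    then obtain q' where q': "q' \<in> chain_set (chain_at R i (\<not> c))" "q'$1 = marks R ! j $ 1" "a (\<not> c) < a c" by blast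
    have "nearest_hit R i j (chain_at R i (\<not> c)) q'" unfolding nearest_hit_iff
    proof (intro conjI allI impI)
      fix c' x assume x: "x \<in> chain_set (chain_at R i c') \<and> x$1 = marks R ! j $ 1"
      show "path_length_to (chain_at R i (\<not> c)) q' \<le> path_length_to (chain_at R i c') x"
        using pa[OF q'(1,2)] pa[of x c'] x q'(3) by (cases "c' = c") auto
    qed (use q' in auto)
    thus ?thesis by blast
  next
    case False
    have "nearest_hit R i j (chain_at R i c) q" unfolding nearest_hit_iff
    proof (intro conjI allI impI)
      fix c' x assume x: "x \<in> chain_set (chain_at R i c') \<and> x$1 = marks R ! j $ 1"
      show "path_length_to (chain_at R i c) q \<le> path_length_to (chain_at R i c') x"
      proof (cases "c' = c")
        case True thus ?thesis using pa[OF assms(4,5)] pa[of x c'] x by simp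
      next
        case F: False
        hence "c' = (\<not> c)" by auto
        thus ?thesis using pa[OF assms(4,5)] pa[of x c'] x False by force
      qed
    qed (use assms in auto)
    thus ?thesis by blast
  qed
qed

text \<open>
  If all cuts near the corner point away from the nearest hits, the shorter of the two
  straight edges at the corner can only end in a fake corner whose marked point violates
  the bound on \<open>l\<close>.
\<close>

lemma first_edge_long:
  fixes r :: real
  assumes "is_rep R" "i < ncorners R" "primitive_vec v" "tangent 1 (pgon R) (corner R i) v" "primitive_vec w" "tangent (-1) (pgon R) (corner R i) w"
    and det: "det2 w v = 1"
    and away: "\<And>j c q. j < length (marks R) \<Longrightarrow> nearest_hit R i j (chain_at R i c) q \<Longrightarrow>
       \<exists>c q. nearest_hit R i j (chain_at R i c) q \<and> q \<notin> cut R j"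
    and mb: "ereal l \<le> marked_bound R i"
    and u: "(c = True \<and> r = 1 \<and> u = v \<and> u' = w) \<or> (c = False \<and> r = -1 \<and> u = w \<and> u' = v)"
    and s: "corner R i + s *\<^sub>R u \<in> pgon R" "ncuts R (corner R i + s *\<^sub>R u) \<ge> 1" "s < l"
    and s': "corner R i + s' *\<^sub>R u' \<in> pgon R" "s \<le> s'"
  shows False
proof -
  let ?p = "corner R i"
  note rr = is_repD[OF assms(1)]
  note em0 = chain_at_emanates[OF assms(1-6)]
  have em: "emanates R ?p r u (chain_at R i c)" and em': "emanates R ?p (- r) u' (chain_at R i (\<not> c))" and r: "r = 1 \<or> r = -1"
    using u em0 by auto
  have pu: "primitive_vec u" "primitive_vec u'" using u assms(3,5) by auto
  have hu: "height ?p w v (?p + x *\<^sub>R u) = x" "height ?p w v (?p + x *\<^sub>R u') = x" for x using u height_ray[OF det] by auto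
  \<comment> \<open>The end of the shorter straight edge, on a cut of some marked point
    \<open>k\<close>. As \<open>z\<close> is a hit for \<open>k\<close>, a nearest hit
    \<open>q\<close> off that cut is at most as far from the corner.\<close>
  define z where "z = ?p + s *\<^sub>R u"
  obtain k where k: "k < length (marks R)" "marks R ! k $ 1 = z$1" "z \<in> cut R k" using ncuts_pos[OF s(2)] unfolding z_def by metis
  have zc: "z \<in> chain_set (chain_at R i c)" "path_length_to (chain_at R i c) z = s" using emanates_ray(1,2)[OF em s(1)] unfolding z_def by auto
  obtain c1 q where q: "nearest_hit R i k (chain_at R i c1) q" "q \<notin> cut R k"
    using away[OF k(1)] nearest_hit_exists[OF assms(1,2) k(1) zc(1)] k(2) by metis
  let ?a = "path_length_to (chain_at R i c1) q"
  have qn: "q \<in> chain_set (chain_at R i c1)" "q$1 = z$1" "?a \<le> s"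
    using q(1) zc k(2) unfolding nearest_hit_iff by auto
  have zq: "z \<noteq> q" using k(3) q(2) by blast
  have zf: "u$1 \<noteq> 0" "z \<in> frontier (pgon R)" using chain_frontier[OF assms(1,2) zc(1) k(1) _ pu(1) em r] k(2) by auto
  show False
  proof (cases "c1 = c")
    case True
    hence "q = ?p + ?a *\<^sub>R u" using emanates_point(1)[OF em r _ _ s(1) rr(3)] qn by simp
    hence "?a * u$1 = s * u$1" using qn(2) unfolding z_def by (metis add_left_cancel vector_add_component vector_scaleR_component real_scaleR_def)
    hence "?a = s" using zf(1) by simp
    thus False using \<open>q = ?p + ?a *\<^sub>R u\<close> zq unfolding z_def by simp
  next
    case False
    hence c1: "c1 = (\<not> c)" by auto
    have r': "- r = 1 \<or> - r = -1" using r by auto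
    have qe: "q = ?p + ?a *\<^sub>R u'" using emanates_point(1)[OF em' r' _ _ s'(1) rr(3)] qn s'(2) c1 by simp
    have qf: "q \<in> frontier (pgon R)" using chain_frontier(2)[OF assms(1,2) qn(1) k(1) _ pu(2) _ r'] em' c1 qn(2) k(2) by simp
    have ci: "marks R ! k \<in> interior (pgon R)" using rr(8) k(1) by auto
    let ?c = "marks R ! k"
    obtain t where t: "t = 1 \<or> t = -1" "t * z$2 > t * ?c$2" "t * ?c$2 > t * q$2"
      using opposite_boundary[OF zf(2) qf ci _ _ zq rr(1)] k(2) qn(2) by metis
    \<comment> \<open>The marked point lies vertically between \<open>q\<close> and
      \<open>z\<close>, so its distance to \<open>q\<close>, weighted by the slope, is at most the
      height difference \<open>s - ?a\<close>. The bound at \<open>q\<close> is then at most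
      \<open>s\<close>, which is less than \<open>l\<close>.\<close>
    let ?k = "w$1 - v$1"
    have hz: "s = ?a + ?k * (z$2 - q$2)" using height_vertical[of z q ?p w v] qn(2) hu(1)[of s] hu(2)[of ?a] qe unfolding z_def by simp
    have "\<bar>?c$2 - q$2\<bar> * \<bar>?k\<bar> \<le> \<bar>z$2 - q$2\<bar> * \<bar>?k\<bar>" using t by (intro mult_right_mono) auto
    also have "\<dots> = \<bar>s - ?a\<bar>" using hz by (simp add: abs_mult[symmetric] mult.commute)
    also have "\<dots> = s - ?a" using qn(3) by simp
    finally have "?a + \<bar>?c$2 - q$2\<bar> * \<bar>v$1 - w$1\<bar> \<le> s" by (simp add: abs_minus_commute)
    moreover have "l \<le> ?a + \<bar>?c$2 - q$2\<bar> * \<bar>v$1 - w$1\<bar>"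
      using marked_bound_iff[OF assms(1,3-6)] mb k(1) q(1) by blast
    ultimately show False using s(3) by linarith
  qed
qed

text \<open>The hypothesis \<open>away\<close> makes the corner Delzant and both edges straight up
  to distance \<open>l\<close>. A marked point in the resulting triangle would contradict its own
  bound, because the lower end of its slice, in terms of height, is a nearest hit.\<close>

lemma straight_triangle_exists:
  assumes "is_rep R" "i < ncorners R" "l > 0" "l \<le> edge_length R i" "l \<le> edge_length R (prev_index R i)"
    and mb: "ereal l \<le> marked_bound R i"
    and away: "\<And>j c q. j < length (marks R) \<Longrightarrow> nearest_hit R i j (chain_at R i c) q \<Longrightarrow>
       \<exists>c q. nearest_hit R i j (chain_at R i c) q \<and> q \<notin> cut R j"
  shows "\<exists>B. straight_triangle R (corner R i) l B"
proof -
  let ?p = "corner R i" and ?D = "pgon R"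
  note rr = is_repD[OF assms(1)]
  obtain v w where d: "primitive_vec v" "tangent 1 ?D ?p v" "primitive_vec w" "tangent (-1) ?D ?p w"
    using corner_dirs[OF assms(1)] .
  note em = chain_at_emanates[OF assms(1,2) d]
  have pD: "?p \<in> ?D" by (rule tangentD(2)[OF d(2)])
  note tc = corner_true[OF assms(1), of i]
  \<comment> \<open>A marked point over the corner has the corner itself as its nearest hit, at
    distance 0, and by \<open>away\<close> its cut avoids that point.\<close>
  have "ncuts R ?p = 0"
  proof (rule ccontr)
    assume "ncuts R ?p \<noteq> 0"
    then obtain k where k: "k < length (marks R)" "marks R ! k $ 1 = ?p$1" "?p \<in> cut R k" using ncuts_pos[of R ?p] by force
    have p0: "?p \<in> chain_set (chain_at R i True)" "path_length_to (chain_at R i True) ?p = 0"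
      using emanates_ray(1,2)[OF em(1), of 0] pD by auto
    obtain c q where q: "nearest_hit R i k (chain_at R i c) q" "q \<notin> cut R k"
      using away[OF k(1)] nearest_hit_exists[OF assms(1,2) k(1) p0(1)] k(2) by metis
    have qn: "q \<in> chain_set (chain_at R i c)" "path_length_to (chain_at R i c) q \<le> 0"
      using q(1) p0 k(2) unfolding nearest_hit_iff by metis+
    have "q = ?p"
    proof (cases c)
      case True
      hence e: "emanates R ?p 1 v (chain_at R i c)" using em by simp
      have "path_length_to (chain_at R i c) q = 0" using emanates_path_bounds[OF e qn(1)] qn(2) by simp
      thus ?thesis using emanates_point(1)[OF e _ qn, of] pD rr(3) by simp
    next
      case False
      hence e: "emanates R ?p (-1) w (chain_at R i c)" using em by simp
      have "path_length_to (chain_at R i c) q = 0" using emanates_path_bounds[OF e qn(1)] qn(2) by simp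
      thus ?thesis using emanates_point(1)[OF e _ qn, of] pD rr(3) by simp
    qed
    thus False using q(2) k(3) by simp
  qed
  hence dc: "delzant_corner R ?p" using tc assms(1) unfolding true_corner_def hidden_corner_def delzant_corner_def is_rep_def by auto
  have det: "det2 w v = 1" by (rule delzant_det[OF assms(1) dc d])
  obtain a where a: "?p + a *\<^sub>R v \<in> ?D" "a < edge_length R i \<Longrightarrow> ncuts R (?p + a *\<^sub>R v) \<ge> 1" "a > 0"
  proof -
    obtain a where "?p + a *\<^sub>R v \<in> ?D" "a < chain_length (chain_at R i True) \<Longrightarrow> ncuts R (?p + a *\<^sub>R v) \<ge> 1" "a > 0"
      using emanates_max[OF em(1)] by metis
    thus ?thesis using that by (simp add: chain_at_def edge_length_def)
  qed
  obtain b where b: "?p + b *\<^sub>R w \<in> ?D" "b < edge_length R (prev_index R i) \<Longrightarrow> ncuts R (?p + b *\<^sub>R w) \<ge> 1" "b > 0"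
  proof -
    obtain b where "?p + b *\<^sub>R w \<in> ?D" "b < chain_length (chain_at R i False) \<Longrightarrow> ncuts R (?p + b *\<^sub>R w) \<ge> 1" "b > 0"
      using emanates_max[OF em(2)] by metis
    thus ?thesis using that chain_at_rev(1)[OF assms(1) semi_edge_nonempty[OF assms(1)]] by (simp add: chain_at_def)
  qed
  have long: "l \<le> a \<and> l \<le> b"
  proof (rule ccontr)
    assume n: "\<not> (l \<le> a \<and> l \<le> b)"
    show False
    proof (cases "a \<le> b")
      case True
      show False
        by (rule first_edge_long[OF assms(1,2) d det away mb, where c = True and r = 1 and u = v and u' = w and s = a and s' = b]) (use True n a b assms(4) in auto)
    next
      case False
      show False
        by (rule first_edge_long[OF assms(1,2) d det away mb, where c = False and r = "-1" and u = w and u' = v and s = b and s' = a]) (use False n a b assms(5) in auto)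
    qed
  qed
  have ends: "?p + l *\<^sub>R v \<in> ?D" "?p + l *\<^sub>R w \<in> ?D"
    using ray_mem[OF rr(3) pD a(1)] ray_mem[OF rr(3) pD b(1)] long assms(3) by auto
  define B where "B = {z\<in>?D. height ?p w v z < l}"
  have tri: "B = {?p + s *\<^sub>R w + t *\<^sub>R v |s t. 0 \<le> s \<and> 0 \<le> t \<and> s + t < l}"
    unfolding B_def by (rule corner_triangle_eq[OF rr(3) d(2,4) det ends])
  have nomark: "c \<notin> B" if cm: "c \<in> set (marks R)" for c
  proof
    assume cB: "c \<in> B"
    obtain j where j: "j < length (marks R)" "c = marks R ! j" using cm by (metis in_set_conv_nth)
    have ci: "c \<in> interior ?D" using rr(8) cm by blast
    have cD: "c \<in> ?D" "height ?p w v c < l" using cB unfolding B_def by auto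
    define k where "k = w$1 - v$1"
    \<comment> \<open>The vertical direction in which the height does not increase. The end
      \<open>q\<close> of the slice on that side therefore still lies in \<open>B\<close>.\<close>
    define s where "s = (if k \<le> 0 then 1 else -1 :: real)"
    have s: "s = 1 \<or> s = -1" "s * k \<le> 0" unfolding s_def by auto
    obtain q where q: "vtop s ?D q" "q$1 = c$1" using vtop_exists[OF rr(6) cD(1)] by metis
    have qc: "s * (q$2 - c$2) > 0" by (rule vtop_interior[OF q(1) ci _ s(1)]) (use q(2) in simp)
    have hq: "height ?p w v q = height ?p w v c + k * (q$2 - c$2)" unfolding k_def by (rule height_vertical[OF q(2)])
    have kq: "k * (q$2 - c$2) \<le> 0" using s qc by (auto simp: mult_le_0_iff zero_less_mult_iff)
    have hql: "height ?p w v q < l" using hq kq cD(2) by simp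
    have qD: "q \<in> ?D" using q(1) by (simp add: vtop_def)
    have qB: "q \<in> B" unfolding B_def using qD hql by blast
    have qf: "q \<in> frontier ?D" by (rule vtop_frontier[OF q(1) s(1)])
    have "\<exists>cc. q \<in> chain_set (chain_at R i cc) \<and> path_length_to (chain_at R i cc) q = height ?p w v q"
    proof -
      let ?O = "{z. 0 < det2 (z - ?p) v} \<inter> {z. 0 < det2 w (z - ?p)} \<inter> {z. height ?p w v z < l}"
      have "continuous_on UNIV (\<lambda>z. det2 (z - ?p) v)" "continuous_on UNIV (\<lambda>z. det2 w (z - ?p))"
        unfolding det2_eq by (intro continuous_intros)+
      hence O: "open ?O" using continuous_height by (intro open_Int open_Collect_less continuous_on_const) auto
      have "?O \<subseteq> ?D"
      proof
        fix x assume x: "x \<in> ?O"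
        have "x = ?p + det2 (x - ?p) v *\<^sub>R w + det2 w (x - ?p) *\<^sub>R v" by (rule cone_coordinates[OF det])
        moreover have "det2 (x - ?p) v + det2 w (x - ?p) < l" using x by (simp add: height_def)
        moreover have "0 \<le> det2 (x - ?p) v" "0 \<le> det2 w (x - ?p)" using x by auto
        ultimately have "x \<in> B" unfolding tri by blast
        thus "x \<in> ?D" unfolding B_def by blast
      qed
      hence "?O \<subseteq> interior ?D" using O by (rule interior_maximal)
      hence nO: "q \<notin> ?O" using qf by (auto simp: frontier_def)
      obtain x y where xy: "q = ?p + x *\<^sub>R w + y *\<^sub>R v" "0 \<le> x" "0 \<le> y" "x + y < l" using qB tri by blast
      have "det2 (q - ?p) v = x" "det2 w (q - ?p) = y" unfolding xy(1) using det by (simp_all add: det2_simps)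
      hence "x = 0 \<or> y = 0" using nO xy hql by auto
      thus ?thesis
      proof
        assume x0: "x = 0"
        hence qe: "q = ?p + y *\<^sub>R v" using xy(1) by simp
        have "?p + y *\<^sub>R v \<in> ?D" using qe qD by simp
        thus ?thesis using emanates_ray(1,2)[OF em(1)] qe height_ray(1)[OF det] by metis
      next
        assume y0: "y = 0"
        hence qe: "q = ?p + x *\<^sub>R w" using xy(1) by simp
        have "?p + x *\<^sub>R w \<in> ?D" using qe qD by simp
        thus ?thesis using emanates_ray(1,2)[OF em(2)] qe height_ray(2)[OF det] by metis
      qed
    qed
    then obtain cc where cc: "q \<in> chain_set (chain_at R i cc)" "path_length_to (chain_at R i cc) q = height ?p w v q" by blast
    \<comment> \<open>A closer hit would be the other end of the slice. It lies across the marked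
      point, in the direction in which the height does not decrease, so it cannot be closer.\<close>
    have "nearest_hit R i j (chain_at R i cc) q" unfolding nearest_hit_iff
    proof (intro conjI allI impI)
      show "q$1 = marks R ! j $ 1" using q(2) j(2) by simp
      fix c' q' assume q': "q' \<in> chain_set (chain_at R i c') \<and> q'$1 = marks R ! j $ 1"
      show "path_length_to (chain_at R i cc) q \<le> path_length_to (chain_at R i c') q'"
      proof (rule ccontr)
        assume lt: "\<not> path_length_to (chain_at R i cc) q \<le> path_length_to (chain_at R i c') q'"
        let ?a = "path_length_to (chain_at R i c') q'"
        have al: "?a \<le> l" using lt cc(2) hql by simp
        have "height ?p w v q' = ?a \<and> q' \<in> frontier ?D"
        proof (cases c')
          case True
          hence e: "emanates R ?p 1 v (chain_at R i c')" using em by simp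
          have "q' = ?p + ?a *\<^sub>R v" using emanates_point(1)[OF e _ _ al ends(1) rr(3)] q' by simp
          moreover have "q' \<in> frontier ?D" using chain_frontier(2)[OF assms(1,2) _ j(1) _ d(1) e] q' by simp
          ultimately show ?thesis using height_ray(1)[OF det] by metis
        next
          case False
          hence e: "emanates R ?p (-1) w (chain_at R i c')" using em by simp
          have "q' = ?p + ?a *\<^sub>R w" using emanates_point(1)[OF e _ _ al ends(2) rr(3)] q' by simp
          moreover have "q' \<in> frontier ?D" using chain_frontier(2)[OF assms(1,2) _ j(1) _ d(3) e] q' by simp
          ultimately show ?thesis using height_ray(2)[OF det] by metis
        qed
        hence q'h: "height ?p w v q' = ?a" "q' \<in> frontier ?D" by auto
        have q'x: "q'$1 = c$1" using q' j(2) by simp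
        have neq: "q \<noteq> q'" using lt cc(2) q'h(1) by auto
        obtain t where t: "t = 1 \<or> t = -1" "t * q$2 > t * c$2" "t * c$2 > t * q'$2"
          using opposite_boundary[OF qf q'h(2) ci q(2) q'x neq rr(1)] by blast
        have ts: "t = s" using t(1,2) qc s(1) by auto
        have "height ?p w v q' = height ?p w v c + k * (q'$2 - c$2)" unfolding k_def by (rule height_vertical[OF q'x])
        moreover have "k * (q'$2 - c$2) \<ge> 0" using s t(3) ts by (auto simp: zero_le_mult_iff)
        ultimately show False using lt cc(2) q'h(1) hq kq by linarith
      qed
    qed (use cc in auto)
    hence "l \<le> height ?p w v q + \<bar>c$2 - q$2\<bar> * \<bar>v$1 - w$1\<bar>"
      using marked_bound_iff[OF assms(1) d] mb j cc(2) by metis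
    moreover have "\<bar>c$2 - q$2\<bar> * \<bar>v$1 - w$1\<bar> = \<bar>k * (q$2 - c$2)\<bar>" unfolding k_def by (simp add: abs_mult abs_minus_commute mult.commute)
    ultimately show False using hq kq cD(2) by simp
  qed
  have "straight_triangle R ?p l B"
    unfolding straight_triangle_iff[OF assms(1) dc d] using assms(3) ends nomark B_def by blast
  thus ?thesis by blast
qed

text \<open>Moves to the representative in which every cut points away from a chosen nearest hit,
  builds a straight triangle there and pulls it back.\<close>

lemma packed_triangle_exists:
  assumes "is_rep R" "i < ncorners R" "l > 0" "l \<le> edge_length R i" "l \<le> edge_length R (prev_index R i)" "ereal l \<le> marked_bound R i"
  shows "\<exists>B. packed_triangle R (corner R i) l B"
proof -
  note rr = is_repD[OF assms(1)]
  let ?m = "length (marks R)"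
  define hit where "hit j q \<longleftrightarrow> (\<exists>c. nearest_hit R i j (chain_at R i c) q)" for j q
  \<comment> \<open>Chosen so that the new sign is 1 exactly if the marked point is not below its
    chosen hit. For a marked point without hits the choice is arbitrary and harmless.\<close>
  define e where "e = map (\<lambda>j. if marks R ! j $ 2 - (SOME q. hit j q)$2 \<ge> 0 then signs R ! j else - signs R ! j) [0..<?m]"
  have sg: "signs R ! j = 1 \<or> signs R ! j = -1" if "j < ?m" for j using pm1_nth that rr(7) unfolding wf_rep_def by metis
  have e: "length e = ?m" "set e \<subseteq> {-1, 1}" unfolding e_def using sg by (simp, fastforce)
  define g where "g = group_elt 0 0 e"
  have g: "g \<in> grp ?m" unfolding g_def using e by (simp add: group_elt_grp)
  let ?R = "act g R" and ?\<sigma> = "act_map g R"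
  have R': "is_rep ?R" by (rule is_rep_act[OF assms(1) g])
  have am: "?\<sigma> = vshear (act_shift g R)" by (rule act_map_vshear[OF g])
  have i': "i < ncorners ?R" using assms(2) by (simp add: ncorners_act[OF assms(1) g])
  have pr: "prev_index ?R i = prev_index R i" by (simp add: prev_index_def ncorners_act[OF assms(1) g])
  have "\<exists>B. straight_triangle ?R (corner ?R i) l B"
  proof (rule straight_triangle_exists[OF R' i' assms(3)])
    show "l \<le> edge_length ?R i" "l \<le> edge_length ?R (prev_index ?R i)" using assms(4,5) pr edge_length_act[OF assms(1) g] by auto
    show "ereal l \<le> marked_bound ?R i" using marked_bound_act[OF assms(1) g] assms(6) by blast
    fix j c q' assume j': "j < length (marks ?R)" and h: "nearest_hit ?R i j (chain_at ?R i c) q'"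
    have j: "j < ?m" using j' by simp
    have "\<exists>q. hit j q"
    proof -
      obtain q where q: "q' = ?\<sigma> q" "q \<in> chain_set (chain_at R i c)" using h chain_at_act(1)[OF assms(1) g] unfolding nearest_hit_iff by blast
      moreover have "q$1 = marks R ! j $ 1" using h q(1) j unfolding nearest_hit_iff by (simp add: am)
      ultimately show ?thesis using nearest_hit_exists[OF assms(1,2) j] unfolding hit_def by blast
    qed
    hence "hit j (SOME q. hit j q)" by (rule someI_ex)
    then obtain c1 q where q: "q = (SOME q. hit j q)" "nearest_hit R i j (chain_at R i c1) q" unfolding hit_def by blast
    have qc: "q \<in> chain_set (chain_at R i c1)" "q$1 = marks R ! j $ 1" using q(2) unfolding nearest_hit_iff by auto
    obtain v w where d: "primitive_vec v" "tangent 1 (pgon R) (corner R i) v" "primitive_vec w" "tangent (-1) (pgon R) (corner R i) w"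
      using corner_dirs[OF assms(1)] .
    note em = chain_at_emanates[OF assms(1,2) d]
    have qf: "q \<in> frontier (pgon R)"
      using chain_frontier(2)[OF assms(1,2) qc(1) j qc(2) d(1)] chain_frontier(2)[OF assms(1,2) qc(1) j qc(2) d(3)] em
      by (cases c1) auto
    have ci: "marks R ! j \<in> interior (pgon R)" using rr(8) j by auto
    have "marks R ! j \<noteq> q" using qf ci by (auto simp: frontier_def)
    hence neq: "marks R ! j $ 2 \<noteq> q$2" using qc(2) by (auto simp: vec2_eq)
    have qD: "q \<in> pgon R" using qf frontier_subset_closed[OF rr(5)] by blast
    have es: "signs ?R ! j = (if marks R ! j $ 2 - q$2 \<ge> 0 then 1 else -1)"
      using j sg[OF j] e rr(7) unfolding g_def e_def q(1) wf_rep_def by auto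
    have "?\<sigma> q \<notin> cut ?R j"
    proof
      assume "?\<sigma> q \<in> cut ?R j"
      hence "of_int (signs ?R ! j) * (?\<sigma> q$2 - marks ?R ! j $ 2) \<ge> 0"
        using cut_iff[OF _ j' is_repD(7)[OF R']] qD by simp
      hence "of_int (signs ?R ! j) * (q$2 - marks R ! j $ 2) \<ge> 0" using j qc(2) by (simp add: am)
      thus False using es neq by (auto split: if_splits)
    qed
    moreover have "nearest_hit ?R i j (chain_at ?R i c1) (?\<sigma> q)" by (rule nearest_hit_act[OF assms(1) g j q(2)])
    ultimately show "\<exists>c q. nearest_hit ?R i j (chain_at ?R i c) q \<and> q \<notin> cut ?R j" by blast
  qed
  then obtain B' where B': "straight_triangle ?R (?\<sigma> (corner R i)) l B'" unfolding corner_act[OF assms(1) g] by blast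
  have "B' = ?\<sigma> ` (vshear (\<lambda>x. - act_shift g R x) ` B')" unfolding am image_image by simp
  hence "packed_triangle R (corner R i) l (vshear (\<lambda>x. - act_shift g R x) ` B')" unfolding packed_triangle_iff[OF assms(1)]
    using B' g by metis
  thus ?thesis by blast
qed

text \<open>Together with the converse \<open>packed_triangle_chain_mem\<close>: on the boundary a
  packed triangle consists of the points at distance less than \<open>l\<close> along the two
  semitoric edges, in every representative.\<close>

lemma packed_triangle_frontier:
  assumes "is_rep R" "i < ncorners R" "packed_triangle R (corner R i) l B" "z \<in> B" "z \<in> frontier (pgon R)"
  shows "\<exists>c. z \<in> chain_set (chain_at R i c) \<and> path_length_to (chain_at R i c) z < l"
proof -
  obtain g where g: "g \<in> grp (length (marks R))" "straight_triangle (act g R) (act_map g R (corner R i)) l (act_map g R ` B)"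
    using assms(3) packed_triangle_iff[OF assms(1)] by blast
  let ?R = "act g R" and ?\<sigma> = "act_map g R"
  have R': "is_rep ?R" by (rule is_rep_act[OF assms(1) g(1)])
  have am: "?\<sigma> = vshear (act_shift g R)" by (rule act_map_vshear[OF g(1)])
  obtain v w where co: "cuts_off ?R (corner ?R i) l (?\<sigma> ` B) v w"
    using straight_triangle_cuts_off[OF R' g(2)] unfolding corner_act[OF assms(1) g(1)] by blast
  note t = cuts_offD[OF co]
  have i': "i < ncorners ?R" using assms(2) by (simp add: ncorners_act[OF assms(1) g(1)])
  note em = chain_at_emanates[OF R' i' t(1-4)]
  have zf: "?\<sigma> z \<in> frontier (pgon ?R)" "?\<sigma> z \<in> ?\<sigma> ` B" using assms(4,5) frontier_act[OF assms(1) g(1)] by auto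
  have zD: "?\<sigma> z \<in> pgon ?R" using zf(1) frontier_subset_closed[OF is_repD(5)[OF R']] by blast
  obtain u a where ua: "u = v \<or> u = w" "0 \<le> a" "a < l" "?\<sigma> z = corner ?R i + a *\<^sub>R u" using cuts_off_interior[OF co zf(2,1)] .
  have aD: "corner ?R i + a *\<^sub>R u \<in> pgon ?R" using zD ua(4) by simp
  have "\<exists>c. ?\<sigma> z \<in> chain_set (chain_at ?R i c) \<and> path_length_to (chain_at ?R i c) (?\<sigma> z) = a"
    using ua(1) emanates_ray(1,2)[OF em(1), of a] emanates_ray(1,2)[OF em(2), of a] aD unfolding ua(4) by blast
  then obtain c where c: "?\<sigma> z \<in> chain_set (chain_at ?R i c)" "path_length_to (chain_at ?R i c) (?\<sigma> z) = a" by blast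
  have "z \<in> chain_set (chain_at R i c)" using c(1) unfolding chain_at_act(1)[OF assms(1) g(1)] by (simp add: am)
  thus ?thesis using chain_at_act(2)[OF assms(1) g(1)] c(2) ua(3) by fastforce
qed

lemma packed_triangle_chain_mem:
  assumes "is_rep R" "i < ncorners R" "packed_triangle R (corner R i) l B" "z \<in> chain_set (chain_at R i c)"
    "path_length_to (chain_at R i c) z < l"
  shows "z \<in> B"
proof -
  obtain g where g: "g \<in> grp (length (marks R))" "straight_triangle (act g R) (act_map g R (corner R i)) l (act_map g R ` B)"
    using assms(3) packed_triangle_iff[OF assms(1)] by blast
  let ?R = "act g R" and ?\<sigma> = "act_map g R"
  have R': "is_rep ?R" by (rule is_rep_act[OF assms(1) g(1)])
  have am: "?\<sigma> = vshear (act_shift g R)" by (rule act_map_vshear[OF g(1)])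
  obtain v w where co: "cuts_off ?R (corner ?R i) l (?\<sigma> ` B) v w"
    using straight_triangle_cuts_off[OF R' g(2)] unfolding corner_act[OF assms(1) g(1)] by blast
  note t = cuts_offD[OF co]
  have i': "i < ncorners ?R" using assms(2) by (simp add: ncorners_act[OF assms(1) g(1)])
  note em = chain_at_emanates[OF R' i' t(1-4)]
  have z: "?\<sigma> z \<in> chain_set (chain_at ?R i c)" "path_length_to (chain_at ?R i c) (?\<sigma> z) < l"
    using chain_at_act[OF assms(1) g(1)] assms(4,5) by auto
  let ?a = "path_length_to (chain_at ?R i c) (?\<sigma> z)"
  have "height (corner ?R i) w v (?\<sigma> z) = ?a \<and> ?\<sigma> z \<in> pgon ?R"
  proof (cases c)
    case True
    hence e: "emanates ?R (corner ?R i) 1 v (chain_at ?R i c)" using em by simp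
    show ?thesis using emanates_point[OF e _ z(1) _ t(7) is_repD(3)[OF R']] z(2) height_ray(1)[OF t(5)]
      by (metis less_imp_le)
  next
    case False
    hence e: "emanates ?R (corner ?R i) (-1) w (chain_at ?R i c)" using em by simp
    show ?thesis using emanates_point[OF e _ z(1) _ t(8) is_repD(3)[OF R']] z(2) height_ray(2)[OF t(5)]
      by (metis less_imp_le)
  qed
  hence "?\<sigma> z \<in> ?\<sigma> ` B" using t(9) z(2) by auto
  thus ?thesis by (simp add: am)
qed

section \<open>Disjointness\<close>

lemma emanates_semi_edge:
  assumes "is_rep R" "primitive_vec v" "tangent 1 (pgon R) (corner R i) v"
  shows "emanates R (corner R i) 1 v (semi_edge R i)"
  unfolding semi_edge_eq by (rule edge_chain_props(1)[OF assms(1) true_corner_extreme[OF corner_true[OF assms(1)]] assms(2,3)])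

text \<open>A slice shrinks to a point only at the left or right extreme of the polygon, elsewhere
  it contains interior points.\<close>

lemma vtop_both_true_corner:
  assumes "is_rep R" "vtop 1 (pgon R) z" "vtop (-1) (pgon R) z" shows "true_corner R z"
proof -
  note r = is_repD[OF assms(1)]
  have "(\<forall>x\<in>pgon R. z$1 \<le> x$1) \<or> (\<forall>x\<in>pgon R. x$1 \<le> z$1)"
  proof (rule ccontr)
    assume "\<not> ?thesis"
    then obtain a b where ab: "a \<in> pgon R" "b \<in> pgon R" "a$1 < z$1" "z$1 < b$1" by force
    obtain c where c: "c \<in> interior (pgon R)" "c$1 = z$1" by (rule interior_slice[OF r(3) ab r(4)])
    show False by (rule vtop_both_interior[OF assms(2,3) c])
  qed
  thus ?thesis
  proof
    assume "\<forall>x\<in>pgon R. z$1 \<le> x$1"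
    thus ?thesis using end_true_corner[OF assms(1,2), of 1] by simp
  next
    assume "\<forall>x\<in>pgon R. x$1 \<le> z$1"
    thus ?thesis using end_true_corner[OF assms(1,2), of "-1"] by simp
  qed
qed

lemma semi_edge_vtop_set:
  assumes "is_rep R" "primitive_vec v" "tangent 1 (pgon R) (corner R i) v" "v$1 \<noteq> 0"
  shows "semi_edge R i \<noteq> []"
    "chain_set (semi_edge R i) = {q. vtop (sgn (v$1)) (pgon R) q \<and> (q$1 - corner R i$1) / v$1 \<ge> 0 \<and>
       (next_corner R (corner R i)$1 - q$1) / v$1 \<ge> 0}"
proof -
  note em = emanates_semi_edge[OF assms(1-3)]
  show "semi_edge R i \<noteq> []" by (rule emanatesD(6)[OF em])
  have "last (semi_edge R i) = next_corner R (corner R i)" unfolding semi_edge_eq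
    by (rule edge_chain_props(4)[OF assms(1) true_corner_extreme[OF corner_true[OF assms(1)]] assms(2,3)])
  thus "chain_set (semi_edge R i) = {q. vtop (sgn (v$1)) (pgon R) q \<and> (q$1 - corner R i$1) / v$1 \<ge> 0 \<and>
       (next_corner R (corner R i)$1 - q$1) / v$1 \<ge> 0}"
    using emanates_chain_set[OF em assms(4)] by simp
qed

text \<open>If the second corner lies ahead of the first on the same half of the boundary, the first
  edge ends at or before it, so the second corner is the only possible common point.\<close>

lemma same_side_meet:
  assumes "is_rep R" "primitive_vec v" "tangent 1 (pgon R) (corner R i) v" "primitive_vec v'" "tangent 1 (pgon R) (corner R j) v'"
    "z \<in> chain_set (semi_edge R i)" "z \<in> chain_set (semi_edge R j)" "v$1 * v'$1 > 0" "v$1 * (corner R j$1 - corner R i$1) > 0"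
  shows "true_corner R z"
proof -
  let ?p = "corner R i" and ?q = "corner R j"
  have n: "v$1 \<noteq> 0" "v'$1 \<noteq> 0" using assms(8) by auto
  have s: "sgn (v'$1) = sgn (v$1)" using assms(8) by (auto simp: zero_less_mult_iff)
  have s1: "sgn (v$1) = 1 \<or> sgn (v$1) = -1" using n(1) by (auto simp: sgn_if)
  note C = semi_edge_vtop_set(2)[OF assms(1-3) n(1)] and C' = semi_edge_vtop_set(2)[OF assms(1,4,5) n(2)]
  have vq: "vtop (sgn (v$1)) (pgon R) ?q" using tangent_vtop0[OF assms(5) n(2)] s by simp
  have "(?q$1 - ?p$1) / v$1 > 0" using assms(9) by (auto simp: zero_less_divide_iff zero_less_mult_iff)
  hence le: "(next_corner R ?p$1 - ?p$1) / v$1 \<le> (?q$1 - ?p$1) / v$1"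
    by (rule next_corner_least(3)[OF assms(1) true_corner_extreme[OF corner_true[OF assms(1)]] assms(2,3) n(1) corner_true[OF assms(1)] vq])
  have z: "vtop (sgn (v$1)) (pgon R) z" "(next_corner R ?p$1 - z$1) / v$1 \<ge> 0" using assms(6) C by auto
  have z': "(z$1 - ?q$1) / v'$1 \<ge> 0" using assms(7) C' by auto
  have "z$1 = ?q$1"
  proof (cases "v$1 > 0")
    case True
    hence "v'$1 > 0" using assms(8) by (simp add: zero_less_mult_iff)
    thus ?thesis using True le z(2) z' by (simp add: divide_le_cancel zero_le_divide_iff)
  next
    case False
    hence v: "v$1 < 0" "v'$1 < 0" using assms(8) n by (auto simp: zero_less_mult_iff)
    thus ?thesis using le z(2) z' by (simp add: divide_le_cancel zero_le_divide_iff)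
  qed
  hence "z = ?q" using vtop_unique[OF z(1) vq] s1 by simp
  thus ?thesis using corner_true[OF assms(1)] by simp
qed

lemma semi_edge_vertical:
  assumes "is_rep R" "primitive_vec v" "tangent 1 (pgon R) (corner R i) v" "v$1 = 0" "z \<in> chain_set (semi_edge R i)"
  obtains a where "z = corner R i + a *\<^sub>R v" "0 \<le> a" "\<And>s. corner R i + s *\<^sub>R v \<in> pgon R \<Longrightarrow> 0 \<le> s"
    "z$1 = corner R i$1" "v$2 \<noteq> 0" "\<And>x. x \<in> pgon R \<Longrightarrow> sgn (v$2) * z$1 \<le> sgn (v$2) * x$1"
proof -
  obtain L where L: "single_edge (pgon R) (corner R i) v (semi_edge R i) L"
    using emanates_short[OF emanates_semi_edge[OF assms(1-3)] assms(4)] by blast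
  note s = single_edgeD[OF L]
  obtain a where a: "0 \<le> a" "a \<le> L" "z = corner R i + a *\<^sub>R v" using s(5) assms(5) by blast
  have zx: "z$1 = corner R i$1" using a(3) assms(4) by simp
  have v2: "v$2 \<noteq> 0" using tangentD(1)[OF assms(3)] assms(4) by (simp add: vec2_eq)
  have "sgn (v$2) * z$1 \<le> sgn (v$2) * x$1" if x: "x \<in> pgon R" for x
  proof -
    have "v$2 * (x$1 - z$1) \<ge> 0" using tangentD(4)[OF assms(3) x] assms(4) zx by (simp add: det2_eq)
    thus ?thesis using v2 by (auto simp: sgn_if zero_le_mult_iff)
  qed
  thus ?thesis using that a(1,3) s(7) zx v2 by metis
qed

text \<open>Non-vertical edges on opposite halves of the boundary can meet only in a degenerate
  slice, and a vertical edge lies in an extreme slice, so in these cases a common point is an end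
  covered by the previous lemmas. The remaining cases are two edges on the same half and two
  vertical edges.\<close>

lemma semi_edges_meet:
  assumes "is_rep R" "i < ncorners R" "j < ncorners R" "i \<noteq> j" "z \<in> chain_set (semi_edge R i)" "z \<in> chain_set (semi_edge R j)"
  shows "true_corner R z"
proof -
  note r = is_repD[OF assms(1)]
  have pq: "corner R i \<noteq> corner R j" using bij_betw_imp_inj_on[OF corner_enumeration(1)[OF assms(1)]] assms(2-4)
    by (auto simp: inj_on_def)
  obtain v where v: "primitive_vec v" "tangent 1 (pgon R) (corner R i) v" using corner_dirs[OF assms(1)] by metis
  obtain v' where v': "primitive_vec v'" "tangent 1 (pgon R) (corner R j) v'" using corner_dirs[OF assms(1)] by metis
  have vert: "true_corner R z" if h: "primitive_vec u" "tangent 1 (pgon R) (corner R a) u" "u$1 = 0" "z \<in> chain_set (semi_edge R a)"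
    "primitive_vec u'" "tangent 1 (pgon R) (corner R b) u'" "u'$1 \<noteq> 0" "z \<in> chain_set (semi_edge R b)" for a b u u'
  proof -
    obtain x where x: "u$2 \<noteq> 0" "\<And>x. x \<in> pgon R \<Longrightarrow> sgn (u$2) * z$1 \<le> sgn (u$2) * x$1"
      using semi_edge_vertical[OF assms(1) h(1-4)] by metis
    have "vtop (sgn (u'$1)) (pgon R) z" using semi_edge_vtop_set(2)[OF assms(1) h(5-7)] h(8) by simp
    moreover have "sgn (u'$1) = 1 \<or> sgn (u'$1) = -1" "sgn (u$2) = 1 \<or> sgn (u$2) = -1" using h(7) x(1) by (auto simp: sgn_if)
    ultimately show ?thesis using end_true_corner[OF assms(1)] x(2) by metis
  qed
  show ?thesis
  proof (cases "v$1 = 0")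
    case True
    show ?thesis
    proof (cases "v'$1 = 0")
      case False
      show ?thesis by (rule vert[OF v True assms(5) v' False assms(6)])
    next
      case vt: True
      obtain a where a: "z = corner R i + a *\<^sub>R v" "\<And>s. corner R i + s *\<^sub>R v \<in> pgon R \<Longrightarrow> 0 \<le> s" "z$1 = corner R i$1" "v$2 \<noteq> 0"
        using semi_edge_vertical[OF assms(1) v True assms(5)] by metis
      obtain b where b: "z = corner R j + b *\<^sub>R v'" "\<And>s. corner R j + s *\<^sub>R v' \<in> pgon R \<Longrightarrow> 0 \<le> s" "z$1 = corner R j$1" "v'$2 \<noteq> 0"
        using semi_edge_vertical[OF assms(1) v' vt assms(6)] by metis
      obtain c where c: "c \<in> interior (pgon R)" using r(4) by blast
      \<comment> \<open>Both edges lie on one vertical line with the polygon on the same side, so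
        their directions agree. Each corner is then ahead of the other on the same ray, and they
        coincide.\<close>
      have "v$2 * (c$1 - z$1) > 0" "v'$2 * (c$1 - z$1) > 0"
        using tangent_interior_strict[OF v(2) _ c] tangent_interior_strict[OF v'(2) _ c] True vt a(3) b(3) by (auto simp: det2_eq)
      hence vv: "v$2 * v'$2 > 0" by (auto simp: zero_less_mult_iff)
      define k where "k = v'$2 / v$2"
      have k: "k > 0" "v' = k *\<^sub>R v" using vv a(4) True vt by (auto simp: k_def vec2_eq zero_less_divide_iff zero_less_mult_iff)
      have e: "corner R j = corner R i + (a - b * k) *\<^sub>R v" "corner R i = corner R j + (b - a / k) *\<^sub>R v'"
        using a(1) b(1) k by (auto simp: algebra_simps vec2_eq)
      have "0 \<le> a - b * k" using a(2) e(1) tangentD(2)[OF v'(2)] by metis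
      moreover have "0 \<le> b - a / k" using b(2) e(2) tangentD(2)[OF v(2)] by metis
      ultimately have "a - b * k = 0" using k(1) by (simp add: field_simps)
      thus ?thesis using e(1) pq by simp
    qed
  next
    case nv: False
    show ?thesis
    proof (cases "v'$1 = 0")
      case True
      show ?thesis by (rule vert[OF v' True assms(6) v nv assms(5)])
    next
      case nv': False
      have vz: "vtop (sgn (v$1)) (pgon R) z" "vtop (sgn (v'$1)) (pgon R) z"
        using semi_edge_vtop_set(2)[OF assms(1) v nv] semi_edge_vtop_set(2)[OF assms(1) v' nv'] assms(5,6) by auto
      show ?thesis
      proof (cases "v$1 * v'$1 > 0")
        case False
        hence "(sgn (v$1) = 1 \<and> sgn (v'$1) = -1) \<or> (sgn (v$1) = -1 \<and> sgn (v'$1) = 1)"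
          using nv nv' by (auto simp: sgn_if zero_less_mult_iff)
        thus ?thesis using vtop_both_true_corner[OF assms(1)] vz by metis
      next
        case True
        have s: "sgn (v'$1) = sgn (v$1)" "sgn (v$1) = 1 \<or> sgn (v$1) = -1" using True by (auto simp: zero_less_mult_iff)
        have "corner R i$1 \<noteq> corner R j$1"
          using vtop_unique[OF tangent_vtop0[OF v(2) nv], of "corner R j"] tangent_vtop0[OF v'(2) nv'] s pq by auto
        hence "v$1 * (corner R j$1 - corner R i$1) > 0 \<or> v'$1 * (corner R i$1 - corner R j$1) > 0"
          using True by (auto simp: zero_less_mult_iff)
        moreover have "v'$1 * v$1 > 0" using True by (simp add: mult.commute)
        ultimately show ?thesis
          using same_side_meet[OF assms(1) v v' assms(5,6) True] same_side_meet[OF assms(1) v' v assms(6,5)] by blast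
      qed
    qed
  qed
qed

text \<open>\<open>J\<close> holds the permitted kinks. The shear profiles belong to this class for
  the abscissae of the marked points, and it is closed under linear combinations.\<close>

definition affine_off :: "real set \<Rightarrow> (real \<Rightarrow> real) \<Rightarrow> bool" where
  "affine_off J h \<longleftrightarrow> continuous_on UNIV h \<and>
     (\<forall>\<alpha> \<beta>. (\<forall>j\<in>J. j \<le> \<alpha> \<or> \<beta> \<le> j) \<longrightarrow> (\<exists>c d. \<forall>x. \<alpha> \<le> x \<longrightarrow> x \<le> \<beta> \<longrightarrow> h x = c * x + d))"

lemma affine_off_comb:
  assumes "affine_off J f" "affine_off J g" shows "affine_off J (\<lambda>x. a * f x + b * g x)"
proof -
  have "\<exists>c d. \<forall>x. \<alpha> \<le> x \<longrightarrow> x \<le> \<beta> \<longrightarrow> a * f x + b * g x = c * x + d" if h: "\<forall>j\<in>J. j \<le> \<alpha> \<or> \<beta> \<le> j" for \<alpha> \<beta>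
  proof -
    obtain c d c' d' where e: "\<forall>x. \<alpha> \<le> x \<longrightarrow> x \<le> \<beta> \<longrightarrow> f x = c * x + d" "\<forall>x. \<alpha> \<le> x \<longrightarrow> x \<le> \<beta> \<longrightarrow> g x = c' * x + d'"
      using assms h unfolding affine_off_def by metis
    show ?thesis
      by (intro exI[of _ "a * c + b * c'"] exI[of _ "a * d + b * d'"]) (use e in \<open>auto simp: algebra_simps\<close>)
  qed
  thus ?thesis using assms unfolding affine_off_def by (auto intro!: continuous_intros)
qed

text \<open>
  The strip between the graphs of \<open>P\<close> and \<open>Q\<close> cannot leave \<open>D\<close> through a vertical slice with a
  marked point, and its width is affine in between, so in one of the two directions it stays
  nonempty up to an extreme slice of \<open>D\<close>.
\<close>

lemma strip_meets_frontier:
  fixes z0 :: "real^2"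
  assumes "compact D" "convex D" "z0 \<in> D" "P (z0$1) < z0$2" "z0$2 < Q (z0$1)" "affine_off J P" "affine_off J Q"
    "finite J" "\<And>j. j \<in> J \<Longrightarrow> Q j \<le> P j"
  shows "\<exists>z\<in>frontier D. P (z$1) < z$2 \<and> z$2 < Q (z$1)"
proof (rule ccontr)
  assume none: "\<not> ?thesis"
  have cl: "closed D" by (rule compact_imp_closed[OF assms(1)])
  have frD: "frontier D \<subseteq> D" by (rule frontier_subset_closed[OF cl])
  let ?X = "(\<lambda>z. z$1) ` D"
  have X: "compact ?X" by (intro compact_continuous_image assms(1) continuous_intros)
  have ne: "?X \<noteq> {}" using assms(3) by blast
  obtain a where a: "a \<in> ?X" "\<And>x. x \<in> ?X \<Longrightarrow> a \<le> x" using compact_attains_inf[OF X ne] by metis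
  obtain b where b: "b \<in> ?X" "\<And>x. x \<in> ?X \<Longrightarrow> x \<le> b" using compact_attains_sup[OF X ne] by metis
  define x0 where "x0 = z0$1"
  define G where "G x = 1 * Q x + (-1) * P x" for x
  have G0: "G x0 > 0" using assms(4,5) by (simp add: G_def x0_def)
  have abx: "a \<le> x0" "x0 \<le> b" using a(2) b(2) assms(3) by (auto simp: x0_def)
  \<comment> \<open>\<alpha> and \<beta> are the nearest kinks around \<open>x0\<close>, or the
    extreme abscissae of \<open>D\<close> where there are none; the width \<open>G\<close> is affine
    between them.\<close>
  define \<alpha> where "\<alpha> = Max (insert a {j\<in>J. j \<le> x0})"
  define \<beta> where "\<beta> = Min (insert b {j\<in>J. x0 \<le> j})"
  have fin: "finite (insert a {j\<in>J. j \<le> x0})" "finite (insert b {j\<in>J. x0 \<le> j})" using assms(8) by auto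
  have al: "\<alpha> \<in> insert a {j\<in>J. j \<le> x0}" "\<And>j. j \<in> J \<Longrightarrow> j \<le> x0 \<Longrightarrow> j \<le> \<alpha>"
    unfolding \<alpha>_def using Max_in[OF fin(1)] Max_ge[OF fin(1)] by auto
  have be: "\<beta> \<in> insert b {j\<in>J. x0 \<le> j}" "\<And>j. j \<in> J \<Longrightarrow> x0 \<le> j \<Longrightarrow> \<beta> \<le> j"
    unfolding \<beta>_def using Min_in[OF fin(2)] Min_le[OF fin(2)] by auto
  have alx: "\<alpha> \<le> x0" "x0 \<le> \<beta>" using al(1) be(1) abx by auto
  have "\<forall>j\<in>J. j \<le> \<alpha> \<or> \<beta> \<le> j" using al(2) be(2) by (meson le_cases)
  then obtain c d where G: "\<And>x. \<alpha> \<le> x \<Longrightarrow> x \<le> \<beta> \<Longrightarrow> G x = c * x + d"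
    using affine_off_comb[OF assms(7,6), of 1 "-1"] unfolding affine_off_def G_def by metis
  have Gj: "G j \<le> 0" if h: "j \<in> J" for j using assms(9)[OF h] by (simp add: G_def)
  \<comment> \<open>The sign of the slope \<open>c\<close> selects the direction in which the width
    does not decrease. It stays positive there, so no marked abscissa is reached before the extreme
    slice.\<close>
  obtain e where e: "e = a \<or> e = b" "\<And>x. x \<in> closed_segment x0 e \<Longrightarrow> G x > 0"
  proof (cases "c \<ge> 0")
    case True
    have pos: "G x > 0" if h: "x \<in> closed_segment x0 \<beta>" for x
    proof -
      have x: "x0 \<le> x" "x \<le> \<beta>" using h alx by (auto simp: closed_segment_eq_real_ivl)
      have "c * x0 \<le> c * x" using True x(1) by (rule mult_left_mono[rotated])
      thus ?thesis using G[of x] G[of x0] x alx G0 by simp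
    qed
    have "\<beta> \<notin> J" using pos[of \<beta>] Gj by force
    hence "\<beta> = b" using be(1) by simp
    thus ?thesis using that pos by metis
  next
    case False
    have pos: "G x > 0" if h: "x \<in> closed_segment x0 \<alpha>" for x
    proof -
      have x: "\<alpha> \<le> x" "x \<le> x0" using h alx by (auto simp: closed_segment_eq_real_ivl split: if_splits)
      have "c * x0 \<le> c * x" using False x(2) by (intro mult_left_mono_neg) auto
      thus ?thesis using G[of x] G[of x0] x alx G0 by simp
    qed
    have "\<alpha> \<notin> J" using pos[of \<alpha>] Gj by force
    hence "\<alpha> = a" using al(1) by simp
    thus ?thesis using that pos by metis
  qed
  \<comment> \<open>The midline of the strip, followed from the slice of \<open>z0\<close> to the
    extreme slice.\<close>
  define \<gamma> where "\<gamma> x = x *\<^sub>R vector [1, 0] + ((P x + Q x) / 2) *\<^sub>R (vector [0, 1] :: real^2)" for x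
  have g: "\<gamma> x $ 1 = x" "\<gamma> x $ 2 = (P x + Q x) / 2" for x by (simp_all add: \<gamma>_def)
  have PQ: "continuous_on A P" "continuous_on A Q" for A
    using assms(6,7) continuous_on_subset[OF _ subset_UNIV] unfolding affine_off_def by metis+
  have conn: "connected (\<gamma> ` closed_segment x0 e)" unfolding \<gamma>_def
    by (intro connected_continuous_image continuous_intros PQ) auto
  have strip: "P x < \<gamma> x $ 2 \<and> \<gamma> x $ 2 < Q x" if h: "x \<in> closed_segment x0 e" for x
    using e(2)[OF h] unfolding g G_def by simp
  \<comment> \<open>The ends of the slice through \<open>z0\<close> are boundary points and hence
    outside the strip by assumption. They enclose it, so the midline starts in
    \<open>D\<close>.\<close>
  obtain t where t: "vtop 1 D t" "t$1 = z0$1" by (rule vtop_exists[OF assms(1,3)])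
  obtain u where u: "vtop (-1) D u" "u$1 = z0$1" by (rule vtop_exists[OF assms(1,3)])
  have "t$2 \<ge> Q x0"
  proof (rule ccontr)
    assume n: "\<not> t$2 \<ge> Q x0"
    have "t$2 \<ge> z0$2" using vtopD[OF t(1) assms(3)] t(2) by simp
    thus False using none vtop_frontier[OF t(1)] n t(2) assms(4) unfolding x0_def by force
  qed
  moreover have "u$2 \<le> P x0"
  proof (rule ccontr)
    assume n: "\<not> u$2 \<le> P x0"
    have "u$2 \<le> z0$2" using vtopD[OF u(1) assms(3)] u(2) by simp
    thus False using none vtop_frontier[OF u(1)] n u(2) assms(5) unfolding x0_def by force
  qed
  moreover have tu: "t \<in> D" "u \<in> D" using t(1) u(1) unfolding vtop_def by auto
  moreover have "P x0 \<le> (P x0 + Q x0) / 2" "(P x0 + Q x0) / 2 \<le> Q x0" using G0 by (simp_all add: G_def)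
  ultimately have start: "\<gamma> x0 \<in> D"
    by (intro vertical_between[OF assms(2) tu, of "\<gamma> x0" 1]) (use t(2) u(2) in \<open>simp_all add: g x0_def\<close>)
  have "\<gamma> ` closed_segment x0 e \<subseteq> D"
  proof (rule ccontr)
    assume n: "\<not> ?thesis"
    have "\<gamma> ` closed_segment x0 e \<inter> frontier D \<noteq> {}"
      by (rule connected_Int_frontier[OF conn]) (use start n in auto)
    then obtain x where x: "x \<in> closed_segment x0 e" "\<gamma> x \<in> frontier D" by blast
    show False using none x(2) strip[OF x(1)] g by metis
  qed
  hence ge: "\<gamma> e \<in> D" by blast
  \<comment> \<open>The midline stays in \<open>D\<close>, since leaving it would mean crossing the
    boundary within the strip. Its end lies on an extreme slice, which contains no interior
    points.\<close>
  have "\<gamma> e \<notin> interior D"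
  proof
    assume i: "\<gamma> e \<in> interior D"
    have "(\<forall>x\<in>D. 1 * \<gamma> e$1 \<le> 1 * x$1) \<or> (\<forall>x\<in>D. (-1) * \<gamma> e$1 \<le> (-1) * x$1)" using e(1) a(2) b(2) by (auto simp: g)
    thus False using mark_not_end[OF i, of 1 "\<gamma> e"] mark_not_end[OF i, of "-1" "\<gamma> e"] by auto
  qed
  hence "\<gamma> e \<in> frontier D" using ge cl by (simp add: frontier_def)
  thus False using none strip[of e] g by (metis ends_in_segment(2))
qed

lemma packed_triangle_cuts_off:
  assumes "is_rep R" "packed_triangle R p l B"
  obtains g v w where "g \<in> grp (length (marks R))" "is_rep (act g R)" "cuts_off (act g R) (act_map g R p) l (act_map g R ` B) v w"
proof -
  obtain g where g: "g \<in> grp (length (marks R))" "straight_triangle (act g R) (act_map g R p) l (act_map g R ` B)"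
    using assms(2) packed_triangle_iff[OF assms(1)] by blast
  have R': "is_rep (act g R)" by (rule is_rep_act[OF assms(1) g(1)])
  show ?thesis using straight_triangle_cuts_off[OF R' g(2)] that g(1) R' by metis
qed

lemma packed_triangle_true_corner:
  assumes "is_rep R" "packed_triangle R p l B"
  shows "true_corner R p" "p \<in> B" "\<And>q. q \<in> B \<Longrightarrow> true_corner R q \<Longrightarrow> q = p" "\<And>c. c \<in> set (marks R) \<Longrightarrow> c \<notin> B" "B \<subseteq> pgon R" "l > 0"
proof -
  obtain g v w where g: "g \<in> grp (length (marks R))" "is_rep (act g R)" "cuts_off (act g R) (act_map g R p) l (act_map g R ` B) v w"
    by (rule packed_triangle_cuts_off[OF assms])
  note c = cuts_offD[OF g(3)]
  have inj: "act_map g R x = act_map g R y \<longleftrightarrow> x = y" for x y unfolding act_map_vshear[OF g(1)] by simp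
  have mem: "act_map g R x \<in> act_map g R ` B \<longleftrightarrow> x \<in> B" for x unfolding act_map_vshear[OF g(1)] by simp
  show "true_corner R p" using c(12) true_corner_act[OF assms(1) g(1), of p] unfolding true_corner_def by blast
  have "act_map g R p \<in> act_map g R ` B" unfolding c(10) using triangle_memI[of 0 0 l "act_map g R p" w v] c(6) by simp
  thus "p \<in> B" by (simp add: mem)
  show "q = p" if h: "q \<in> B" "true_corner R q" for q
  proof -
    have "act_map g R q extreme_point_of pgon (act g R)"
      using h(2) true_corner_act[OF assms(1) g(1)] by (intro true_corner_extreme) simp
    thus ?thesis using cuts_off_extreme[OF g(3)] h(1) mem inj by metis
  qed
  show "x \<notin> B" if h: "x \<in> set (marks R)" for x using c(11)[of "act_map g R x"] h mem by auto
  show "B \<subseteq> pgon R" "l > 0" using assms(2) unfolding packed_triangle_def by auto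
qed

text \<open>The height pulled back by the shear. The coefficient of the second coordinate is
  constant, and all kinks go into a function of the first coordinate.\<close>

lemma packed_triangle_halfplane:
  assumes "is_rep R" "packed_triangle R p l B"
  obtains k h where "B = {z\<in>pgon R. k * z$2 + h (z$1) < 0}" "affine_off ((\<lambda>c. c$1) ` set (marks R)) h"
proof -
  obtain g v w where g: "g \<in> grp (length (marks R))" "is_rep (act g R)" "cuts_off (act g R) (act_map g R p) l (act_map g R ` B) v w"
    by (rule packed_triangle_cuts_off[OF assms])
  note c = cuts_offD[OF g(3)]
  define q where "q = act_map g R p"
  let ?J = "(\<lambda>c. c$1) ` set (marks R)"
  define h where "h x = (w$1 - v$1) * act_shift g R x + 1 * ((v$2 - w$2) * x - (v$2 - w$2) * q$1 - (w$1 - v$1) * q$2 - l)" for x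
  have "z \<in> B \<longleftrightarrow> z \<in> pgon R \<and> (w$1 - v$1) * z$2 + h (z$1) < 0" for z
  proof -
    have "z \<in> B \<longleftrightarrow> act_map g R z \<in> act_map g R ` B" unfolding act_map_vshear[OF g(1)] by simp
    also have "\<dots> \<longleftrightarrow> z \<in> pgon R \<and> height q w v (act_map g R z) < l"
      unfolding c(9) unfolding q_def act_sel act_map_vshear[OF g(1)] by simp
    also have "height q w v (act_map g R z) < l \<longleftrightarrow> (w$1 - v$1) * z$2 + h (z$1) < 0"
      unfolding height_eq h_def act_map_vshear[OF g(1)] by (simp add: algebra_simps)
    finally show ?thesis .
  qed
  moreover have "affine_off ?J h" unfolding h_def
  proof (rule affine_off_comb)
    show "affine_off ?J (act_shift g R)" unfolding affine_off_def
    proof (intro conjI allI impI)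
      show "continuous_on UNIV (act_shift g R)" by (rule continuous_act_shift[OF g(1)])
      fix \<alpha> \<beta> :: real assume j: "\<forall>j\<in>?J. j \<le> \<alpha> \<or> \<beta> \<le> j"
      have "marks R ! k $ 1 \<le> \<alpha> \<or> \<beta> \<le> marks R ! k $ 1" if "k < length (marks R)" for k using j that nth_mem by blast
      then obtain c :: int and d where "\<And>x. \<alpha> \<le> x \<Longrightarrow> x \<le> \<beta> \<Longrightarrow> act_shift g R x = of_int c * x + d"
        using act_shift_affine[OF g(1), of \<alpha> \<beta>] by metis
      thus "\<exists>c d. \<forall>x. \<alpha> \<le> x \<longrightarrow> x \<le> \<beta> \<longrightarrow> act_shift g R x = c * x + d" by blast
    qed
    show "affine_off ?J (\<lambda>x. (v$2 - w$2) * x - (v$2 - w$2) * q$1 - (w$1 - v$1) * q$2 - l)" unfolding affine_off_def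
    proof (intro conjI allI impI)
      show "continuous_on UNIV (\<lambda>x. (v$2 - w$2) * x - (v$2 - w$2) * q$1 - (w$1 - v$1) * q$2 - l)" by (intro continuous_intros)
      show "\<exists>c d. \<forall>x. \<alpha> \<le> x \<longrightarrow> x \<le> \<beta> \<longrightarrow> (v$2 - w$2) * x - (v$2 - w$2) * q$1 - (w$1 - v$1) * q$2 - l = c * x + d" for \<alpha> \<beta>
        by (rule exI[of _ "v$2 - w$2"], rule exI[of _ "- (v$2 - w$2) * q$1 - (w$1 - v$1) * q$2 - l"]) (simp add: algebra_simps)
    qed
  qed
  ultimately show ?thesis using that by blast
qed

text \<open>If the coefficients \<open>k\<close> and \<open>k'\<close> have the same sign, both
  triangles contain the same end of a common slice. If the signs are opposite, the overlap is a
  strip between two graphs, and a marked point lying in neither triangle means that the strip is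
  empty over it.\<close>

lemma packed_triangles_meet_frontier:
  assumes "is_rep R" "packed_triangle R p l B" "packed_triangle R p' l' B'" "B \<inter> B' \<noteq> {}"
  shows "B \<inter> B' \<inter> frontier (pgon R) \<noteq> {}"
proof -
  note r = is_repD[OF assms(1)]
  let ?J = "(\<lambda>c. c$1) ` set (marks R)"
  obtain k h where B: "B = {z\<in>pgon R. k * z$2 + h (z$1) < 0}" "affine_off ?J h" by (rule packed_triangle_halfplane[OF assms(1,2)])
  obtain k' h' where B': "B' = {z\<in>pgon R. k' * z$2 + h' (z$1) < 0}" "affine_off ?J h'" by (rule packed_triangle_halfplane[OF assms(1,3)])
  obtain z where z: "z \<in> B" "z \<in> B'" using assms(4) by blast
  have zD: "z \<in> pgon R" using z B(1) by simp
  have marks: "\<not> k * c$2 + h (c$1) < 0" "\<not> k' * c$2 + h' (c$1) < 0" if m: "c \<in> set (marks R)" for c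
    using packed_triangle_true_corner(4)[OF assms(1,2) m] packed_triangle_true_corner(4)[OF assms(1,3) m] B(1) B'(1) m r(8) interior_subset
    by auto
  have fin: "finite ?J" by simp
  have same: ?thesis if s: "s = 1 \<or> s = -1" "s * k \<le> 0" "s * k' \<le> 0" for s :: real
  proof -
    obtain t where t: "vtop s (pgon R) t" "t$1 = z$1" by (rule vtop_exists[OF r(6) zD])
    have d: "s * t$2 \<ge> s * z$2" by (rule vtopD[OF t(1) zD]) (simp add: t(2))
    have "m * t$2 \<le> m * z$2" if m: "s * m \<le> 0" for m using s(1) m d by (auto intro: mult_left_mono mult_left_mono_neg)
    hence "k * t$2 \<le> k * z$2" "k' * t$2 \<le> k' * z$2" using s by auto
    hence "t \<in> B \<inter> B'" using z t vtop_def B(1) B'(1) by auto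
    thus ?thesis using vtop_frontier[OF t(1) s(1)] by blast
  qed
  have opp: "\<exists>y\<in>frontier (pgon R). a * y$2 + f (y$1) < 0 \<and> a' * y$2 + f' (y$1) < 0"
    if h: "a > 0" "a' < 0" "affine_off ?J f" "affine_off ?J f'" "a * z$2 + f (z$1) < 0" "a' * z$2 + f' (z$1) < 0"
      "\<And>c. c \<in> set (marks R) \<Longrightarrow> \<not> a * c$2 + f (c$1) < 0 \<and> \<not> a' * c$2 + f' (c$1) < 0" for a a' f f'
  proof -
    \<comment> \<open>The two inequalities solved for the second coordinate. The summands with
      factor 0 only bring the functions into the form treated by
      \<open>affine_off_comb\<close>.\<close>
    let ?Q = "\<lambda>x. (- 1 / a) * f x + 0 * f x" and ?P = "\<lambda>x. (- 1 / a') * f' x + 0 * f' x"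
    have q: "y2 < ?Q x \<longleftrightarrow> a * y2 + f x < 0" and p: "?P x < y2 \<longleftrightarrow> a' * y2 + f' x < 0" for x y2
      using h(1,2) by (auto simp: field_simps)
    have J: "?Q j \<le> ?P j" if j: "j \<in> ?J" for j
    proof -
      obtain c where c: "c \<in> set (marks R)" "j = c$1" using j by blast
      show ?thesis using h(7)[OF c(1)] q[of "c$2" j] p[of j "c$2"] c(2) by auto
    qed
    have "\<exists>y\<in>frontier (pgon R). ?P (y$1) < y$2 \<and> y$2 < ?Q (y$1)"
      by (rule strip_meets_frontier[OF r(6,3) zD _ _ affine_off_comb[OF h(4,4)] affine_off_comb[OF h(3,3)] fin J])
        (use h(5,6) q p in auto)
    thus ?thesis unfolding q p by blast
  qed
  have frD: "y \<in> pgon R" if "y \<in> frontier (pgon R)" for y using that frontier_subset_closed[OF r(5)] by blast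
  have zz: "k * z$2 + h (z$1) < 0" "k' * z$2 + h' (z$1) < 0" using z B(1) B'(1) by auto
  consider "k \<le> 0 \<and> k' \<le> 0" | "k \<ge> 0 \<and> k' \<ge> 0" | "k > 0 \<and> k' < 0" | "k < 0 \<and> k' > 0" by linarith
  thus ?thesis
  proof cases
    case 1 thus ?thesis using same[of 1] by simp
  next
    case 2 thus ?thesis using same[of "-1"] by simp
  next
    case 3
    then obtain y where y: "y \<in> frontier (pgon R)" "k * y$2 + h (y$1) < 0" "k' * y$2 + h' (y$1) < 0"
      using opp[OF _ _ B(2) B'(2) zz] marks by blast
    thus ?thesis using frD B(1) B'(1) by blast
  next
    case 4
    then obtain y where y: "y \<in> frontier (pgon R)" "k' * y$2 + h' (y$1) < 0" "k * y$2 + h (y$1) < 0"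
      using opp[OF _ _ B'(2) B(2) zz(2,1)] marks by blast
    thus ?thesis using frD B(1) B'(1) by blast
  qed
qed

text \<open>A common boundary point would not be a true corner, as each triangle contains only its
  own. It would lie on a single semitoric edge joining the two corners, at distances summing to the
  edge length yet less than \<open>l\<close> and \<open>l'\<close>.\<close>

lemma packed_triangles_disjoint:
  assumes "is_rep R" "i < ncorners R" "j < ncorners R" "i \<noteq> j"
    "packed_triangle R (corner R i) l B" "packed_triangle R (corner R j) l' B'"
    "j = Suc i mod ncorners R \<Longrightarrow> l + l' \<le> edge_length R i" "i = Suc j mod ncorners R \<Longrightarrow> l + l' \<le> edge_length R j"
  shows "B \<inter> B' = {}"
proof (rule ccontr)
  assume "B \<inter> B' \<noteq> {}"
  then obtain z where z: "z \<in> B" "z \<in> B'" "z \<in> frontier (pgon R)"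
    using packed_triangles_meet_frontier[OF assms(1,5,6)] by blast
  have pq: "corner R i \<noteq> corner R j" using bij_betw_imp_inj_on[OF corner_enumeration(1)[OF assms(1)]] assms(2-4)
    by (auto simp: inj_on_def)
  have ntc: "\<not> true_corner R z"
    using packed_triangle_true_corner(3)[OF assms(1,5) z(1)] packed_triangle_true_corner(3)[OF assms(1,6) z(2)] pq by auto
  obtain c where c: "z \<in> chain_set (chain_at R i c)" "path_length_to (chain_at R i c) z < l"
    using packed_triangle_frontier[OF assms(1,2,5) z(1,3)] by blast
  obtain c' where c': "z \<in> chain_set (chain_at R j c')" "path_length_to (chain_at R j c') z < l'"
    using packed_triangle_frontier[OF assms(1,3,6) z(2,3)] by blast
  define a where "a = (if c then i else prev_index R i)"
  define b where "b = (if c' then j else prev_index R j)"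
  note pi = prev_index[OF assms(1,2)] and pj = prev_index[OF assms(1,3)]
  have za: "z \<in> chain_set (semi_edge R a)" "z \<in> chain_set (semi_edge R b)"
    using c(1) c'(1) unfolding a_def b_def chain_at_def by (auto simp: chain_set_rev split: if_splits)
  have "a < ncorners R" "b < ncorners R" unfolding a_def b_def using assms(2,3) pi(1) pj(1) by auto
  hence ab: "a = b" using semi_edges_meet[OF assms(1) _ _ _ za] ntc by blast
  note len = chain_at_rev(2)[OF assms(1) za(1)]
  show False
  proof (cases c)
    case True
    hence nc: "\<not> c'" and j: "prev_index R j = i" "a = i" using ab assms(4) unfolding a_def b_def by (auto split: if_splits)
    have "j = Suc i mod ncorners R" using pj(2) j(1) by simp
    thus False using assms(7) len c(2) c'(2) True nc j unfolding chain_at_def by simp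
  next
    case False
    have ct: c'
    proof (rule ccontr)
      assume "\<not> c'"
      hence "prev_index R i = prev_index R j" using ab False unfolding a_def b_def by simp
      thus False using pi(2) pj(2) assms(4) by metis
    qed
    hence i: "prev_index R i = j" "a = j" using ab False unfolding a_def b_def by auto
    have "i = Suc j mod ncorners R" using pi(2) i(1) by simp
    thus False using assms(8) len c(2) c'(2) False ct i unfolding chain_at_def by simp
  qed
qed

section \<open>Packings and their sizes\<close>

lemma packed_triangle_connected:
  assumes "is_rep R" "packed_triangle R p l B" shows "connected B"
proof -
  obtain g v w where g: "g \<in> grp (length (marks R))" "is_rep (act g R)" "cuts_off (act g R) (act_map g R p) l (act_map g R ` B) v w"
    by (rule packed_triangle_cuts_off[OF assms])
  define q where "q = act_map g R p"
  define a :: "real^2" where "a = vector [v$2 - w$2, w$1 - v$1]"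
  have "height q w v z = a \<bullet> z - a \<bullet> q" for z by (simp add: height_eq a_def inner2 algebra_simps)
  hence "act_map g R ` B = pgon (act g R) \<inter> {z. a \<bullet> z < l + a \<bullet> q}"
    unfolding cuts_offD(9)[OF g(3)] q_def[symmetric] by auto
  hence "connected (act_map g R ` B)"
    using convex_connected[OF convex_Int[OF is_repD(3)[OF g(2)] convex_halfspace_lt]] by metis
  hence "connected (vshear (\<lambda>x. - act_shift g R x) ` act_map g R ` B)"
    by (rule connected_continuous_image[OF continuous_vshear[OF continuous_on_minus[OF continuous_act_shift[OF g(1)]]]])
  thus ?thesis unfolding act_map_vshear[OF g(1)] image_image by simp
qed

lemma packed_triangle_openin:
  assumes "is_rep R" "packed_triangle R p l B" shows "openin (top_of_set (pgon R)) B"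
proof -
  obtain k h where B: "B = {z\<in>pgon R. k * z$2 + h (z$1) < 0}" "affine_off ((\<lambda>c. c$1) ` set (marks R)) h"
    by (rule packed_triangle_halfplane[OF assms])
  have h: "continuous_on UNIV h" using B(2) unfolding affine_off_def by blast
  have "continuous_on UNIV (\<lambda>z::real^2. h (z$1))"
    by (rule continuous_on_compose2[OF h]) (auto intro: continuous_intros)
  hence "open {z::real^2. k * z$2 + h (z$1) < 0}" by (intro open_Collect_less continuous_intros)
  moreover have "B = pgon R \<inter> {z. k * z$2 + h (z$1) < 0}" using B(1) by auto
  ultimately show ?thesis by (auto simp: openin_open)
qed

section \<open>Areas and recovery of the triangles from their union\<close>

lemma corner_triangle_measure:
  fixes p v w :: "real^2"
  assumes "det2 w v = 1" "l > 0"
  defines "T \<equiv> {p + s *\<^sub>R w + t *\<^sub>R v |s t. 0 \<le> s \<and> 0 \<le> t \<and> s + t < l}"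
  shows "T \<in> lmeasurable" "measure lebesgue T = l\<^sup>2 / 2"
proof -
  let ?H = "convex hull {p, p + l *\<^sub>R w, p + l *\<^sub>R v}"
  have H: "?H = {p + s *\<^sub>R w + t *\<^sub>R v |s t. 0 \<le> s \<and> 0 \<le> t \<and> s + t \<le> l}" (is "_ = ?K")
  proof (intro equalityI subsetI)
    fix x assume "x \<in> ?H"
    then obtain a b c where x: "x = a *\<^sub>R p + b *\<^sub>R (p + l *\<^sub>R w) + c *\<^sub>R (p + l *\<^sub>R v)" "0 \<le> a" "0 \<le> b" "0 \<le> c" "a + b + c = 1"
      unfolding convex_hull_3 by blast
    have "x = (a + b + c) *\<^sub>R p + (b * l) *\<^sub>R w + (c * l) *\<^sub>R v" unfolding x(1) by (simp add: algebra_simps)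
    hence "x = p + (b * l) *\<^sub>R w + (c * l) *\<^sub>R v" using x(5) by simp
    moreover have "b * l + c * l \<le> l" using mult_right_mono[of "b + c" 1 l] x assms(2) by (simp add: algebra_simps)
    ultimately show "x \<in> ?K" using x assms(2) by (intro CollectI exI[of _ "b * l"] exI[of _ "c * l"]) simp
  next
    fix x assume "x \<in> ?K"
    then obtain s t where x: "x = p + s *\<^sub>R w + t *\<^sub>R v" "0 \<le> s" "0 \<le> t" "s + t \<le> l" by blast
    have "x = (1 - s / l - t / l) *\<^sub>R p + (s / l) *\<^sub>R (p + l *\<^sub>R w) + (t / l) *\<^sub>R (p + l *\<^sub>R v)"
      unfolding x(1) using assms(2) by (simp add: algebra_simps)
    moreover have "0 \<le> 1 - s / l - t / l" using x(4) assms(2)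
      by (simp add: diff_diff_eq add_divide_distrib[symmetric])
    ultimately show "x \<in> ?H" unfolding convex_hull_3 using x assms(2)
      by (intro CollectI exI[of _ "1 - s / l - t / l"] exI[of _ "s / l"] exI[of _ "t / l"]) auto
  qed
  have comp: "compact ?H" by (intro finite_imp_compact_convex_hull) simp
  have Hl: "?H \<in> lmeasurable" by (rule lmeasurable_compact[OF comp])
  have "measure lborel ?H = \<bar>((p + l *\<^sub>R v)$1 - p$1) * ((p + l *\<^sub>R w)$2 - p$2) - ((p + l *\<^sub>R w)$1 - p$1) * ((p + l *\<^sub>R v)$2 - p$2)\<bar> / 2"
    by (rule content_triangle)
  also have "((p + l *\<^sub>R v)$1 - p$1) * ((p + l *\<^sub>R w)$2 - p$2) - ((p + l *\<^sub>R w)$1 - p$1) * ((p + l *\<^sub>R v)$2 - p$2) = - (l\<^sup>2 * det2 w v)"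
    by (simp add: det2_eq power2_eq_square algebra_simps)
  finally have "measure lborel ?H = l\<^sup>2 / 2" using assms(1) by simp
  moreover have "measure lebesgue ?H = measure lborel ?H" using comp by (intro measure_completion) (auto dest: compact_imp_closed)
  ultimately have mH: "measure lebesgue ?H = l\<^sup>2 / 2" by simp
  define a :: "real^2" where "a = vector [v$2 - w$2, w$1 - v$1]"
  have hfa: "height p w v z = a \<bullet> z - a \<bullet> p" for z by (simp add: height_eq a_def inner2 algebra_simps)
  have a0: "a \<noteq> 0"
  proof
    assume "a = 0"
    hence "height p w v (p + 1 *\<^sub>R v) = 0" unfolding hfa by simp
    thus False using height_ray(1)[OF assms(1), of p 1] by simp
  qed
  \<comment> \<open>The closed triangle and the half-open one differ only on the third side, which
    is contained in a line.\<close>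
  have "(?H - T) \<union> (T - ?H) \<subseteq> {z. a \<bullet> z = l + a \<bullet> p}"
  proof
    fix z assume z: "z \<in> (?H - T) \<union> (T - ?H)"
    have "T \<subseteq> ?H" unfolding H T_def by force
    hence "z \<in> ?H" "z \<notin> T" using z by auto
    then obtain s t where st: "z = p + s *\<^sub>R w + t *\<^sub>R v" "s + t = l" unfolding H T_def by fastforce
    have "height p w v z = l" unfolding st(1) height_comb[OF assms(1)] by (rule st(2))
    thus "z \<in> {z. a \<bullet> z = l + a \<bullet> p}" unfolding hfa by simp
  qed
  hence neg: "negligible ((?H - T) \<union> (T - ?H))" using negligible_subset[OF negligible_hyperplane] a0 by blast
  show "T \<in> lmeasurable" by (rule lmeasurable_negligible_symdiff[OF Hl neg])
  show "measure lebesgue T = l\<^sup>2 / 2" using measure_negligible_symdiff[OF Hl neg] mH by simp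
qed

lemma packed_triangle_measure:
  assumes "is_rep R" "packed_triangle R p l B"
  shows "B \<in> lmeasurable" "measure lebesgue B = l\<^sup>2 / 2"
proof -
  obtain g v w where g: "g \<in> grp (length (marks R))" "is_rep (act g R)" "cuts_off (act g R) (act_map g R p) l (act_map g R ` B) v w"
    by (rule packed_triangle_cuts_off[OF assms])
  note c = cuts_offD[OF g(3)]
  have m: "act_map g R ` B \<in> lmeasurable" "measure lebesgue (act_map g R ` B) = l\<^sup>2 / 2"
    using corner_triangle_measure[OF c(5,6), of "act_map g R p"] unfolding c(10)[symmetric] by auto
  obtain h where h: "h \<in> grp (length (marks R))" "act_map h (act g R) \<circ> act_map g R = id"
    using act_inverse[OF wf_repI[OF assms(1)] g(1)] by metis
  have hl: "h \<in> grp (length (marks (act g R)))" using h(1) by simp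
  have "act_map h (act g R) ` act_map g R ` B = B" using h(2) by (metis image_comp image_id id_apply)
  thus "B \<in> lmeasurable" "measure lebesgue B = l\<^sup>2 / 2" using measure_preserving_act_map[OF hl, of "act g R"] m unfolding measure_preserving_def by metis+
qed

text \<open>A triangle of one decomposition is connected and covered by the disjoint, relatively
  open triangles of the other, so it lies inside the one it meets; by symmetry the two are
  equal.\<close>

lemma overlapping_packed_triangles_eq:
  assumes "is_rep R" "packs R \<B> P" "packs R \<B>' P" "B \<in> \<B>" "B' \<in> \<B>'" "B \<inter> B' \<noteq> {}"
  shows "B = B'"
proof -
  have sub: "B1 \<subseteq> B2" if h: "packs R \<C> P" "packs R \<C>' P" "B1 \<in> \<C>" "B2 \<in> \<C>'" "B1 \<inter> B2 \<noteq> {}" for \<C> \<C>' B1 B2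
  proof -
    have op: "openin (top_of_set (pgon R)) X" if x: "X \<in> \<C>'" for X
      using packed_triangle_openin[OF assms(1)] h(2) x unfolding packs_def by blast
    obtain p l where pt: "packed_triangle R p l B1" using h(1,3) unfolding packs_def by blast
    have BD: "B1 \<subseteq> pgon R" by (rule packed_triangle_true_corner(5)[OF assms(1) pt])
    obtain U where U: "open U" "B2 = pgon R \<inter> U" using op[OF h(4)] unfolding openin_open by blast
    have "openin (top_of_set (pgon R)) (\<Union>(\<C>' - {B2}))" by (rule openin_Union) (use op in auto)
    then obtain V where V: "open V" "\<Union>(\<C>' - {B2}) = pgon R \<inter> V" unfolding openin_open by blast
    have "B1 \<subseteq> \<Union>\<C>'" using h(1-3) unfolding packs_def by blast
    hence cov: "B1 \<subseteq> U \<union> V" using BD U(2) V(2) by blast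
    have "B2 \<inter> \<Union>(\<C>' - {B2}) = {}" using h(2,4) unfolding packs_def pairwise_def disjnt_def by blast
    hence "U \<inter> V \<inter> B1 = {}" using BD U(2) V(2) by blast
    hence "U \<inter> B1 = {} \<or> V \<inter> B1 = {}"
      by (rule connectedD[OF packed_triangle_connected[OF assms(1) pt] U(1) V(1) _ cov])
    thus ?thesis using h(5) U(2) cov BD by blast
  qed
  have "B' \<inter> B \<noteq> {}" using assms(6) by blast
  thus ?thesis using sub[OF assms(2,3,4,5,6)] sub[OF assms(3,2,5,4)] by blast
qed

text \<open>The size can be read off the area.\<close>

lemma packed_triangle_size_unique:
  assumes "is_rep R" "packed_triangle R p l B" "packed_triangle R p' l' B" shows "l = l'"
proof -
  have "l\<^sup>2 / 2 = l'\<^sup>2 / 2" using packed_triangle_measure(2)[OF assms(1,2)] packed_triangle_measure(2)[OF assms(1,3)] by simp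
  thus ?thesis using packed_triangle_true_corner(6)[OF assms(1,2)] packed_triangle_true_corner(6)[OF assms(1,3)] by (simp add: power2_eq_iff)
qed

text \<open>\<open>triangle_size\<close> ranges over all decompositions of \<open>P\<close>;
  triangles at the same corner contain it and so overlap, hence they coincide and have the same
  size.\<close>

lemma triangle_size_packed:
  assumes "is_rep R" "packs R \<B> P" "B \<in> \<B>" "packed_triangle R p l B"
  shows "triangle_size R P p = l"
proof -
  have uniq: "l' = l" if h: "packs R \<B>' P" "B' \<in> \<B>'" "packed_triangle R p l' B'" for l' \<B>' B'
  proof -
    have "p \<in> B \<inter> B'" using packed_triangle_true_corner(2)[OF assms(1)] assms(4) h(3) by blast
    hence "B = B'" using overlapping_packed_triangles_eq[OF assms(1,2) h(1) assms(3) h(2)] by blast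
    thus ?thesis using packed_triangle_size_unique[OF assms(1) h(3)] assms(4) by simp
  qed
  have ex: "\<exists>l \<B> B. packs R \<B> P \<and> B \<in> \<B> \<and> packed_triangle R p l B" using assms(2-4) by blast
  have "(THE l. \<exists>\<B> B. packs R \<B> P \<and> B \<in> \<B> \<and> packed_triangle R p l B) = l"
    by (rule the_equality) (use assms(2-4) uniq in blast)+
  thus ?thesis unfolding triangle_size_def using ex by simp
qed

lemma triangle_size_empty:
  assumes "is_rep R" "packs R \<B> P" "\<And>B l. B \<in> \<B> \<Longrightarrow> \<not> packed_triangle R p l B"
  shows "triangle_size R P p = 0"
proof -
  have "\<not> (packs R \<B>' P \<and> B' \<in> \<B>' \<and> packed_triangle R p l B')" for l \<B>' B'
  proof
    assume h: "packs R \<B>' P \<and> B' \<in> \<B>' \<and> packed_triangle R p l B'"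
    have p: "p \<in> B'" using packed_triangle_true_corner(2)[OF assms(1)] h by blast
    hence "p \<in> P" using h unfolding packs_def by blast
    then obtain B where B: "B \<in> \<B>" "p \<in> B" using assms(2) unfolding packs_def by blast
    have "B = B'" using overlapping_packed_triangles_eq[OF assms(1,2) _ B(1)] h p B(2) by blast
    thus False using assms(3) B(1) h by blast
  qed
  thus ?thesis unfolding triangle_size_def by auto
qed

lemma triangle_size_positive:
  assumes "is_rep R" "packs R \<B> P" "triangle_size R P p \<noteq> 0"
  obtains B where "B \<in> \<B>" "packed_triangle R p (triangle_size R P p) B"
proof -
  obtain B l where B: "B \<in> \<B>" "packed_triangle R p l B" using triangle_size_empty[OF assms(1,2)] assms(3) by blast
  thus ?thesis using triangle_size_packed[OF assms(1,2) B] that by simp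
qed

lemma triangle_size_nonneg:
  assumes "is_rep R" "packs R \<B> P" shows "triangle_size R P p \<ge> 0"
proof (cases "triangle_size R P p = 0")
  case False
  then obtain B where "packed_triangle R p (triangle_size R P p) B" using triangle_size_positive[OF assms] by metis
  thus ?thesis using packed_triangle_true_corner(6)[OF assms(1)] by (metis less_imp_le)
qed simp

lemma packs_act:
  assumes "is_rep R" "g \<in> grp (length (marks R))" "packs R \<B> P"
  shows "packs (act g R) ((`) (act_map g R) ` \<B>) (act_map g R ` P)"
proof -
  have "\<exists>p l. packed_triangle (act g R) p l (act_map g R ` B)" if "B \<in> \<B>" for B
    using packed_triangle_act[OF assms(1,2)] assms(3) that unfolding packs_def by blast
  moreover have "pairwise disjnt ((`) (act_map g R) ` \<B>)"
    using assms(3) unfolding packs_def pairwise_def disjnt_def act_map_vshear[OF assms(2)] by fastforce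
  moreover have "act_map g R ` P = \<Union> ((`) (act_map g R) ` \<B>)" using assms(3) unfolding packs_def by blast
  ultimately show ?thesis unfolding packs_def by blast
qed

lemma triangle_size_act:
  assumes "is_rep R" "g \<in> grp (length (marks R))" "packs R \<B> P"
  shows "triangle_size (act g R) (act_map g R ` P) (act_map g R p) = triangle_size R P p"
proof -
  note R' = is_rep_act[OF assms(1,2)] and pk = packs_act[OF assms]
  show ?thesis
  proof (cases "triangle_size R P p = 0")
    case True
    have "\<not> packed_triangle (act g R) (act_map g R p) l B'" if h: "B' \<in> (`) (act_map g R) ` \<B>" for B' l
    proof
      assume a: "packed_triangle (act g R) (act_map g R p) l B'"
      obtain B where B: "B \<in> \<B>" "B' = act_map g R ` B" using h by blast
      have p: "packed_triangle R p l B" using a packed_triangle_act[OF assms(1,2)] unfolding B(2) by blast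
      have "l > 0" by (rule packed_triangle_true_corner(6)[OF assms(1) p])
      thus False using triangle_size_packed[OF assms(1,3) B(1) p] True by simp
    qed
    thus ?thesis using triangle_size_empty[OF R' pk] True by metis
  next
    case False
    obtain B where B: "B \<in> \<B>" "packed_triangle R p (triangle_size R P p) B" by (rule triangle_size_positive[OF assms(1,3) False])
    have "packed_triangle (act g R) (act_map g R p) (triangle_size R P p) (act_map g R ` B)"
      using packed_triangle_act[OF assms(1,2)] B(2) by blast
    thus ?thesis using triangle_size_packed[OF R' pk] B(1) by blast
  qed
qed

lemma Lam_packing_class:
  assumes "is_rep R" "is_packing R P"
  shows "Lam idx (packing_class R P) $ k = triangle_size R P (corner R (idx k))"
proof -
  obtain \<B> where pk: "packs R \<B> P" using assms(2) unfolding is_packing_def by blast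
  let ?s = "triangle_size R P (corner R (idx k))"
  have all: "\<forall>(R', P') \<in> packing_class R P. ?s = triangle_size R' P' (corner R' (idx k))"
    unfolding packing_class_def using triangle_size_act[OF assms(1) _ pk] corner_act[OF assms(1)] by auto
  have mem: "(R, P) \<in> packing_class R P"
  proof -
    note u = act_unit[OF wf_repI[OF assms(1)]]
    show ?thesis unfolding packing_class_def
      by (intro CollectI exI[of _ "group_elt 0 0 (replicate (length (marks R)) 1)"]) (simp only: u image_id id_apply simp_thms)
  qed
  have "(THE s. \<forall>(R', P') \<in> packing_class R P. s = triangle_size R' P' (corner R' (idx k))) = ?s"
  proof (rule the_equality)
    show "\<forall>(R', P') \<in> packing_class R P. ?s = triangle_size R' P' (corner R' (idx k))" by (rule all)
    fix s assume "\<forall>(R', P') \<in> packing_class R P. s = triangle_size R' P' (corner R' (idx k))"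
    thus "s = ?s" using mem by auto
  qed
  thus ?thesis by (simp add: Lam_def)
qed

section \<open>Packing classes of the orbit\<close>

lemma packing_class_act:
  assumes "is_rep R" "h \<in> grp (length (marks R))"
  shows "packing_class (act h R) (act_map h R ` P) = packing_class R P"
proof (intro equalityI subsetI)
  note wf = wf_repI[OF assms(1)]
  fix x assume "x \<in> packing_class (act h R) (act_map h R ` P)"
  then obtain g where g: "g \<in> grp (length (marks R))" "x = (act g (act h R), act_map g (act h R) ` act_map h R ` P)"
    unfolding packing_class_def by auto
  obtain k where k: "k \<in> grp (length (marks R))" "act g (act h R) = act k R" "act_map g (act h R) \<circ> act_map h R = act_map k R"
    by (rule act_compose[OF wf assms(2) g(1)])
  have "x = (act k R, act_map k R ` P)" unfolding g(2) k(2) image_comp k(3) ..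
  thus "x \<in> packing_class R P" unfolding packing_class_def using k(1) by blast
next
  note wf = wf_repI[OF assms(1)]
  fix x assume "x \<in> packing_class R P"
  then obtain g where g: "g \<in> grp (length (marks R))" "x = (act g R, act_map g R ` P)"
    unfolding packing_class_def by auto
  obtain k where k: "k \<in> grp (length (marks R))" "act k (act h R) = R" "act_map k (act h R) \<circ> act_map h R = id"
    by (rule act_inverse[OF wf assms(2)])
  have wf': "wf_rep (act h R)" by (rule wf_rep_act[OF wf assms(2)])
  have kl: "k \<in> grp (length (marks (act h R)))" "g \<in> grp (length (marks (act h R)))" using k(1) g(1) by auto
  obtain f where f: "f \<in> grp (length (marks (act h R)))" "act g (act k (act h R)) = act f (act h R)"
    "act_map g (act k (act h R)) \<circ> act_map k (act h R) = act_map f (act h R)"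
    by (rule act_compose[OF wf' kl])
  have "act_map f (act h R) ` act_map h R ` P = act_map g R ` (act_map k (act h R) \<circ> act_map h R) ` P"
    unfolding f(3)[symmetric] k(2) by (simp only: image_comp o_assoc)
  hence "x = (act f (act h R), act_map f (act h R) ` act_map h R ` P)" using g(2) f(2) k(2,3) by simp
  thus "x \<in> packing_class (act h R) (act_map h R ` P)" unfolding packing_class_def using f(1) by blast
qed

text \<open>The action is transitive on the orbit, so every packing class can be based at the given
  representative.\<close>

lemma packings_eq:
  assumes "semitoric_polygon S" "R \<in> S"
  shows "is_rep R" "packings S = {packing_class R P |P. is_packing R P}"
proof -
  obtain R0 where R0: "is_rep R0" "S = orbit R0" using assms(1) unfolding semitoric_polygon_def by blast
  obtain g where g: "g \<in> grp (length (marks R0))" "R = act g R0" using assms(2) R0(2) unfolding orbit_def by blast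
  note wf = wf_repI[OF R0(1)]
  show R: "is_rep R" unfolding g(2) by (rule is_rep_act[OF R0(1) g(1)])
  show "packings S = {packing_class R P |P. is_packing R P}"
  proof (intro equalityI subsetI)
    fix F assume "F \<in> packings S"
    then obtain R1 Q where F: "F = packing_class R1 Q" "R1 \<in> S" "is_packing R1 Q" unfolding packings_def by blast
    obtain h where h: "h \<in> grp (length (marks R0))" "R1 = act h R0" using F(2) R0(2) unfolding orbit_def by blast
    have R1: "is_rep R1" unfolding h(2) by (rule is_rep_act[OF R0(1) h(1)])
    have wf1: "wf_rep (act h R0)" by (rule wf_rep_act[OF wf h(1)])
    obtain k where k: "k \<in> grp (length (marks R0))" "act k (act h R0) = R0" by (rule act_inverse[OF wf h(1)])
    have kl: "k \<in> grp (length (marks (act h R0)))" "g \<in> grp (length (marks (act h R0)))" using k(1) g(1) by auto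
    obtain f where f: "f \<in> grp (length (marks (act h R0)))" "act g (act k (act h R0)) = act f (act h R0)"
      by (rule act_compose[OF wf1 kl])
    have R': "R = act f R1" using f(2) k(2) g(2) h(2) by simp
    have fl: "f \<in> grp (length (marks R1))" using f(1) h(2) by simp
    have "is_packing R (act_map f R1 ` Q)" using F(3) packs_act[OF R1 fl] R' unfolding is_packing_def by blast
    moreover have "F = packing_class R (act_map f R1 ` Q)" unfolding F(1) R' by (rule packing_class_act[OF R1 fl, symmetric])
    ultimately show "F \<in> {packing_class R P |P. is_packing R P}" by blast
  next
    fix F assume "F \<in> {packing_class R P |P. is_packing R P}"
    thus "F \<in> packings S" unfolding packings_def using assms(2) by blast
  qed
qed

section \<open>Packing vectors and the polytope\<close>

lemma edge_length_nonneg: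
  assumes "is_rep R" shows "edge_length R i \<ge> 0"
proof -
  obtain v where v: "primitive_vec v" "tangent 1 (pgon R) (corner R i) v" using corner_dirs[OF assms] by metis
  show ?thesis unfolding edge_length_def
    using emanates_path_bounds[OF emanates_semi_edge[OF assms v] semi_edge_nonempty[OF assms]] by simp
qed

lemma marked_bound_nonneg:
  assumes "is_rep R" "i < ncorners R" shows "0 \<le> marked_bound R i"
proof -
  obtain v w where d: "primitive_vec v" "tangent 1 (pgon R) (corner R i) v" "primitive_vec w" "tangent (-1) (pgon R) (corner R i) w"
    using corner_dirs[OF assms(1)] by metis
  note em = chain_at_emanates[OF assms d]
  have "path_length_to (chain_at R i c) q \<ge> 0" if "q \<in> chain_set (chain_at R i c)" for c q
    using emanates_path_bounds[OF em(1)] emanates_path_bounds[OF em(2)] that by (cases c) auto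
  hence "0 \<le> path_length_to (chain_at R i c) q + \<bar>marks R ! j $ 2 - q$2\<bar> * \<bar>v$1 - w$1\<bar>"
    if "nearest_hit R i j (chain_at R i c) q" for c q j using that by (simp add: nearest_hit_iff)
  hence "ereal 0 \<le> marked_bound R i" unfolding marked_bound_iff[OF assms(1) d] by blast
  thus ?thesis by (simp add: zero_ereal_def)
qed

text \<open>Excludes that a corner is its own neighbour, when the adjacency condition would bound
  twice its size. The leftmost and the rightmost slice each contain a true corner.\<close>

lemma two_corners:
  assumes "is_rep R" shows "ncorners R \<noteq> 1"
proof
  assume one: "ncorners R = 1"
  note r = is_repD[OF assms]
  have uni: "p = q" if "true_corner R p" "true_corner R q" for p q
    using one that unfolding ncorners_def by (metis (mono_tags, lifting) card_1_singletonE mem_Collect_eq singletonD)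
  have ne: "pgon R \<noteq> {}" using r(4) interior_subset by blast
  let ?X = "(\<lambda>z. z$1) ` pgon R"
  have X: "compact ?X" by (intro compact_continuous_image r(6) continuous_intros)
  obtain a where a: "a \<in> pgon R" "\<And>x. x \<in> pgon R \<Longrightarrow> a$1 \<le> x$1" using compact_attains_inf[OF X] ne by auto
  obtain b where b: "b \<in> pgon R" "\<And>x. x \<in> pgon R \<Longrightarrow> x$1 \<le> b$1" using compact_attains_sup[OF X] ne by auto
  obtain a' where a': "vtop 1 (pgon R) a'" "a'$1 = a$1" by (rule vtop_exists[OF r(6) a(1)])
  obtain b' where b': "vtop 1 (pgon R) b'" "b'$1 = b$1" by (rule vtop_exists[OF r(6) b(1)])
  have "true_corner R a'" using end_true_corner[OF assms a'(1), of 1] a(2) a'(2) by simp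
  moreover have "true_corner R b'" using end_true_corner[OF assms b'(1), of "-1"] b(2) b'(2) by simp
  ultimately have ab: "a$1 = b$1" using uni a'(2) b'(2) by metis
  obtain c where c: "c \<in> interior (pgon R)" using r(4) by blast
  have "a$1 \<le> c$1" "c$1 \<le> b$1" using a(2) b(2) c interior_subset by blast+
  hence "c$1 = a$1" using ab by simp
  moreover have "c$1 \<noteq> a$1" using mark_not_end[OF c, of 1 a] a(2) by simp
  ultimately show False by simp
qed

text \<open>The chord between the two corners provides a point of the polygon over the required
  abscissa; the appropriate end of its slice lies on the semitoric edge.\<close>

lemma semi_edge_point:
  assumes "is_rep R" "0 \<le> a" "a \<le> edge_length R i"
  obtains z where "z \<in> chain_set (semi_edge R i)" "path_length_to (semi_edge R i) z = a"
proof -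
  let ?p = "corner R i" and ?q = "next_corner R (corner R i)"
  note r = is_repD[OF assms(1)]
  note ex = true_corner_extreme[OF corner_true[OF assms(1)]]
  obtain v where v: "primitive_vec v" "tangent 1 (pgon R) ?p v" using corner_dirs[OF assms(1)] by metis
  note em = emanates_semi_edge[OF assms(1) v]
  show ?thesis
  proof (cases "v$1 = 0")
    case True
    obtain L where L: "single_edge (pgon R) ?p v (semi_edge R i) L" using emanates_short[OF em True] by blast
    note s = single_edgeD[OF L]
    have "a \<le> L" using assms(3) s(3) by (simp add: edge_length_def)
    thus ?thesis using that[of "?p + a *\<^sub>R v"] s(5,6) assms(2) by blast
  next
    case False
    have last: "last (semi_edge R i) = ?q" unfolding semi_edge_eq by (rule edge_chain_props(4)[OF assms(1) ex v])
    have len: "edge_length R i = (?q$1 - ?p$1) / v$1" unfolding edge_length_def using emanates_length[OF em False] last by simp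
    have pos: "edge_length R i > 0" unfolding len by (rule next_corner_least(2)[OF assms(1) ex v False])
    define t where "t = a / edge_length R i"
    have t: "0 \<le> t" "t \<le> 1" using assms(2,3) pos by (auto simp: t_def)
    have "?p \<in> pgon R" by (rule tangentD(2)[OF v(2)])
    moreover have "?q \<in> pgon R" using true_corner_frontier[OF assms(1) steps_to_corner_props(2)[OF assms(1) ex]]
      frontier_subset_closed[OF r(5)] by blast
    ultimately have D: "(1 - t) *\<^sub>R ?p + t *\<^sub>R ?q \<in> pgon R" using r(3) t by (simp add: convex_alt)
    obtain z where z: "vtop (sgn (v$1)) (pgon R) z" "z$1 = ((1 - t) *\<^sub>R ?p + t *\<^sub>R ?q)$1" by (rule vtop_exists[OF r(6) D])
    have qx: "?q$1 - ?p$1 = edge_length R i * v$1" using len False by simp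
    have "z$1 - ?p$1 = t * (?q$1 - ?p$1)" using z(2) by (simp add: algebra_simps)
    hence zx: "z$1 - ?p$1 = a * v$1" unfolding qx t_def using pos by simp
    have zq: "?q$1 - z$1 = (edge_length R i - a) * v$1" using zx qx by (simp add: algebra_simps)
    have "z \<in> chain_set (semi_edge R i)" unfolding semi_edge_vtop_set(2)[OF assms(1) v False]
      using z(1) zx zq assms(2,3) False by simp
    moreover have "path_length_to (semi_edge R i) z = a" using emanates_path[OF em False calculation] zx False by simp
    ultimately show ?thesis by (rule that)
  qed
qed

text \<open>
  If the two sizes exceeded the length of the common edge, the point at equal slack from both
  ends would lie in both triangles.
\<close>

lemma adjacent_triangles_sum:
  assumes "is_rep R" "i < ncorners R" "j = Suc i mod ncorners R" "packed_triangle R (corner R i) l B"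
    "packed_triangle R (corner R j) l' B'" "B \<inter> B' = {}"
  shows "l + l' \<le> edge_length R i"
proof (rule ccontr)
  assume n: "\<not> l + l' \<le> edge_length R i"
  have j: "j < ncorners R" "prev_index R j = i" using assms(2,3) prev_index_Suc[OF assms(1,2)] by auto
  note b = packed_triangle_bounds[OF assms(1,2,4)] and b' = packed_triangle_bounds[OF assms(1) j(1) assms(5), unfolded j(2)]
  obtain z where z: "z \<in> chain_set (semi_edge R i)" "path_length_to (semi_edge R i) z < l"
    "edge_length R i - path_length_to (semi_edge R i) z < l'"
  proof -
    \<comment> \<open>The value lies between 0 and the edge length because neither size alone
      exceeds that length.\<close>
    obtain z where "z \<in> chain_set (semi_edge R i)" "path_length_to (semi_edge R i) z = (edge_length R i - l' + l) / 2"
      using semi_edge_point[OF assms(1), of "(edge_length R i - l' + l) / 2" i] b(1,2) b'(1,3) by auto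
    thus ?thesis using that n by simp
  qed
  have "path_length_to (chain_at R i True) z < l" using z(2) by (simp add: chain_at_def)
  hence "z \<in> B" using packed_triangle_chain_mem[OF assms(1,2,4), of z True] z(1) by (simp add: chain_at_def)
  moreover have "path_length_to (chain_at R j False) z < l'"
    using z(3) chain_at_rev(2)[OF assms(1) z(1)] j(2) by (simp add: chain_at_def)
  hence "z \<in> B'" using packed_triangle_chain_mem[OF assms(1) j(1) assms(5), of z False] z(1) j(2) by (simp add: chain_at_def chain_set_rev)
  ultimately show False using assms(6) by blast
qed

lemma packing_sizes_in_polytope:
  assumes "is_rep R" "bij_betw idx UNIV {..<ncorners R}" "is_packing R P"
  shows "Lam idx (packing_class R P) \<in> packing_polytope R idx"
proof -
  obtain \<B> where pk: "packs R \<B> P" using assms(3) unfolding is_packing_def by blast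
  define s where "s i = triangle_size R P (corner R i)" for i
  have L: "Lam idx (packing_class R P) $ k = s (idx k)" for k unfolding s_def by (rule Lam_packing_class[OF assms(1,3)])
  have idx: "idx k < ncorners R" for k using assms(2) by (auto dest: bij_betwE)
  have s0: "s i \<ge> 0" for i unfolding s_def by (rule triangle_size_nonneg[OF assms(1) pk])
  have pos: "\<exists>B\<in>\<B>. packed_triangle R (corner R i) (s i) B" if "s i \<noteq> 0" for i
    using triangle_size_positive[OF assms(1) pk that[unfolded s_def]] unfolding s_def by metis
  have mb: "ereal (s i) \<le> marked_bound R i" if i: "i < ncorners R" for i
  proof (cases "s i = 0")
    case True thus ?thesis using marked_bound_nonneg[OF assms(1) i] by (simp add: zero_ereal_def)
  next
    case False thus ?thesis using pos packed_triangle_bounds(4)[OF assms(1) i] by blast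
  qed
  have sum: "s i + s j \<le> edge_length R i" if h: "i < ncorners R" "j = Suc i mod ncorners R" for i j
  proof -
    have j: "j < ncorners R" "prev_index R j = i" using h prev_index_Suc[OF assms(1) h(1)] by auto
    have ij: "i \<noteq> j"
    proof (cases "Suc i = ncorners R")
      case True
      hence "j = 0" using h(2) by simp
      moreover have "i \<noteq> 0" using True two_corners[OF assms(1)] by auto
      ultimately show ?thesis by simp
    next
      case False
      hence "Suc i < ncorners R" using h(1) by simp
      thus ?thesis using h(2) by simp
    qed
    consider "s i = 0" "s j = 0" | "s i = 0" "s j \<noteq> 0" | "s i \<noteq> 0" "s j = 0" | "s i \<noteq> 0" "s j \<noteq> 0" by blast
    thus ?thesis
    proof cases
      case 1 thus ?thesis using edge_length_nonneg[OF assms(1)] by simp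
    next
      case 2 thus ?thesis using pos[of j] packed_triangle_bounds(3)[OF assms(1) j(1)] j(2) by auto
    next
      case 3 thus ?thesis using pos[of i] packed_triangle_bounds(2)[OF assms(1) h(1)] by auto
    next
      case 4
      obtain B where B: "B \<in> \<B>" "packed_triangle R (corner R i) (s i) B" using pos 4 by blast
      obtain B' where B': "B' \<in> \<B>" "packed_triangle R (corner R j) (s j) B'" using pos 4 by blast
      have "corner R i \<noteq> corner R j" using bij_betw_imp_inj_on[OF corner_enumeration(1)[OF assms(1)]] h(1) j(1) ij
        by (auto simp: inj_on_def)
      hence "B \<noteq> B'" using packed_triangle_true_corner(1,2,3)[OF assms(1) B(2)] packed_triangle_true_corner(1,2,3)[OF assms(1) B'(2)] by metis
      hence "B \<inter> B' = {}" using pk B(1) B'(1) unfolding packs_def pairwise_def disjnt_def by blast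
      thus ?thesis by (rule adjacent_triangles_sum[OF assms(1) h B(2) B'(2)])
    qed
  qed
  show ?thesis unfolding packing_polytope_def using L s0 mb sum idx by simp
qed

lemma packing_of_sizes:
  assumes "is_rep R" "bij_betw idx UNIV {..<ncorners R}" "v \<in> packing_polytope R idx"
  shows "\<exists>P. is_packing R P \<and> Lam idx (packing_class R P) = v"
proof -
  have idx: "idx k < ncorners R" for k using assms(2) by (auto dest: bij_betwE)
  have v0: "v$k \<ge> 0" and mb: "ereal (v$k) \<le> marked_bound R (idx k)" for k using assms(3) unfolding packing_polytope_def by auto
  have sum: "v$k + v$k' \<le> edge_length R (idx k)" if "idx k' = Suc (idx k) mod ncorners R" for k k'
    using assms(3) that unfolding packing_polytope_def by auto
  have ex: "\<exists>k. idx k = i" if "i < ncorners R" for i using assms(2) that unfolding bij_betw_def by (metis imageE lessThan_iff)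
  have "\<exists>B. packed_triangle R (corner R (idx k)) (v$k) B" if k: "v$k \<noteq> 0" for k
  proof -
    have d: "ncorners R > 0" using idx[of k] by simp
    obtain k1 where k1: "idx k1 = Suc (idx k) mod ncorners R" using ex[of "Suc (idx k) mod ncorners R"] d by auto
    note p = prev_index[OF assms(1) idx[of k]]
    obtain k2 where k2: "idx k2 = prev_index R (idx k)" using ex p(1) by blast
    \<comment> \<open>The bound by a single edge is the adjacency inequality together with the
      nonnegativity of the neighbour's size, on either side of the corner.\<close>
    have "v$k \<le> edge_length R (idx k)" using sum[OF k1] v0[of k1] by simp
    moreover have "v$k \<le> edge_length R (prev_index R (idx k))" using sum[of k k2] p(2) v0[of k2] k2 by simp
    moreover have "v$k > 0" using k v0[of k] by simp
    ultimately show ?thesis using packed_triangle_exists[OF assms(1) idx] mb by blast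
  qed
  then obtain T where T: "\<And>k. v$k \<noteq> 0 \<Longrightarrow> packed_triangle R (corner R (idx k)) (v$k) (T k)" by metis
  define \<B> where "\<B> = T ` {k. v$k \<noteq> 0}"
  have "T k \<inter> T k' = {}" if h: "v$k \<noteq> 0" "v$k' \<noteq> 0" "k \<noteq> k'" for k k'
  proof (rule packed_triangles_disjoint[OF assms(1) idx idx _ T[OF h(1)] T[OF h(2)]])
    show "idx k \<noteq> idx k'" using h(3) bij_betw_imp_inj_on[OF assms(2)] by (auto simp: inj_on_def)
    show "v$k + v$k' \<le> edge_length R (idx k)" if "idx k' = Suc (idx k) mod ncorners R" by (rule sum[OF that])
    show "v$k + v$k' \<le> edge_length R (idx k')" if "idx k = Suc (idx k') mod ncorners R" using sum[OF that] by simp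
  qed
  hence "pairwise disjnt \<B>" unfolding \<B>_def pairwise_def disjnt_def by blast
  hence pk: "packs R \<B> (\<Union>\<B>)" unfolding packs_def \<B>_def using T by blast
  have ts: "triangle_size R (\<Union>\<B>) (corner R (idx k)) = v$k" for k
  proof (cases "v$k = 0")
    case True
    have "\<not> packed_triangle R (corner R (idx k)) l B" if h: "B \<in> \<B>" for B l
    proof
      assume a: "packed_triangle R (corner R (idx k)) l B"
      obtain k' where k': "B = T k'" "v$k' \<noteq> 0" using h unfolding \<B>_def by blast
      note B = T[OF k'(2), folded k'(1)]
      have "corner R (idx k) = corner R (idx k')"
        using packed_triangle_true_corner(1,2)[OF assms(1) a] packed_triangle_true_corner(3)[OF assms(1) B] by blast
      hence "idx k = idx k'" using bij_betw_imp_inj_on[OF corner_enumeration(1)[OF assms(1)]] idx by (auto simp: inj_on_def)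
      hence "k = k'" using bij_betw_imp_inj_on[OF assms(2)] by (auto simp: inj_on_def)
      thus False using True k'(2) by simp
    qed
    thus ?thesis using triangle_size_empty[OF assms(1) pk] True by metis
  next
    case False
    show ?thesis by (rule triangle_size_packed[OF assms(1) pk _ T[OF False]]) (use False in \<open>auto simp: \<B>_def\<close>)
  qed
  have ip: "is_packing R (\<Union>\<B>)" using pk unfolding is_packing_def by blast
  have "Lam idx (packing_class R (\<Union>\<B>)) $ k = v $ k" for k by (rule trans[OF Lam_packing_class[OF assms(1) ip] ts])
  hence "Lam idx (packing_class R (\<Union>\<B>)) = v" by (simp add: vec_eq_iff)
  thus ?thesis using ip by blast
qed

lemma packing_determined_by_sizes:
  assumes "is_rep R" "packs R \<B> P" "packs R \<B>' P'" "\<And>i. i < ncorners R \<Longrightarrow> triangle_size R P (corner R i) = triangle_size R P' (corner R i)"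
  shows "\<B> \<subseteq> \<B>'"
proof
  fix B assume B: "B \<in> \<B>"
  then obtain p l where p: "packed_triangle R p l B" using assms(2) unfolding packs_def by blast
  note tc = packed_triangle_true_corner[OF assms(1) p]
  have "p \<in> corner R ` {..<ncorners R}" using tc(1) corner_enumeration(1)[OF assms(1)] unfolding bij_betw_def by blast
  then obtain i where i: "i < ncorners R" "p = corner R i" by auto
  have "triangle_size R P' p = l" using triangle_size_packed[OF assms(1,2) B p] assms(4)[OF i(1)] i(2) by simp
  moreover have "l \<noteq> 0" using tc(6) by simp
  ultimately obtain B' where "B' \<in> \<B>'" "packed_triangle R p l B'" using triangle_size_positive[OF assms(1,3)] by metis
  thus "B \<in> \<B>'" using packed_triangle_unique[OF assms(1) p] by metis
qed

lemma packing_area: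
  fixes idx :: "'n::finite \<Rightarrow> nat"
  assumes "is_rep R" "bij_betw idx UNIV {..<ncorners R}" "is_packing R P"
  shows "P \<in> lmeasurable" "measure lebesgue P = 1/2 * (norm (Lam idx (packing_class R P)))\<^sup>2"
proof -
  obtain \<B> where pk: "packs R \<B> P" using assms(3) unfolding is_packing_def by blast
  define s where "s k = triangle_size R P (corner R (idx k))" for k
  have L: "Lam idx (packing_class R P) $ k = s k" for k unfolding s_def by (rule Lam_packing_class[OF assms(1,3)])
  define K where "K = {k. s k \<noteq> 0}"
  have "\<exists>B. B \<in> \<B> \<and> packed_triangle R (corner R (idx k)) (s k) B" if "k \<in> K" for k
    using triangle_size_positive[OF assms(1) pk] that unfolding K_def s_def by (metis mem_Collect_eq)
  then obtain T where T: "\<And>k. k \<in> K \<Longrightarrow> T k \<in> \<B>" "\<And>k. k \<in> K \<Longrightarrow> packed_triangle R (corner R (idx k)) (s k) (T k)" by metis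
  have inj: "inj_on T K"
  proof (rule inj_onI)
    fix k k' assume k: "k \<in> K" "k' \<in> K" "T k = T k'"
    have "corner R (idx k) = corner R (idx k')"
      using packed_triangle_true_corner(1,2)[OF assms(1) T(2)[OF k(1)]] packed_triangle_true_corner(3)[OF assms(1) T(2)[OF k(2)]] k(3) by metis
    moreover have "idx k < ncorners R" "idx k' < ncorners R" using assms(2) by (auto dest: bij_betwE)
    ultimately have "idx k = idx k'" using bij_betw_imp_inj_on[OF corner_enumeration(1)[OF assms(1)]] by (auto simp: inj_on_def)
    thus "k = k'" using bij_betw_imp_inj_on[OF assms(2)] by (auto simp: inj_on_def)
  qed
  have img: "T ` K = \<B>"
  proof (intro equalityI subsetI)
    fix B assume "B \<in> T ` K" thus "B \<in> \<B>" using T(1) by blast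
  next
    fix B assume B: "B \<in> \<B>"
    then obtain p l where p: "packed_triangle R p l B" using pk unfolding packs_def by blast
    note tc = packed_triangle_true_corner[OF assms(1) p]
    have "p \<in> corner R ` {..<ncorners R}" using tc(1) corner_enumeration(1)[OF assms(1)] unfolding bij_betw_def by blast
    then obtain i where i: "i < ncorners R" "p = corner R i" by auto
    obtain k where k: "idx k = i" using assms(2) i(1) unfolding bij_betw_def by (metis imageE lessThan_iff)
    have sk: "s k = l" using triangle_size_packed[OF assms(1) pk B p] i(2) k unfolding s_def by simp
    hence kK: "k \<in> K" using tc(6) unfolding K_def by simp
    \<comment> \<open>Corner and size determine the triangle, so the chosen triangles exhaust the
      given decomposition.\<close>
    have "T k = B" using packed_triangle_unique[OF assms(1) p, of "T k"] T(2)[OF kK] i(2) k sk by simp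
    thus "B \<in> T ` K" using kK by blast
  qed
  have fin: "finite \<B>" unfolding img[symmetric] by simp
  have lm: "B \<in> lmeasurable" if "B \<in> \<B>" for B using pk that packed_triangle_measure(1)[OF assms(1)] unfolding packs_def by blast
  have P: "P = \<Union>\<B>" "pairwise disjnt \<B>" using pk unfolding packs_def by auto
  show "P \<in> lmeasurable" unfolding P(1) using fin lm by (intro fmeasurable.finite_Union) auto
  have "measure lebesgue P = (\<Sum>B\<in>\<B>. measure lebesgue B)" unfolding P(1) by (rule measure_Union'[OF fin lm P(2)])
  also have "\<dots> = (\<Sum>k\<in>K. measure lebesgue (T k))" unfolding img[symmetric] by (simp add: sum.reindex[OF inj])
  also have "\<dots> = (\<Sum>k\<in>K. (s k)\<^sup>2 / 2)" using packed_triangle_measure(2)[OF assms(1) T(2)] by (intro sum.cong) auto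
  also have "\<dots> = (\<Sum>k\<in>UNIV. (s k)\<^sup>2 / 2)" by (rule sum.mono_neutral_left) (auto simp: K_def)
  also have "\<dots> = 1/2 * (norm (Lam idx (packing_class R P)))\<^sup>2"
    unfolding power2_norm_eq_inner inner_vec_def L by (simp add: sum_divide_distrib power2_eq_square)
  finally show "measure lebesgue P = 1/2 * (norm (Lam idx (packing_class R P)))\<^sup>2" .
qed

lemma polytope_packing_polytope:
  fixes idx :: "'n::finite \<Rightarrow> nat"
  assumes "is_rep R" "bij_betw idx UNIV {..<ncorners R}"
  shows "polytope (packing_polytope R idx)"
proof -
  have idx: "idx k < ncorners R" for k using assms(2) by (auto dest: bij_betwE)
  have comp: "axis k 1 \<bullet> v = v$k" for k and v :: "real^'n" by (simp add: inner_axis')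
  define A where "A k = {v :: real^'n. (- axis k 1) \<bullet> v \<le> 0}" for k
  define M where "M k = {v :: real^'n. ereal (v$k) \<le> marked_bound R (idx k)}" for k
  define E where "E k k' = {v :: real^'n. idx k' = Suc (idx k) mod ncorners R \<longrightarrow> v$k + v$k' \<le> edge_length R (idx k)}" for k k'
  have poly: "polyhedron (A k)" for k unfolding A_def by (rule polyhedron_halfspace_le)
  have polyM: "polyhedron (M k)" for k
  proof (cases "marked_bound R (idx k)")
    case (real m)
    hence "M k = {v. axis k 1 \<bullet> v \<le> m}" unfolding M_def comp by simp
    thus ?thesis by (simp add: polyhedron_halfspace_le)
  next
    case PInf
    hence "M k = UNIV" unfolding M_def by simp
    thus ?thesis by simp
  next
    case MInf
    thus ?thesis using marked_bound_nonneg[OF assms(1) idx[of k]] by simp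
  qed
  have polyE: "polyhedron (E k k')" for k k'
  proof (cases "idx k' = Suc (idx k) mod ncorners R")
    case True
    hence "E k k' = {v. (axis k 1 + axis k' 1) \<bullet> v \<le> edge_length R (idx k)}" unfolding E_def inner_add_left comp by simp
    thus ?thesis by (simp only: polyhedron_halfspace_le)
  next
    case False
    hence "E k k' = UNIV" unfolding E_def by simp
    thus ?thesis by simp
  qed
  have eq: "packing_polytope R idx = \<Inter> (range A \<union> range M \<union> (\<Union>k. range (E k)))"
  proof (rule set_eqI)
    fix v :: "real^'n"
    have "v \<in> packing_polytope R idx \<longleftrightarrow> (\<forall>k. v \<in> A k) \<and> (\<forall>k. v \<in> M k) \<and> (\<forall>k k'. v \<in> E k k')"
      unfolding packing_polytope_def A_def M_def E_def by (auto simp: inner_axis')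
    thus "v \<in> packing_polytope R idx \<longleftrightarrow> v \<in> \<Inter> (range A \<union> range M \<union> (\<Union>k. range (E k)))"
      unfolding Inter_iff by (simp add: ball_Un)
  qed
  have "polyhedron (packing_polytope R idx)" unfolding eq
    by (rule polyhedron_Inter) (use poly polyM polyE in auto)
  \<comment> \<open>The marked bounds may be infinite; boundedness comes from the edge inequalities,
    in which both summands are nonnegative.\<close>
  moreover have "bounded (packing_polytope R idx)"
  proof (rule bounded_subset[OF bounded_cbox], rule subsetI)
    fix v assume v: "v \<in> packing_polytope R idx"
    have "0 \<le> v$k \<and> v$k \<le> edge_length R (idx k)" for k
    proof -
      have "Suc (idx k) mod ncorners R < ncorners R" using idx[of k] by simp
      then obtain k' where k': "idx k' = Suc (idx k) mod ncorners R" using assms(2) unfolding bij_betw_def by (metis imageE lessThan_iff)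
      have "v$k + v$k' \<le> edge_length R (idx k)" "0 \<le> v$k" "0 \<le> v$k'" using v k' unfolding packing_polytope_def by auto
      thus ?thesis by simp
    qed
    thus "v \<in> cbox 0 (\<chi> k. edge_length R (idx k))" by (simp add: mem_box_cart)
  qed
  ultimately show ?thesis by (simp add: polytope_eq_bounded_polyhedron)
qed

theorem theorem1p6:
  fixes S :: "srep set" and R :: srep and idx :: "'n::finite \<Rightarrow> nat"
  assumes "semitoric_polygon S"
    and "R \<in> S"
    and "bij_betw idx UNIV {..<ncorners R}"
  shows "Lam idx ` packings S = packing_polytope R idx \<and>
         bij_betw (Lam idx) (packings S) (packing_polytope R idx) \<and>
         compact (packing_polytope R idx) \<and> convex (packing_polytope R idx) \<and>
         polytope (packing_polytope R idx) \<and>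
         (\<forall>F \<in> packings S. \<forall>(R', P) \<in> F. measure lebesgue P = 1/2 * (norm (Lam idx F))\<^sup>2)"
proof -
  note R = packings_eq(1)[OF assms(1,2)] and pe = packings_eq(2)[OF assms(1,2)]
  have img: "Lam idx ` packings S = packing_polytope R idx"
  proof (intro equalityI subsetI)
    fix v assume "v \<in> Lam idx ` packings S"
    thus "v \<in> packing_polytope R idx" unfolding pe using packing_sizes_in_polytope[OF R assms(3)] by blast
  next
    fix v assume "v \<in> packing_polytope R idx"
    from packing_of_sizes[OF R assms(3) this] show "v \<in> Lam idx ` packings S" unfolding pe by blast
  qed
  have inj: "inj_on (Lam idx) (packings S)"
  proof (rule inj_onI)
    fix F F' assume F: "F \<in> packings S" "F' \<in> packings S" "Lam idx F = Lam idx F'"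
    obtain P where P: "F = packing_class R P" "is_packing R P" using F(1) unfolding pe by blast
    obtain P' where P': "F' = packing_class R P'" "is_packing R P'" using F(2) unfolding pe by blast
    have eq: "triangle_size R P (corner R i) = triangle_size R P' (corner R i)" if i: "i < ncorners R" for i
    proof -
      obtain k where "idx k = i" using assms(3) i unfolding bij_betw_def by (metis imageE lessThan_iff)
      thus ?thesis using Lam_packing_class[OF R P(2), of idx k] Lam_packing_class[OF R P'(2), of idx k] F(3) P(1) P'(1) by simp
    qed
    obtain \<B> \<B>' where pk: "packs R \<B> P" "packs R \<B>' P'" using P(2) P'(2) unfolding is_packing_def by blast
    have "\<B> = \<B>'" using packing_determined_by_sizes[OF R pk eq] packing_determined_by_sizes[OF R pk(2,1) eq[symmetric]] by blast
    hence "P = P'" using pk unfolding packs_def by simp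
    thus "F = F'" using P(1) P'(1) by simp
  qed
  have area: "measure lebesgue P' = 1/2 * (norm (Lam idx F))\<^sup>2" if h: "F \<in> packings S" "(R', P') \<in> F" for F R' P'
  proof -
    obtain P where P: "F = packing_class R P" "is_packing R P" using h(1) unfolding pe by blast
    obtain g where g: "g \<in> grp (length (marks R))" "P' = act_map g R ` P" using h(2) unfolding P(1) packing_class_def by blast
    note a = packing_area[OF R assms(3) P(2)]
    have "measure lebesgue P' = measure lebesgue P" unfolding g(2) using measure_preserving_act_map[OF g(1), of R] a(1) unfolding measure_preserving_def by blast
    thus ?thesis using a(2) unfolding P(1) by simp
  qed
  have poly: "polytope (packing_polytope R idx)" by (rule polytope_packing_polytope[OF R assms(3)])
  show ?thesis
    using img inj area poly polytope_imp_compact[OF poly] polytope_imp_convex[OF poly] unfolding bij_betw_def by blast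
qed

end
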